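(* Let $\mathcal T$ be a rigid tensor abelian category over a field $k$. For any finite separable field extension $K$ of $k$, the base change $\mathcal T_{(K)}$ exists. More precisely, $\mathcal T_{(K)}$ can be defined as the category $\mathcal T_K$ of $K$-modules in $\mathcal T$.
   Context: A rigid tensor abelian category over a field $k$ is a $k$-linear abelian category with a symmetric ($k$-bilinear, unital) tensor product and unit object $I$ such that $\operatorname{End}(I)=k$, every object has a dual, and every object has finite length. A tensor functor is an additive functor preserving the tensor product and the symmetry. A trivial object is one isomorphic to a direct sum of copies of $I$. $K$-quotient of $\mathcal T$ (for a field extension $K\supset k$): a pair $(\mathcal Q,\mathfrak q)$ with $\mathcal Q$ a rigid tensor abelian category over $K$ and $\mathfrak q:\mathcal T\to\mathcal Q$ a $k$-linear exact tensor functor such that (i) for every $X\in\mathcal T$ the largest trivial subobject of $\mathfrak q(X)$ is isomorphic to the image under $\mathfrak q$ of a subobject of $X$; (ii) every object of $\mathcal Q$ is isomorphic to a subobject of $\mathfrak q(X)$ for some $X\in\mathcal T$ and also to a quotient of $\mathfrak q(X')$ for some $X'\in\mathcal T$. Its invariant subcategory is the full subcategory of objects of $\mathcal T$ whose image in $\mathcal Q$ is trivial. A base change $\mathcal T_{(K)}$ of $\mathcal T$ is a $K$-quotient of $\mathcal T$ whose invariant subcategory is the subcategory of trivial objects of $\mathcal T$ (equivalent to $\mathsf{vect}_k$). For $K/k$ finite, $K$ is identified with the commutative algebra $K\otimes_kI$ in $\mathcal T$; $K$-modules in $\mathcal T$ are objects of $\mathcal T$ with an action of this algebra, with tensor product over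 $K$; the quotient functor is $X\mapsto X\otimes_kK$. *)

theory Defs
  imports "HOL-Computational_Algebra.Polynomial"
begin

section \<open>Field extensions\<close>

text \<open>An extension \<open>K \<supseteq> k\<close> is given by two field types and an embedding
  \<open>\<iota>\<close> of the first into the second.\<close>

definition field_embedding :: "('k::field \<Rightarrow> 'l::field) \<Rightarrow> bool" where
  "field_embedding \<iota> \<longleftrightarrow>
     \<iota> 1 = 1 \<and> (\<forall>a b. \<iota> (a + b) = \<iota> a + \<iota> b) \<and> (\<forall>a b. \<iota> (a * b) = \<iota> a * \<iota> b)"

definition finite_extension :: "('k::field \<Rightarrow> 'l::field) \<Rightarrow> bool" where
  "finite_extension \<iota> \<longleftrightarrow> (\<exists>B. finite_dimensional_vector_space (\<lambda>a x. \<iota> a * x) B)"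

text \<open>The polynomial \<open>p\<close> is, up to a nonzero constant, the minimal polynomial of \<open>x\<close>.\<close>

definition separable_element :: "('k::field \<Rightarrow> 'l::field) \<Rightarrow> 'l \<Rightarrow> bool" where
  "separable_element \<iota> x \<longleftrightarrow>
     (\<exists>p. irreducible p \<and> poly (map_poly \<iota> p) x = 0 \<and> coprime p (pderiv p))"

definition finite_separable_extension :: "('k::field \<Rightarrow> 'l::field) \<Rightarrow> bool" where
  "finite_separable_extension \<iota> \<longleftrightarrow>
     field_embedding \<iota> \<and> finite_extension \<iota> \<and> (\<forall>x. separable_element \<iota> x)"


section \<open>Categories with a linear structure and a tensor product\<close>

text \<open>All operations are total functions and are only meaningful on the carriers \<open>obj\<close> and
  \<open>arr\<close>, and for composable (\<open>cmp\<close>) or parallel (\<open>add\<close>) arrows.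
  \<open>g \<cdot> f\<close> is \<open>g\<close> after \<open>f\<close>; \<open>\<otimes>\<close> is the tensor product of objects and
  \<open>\<odot>\<close> that of arrows. The constraints are
  \<open>asc X Y Z : (X \<otimes> Y) \<otimes> Z \<rightarrow> X \<otimes> (Y \<otimes> Z)\<close>, \<open>lun X : unt \<otimes> X \<rightarrow> X\<close>,
  \<open>run X : X \<otimes> unt \<rightarrow> X\<close> and \<open>bra X Y : X \<otimes> Y \<rightarrow> Y \<otimes> X\<close>.\<close>

record ('o, 'm, 'k) tensor_cat =
  obj :: "'o set"
  arr :: "'m set"
  src :: "'m \<Rightarrow> 'o"
  tgt :: "'m \<Rightarrow> 'o"
  idm :: "'o \<Rightarrow> 'm"
  cmp :: "'m \<Rightarrow> 'm \<Rightarrow> 'm"  (infixl "\<cdot>\<index>" 70)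
  zer :: "'o \<Rightarrow> 'o \<Rightarrow> 'm"
  add :: "'m \<Rightarrow> 'm \<Rightarrow> 'm"  (infixl "\<oplus>\<index>" 65)
  scl :: "'k \<Rightarrow> 'm \<Rightarrow> 'm"
  tob :: "'o \<Rightarrow> 'o \<Rightarrow> 'o"  (infixl "\<otimes>\<index>" 75)
  tar :: "'m \<Rightarrow> 'm \<Rightarrow> 'm"  (infixl "\<odot>\<index>" 75)
  unt :: "'o"
  asc :: "'o \<Rightarrow> 'o \<Rightarrow> 'o \<Rightarrow> 'm"
  lun :: "'o \<Rightarrow> 'm"
  run :: "'o \<Rightarrow> 'm"
  bra :: "'o \<Rightarrow> 'o \<Rightarrow> 'm"

definition hom :: "('o, 'm, 'k) tensor_cat \<Rightarrow> 'o \<Rightarrow> 'o \<Rightarrow> 'm set" where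
  "hom C X Y = {f \<in> arr C. src C f = X \<and> tgt C f = Y}"

definition inverses :: "('o, 'm, 'k) tensor_cat \<Rightarrow> 'm \<Rightarrow> 'm \<Rightarrow> bool" where
  "inverses C f g \<longleftrightarrow> f \<in> arr C \<and> g \<in> hom C (tgt C f) (src C f) \<and>
     g \<cdot>\<^bsub>C\<^esub> f = idm C (src C f) \<and> f \<cdot>\<^bsub>C\<^esub> g = idm C (tgt C f)"

definition is_iso :: "('o, 'm, 'k) tensor_cat \<Rightarrow> 'm \<Rightarrow> bool" where
  "is_iso C f \<longleftrightarrow> (\<exists>g. inverses C f g)"

definition inv_arr :: "('o, 'm, 'k) tensor_cat \<Rightarrow> 'm \<Rightarrow> 'm" where
  "inv_arr C f = (THE g. inverses C f g)"

definition isomorphic :: "('o, 'm, 'k) tensor_cat \<Rightarrow> 'o \<Rightarrow> 'o \<Rightarrow> bool" where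
  "isomorphic C X Y \<longleftrightarrow> (\<exists>f \<in> hom C X Y. is_iso C f)"

definition is_mono :: "('o, 'm, 'k) tensor_cat \<Rightarrow> 'm \<Rightarrow> bool" where
  "is_mono C f \<longleftrightarrow> f \<in> arr C \<and>
     (\<forall>W. \<forall>g \<in> hom C W (src C f). \<forall>h \<in> hom C W (src C f). f \<cdot>\<^bsub>C\<^esub> g = f \<cdot>\<^bsub>C\<^esub> h \<longrightarrow> g = h)"

definition is_epi :: "('o, 'm, 'k) tensor_cat \<Rightarrow> 'm \<Rightarrow> bool" where
  "is_epi C f \<longleftrightarrow> f \<in> arr C \<and>
     (\<forall>W. \<forall>g \<in> hom C (tgt C f) W. \<forall>h \<in> hom C (tgt C f) W. g \<cdot>\<^bsub>C\<^esub> f = h \<cdot>\<^bsub>C\<^esub> f \<longrightarrow> g = h)"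

definition is_kernel :: "('o, 'm, 'k) tensor_cat \<Rightarrow> 'm \<Rightarrow> 'm \<Rightarrow> bool" where
  "is_kernel C g i \<longleftrightarrow> g \<in> arr C \<and> i \<in> arr C \<and> tgt C i = src C g \<and>
     g \<cdot>\<^bsub>C\<^esub> i = zer C (src C i) (tgt C g) \<and>
     (\<forall>W. \<forall>h \<in> hom C W (src C g). g \<cdot>\<^bsub>C\<^esub> h = zer C W (tgt C g) \<longrightarrow>
        (\<exists>!u. u \<in> hom C W (src C i) \<and> i \<cdot>\<^bsub>C\<^esub> u = h))"

definition is_cokernel :: "('o, 'm, 'k) tensor_cat \<Rightarrow> 'm \<Rightarrow> 'm \<Rightarrow> bool" where
  "is_cokernel C f p \<longleftrightarrow> f \<in> arr C \<and> p \<in> arr C \<and> src C p = tgt C f \<and>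
     p \<cdot>\<^bsub>C\<^esub> f = zer C (src C f) (tgt C p) \<and>
     (\<forall>W. \<forall>h \<in> hom C (tgt C f) W. h \<cdot>\<^bsub>C\<^esub> f = zer C (src C f) W \<longrightarrow>
        (\<exists>!u. u \<in> hom C (tgt C p) W \<and> u \<cdot>\<^bsub>C\<^esub> p = h))"

definition is_coequalizer :: "('o, 'm, 'k) tensor_cat \<Rightarrow> 'm \<Rightarrow> 'm \<Rightarrow> 'm \<Rightarrow> bool" where
  "is_coequalizer C f g p \<longleftrightarrow> f \<in> arr C \<and> g \<in> hom C (src C f) (tgt C f) \<and>
     p \<in> arr C \<and> src C p = tgt C f \<and> p \<cdot>\<^bsub>C\<^esub> f = p \<cdot>\<^bsub>C\<^esub> g \<and>
     (\<forall>W. \<forall>h \<in> hom C (tgt C f) W. h \<cdot>\<^bsub>C\<^esub> f = h \<cdot>\<^bsub>C\<^esub> g \<longrightarrow>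
        (\<exists>!u. u \<in> hom C (tgt C p) W \<and> u \<cdot>\<^bsub>C\<^esub> p = h))"

definition short_exact :: "('o, 'm, 'k) tensor_cat \<Rightarrow> 'm \<Rightarrow> 'm \<Rightarrow> bool" where
  "short_exact C f g \<longleftrightarrow> is_kernel C g f \<and> is_cokernel C f g"

primrec arr_sum :: "('o, 'm, 'k) tensor_cat \<Rightarrow> 'o \<Rightarrow> 'o \<Rightarrow> (nat \<Rightarrow> 'm) \<Rightarrow> nat \<Rightarrow> 'm" where
  "arr_sum C X Y f 0 = zer C X Y"
| "arr_sum C X Y f (Suc n) = arr_sum C X Y f n \<oplus>\<^bsub>C\<^esub> f n"

text \<open>\<open>S\<close> is the direct sum of \<open>F 0, \<dots>, F (n - 1)\<close> via the injections \<open>i\<close> and the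
  projections \<open>p\<close>; for \<open>n = 0\<close> this says that \<open>S\<close> is a zero object.\<close>

definition is_direct_sum ::
  "('o, 'm, 'k) tensor_cat \<Rightarrow> nat \<Rightarrow> (nat \<Rightarrow> 'o) \<Rightarrow> 'o \<Rightarrow> (nat \<Rightarrow> 'm) \<Rightarrow> (nat \<Rightarrow> 'm) \<Rightarrow> bool" where
  "is_direct_sum C n F S i p \<longleftrightarrow> S \<in> obj C \<and>
     (\<forall>j<n. i j \<in> hom C (F j) S \<and> p j \<in> hom C S (F j)) \<and>
     (\<forall>j<n. \<forall>l<n. p j \<cdot>\<^bsub>C\<^esub> i l = (if j = l then idm C (F j) else zer C (F l) (F j))) \<and>
     arr_sum C S S (\<lambda>j. i j \<cdot>\<^bsub>C\<^esub> p j) n = idm C S"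

definition is_zero_object :: "('o, 'm, 'k) tensor_cat \<Rightarrow> 'o \<Rightarrow> bool" where
  "is_zero_object C X \<longleftrightarrow> X \<in> obj C \<and> idm C X = zer C X X"

definition is_simple :: "('o, 'm, 'k) tensor_cat \<Rightarrow> 'o \<Rightarrow> bool" where
  "is_simple C X \<longleftrightarrow> X \<in> obj C \<and> \<not> is_zero_object C X \<and>
     (\<forall>i. is_mono C i \<and> tgt C i = X \<longrightarrow> is_zero_object C (src C i) \<or> is_iso C i)"

text \<open>The derivations of \<open>finite_length C X\<close> are the composition series of \<open>X\<close>.\<close>

inductive finite_length :: "('o, 'm, 'k) tensor_cat \<Rightarrow> 'o \<Rightarrow> bool" for C where
  zero: "is_zero_object C X \<Longrightarrow> finite_length C X"
| extend: "short_exact C f g \<Longrightarrow> finite_length C (src C f) \<Longrightarrow> is_simple C (tgt C g) \<Longrightarrow>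
     finite_length C (tgt C f)"

text \<open>\<open>ev : Y \<otimes> X \<rightarrow> unt\<close> and \<open>co : unt \<rightarrow> X \<otimes> Y\<close> satisfying the triangle identities.\<close>

definition is_dual :: "('o, 'm, 'k) tensor_cat \<Rightarrow> 'o \<Rightarrow> 'o \<Rightarrow> 'm \<Rightarrow> 'm \<Rightarrow> bool" where
  "is_dual C X Y ev co \<longleftrightarrow> Y \<in> obj C \<and>
     ev \<in> hom C (Y \<otimes>\<^bsub>C\<^esub> X) (unt C) \<and> co \<in> hom C (unt C) (X \<otimes>\<^bsub>C\<^esub> Y) \<and>
     run C X \<cdot>\<^bsub>C\<^esub> (idm C X \<odot>\<^bsub>C\<^esub> ev) \<cdot>\<^bsub>C\<^esub> asc C X Y X \<cdot>\<^bsub>C\<^esub> (co \<odot>\<^bsub>C\<^esub> idm C X) = lun C X \<and>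
     lun C Y \<cdot>\<^bsub>C\<^esub> (ev \<odot>\<^bsub>C\<^esub> idm C Y) \<cdot>\<^bsub>C\<^esub> inv_arr C (asc C Y X Y) \<cdot>\<^bsub>C\<^esub> (idm C Y \<odot>\<^bsub>C\<^esub> co) = run C Y"

definition is_trivial :: "('o, 'm, 'k) tensor_cat \<Rightarrow> 'o \<Rightarrow> bool" where
  "is_trivial C X \<longleftrightarrow> (\<exists>n i p. is_direct_sum C n (\<lambda>_. unt C) X i p)"

locale category =
  fixes C :: "('o, 'm, 'k::field) tensor_cat" (structure)
  assumes src_obj: "f \<in> arr C \<Longrightarrow> src C f \<in> obj C"
    and tgt_obj: "f \<in> arr C \<Longrightarrow> tgt C f \<in> obj C"
    and id_hom: "X \<in> obj C \<Longrightarrow> idm C X \<in> hom C X X"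
    and cmp_hom: "f \<in> hom C X Y \<Longrightarrow> g \<in> hom C Y Z \<Longrightarrow> g \<cdot> f \<in> hom C X Z"
    and cmp_id: "f \<in> hom C X Y \<Longrightarrow> f \<cdot> idm C X = f"
    and id_cmp: "f \<in> hom C X Y \<Longrightarrow> idm C Y \<cdot> f = f"
    and cmp_assoc: "f \<in> hom C W X \<Longrightarrow> g \<in> hom C X Y \<Longrightarrow> h \<in> hom C Y Z \<Longrightarrow>
      h \<cdot> (g \<cdot> f) = (h \<cdot> g) \<cdot> f"

locale linear_category = category +
  assumes zer_hom: "X \<in> obj C \<Longrightarrow> Y \<in> obj C \<Longrightarrow> zer C X Y \<in> hom C X Y"
    and add_hom: "f \<in> hom C X Y \<Longrightarrow> g \<in> hom C X Y \<Longrightarrow> f \<oplus> g \<in> hom C X Y"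
    and scl_hom: "f \<in> hom C X Y \<Longrightarrow> scl C a f \<in> hom C X Y"
    and add_assoc: "f \<in> hom C X Y \<Longrightarrow> g \<in> hom C X Y \<Longrightarrow> h \<in> hom C X Y \<Longrightarrow>
      (f \<oplus> g) \<oplus> h = f \<oplus> (g \<oplus> h)"
    and add_commute: "f \<in> hom C X Y \<Longrightarrow> g \<in> hom C X Y \<Longrightarrow> f \<oplus> g = g \<oplus> f"
    and add_zer: "f \<in> hom C X Y \<Longrightarrow> f \<oplus> zer C X Y = f"
    and add_inverse: "f \<in> hom C X Y \<Longrightarrow> \<exists>g \<in> hom C X Y. f \<oplus> g = zer C X Y"
    and scl_add_left: "f \<in> hom C X Y \<Longrightarrow> scl C (a + b) f = scl C a f \<oplus> scl C b f"
    and scl_add_right: "f \<in> hom C X Y \<Longrightarrow> g \<in> hom C X Y \<Longrightarrow>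
      scl C a (f \<oplus> g) = scl C a f \<oplus> scl C a g"
    and scl_mult: "f \<in> hom C X Y \<Longrightarrow> scl C (a * b) f = scl C a (scl C b f)"
    and scl_one: "f \<in> hom C X Y \<Longrightarrow> scl C 1 f = f"
    and cmp_add_left: "f \<in> hom C X Y \<Longrightarrow> g \<in> hom C Y Z \<Longrightarrow> h \<in> hom C Y Z \<Longrightarrow>
      (g \<oplus> h) \<cdot> f = g \<cdot> f \<oplus> h \<cdot> f"
    and cmp_add_right: "f \<in> hom C X Y \<Longrightarrow> g \<in> hom C X Y \<Longrightarrow> h \<in> hom C Y Z \<Longrightarrow>
      h \<cdot> (f \<oplus> g) = h \<cdot> f \<oplus> h \<cdot> g"
    and cmp_scl_left: "f \<in> hom C X Y \<Longrightarrow> g \<in> hom C Y Z \<Longrightarrow> scl C a g \<cdot> f = scl C a (g \<cdot> f)"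
    and cmp_scl_right: "f \<in> hom C X Y \<Longrightarrow> g \<in> hom C Y Z \<Longrightarrow> g \<cdot> scl C a f = scl C a (g \<cdot> f)"

locale linear_abelian_category = linear_category +
  assumes direct_sums: "(\<And>j. j < n \<Longrightarrow> F j \<in> obj C) \<Longrightarrow> \<exists>S i p. is_direct_sum C n F S i p"
    and kernels: "f \<in> arr C \<Longrightarrow> \<exists>i. is_kernel C f i"
    and cokernels: "f \<in> arr C \<Longrightarrow> \<exists>p. is_cokernel C f p"
    and mono_kernel: "is_mono C f \<Longrightarrow> \<exists>g. is_kernel C g f"
    and epi_cokernel: "is_epi C f \<Longrightarrow> \<exists>g. is_cokernel C g f"

locale linear_tensor_category = linear_category +
  assumes tob_obj: "X \<in> obj C \<Longrightarrow> Y \<in> obj C \<Longrightarrow> X \<otimes> Y \<in> obj C"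
    and tar_hom: "f \<in> hom C X X' \<Longrightarrow> g \<in> hom C Y Y' \<Longrightarrow> f \<odot> g \<in> hom C (X \<otimes> Y) (X' \<otimes> Y')"
    and tar_id: "X \<in> obj C \<Longrightarrow> Y \<in> obj C \<Longrightarrow> idm C X \<odot> idm C Y = idm C (X \<otimes> Y)"
    and tar_cmp: "f \<in> hom C X X' \<Longrightarrow> f' \<in> hom C X' X'' \<Longrightarrow> g \<in> hom C Y Y' \<Longrightarrow> g' \<in> hom C Y' Y'' \<Longrightarrow>
      (f' \<cdot> f) \<odot> (g' \<cdot> g) = (f' \<odot> g') \<cdot> (f \<odot> g)"
    and tar_add_left: "f \<in> hom C X X' \<Longrightarrow> f' \<in> hom C X X' \<Longrightarrow> g \<in> hom C Y Y' \<Longrightarrow>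
      (f \<oplus> f') \<odot> g = f \<odot> g \<oplus> f' \<odot> g"
    and tar_add_right: "f \<in> hom C X X' \<Longrightarrow> g \<in> hom C Y Y' \<Longrightarrow> g' \<in> hom C Y Y' \<Longrightarrow>
      f \<odot> (g \<oplus> g') = f \<odot> g \<oplus> f \<odot> g'"
    and tar_scl_left: "f \<in> hom C X X' \<Longrightarrow> g \<in> hom C Y Y' \<Longrightarrow> scl C a f \<odot> g = scl C a (f \<odot> g)"
    and tar_scl_right: "f \<in> hom C X X' \<Longrightarrow> g \<in> hom C Y Y' \<Longrightarrow> f \<odot> scl C a g = scl C a (f \<odot> g)"
    and unt_obj: "unt C \<in> obj C"
    and asc_hom: "X \<in> obj C \<Longrightarrow> Y \<in> obj C \<Longrightarrow> Z \<in> obj C \<Longrightarrow>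
      asc C X Y Z \<in> hom C ((X \<otimes> Y) \<otimes> Z) (X \<otimes> (Y \<otimes> Z))"
    and asc_iso: "X \<in> obj C \<Longrightarrow> Y \<in> obj C \<Longrightarrow> Z \<in> obj C \<Longrightarrow> is_iso C (asc C X Y Z)"
    and asc_natural: "f \<in> hom C X X' \<Longrightarrow> g \<in> hom C Y Y' \<Longrightarrow> h \<in> hom C Z Z' \<Longrightarrow>
      asc C X' Y' Z' \<cdot> ((f \<odot> g) \<odot> h) = (f \<odot> (g \<odot> h)) \<cdot> asc C X Y Z"
    and lun_hom: "X \<in> obj C \<Longrightarrow> lun C X \<in> hom C (unt C \<otimes> X) X"
    and lun_iso: "X \<in> obj C \<Longrightarrow> is_iso C (lun C X)"
    and lun_natural: "f \<in> hom C X Y \<Longrightarrow> lun C Y \<cdot> (idm C (unt C) \<odot> f) = f \<cdot> lun C X"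
    and run_hom: "X \<in> obj C \<Longrightarrow> run C X \<in> hom C (X \<otimes> unt C) X"
    and run_iso: "X \<in> obj C \<Longrightarrow> is_iso C (run C X)"
    and run_natural: "f \<in> hom C X Y \<Longrightarrow> run C Y \<cdot> (f \<odot> idm C (unt C)) = f \<cdot> run C X"
    and bra_hom: "X \<in> obj C \<Longrightarrow> Y \<in> obj C \<Longrightarrow> bra C X Y \<in> hom C (X \<otimes> Y) (Y \<otimes> X)"
    and bra_natural: "f \<in> hom C X X' \<Longrightarrow> g \<in> hom C Y Y' \<Longrightarrow>
      bra C X' Y' \<cdot> (f \<odot> g) = (g \<odot> f) \<cdot> bra C X Y"
    and pentagon: "W \<in> obj C \<Longrightarrow> X \<in> obj C \<Longrightarrow> Y \<in> obj C \<Longrightarrow> Z \<in> obj C \<Longrightarrow>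
      asc C W X (Y \<otimes> Z) \<cdot> asc C (W \<otimes> X) Y Z =
      (idm C W \<odot> asc C X Y Z) \<cdot> asc C W (X \<otimes> Y) Z \<cdot> (asc C W X Y \<odot> idm C Z)"
    and triangle: "X \<in> obj C \<Longrightarrow> Y \<in> obj C \<Longrightarrow>
      (idm C X \<odot> lun C Y) \<cdot> asc C X (unt C) Y = run C X \<odot> idm C Y"
    and hexagon: "X \<in> obj C \<Longrightarrow> Y \<in> obj C \<Longrightarrow> Z \<in> obj C \<Longrightarrow>
      asc C Y Z X \<cdot> bra C X (Y \<otimes> Z) \<cdot> asc C X Y Z =
      (idm C Y \<odot> bra C X Z) \<cdot> asc C Y X Z \<cdot> (bra C X Y \<odot> idm C Z)"
    and symmetry: "X \<in> obj C \<Longrightarrow> Y \<in> obj C \<Longrightarrow> bra C Y X \<cdot> bra C X Y = idm C (X \<otimes> Y)"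

locale rigid_tensor_abelian_category = linear_abelian_category + linear_tensor_category +
  assumes End_unt: "bij_betw (\<lambda>a. scl C a (idm C (unt C))) UNIV (hom C (unt C) (unt C))"
    and duals: "X \<in> obj C \<Longrightarrow> \<exists>Y ev co. is_dual C X Y ev co"
    and all_finite_length: "X \<in> obj C \<Longrightarrow> finite_length C X"


section \<open>Tensor functors and quotients\<close>

text \<open>A functor \<open>F\<close> with its constraints \<open>fmul F X Y : F X \<otimes> F Y \<rightarrow> F (X \<otimes> Y)\<close> and
  \<open>fone F : unt \<rightarrow> F unt\<close>.\<close>

record ('o, 'm, 'p, 'n) tensor_functor =
  fob :: "'o \<Rightarrow> 'p"
  far :: "'m \<Rightarrow> 'n"
  fmul :: "'o \<Rightarrow> 'o \<Rightarrow> 'n"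
  fone :: "'n"

text \<open>Linearity is over the smaller field, which acts on the target through \<open>\<iota>\<close>.\<close>

locale linear_functor =
  fixes \<iota> :: "'k::field \<Rightarrow> 'l::field"
    and T :: "('o, 'm, 'k) tensor_cat"
    and Q :: "('p, 'n, 'l) tensor_cat"
    and q :: "('o, 'm, 'p, 'n) tensor_functor"
  assumes fob_obj: "X \<in> obj T \<Longrightarrow> fob q X \<in> obj Q"
    and far_hom: "f \<in> hom T X Y \<Longrightarrow> far q f \<in> hom Q (fob q X) (fob q Y)"
    and far_id: "X \<in> obj T \<Longrightarrow> far q (idm T X) = idm Q (fob q X)"
    and far_cmp: "f \<in> hom T X Y \<Longrightarrow> g \<in> hom T Y Z \<Longrightarrow> far q (g \<cdot>\<^bsub>T\<^esub> f) = far q g \<cdot>\<^bsub>Q\<^esub> far q f"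
    and far_add: "f \<in> hom T X Y \<Longrightarrow> g \<in> hom T X Y \<Longrightarrow> far q (f \<oplus>\<^bsub>T\<^esub> g) = far q f \<oplus>\<^bsub>Q\<^esub> far q g"
    and far_scl: "f \<in> hom T X Y \<Longrightarrow> far q (scl T a f) = scl Q (\<iota> a) (far q f)"

locale exact_tensor_functor = linear_functor +
  assumes exact: "short_exact T f g \<Longrightarrow> short_exact Q (far q f) (far q g)"
    and fmul_hom: "X \<in> obj T \<Longrightarrow> Y \<in> obj T \<Longrightarrow>
      fmul q X Y \<in> hom Q (fob q X \<otimes>\<^bsub>Q\<^esub> fob q Y) (fob q (X \<otimes>\<^bsub>T\<^esub> Y))"
    and fmul_iso: "X \<in> obj T \<Longrightarrow> Y \<in> obj T \<Longrightarrow> is_iso Q (fmul q X Y)"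
    and fmul_natural: "f \<in> hom T X X' \<Longrightarrow> g \<in> hom T Y Y' \<Longrightarrow>
      fmul q X' Y' \<cdot>\<^bsub>Q\<^esub> (far q f \<odot>\<^bsub>Q\<^esub> far q g) = far q (f \<odot>\<^bsub>T\<^esub> g) \<cdot>\<^bsub>Q\<^esub> fmul q X Y"
    and fmul_asc: "X \<in> obj T \<Longrightarrow> Y \<in> obj T \<Longrightarrow> Z \<in> obj T \<Longrightarrow>
      far q (asc T X Y Z) \<cdot>\<^bsub>Q\<^esub> fmul q (X \<otimes>\<^bsub>T\<^esub> Y) Z \<cdot>\<^bsub>Q\<^esub> (fmul q X Y \<odot>\<^bsub>Q\<^esub> idm Q (fob q Z)) =
      fmul q X (Y \<otimes>\<^bsub>T\<^esub> Z) \<cdot>\<^bsub>Q\<^esub> (idm Q (fob q X) \<odot>\<^bsub>Q\<^esub> fmul q Y Z) \<cdot>\<^bsub>Q\<^esub>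
        asc Q (fob q X) (fob q Y) (fob q Z)"
    and fmul_bra: "X \<in> obj T \<Longrightarrow> Y \<in> obj T \<Longrightarrow>
      far q (bra T X Y) \<cdot>\<^bsub>Q\<^esub> fmul q X Y = fmul q Y X \<cdot>\<^bsub>Q\<^esub> bra Q (fob q X) (fob q Y)"
    and fone_hom: "fone q \<in> hom Q (unt Q) (fob q (unt T))"
    and fone_iso: "is_iso Q (fone q)"
    and fone_lun: "X \<in> obj T \<Longrightarrow>
      far q (lun T X) \<cdot>\<^bsub>Q\<^esub> fmul q (unt T) X \<cdot>\<^bsub>Q\<^esub> (fone q \<odot>\<^bsub>Q\<^esub> idm Q (fob q X)) = lun Q (fob q X)"
    and fone_run: "X \<in> obj T \<Longrightarrow>
      far q (run T X) \<cdot>\<^bsub>Q\<^esub> fmul q X (unt T) \<cdot>\<^bsub>Q\<^esub> (idm Q (fob q X) \<odot>\<^bsub>Q\<^esub> fone q) = run Q (fob q X)"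

definition largest_trivial_subobject :: "('o, 'm, 'k) tensor_cat \<Rightarrow> 'o \<Rightarrow> 'm \<Rightarrow> bool" where
  "largest_trivial_subobject C X i \<longleftrightarrow>
     is_mono C i \<and> tgt C i = X \<and> is_trivial C (src C i) \<and>
     (\<forall>h. is_mono C h \<and> tgt C h = X \<and> is_trivial C (src C h) \<longrightarrow>
        (\<exists>u \<in> hom C (src C h) (src C i). i \<cdot>\<^bsub>C\<^esub> u = h))"

text \<open>In \<open>trivial_lift\<close> the isomorphism \<open>e\<close> is one of subobjects of \<open>q X\<close>.\<close>

locale K_quotient = exact_tensor_functor +
  assumes rigid: "rigid_tensor_abelian_category Q"
    and trivial_lift: "X \<in> obj T \<Longrightarrow>
      \<exists>i j e. largest_trivial_subobject Q (fob q X) i \<and> is_mono T j \<and> tgt T j = X \<and>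
        e \<in> hom Q (src Q i) (fob q (src T j)) \<and> is_iso Q e \<and> far q j \<cdot>\<^bsub>Q\<^esub> e = i"
    and subobject_of_image: "Z \<in> obj Q \<Longrightarrow>
      \<exists>X \<in> obj T. \<exists>i \<in> hom Q Z (fob q X). is_mono Q i"
    and quotient_of_image: "Z \<in> obj Q \<Longrightarrow>
      \<exists>X \<in> obj T. \<exists>p \<in> hom Q (fob q X) Z. is_epi Q p"

definition invariant_objects ::
  "('o, 'm, 'k) tensor_cat \<Rightarrow> ('p, 'n, 'l) tensor_cat \<Rightarrow> ('o, 'm, 'p, 'n) tensor_functor \<Rightarrow> 'o set"
  where "invariant_objects T Q q = {X \<in> obj T. is_trivial Q (fob q X)}"

text \<open>Full subcategories are compared through their sets of objects.\<close>

definition is_base_change ::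
  "('k::field \<Rightarrow> 'l::field) \<Rightarrow> ('o, 'm, 'k) tensor_cat \<Rightarrow> ('p, 'n, 'l) tensor_cat \<Rightarrow>
   ('o, 'm, 'p, 'n) tensor_functor \<Rightarrow> bool" where
  "is_base_change \<iota> T Q q \<longleftrightarrow>
     K_quotient \<iota> T Q q \<and> invariant_objects T Q q = {X \<in> obj T. is_trivial T X}"


section \<open>The algebra \<open>K \<otimes>\<^sub>k I\<close>\<close>

definition scalar_linear ::
  "('k::field \<Rightarrow> 'l::field) \<Rightarrow> ('o, 'm, 'k) tensor_cat \<Rightarrow> 'o \<Rightarrow> ('l \<Rightarrow> 'm) \<Rightarrow> bool" where
  "scalar_linear \<iota> T Y h \<longleftrightarrow> (\<forall>c. h c \<in> hom T (unt T) Y) \<and>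
     (\<forall>c d. h (c + d) = h c \<oplus>\<^bsub>T\<^esub> h d) \<and> (\<forall>a c. h (\<iota> a * c) = scl T a (h c))"

text \<open>The object \<open>K \<otimes>\<^sub>k I\<close> is defined by
  \<open>Hom (K \<otimes>\<^sub>k I, Y) = Hom\<^sub>k (K, Hom (I, Y))\<close>; here \<open>j c : I \<rightarrow> K \<otimes>\<^sub>k I\<close> is
  \<open>x \<mapsto> c \<otimes> x\<close>.\<close>

definition is_scalar_object ::
  "('k::field \<Rightarrow> 'l::field) \<Rightarrow> ('o, 'm, 'k) tensor_cat \<Rightarrow> 'o \<times> ('l \<Rightarrow> 'm) \<Rightarrow> bool" where
  "is_scalar_object \<iota> T = (\<lambda>(A, j). A \<in> obj T \<and> scalar_linear \<iota> T A j \<and>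
     (\<forall>Y \<in> obj T. \<forall>h. scalar_linear \<iota> T Y h \<longrightarrow>
        (\<exists>!u. u \<in> hom T A Y \<and> (\<forall>c. u \<cdot>\<^bsub>T\<^esub> j c = h c))))"

definition sc_pair :: "('k::field \<Rightarrow> 'l::field) \<Rightarrow> ('o, 'm, 'k) tensor_cat \<Rightarrow> 'o \<times> ('l \<Rightarrow> 'm)" where
  "sc_pair \<iota> T = (SOME P. is_scalar_object \<iota> T P)"

definition sc_obj :: "('k::field \<Rightarrow> 'l::field) \<Rightarrow> ('o, 'm, 'k) tensor_cat \<Rightarrow> 'o" where
  "sc_obj \<iota> T = fst (sc_pair \<iota> T)"

definition sc_elt :: "('k::field \<Rightarrow> 'l::field) \<Rightarrow> ('o, 'm, 'k) tensor_cat \<Rightarrow> 'l \<Rightarrow> 'm" where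
  "sc_elt \<iota> T = snd (sc_pair \<iota> T)"

definition sc_mult :: "('k::field \<Rightarrow> 'l::field) \<Rightarrow> ('o, 'm, 'k) tensor_cat \<Rightarrow> 'm" where
  "sc_mult \<iota> T = (THE m. m \<in> hom T (sc_obj \<iota> T \<otimes>\<^bsub>T\<^esub> sc_obj \<iota> T) (sc_obj \<iota> T) \<and>
     (\<forall>c d. m \<cdot>\<^bsub>T\<^esub> (sc_elt \<iota> T c \<odot>\<^bsub>T\<^esub> sc_elt \<iota> T d) = sc_elt \<iota> T (c * d) \<cdot>\<^bsub>T\<^esub> lun T (unt T)))"

definition sc_unit :: "('k::field \<Rightarrow> 'l::field) \<Rightarrow> ('o, 'm, 'k) tensor_cat \<Rightarrow> 'm" where
  "sc_unit \<iota> T = sc_elt \<iota> T 1"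


section \<open>The category of \<open>K\<close>-modules\<close>

text \<open>A module is an object together with a right action of \<open>K \<otimes>\<^sub>k I\<close>; a morphism
  of modules is stored with its source and target.\<close>

type_synonym ('o, 'm) md = "'o \<times> 'm"
type_synonym ('o, 'm) md_arr = "('o, 'm) md \<times> ('o, 'm) md \<times> 'm"

definition modules :: "('k::field \<Rightarrow> 'l::field) \<Rightarrow> ('o, 'm, 'k) tensor_cat \<Rightarrow> ('o, 'm) md set" where
  "modules \<iota> T = (let A = sc_obj \<iota> T in {(X, r). X \<in> obj T \<and> r \<in> hom T (X \<otimes>\<^bsub>T\<^esub> A) X \<and>
     r \<cdot>\<^bsub>T\<^esub> (r \<odot>\<^bsub>T\<^esub> idm T A) = r \<cdot>\<^bsub>T\<^esub> (idm T X \<odot>\<^bsub>T\<^esub> sc_mult \<iota> T) \<cdot>\<^bsub>T\<^esub> asc T X A A \<and>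
     r \<cdot>\<^bsub>T\<^esub> (idm T X \<odot>\<^bsub>T\<^esub> sc_unit \<iota> T) = run T X})"

definition module_hom ::
  "('k::field \<Rightarrow> 'l::field) \<Rightarrow> ('o, 'm, 'k) tensor_cat \<Rightarrow> ('o, 'm) md \<Rightarrow> ('o, 'm) md \<Rightarrow> 'm set" where
  "module_hom \<iota> T M N = {f \<in> hom T (fst M) (fst N).
     f \<cdot>\<^bsub>T\<^esub> snd M = snd N \<cdot>\<^bsub>T\<^esub> (f \<odot>\<^bsub>T\<^esub> idm T (sc_obj \<iota> T))}"

text \<open>The endomorphism of a module given by multiplication with \<open>c \<in> K\<close>.\<close>

definition homothety ::
  "('k::field \<Rightarrow> 'l::field) \<Rightarrow> ('o, 'm, 'k) tensor_cat \<Rightarrow> 'l \<Rightarrow> ('o, 'm) md \<Rightarrow> 'm" where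
  "homothety \<iota> T c M =
     snd M \<cdot>\<^bsub>T\<^esub> (idm T (fst M) \<odot>\<^bsub>T\<^esub> sc_elt \<iota> T c) \<cdot>\<^bsub>T\<^esub> inv_arr T (run T (fst M))"

text \<open>\<open>M \<otimes>\<^sub>K N\<close> is the coequalizer of the two actions
  \<open>(M \<otimes> A) \<otimes> N \<rightarrow> M \<otimes> N\<close>, where \<open>A = K \<otimes>\<^sub>k I\<close>; \<open>ten_proj\<close> is the projection
  \<open>M \<otimes> N \<rightarrow> M \<otimes>\<^sub>K N\<close>.\<close>

definition ten_proj ::
  "('k::field \<Rightarrow> 'l::field) \<Rightarrow> ('o, 'm, 'k) tensor_cat \<Rightarrow> ('o, 'm) md \<Rightarrow> ('o, 'm) md \<Rightarrow> 'm" where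
  "ten_proj \<iota> T M N = (SOME p. is_coequalizer T
     (snd M \<odot>\<^bsub>T\<^esub> idm T (fst N))
     ((idm T (fst M) \<odot>\<^bsub>T\<^esub> (snd N \<cdot>\<^bsub>T\<^esub> bra T (sc_obj \<iota> T) (fst N))) \<cdot>\<^bsub>T\<^esub>
        asc T (fst M) (sc_obj \<iota> T) (fst N)) p)"

definition ten_carrier ::
  "('k::field \<Rightarrow> 'l::field) \<Rightarrow> ('o, 'm, 'k) tensor_cat \<Rightarrow> ('o, 'm) md \<Rightarrow> ('o, 'm) md \<Rightarrow> 'o" where
  "ten_carrier \<iota> T M N = tgt T (ten_proj \<iota> T M N)"

text \<open>The morphism induced by \<open>h\<close>, i.e. the factorization of \<open>h\<close> through \<open>p\<close>.\<close>

definition factor_through :: "('o, 'm, 'k) tensor_cat \<Rightarrow> 'm \<Rightarrow> 'm \<Rightarrow> 'm" where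
  "factor_through T p h = (THE u. u \<in> hom T (tgt T p) (tgt T h) \<and> u \<cdot>\<^bsub>T\<^esub> p = h)"

definition ten_module ::
  "('k::field \<Rightarrow> 'l::field) \<Rightarrow> ('o, 'm, 'k) tensor_cat \<Rightarrow> ('o, 'm) md \<Rightarrow> ('o, 'm) md \<Rightarrow> ('o, 'm) md" where
  "ten_module \<iota> T M N = (ten_carrier \<iota> T M N,
     factor_through T (ten_proj \<iota> T M N \<odot>\<^bsub>T\<^esub> idm T (sc_obj \<iota> T))
       (ten_proj \<iota> T M N \<cdot>\<^bsub>T\<^esub> (idm T (fst M) \<odot>\<^bsub>T\<^esub> snd N) \<cdot>\<^bsub>T\<^esub>
          asc T (fst M) (fst N) (sc_obj \<iota> T)))"

definition unit_module ::
  "('k::field \<Rightarrow> 'l::field) \<Rightarrow> ('o, 'm, 'k) tensor_cat \<Rightarrow> ('o, 'm) md" where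
  "unit_module \<iota> T = (sc_obj \<iota> T, sc_mult \<iota> T)"

definition module_category ::
  "('k::field \<Rightarrow> 'l::field) \<Rightarrow> ('o, 'm, 'k) tensor_cat \<Rightarrow>
   (('o, 'm) md, ('o, 'm) md_arr, 'l) tensor_cat" where
  "module_category \<iota> T = \<lparr>
     obj = modules \<iota> T,
     arr = {(M, N, f). M \<in> modules \<iota> T \<and> N \<in> modules \<iota> T \<and> f \<in> module_hom \<iota> T M N},
     src = (\<lambda>(M, N, f). M),
     tgt = (\<lambda>(M, N, f). N),
     idm = (\<lambda>M. (M, M, idm T (fst M))),
     cmp = (\<lambda>(M', N', g) (M, N, f). (M, N', g \<cdot>\<^bsub>T\<^esub> f)),
     zer = (\<lambda>M N. (M, N, zer T (fst M) (fst N))),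
     add = (\<lambda>(M, N, f) (M', N', g). (M, N, f \<oplus>\<^bsub>T\<^esub> g)),
     scl = (\<lambda>c (M, N, f). (M, N, f \<cdot>\<^bsub>T\<^esub> homothety \<iota> T c M)),
     tob = ten_module \<iota> T,
     tar = (\<lambda>(M, M', f) (N, N', g). (ten_module \<iota> T M N, ten_module \<iota> T M' N',
       factor_through T (ten_proj \<iota> T M N) (ten_proj \<iota> T M' N' \<cdot>\<^bsub>T\<^esub> (f \<odot>\<^bsub>T\<^esub> g)))),
     unt = unit_module \<iota> T,
     asc = (\<lambda>L M N.
       (ten_module \<iota> T (ten_module \<iota> T L M) N, ten_module \<iota> T L (ten_module \<iota> T M N),
        factor_through T
          (ten_proj \<iota> T (ten_module \<iota> T L M) N \<cdot>\<^bsub>T\<^esub> (ten_proj \<iota> T L M \<odot>\<^bsub>T\<^esub> idm T (fst N)))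
          (ten_proj \<iota> T L (ten_module \<iota> T M N) \<cdot>\<^bsub>T\<^esub> (idm T (fst L) \<odot>\<^bsub>T\<^esub> ten_proj \<iota> T M N) \<cdot>\<^bsub>T\<^esub>
             asc T (fst L) (fst M) (fst N)))),
     lun = (\<lambda>M. (ten_module \<iota> T (unit_module \<iota> T) M, M,
       factor_through T (ten_proj \<iota> T (unit_module \<iota> T) M)
         (snd M \<cdot>\<^bsub>T\<^esub> bra T (sc_obj \<iota> T) (fst M)))),
     run = (\<lambda>M. (ten_module \<iota> T M (unit_module \<iota> T), M,
       factor_through T (ten_proj \<iota> T M (unit_module \<iota> T)) (snd M))),
     bra = (\<lambda>M N. (ten_module \<iota> T M N, ten_module \<iota> T N M,
       factor_through T (ten_proj \<iota> T M N) (ten_proj \<iota> T N M \<cdot>\<^bsub>T\<^esub> bra T (fst M) (fst N))))\<rparr>"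


section \<open>The functor \<open>X \<mapsto> X \<otimes>\<^sub>k K\<close>\<close>

definition free_module ::
  "('k::field \<Rightarrow> 'l::field) \<Rightarrow> ('o, 'm, 'k) tensor_cat \<Rightarrow> 'o \<Rightarrow> ('o, 'm) md" where
  "free_module \<iota> T X = (X \<otimes>\<^bsub>T\<^esub> sc_obj \<iota> T,
     (idm T X \<odot>\<^bsub>T\<^esub> sc_mult \<iota> T) \<cdot>\<^bsub>T\<^esub> asc T X (sc_obj \<iota> T) (sc_obj \<iota> T))"

text \<open>The arrow \<open>(X \<otimes> A) \<otimes> (Y \<otimes> A) \<rightarrow> (X \<otimes> Y) \<otimes> A\<close> that multiplies the two
  factors \<open>A\<close>.\<close>

definition free_mult ::
  "('k::field \<Rightarrow> 'l::field) \<Rightarrow> ('o, 'm, 'k) tensor_cat \<Rightarrow> 'o \<Rightarrow> 'o \<Rightarrow> 'm" where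
  "free_mult \<iota> T X Y = (let A = sc_obj \<iota> T in
     inv_arr T (asc T X Y A) \<cdot>\<^bsub>T\<^esub>
     (idm T X \<odot>\<^bsub>T\<^esub>
        ((idm T Y \<odot>\<^bsub>T\<^esub> sc_mult \<iota> T) \<cdot>\<^bsub>T\<^esub> asc T Y A A \<cdot>\<^bsub>T\<^esub> bra T A (Y \<otimes>\<^bsub>T\<^esub> A))) \<cdot>\<^bsub>T\<^esub>
     asc T X A (Y \<otimes>\<^bsub>T\<^esub> A))"

definition extension_functor ::
  "('k::field \<Rightarrow> 'l::field) \<Rightarrow> ('o, 'm, 'k) tensor_cat \<Rightarrow>
   ('o, 'm, ('o, 'm) md, ('o, 'm) md_arr) tensor_functor" where
  "extension_functor \<iota> T = \<lparr>
     fob = free_module \<iota> T,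
     far = (\<lambda>f. (free_module \<iota> T (src T f), free_module \<iota> T (tgt T f),
       f \<odot>\<^bsub>T\<^esub> idm T (sc_obj \<iota> T))),
     fmul = (\<lambda>X Y. (ten_module \<iota> T (free_module \<iota> T X) (free_module \<iota> T Y),
       free_module \<iota> T (X \<otimes>\<^bsub>T\<^esub> Y),
       factor_through T (ten_proj \<iota> T (free_module \<iota> T X) (free_module \<iota> T Y))
         (free_mult \<iota> T X Y))),
     fone = (unit_module \<iota> T, free_module \<iota> T (unt T), inv_arr T (lun T (sc_obj \<iota> T)))\<rparr>"

end

theory Submission
  imports Defs
begin

text \<open>Write \<open>A = K \<otimes> I\<close>. An arrow out of \<open>X \<otimes> A\<close> is determined by its composites with the
  arrows \<open>x \<mapsto> x \<otimes> c\<close>, \<open>c \<in> K\<close>, so an \<open>A\<close>-module is an object with an action of the field \<open>K\<close>,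
  and kernels, cokernels and lengths of modules are controlled by those in \<open>T\<close>.
  Separability provides an element \<open>e = \<Sum> u\<^sub>i \<otimes> v\<^sub>i\<close> of \<open>K \<otimes> K\<close> with
  \<open>\<Sum> u\<^sub>i v\<^sub>i = 1\<close> and \<open>(c \<otimes> 1) e = (1 \<otimes> c) e\<close>. It acts on \<open>M \<otimes> N\<close> as an idempotent
  with image \<open>M \<otimes>\<^sub>K N\<close>, so that the tensor product over \<open>K\<close> is a retract of \<open>M \<otimes> N\<close>; it also makes
  every module a retract of the free module on its underlying object, which gives condition (ii) and duals.
  Since the unit \<open>I\<close> is simple, \<open>Hom(A, X \<otimes> A) = Hom(I, X) \<otimes> K\<close> shows that the largest trivial
  subobject of \<open>X \<otimes> A\<close> comes from the largest trivial subobject of \<open>X\<close>; this gives condition (i)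
  and identifies the invariant objects.\<close>

section \<open>Categories\<close>

text \<open>Products over \<open>K\<close> are coequalizers given by an unspecified choice, so
  arrows out of them are known only through composites with projections. Hence naturality and
  coherence for modules are checked after precomposition, and the projections have to stay epic when
  tensored further; a split coequalizer has this property. The element \<open>e\<close> is found one
  \<open>x\<close> at a time. If \<open>p\<close> is a separable polynomial with root
  \<open>x\<close>, then \<open>D = (p(s) - p(t)) / (s - t)\<close>, evaluated at the two actions
  \<open>s\<close>, \<open>t\<close> of \<open>x\<close>, satisfies \<open>s D = t D\<close>;
  multiplication sends it to \<open>p'(x)\<close>, by which it is divided. The product of these
  operators over a basis of \<open>K\<close> works for all of \<open>K\<close>. Only the operators
  are formed, each together with its image under multiplication in \<open>K\<close>. For duals of
  modules one triangle identity is verified by hand; the other one is forced by splitting an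
  idempotent. Simplicity of the unit is not an axiom here. It is derived from rigidity and
  \<open>End(I) = k\<close>, and it is what allows an arrow from \<open>I\<close> that does not
  factor through a trivial subobject to be added to it as a direct summand.\<close>

lemma in_hom [simp]: "f \<in> hom C X Y \<longleftrightarrow> f \<in> arr C \<and> src C f = X \<and> tgt C f = Y"
  by (simp add: hom_def)

lemma ex1_eq: "\<exists>!x. P x \<Longrightarrow> P x \<Longrightarrow> P y \<Longrightarrow> x = y"
  by blast

section \<open>Cancellation, isomorphisms and universal properties in a plain category\<close>

context category
begin

lemma src_in_obj [simp]: "f \<in> arr C \<Longrightarrow> src C f \<in> obj C"
  and tgt_in_obj [simp]: "f \<in> arr C \<Longrightarrow> tgt C f \<in> obj C"
  by (auto intro: src_obj tgt_obj)

lemma idm_simps [simp]: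
  assumes "X \<in> obj C"
  shows "idm C X \<in> arr C" "src C (idm C X) = X" "tgt C (idm C X) = X"
  using id_hom[OF assms] by auto

lemma cmp_simps [simp]:
  assumes "f \<in> arr C" "g \<in> arr C" "src C g = tgt C f"
  shows "g \<cdot> f \<in> arr C" "src C (g \<cdot> f) = src C f" "tgt C (g \<cdot> f) = tgt C g"
  using cmp_hom[of f "src C f" "tgt C f" g "tgt C g"] assms by auto

lemma cmp_idm [simp]: "f \<in> arr C \<Longrightarrow> X = src C f \<Longrightarrow> f \<cdot> idm C X = f"
  using cmp_id by auto

lemma idm_cmp [simp]: "f \<in> arr C \<Longrightarrow> X = tgt C f \<Longrightarrow> idm C X \<cdot> f = f"
  using id_cmp by auto

lemma assoc [simp]:
  "f \<in> arr C \<Longrightarrow> g \<in> arr C \<Longrightarrow> h \<in> arr C \<Longrightarrow> src C g = tgt C f \<Longrightarrow> src C h = tgt C g \<Longrightarrow>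
    (h \<cdot> g) \<cdot> f = h \<cdot> (g \<cdot> f)"
  using cmp_assoc[of f "src C f" "tgt C f" g "tgt C g" h "tgt C h"] by auto

text \<open>The simplifier nests composites to the right, so an identity
  \<open>a \<cdot> b = c\<close> no longer matches inside a longer composite; this form applies it
  there.\<close>

lemma reassoc:
  assumes "a \<cdot> b = c" "a \<in> arr C" "b \<in> arr C" "src C a = tgt C b" "y \<in> arr C" "tgt C y = src C b"
  shows "a \<cdot> (b \<cdot> y) = c \<cdot> y"
  using assms assoc[of y b a] by simp

lemma inverses_unique: "inverses C f g \<Longrightarrow> inverses C f h \<Longrightarrow> g = h"
  unfolding inverses_def by (metis in_hom assoc cmp_idm idm_cmp)

lemma inverses_inv: "is_iso C f \<Longrightarrow> inverses C f (inv_arr C f)"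
  unfolding is_iso_def inv_arr_def by (metis inverses_unique theI)

lemma inv_simps [simp]:
  assumes "is_iso C f"
  shows "inv_arr C f \<in> arr C" "src C (inv_arr C f) = tgt C f" "tgt C (inv_arr C f) = src C f"
    "inv_arr C f \<cdot> f = idm C (src C f)" "f \<cdot> inv_arr C f = idm C (tgt C f)"
  using inverses_inv[OF assms] by (auto simp: inverses_def)

lemma iso_arr: "is_iso C f \<Longrightarrow> f \<in> arr C"
  by (auto simp: is_iso_def inverses_def)

lemma inv_cancel [simp]:
  assumes "is_iso C f" "x \<in> arr C"
  shows "tgt C x = src C f \<Longrightarrow> inv_arr C f \<cdot> (f \<cdot> x) = x"
    "tgt C x = tgt C f \<Longrightarrow> f \<cdot> (inv_arr C f \<cdot> x) = x"
  using assms iso_arr[OF assms(1)]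
  by (simp_all flip: assoc)

lemma isoI:
  assumes "f \<in> arr C" "g \<in> arr C" "src C g = tgt C f" "tgt C g = src C f"
    "g \<cdot> f = idm C (src C f)" "f \<cdot> g = idm C (tgt C f)"
  shows "is_iso C f" and inv_eqI: "inv_arr C f = g"
proof -
  have *: "inverses C f g"
    using assms by (simp add: inverses_def)
  then show "is_iso C f"
    by (auto simp: is_iso_def)
  then show "inv_arr C f = g"
    using * inverses_inv inverses_unique by blast
qed

lemma iso_idm [simp]: "X \<in> obj C \<Longrightarrow> is_iso C (idm C X)"
  by (rule isoI[of _ "idm C X"]) auto

lemma iso_inv: "is_iso C f \<Longrightarrow> is_iso C (inv_arr C f)"
  by (rule isoI[of _ f]) (auto simp: iso_arr)

lemma iso_cmp:
  assumes "is_iso C f" "is_iso C g" "src C g = tgt C f"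
  shows "is_iso C (g \<cdot> f)"
  by (rule isoI[of _ "inv_arr C f \<cdot> inv_arr C g"]) (use assms in \<open>auto simp: iso_arr\<close>)

lemma iso_cancel_left:
  assumes "is_iso C f" "f \<cdot> g = f \<cdot> h" "g \<in> arr C" "h \<in> arr C" "tgt C g = src C f" "tgt C h = src C f"
  shows "g = h"
proof -
  have "g = inv_arr C f \<cdot> (f \<cdot> g)" using assms(1,3,5) by simp
  also have "\<dots> = inv_arr C f \<cdot> (f \<cdot> h)" by (simp only: assms(2))
  also have "\<dots> = h" using assms(1,4,6) by simp
  finally show ?thesis .
qed

lemma iso_cancel_right:
  assumes "is_iso C f" "g \<cdot> f = h \<cdot> f" "g \<in> arr C" "h \<in> arr C" "src C g = tgt C f" "src C h = tgt C f"
  shows "g = h"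
proof -
  have "g = (g \<cdot> f) \<cdot> inv_arr C f" using assms(1,3,5) iso_arr[OF assms(1)] by simp
  also have "\<dots> = (h \<cdot> f) \<cdot> inv_arr C f" by (simp only: assms(2))
  also have "\<dots> = h" using assms(1,4,6) iso_arr[OF assms(1)] by simp
  finally show ?thesis .
qed

lemma mono_cancel:
  assumes "is_mono C f" "f \<cdot> g = f \<cdot> h" "g \<in> arr C" "h \<in> arr C" "tgt C g = src C f" "tgt C h = src C f"
    "src C g = src C h"
  shows "g = h"
  using assms unfolding is_mono_def by fastforce

lemma epi_cancel:
  assumes "is_epi C f" "g \<cdot> f = h \<cdot> f" "g \<in> arr C" "h \<in> arr C" "src C g = tgt C f" "src C h = tgt C f"
    "tgt C g = tgt C h"
  shows "g = h"
  using assms unfolding is_epi_def by fastforce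

text \<open>Every arrow is recovered from its composite with \<open>p\<close> by composing with the
  section. Being split also survives any functor, which is how epimorphisms are later kept under
  tensoring.\<close>

lemma split_epi:
  assumes "p \<in> arr C" "s \<in> arr C" "src C p = tgt C s" "p \<cdot> s = idm C (tgt C p)" "src C s = tgt C p"
  shows "is_epi C p"
  unfolding is_epi_def
proof (intro conjI allI ballI impI)
  fix W g h
  assume gh: "g \<in> hom C (tgt C p) W" "h \<in> hom C (tgt C p) W" and e: "g \<cdot> p = h \<cdot> p"
  have "g = (g \<cdot> p) \<cdot> s" using assms gh by simp
  also have "\<dots> = (h \<cdot> p) \<cdot> s" by (simp only: e)
  also have "\<dots> = h" using assms gh by simp
  finally show "g = h" .
qed (rule assms)

lemma split_mono:
  assumes "p \<in> arr C" "s \<in> arr C" "src C p = tgt C s" "p \<cdot> s = idm C (tgt C p)" "src C s = tgt C p"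
  shows "is_mono C s"
  unfolding is_mono_def
proof (intro conjI allI ballI impI)
  fix W g h
  assume gh: "g \<in> hom C W (src C s)" "h \<in> hom C W (src C s)" and e: "s \<cdot> g = s \<cdot> h"
  have "g = p \<cdot> (s \<cdot> g)" using assms gh reassoc[OF assms(4), of g] by simp
  also have "\<dots> = p \<cdot> (s \<cdot> h)" by (simp only: e)
  also have "\<dots> = h" using assms gh reassoc[OF assms(4), of h] by simp
  finally show "g = h" .
qed (rule assms)

lemma iso_mono: "is_iso C f \<Longrightarrow> is_mono C f"
  by (rule split_mono[of "inv_arr C f"]) (auto simp: iso_arr)

lemma iso_epi: "is_iso C f \<Longrightarrow> is_epi C f"
  by (rule split_epi[of _ "inv_arr C f"]) (auto simp: iso_arr)

lemma mono_cmp: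
  assumes "is_mono C f" "is_mono C g" "src C g = tgt C f"
  shows "is_mono C (g \<cdot> f)"
proof -
  have a: "f \<in> arr C" "g \<in> arr C" using assms by (auto simp: is_mono_def)
  show ?thesis
    unfolding is_mono_def
  proof (intro conjI allI ballI impI)
    fix W x y
    assume "x \<in> hom C W (src C (g \<cdot> f))" "y \<in> hom C W (src C (g \<cdot> f))" "g \<cdot> f \<cdot> x = g \<cdot> f \<cdot> y"
    then show "x = y"
      using a assms mono_cancel[OF assms(2), of "f \<cdot> x" "f \<cdot> y"] mono_cancel[OF assms(1), of x y]
      by simp
  qed (use a assms in simp)
qed

lemma epi_cmp:
  assumes "is_epi C f" "is_epi C g" "src C g = tgt C f"
  shows "is_epi C (g \<cdot> f)"
proof -
  have a: "f \<in> arr C" "g \<in> arr C" using assms by (auto simp: is_epi_def)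
  show ?thesis
    unfolding is_epi_def
  proof (intro conjI allI ballI impI)
    fix W x y
    assume "x \<in> hom C (tgt C (g \<cdot> f)) W" "y \<in> hom C (tgt C (g \<cdot> f)) W" "x \<cdot> (g \<cdot> f) = y \<cdot> (g \<cdot> f)"
    then show "x = y"
      using a assms epi_cancel[OF assms(1), of "x \<cdot> g" "y \<cdot> g"] epi_cancel[OF assms(2), of x y]
      by simp
  qed (use a assms in simp)
qed

lemma kernelD:
  assumes "is_kernel C g i"
  shows "g \<in> arr C" "i \<in> arr C" "tgt C i = src C g" "g \<cdot> i = zer C (src C i) (tgt C g)"
  using assms by (auto simp: is_kernel_def)

lemma kernel_factor:
  assumes "is_kernel C g i" "h \<in> arr C" "tgt C h = src C g" "g \<cdot> h = zer C (src C h) (tgt C g)"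
  obtains u where "u \<in> arr C" "src C u = src C h" "tgt C u = src C i" "i \<cdot> u = h"
proof -
  have "\<exists>!u. u \<in> hom C (src C h) (src C i) \<and> i \<cdot> u = h"
    using assms(1-4) unfolding is_kernel_def by simp
  then obtain u where "u \<in> hom C (src C h) (src C i) \<and> i \<cdot> u = h" by blast
  then show thesis by (intro that[of u]) auto
qed

lemma cokernelD:
  assumes "is_cokernel C f p"
  shows "f \<in> arr C" "p \<in> arr C" "src C p = tgt C f" "p \<cdot> f = zer C (src C f) (tgt C p)"
  using assms by (auto simp: is_cokernel_def)

lemma cokernel_factor:
  assumes "is_cokernel C f p" "h \<in> arr C" "src C h = tgt C f" "h \<cdot> f = zer C (src C f) (tgt C h)"
  obtains u where "u \<in> arr C" "src C u = tgt C p" "tgt C u = tgt C h" "u \<cdot> p = h"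
proof -
  have "\<exists>!u. u \<in> hom C (tgt C p) (tgt C h) \<and> u \<cdot> p = h"
    using assms(1-4) unfolding is_cokernel_def by simp
  then obtain u where "u \<in> hom C (tgt C p) (tgt C h) \<and> u \<cdot> p = h" by blast
  then show thesis by (intro that[of u]) auto
qed

end

section \<open>Linear categories\<close>

context linear_category
begin

lemma zer_simps [simp]:
  assumes "X \<in> obj C" "Y \<in> obj C"
  shows "zer C X Y \<in> arr C" "src C (zer C X Y) = X" "tgt C (zer C X Y) = Y"
  using zer_hom[OF assms] by auto

lemma add_simps [simp]:
  assumes "f \<in> arr C" "g \<in> arr C" "src C g = src C f" "tgt C g = tgt C f"
  shows "f \<oplus> g \<in> arr C" "src C (f \<oplus> g) = src C f" "tgt C (f \<oplus> g) = tgt C f"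
  using add_hom[of f "src C f" "tgt C f" g] assms by auto

lemma scl_simps [simp]:
  assumes "f \<in> arr C"
  shows "scl C a f \<in> arr C" "src C (scl C a f) = src C f" "tgt C (scl C a f) = tgt C f"
  using scl_hom[of f "src C f" "tgt C f" a] assms by auto

lemma cmp_add [simp]:
  "f \<in> arr C \<Longrightarrow> g \<in> arr C \<Longrightarrow> h \<in> arr C \<Longrightarrow> src C h = tgt C f \<Longrightarrow> src C g = src C f \<Longrightarrow>
    tgt C g = tgt C f \<Longrightarrow> h \<cdot> (f \<oplus> g) = h \<cdot> f \<oplus> h \<cdot> g"
  by (rule cmp_add_right) auto

lemma add_cmp [simp]:
  "f \<in> arr C \<Longrightarrow> g \<in> arr C \<Longrightarrow> h \<in> arr C \<Longrightarrow> src C g = tgt C f \<Longrightarrow> src C h = src C g \<Longrightarrow>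
    tgt C h = tgt C g \<Longrightarrow> (g \<oplus> h) \<cdot> f = g \<cdot> f \<oplus> h \<cdot> f"
  by (rule cmp_add_left) auto

lemma cmp_scl [simp]:
  "f \<in> arr C \<Longrightarrow> g \<in> arr C \<Longrightarrow> src C g = tgt C f \<Longrightarrow> g \<cdot> scl C a f = scl C a (g \<cdot> f)"
  by (rule cmp_scl_right) auto

lemma scl_cmp [simp]:
  "f \<in> arr C \<Longrightarrow> g \<in> arr C \<Longrightarrow> src C g = tgt C f \<Longrightarrow> scl C a g \<cdot> f = scl C a (g \<cdot> f)"
  by (rule cmp_scl_left) auto

lemma scl_1 [simp]: "f \<in> arr C \<Longrightarrow> scl C 1 f = f"
  by (rule scl_one) auto

lemma scl_scl: "f \<in> arr C \<Longrightarrow> scl C a (scl C b f) = scl C (a * b) f"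
  by (rule scl_mult[symmetric]) auto

lemma add_zero [simp]: "f \<in> arr C \<Longrightarrow> X = src C f \<Longrightarrow> Y = tgt C f \<Longrightarrow> f \<oplus> zer C X Y = f"
  using add_zer by auto

lemma zero_add [simp]: "f \<in> arr C \<Longrightarrow> X = src C f \<Longrightarrow> Y = tgt C f \<Longrightarrow> zer C X Y \<oplus> f = f"
  using add_zer[of f X Y] add_commute[of f X Y "zer C X Y"] by auto

lemma add_left_cancel:
  assumes "f \<oplus> g = f \<oplus> h" "f \<in> arr C" "g \<in> arr C" "h \<in> arr C" "src C g = src C f"
    "tgt C g = tgt C f" "src C h = src C f" "tgt C h = tgt C f"
  shows "g = h"
proof -
  obtain n where n: "n \<in> arr C" "src C n = src C f" "tgt C n = tgt C f"
    "f \<oplus> n = zer C (src C f) (tgt C f)"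
    using add_inverse[of f "src C f" "tgt C f"] assms(2) by auto
  have *: "x = n \<oplus> (f \<oplus> x)" if "x \<in> arr C" "src C x = src C f" "tgt C x = tgt C f" for x
    using that n assms(2) add_assoc[of n "src C f" "tgt C f" f x]
      add_commute[of n "src C f" "tgt C f" f] by simp
  show ?thesis
    using *[of g] *[of h] assms by simp
qed

lemma scl_zero_left [simp]: "f \<in> arr C \<Longrightarrow> scl C 0 f = zer C (src C f) (tgt C f)"
  using scl_add_left[of f "src C f" "tgt C f" 0 0]
    add_left_cancel[of "scl C 0 f" "scl C 0 f" "zer C (src C f) (tgt C f)"] by simp

lemma scl_zer [simp]: "X \<in> obj C \<Longrightarrow> Y \<in> obj C \<Longrightarrow> scl C a (zer C X Y) = zer C X Y"
  using scl_scl[of "zer C X Y" a 0] scl_zero_left[of "zer C X Y"] by simp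

text \<open>Zero arrows are absorbed because a zero arrow is its own multiple by \<open>0\<close>,
  which reduces the claim to \<open>k\<close>-linearity of composition.\<close>

lemma cmp_zer [simp]:
  "f \<in> arr C \<Longrightarrow> X \<in> obj C \<Longrightarrow> src C f = Y \<Longrightarrow> f \<cdot> zer C X Y = zer C X (tgt C f)"
  using cmp_scl[of "zer C X Y" f 0] src_in_obj[of f] by auto

lemma zer_cmp [simp]:
  "f \<in> arr C \<Longrightarrow> Y \<in> obj C \<Longrightarrow> tgt C f = X \<Longrightarrow> zer C X Y \<cdot> f = zer C (src C f) Y"
  using scl_cmp[of f "zer C X Y" 0] tgt_in_obj[of f] by auto

lemma add_neg:
  assumes "f \<in> arr C"
  shows "f \<oplus> scl C (-1) f = zer C (src C f) (tgt C f)"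
proof -
  have "scl C (1 + - 1) f = scl C 1 f \<oplus> scl C (-1) f"
    using assms by (intro scl_add_left) auto
  then show ?thesis using assms by simp
qed

lemma eq_if_diff_zero:
  assumes "f \<oplus> scl C (-1) g = zer C (src C f) (tgt C f)" "f \<in> arr C" "g \<in> arr C"
    "src C g = src C f" "tgt C g = tgt C f"
  shows "f = g"
proof -
  have "(f \<oplus> scl C (-1) g) \<oplus> g = f \<oplus> (scl C (-1) g \<oplus> g)"
    using assms by (intro add_assoc) auto
  also have "scl C (-1) g \<oplus> g = g \<oplus> scl C (-1) g"
    using assms by (intro add_commute) auto
  finally show ?thesis
    using assms by (simp add: add_neg)
qed

text \<open>Hom sets are groups and composition is additive, so cancelling \<open>f\<close> is
  tested on the difference of two arrows.\<close>

lemma monoI: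
  assumes f: "f \<in> arr C"
    and z: "\<And>g. g \<in> arr C \<Longrightarrow> tgt C g = src C f \<Longrightarrow> f \<cdot> g = zer C (src C g) (tgt C f) \<Longrightarrow>
      g = zer C (src C g) (src C f)"
  shows "is_mono C f"
  unfolding is_mono_def
proof (intro conjI allI ballI impI)
  fix W g h
  assume gh: "g \<in> hom C W (src C f)" "h \<in> hom C W (src C f)" and e: "f \<cdot> g = f \<cdot> h"
  have W: "W \<in> obj C" using gh by auto
  let ?d = "g \<oplus> scl C (-1) h"
  have "f \<cdot> ?d = f \<cdot> g \<oplus> scl C (-1) (f \<cdot> h)" using gh f by simp
  also have "\<dots> = zer C (src C ?d) (tgt C f)"
    using gh f add_neg[of "f \<cdot> h"] e by simp
  finally have "?d = zer C (src C ?d) (src C f)"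
    using z[of ?d] gh f W by simp
  then show "g = h"
    using gh by (intro eq_if_diff_zero[of g h]) auto
qed (rule f)

lemma epiI:
  assumes f: "f \<in> arr C"
    and z: "\<And>g. g \<in> arr C \<Longrightarrow> src C g = tgt C f \<Longrightarrow> g \<cdot> f = zer C (src C f) (tgt C g) \<Longrightarrow>
      g = zer C (tgt C f) (tgt C g)"
  shows "is_epi C f"
  unfolding is_epi_def
proof (intro conjI allI ballI impI)
  fix W g h
  assume gh: "g \<in> hom C (tgt C f) W" "h \<in> hom C (tgt C f) W" and e: "g \<cdot> f = h \<cdot> f"
  have W: "W \<in> obj C" using gh by auto
  let ?d = "g \<oplus> scl C (-1) h"
  have "?d \<cdot> f = g \<cdot> f \<oplus> scl C (-1) (h \<cdot> f)" using gh f by simp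
  also have "\<dots> = zer C (src C f) (tgt C ?d)"
    using gh f add_neg[of "h \<cdot> f"] e by simp
  finally have "?d = zer C (tgt C f) (tgt C ?d)"
    using z[of ?d] gh f W by simp
  then show "g = h"
    using gh by (intro eq_if_diff_zero[of g h]) auto
qed (rule f)

lemma mono_zero:
  assumes "is_mono C f" "g \<in> arr C" "tgt C g = src C f" "f \<cdot> g = zer C (src C g) (tgt C f)"
  shows "g = zer C (src C g) (src C f)"
proof -
  have "f \<in> arr C" using assms by (simp add: is_mono_def)
  then show ?thesis
    using assms by (intro mono_cancel[OF assms(1), of g "zer C (src C g) (src C f)"]) auto
qed

lemma epi_zero:
  assumes "is_epi C f" "g \<in> arr C" "src C g = tgt C f" "g \<cdot> f = zer C (src C f) (tgt C g)"
  shows "g = zer C (tgt C f) (tgt C g)"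
proof -
  have "f \<in> arr C" using assms by (simp add: is_epi_def)
  then show ?thesis
    using assms by (intro epi_cancel[OF assms(1), of g "zer C (tgt C f) (tgt C g)"]) auto
qed

lemma kernel_mono: "is_kernel C g i \<Longrightarrow> is_mono C i"
  unfolding is_mono_def
proof (intro conjI allI ballI impI)
  fix W x y
  assume k: "is_kernel C g i" and xy: "x \<in> hom C W (src C i)" "y \<in> hom C W (src C i)" "i \<cdot> x = i \<cdot> y"
  note kD = kernelD[OF k]
  have "g \<cdot> (i \<cdot> x) = zer C W (tgt C g)"
    using xy kD reassoc[OF kD(4), of x] by simp
  then have *: "\<exists>!u. u \<in> hom C W (src C i) \<and> i \<cdot> u = i \<cdot> x"
    using k xy kD unfolding is_kernel_def by simp
  show "x = y" by (rule ex1_eq[OF *]) (use xy in simp_all)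
qed (auto dest: kernelD)

lemma cokernel_epi: "is_cokernel C f p \<Longrightarrow> is_epi C p"
  unfolding is_epi_def
proof (intro conjI allI ballI impI)
  fix W x y
  assume k: "is_cokernel C f p" and xy: "x \<in> hom C (tgt C p) W" "y \<in> hom C (tgt C p) W" "x \<cdot> p = y \<cdot> p"
  note kD = cokernelD[OF k]
  have "(x \<cdot> p) \<cdot> f = zer C (src C f) W"
    using xy kD by simp
  then have *: "\<exists>!u. u \<in> hom C (tgt C p) W \<and> u \<cdot> p = x \<cdot> p"
    using k xy kD unfolding is_cokernel_def by simp
  show "x = y" by (rule ex1_eq[OF *]) (use xy in simp_all)
qed (auto dest: cokernelD)

text \<open>Uniqueness in the universal property is the cancellation of \<open>i\<close>, so that
  only the existence of a factorization has to be supplied.\<close>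

lemma kernelI:
  assumes "is_mono C i" "g \<in> arr C" "tgt C i = src C g" "g \<cdot> i = zer C (src C i) (tgt C g)"
    and f: "\<And>h. h \<in> arr C \<Longrightarrow> tgt C h = src C g \<Longrightarrow> g \<cdot> h = zer C (src C h) (tgt C g) \<Longrightarrow>
      \<exists>u \<in> hom C (src C h) (src C i). i \<cdot> u = h"
  shows "is_kernel C g i"
  unfolding is_kernel_def
proof (intro conjI allI ballI impI)
  fix W h
  assume h: "h \<in> hom C W (src C g)" "g \<cdot> h = zer C W (tgt C g)"
  then obtain u where "u \<in> hom C W (src C i)" "i \<cdot> u = h" using f[of h] by auto
  moreover have "u' = u" if "u' \<in> hom C W (src C i) \<and> i \<cdot> u' = h" for u'
    using that \<open>u \<in> hom C W (src C i)\<close> \<open>i \<cdot> u = h\<close> by (intro mono_cancel[OF assms(1), of u' u]) auto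
  ultimately show "\<exists>!u. u \<in> hom C W (src C i) \<and> i \<cdot> u = h" by blast
qed (use assms in \<open>auto simp: is_mono_def\<close>)

lemma cokernelI:
  assumes "is_epi C p" "f \<in> arr C" "src C p = tgt C f" "p \<cdot> f = zer C (src C f) (tgt C p)"
    and e: "\<And>h. h \<in> arr C \<Longrightarrow> src C h = tgt C f \<Longrightarrow> h \<cdot> f = zer C (src C f) (tgt C h) \<Longrightarrow>
      \<exists>u \<in> hom C (tgt C p) (tgt C h). u \<cdot> p = h"
  shows "is_cokernel C f p"
  unfolding is_cokernel_def
proof (intro conjI allI ballI impI)
  fix W h
  assume h: "h \<in> hom C (tgt C f) W" "h \<cdot> f = zer C (src C f) W"
  then obtain u where "u \<in> hom C (tgt C p) W" "u \<cdot> p = h" using e[of h] by auto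
  moreover have "u' = u" if "u' \<in> hom C (tgt C p) W \<and> u' \<cdot> p = h" for u'
    using that \<open>u \<in> hom C (tgt C p) W\<close> \<open>u \<cdot> p = h\<close> by (intro epi_cancel[OF assms(1), of u' u]) auto
  ultimately show "\<exists>!u. u \<in> hom C (tgt C p) W \<and> u \<cdot> p = h" by blast
qed (use assms in \<open>auto simp: is_epi_def\<close>)

lemma zero_objectD:
  assumes "is_zero_object C X"
  shows "f \<in> arr C \<Longrightarrow> src C f = X \<Longrightarrow> f = zer C X (tgt C f)"
    and "f \<in> arr C \<Longrightarrow> tgt C f = X \<Longrightarrow> f = zer C (src C f) X"
proof -
  have z: "idm C X = zer C X X" "X \<in> obj C" using assms by (auto simp: is_zero_object_def)
  show "f \<in> arr C \<Longrightarrow> src C f = X \<Longrightarrow> f = zer C X (tgt C f)"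
    using z cmp_idm[of f X] by simp
  show "f \<in> arr C \<Longrightarrow> tgt C f = X \<Longrightarrow> f = zer C (src C f) X"
    using z idm_cmp[of f X] by simp
qed

text \<open>The arrow \<open>i\<close> vanishes, so the monomorphism kills the identity of its
  source, which therefore vanishes as well.\<close>

lemma mono_to_zero:
  assumes "is_mono C i" "tgt C i = X" "is_zero_object C X"
  shows "is_zero_object C (src C i)" "is_iso C i"
proof -
  have a: "i \<in> arr C" using assms by (simp add: is_mono_def)
  then have z: "i = zer C (src C i) X" using zero_objectD assms by blast
  have X: "X \<in> obj C" "idm C X = zer C X X" using assms by (auto simp: is_zero_object_def)
  have "i \<cdot> idm C (src C i) = zer C (src C i) X" using a z[symmetric] by simp
  then have *: "idm C (src C i) = zer C (src C i) (src C i)"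
    using mono_zero[OF assms(1), of "idm C (src C i)"] a assms(2) by simp
  then show "is_zero_object C (src C i)" using a by (simp add: is_zero_object_def)
  show "is_iso C i"
    using a X * assms(2) by (intro isoI[of _ "zer C X (src C i)"]) auto
qed

lemma epi_from_zero:
  assumes "is_epi C p" "src C p = X" "is_zero_object C X"
  shows "is_zero_object C (tgt C p)" "is_iso C p"
proof -
  have a: "p \<in> arr C" using assms by (simp add: is_epi_def)
  then have z: "p = zer C X (tgt C p)" using zero_objectD assms by blast
  have X: "X \<in> obj C" "idm C X = zer C X X" using assms by (auto simp: is_zero_object_def)
  have "idm C (tgt C p) \<cdot> p = zer C X (tgt C p)" using a z[symmetric] by simp
  then have *: "idm C (tgt C p) = zer C (tgt C p) (tgt C p)"
    using epi_zero[OF assms(1), of "idm C (tgt C p)"] a assms(2) by simp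
  then show "is_zero_object C (tgt C p)" using a by (simp add: is_zero_object_def)
  show "is_iso C p"
    using a X * assms(2) by (intro isoI[of _ "zer C (tgt C p) X"]) auto
qed

subsection \<open>Finite sums of arrows and direct sums\<close>

lemma arr_sum_simps [simp]:
  assumes "X \<in> obj C" "Y \<in> obj C" "\<And>l. l < n \<Longrightarrow> f l \<in> hom C X Y"
  shows "arr_sum C X Y f n \<in> arr C" "src C (arr_sum C X Y f n) = X" "tgt C (arr_sum C X Y f n) = Y"
  using assms(3) by (induction n) (use assms(1,2) in auto)

lemma arr_sum_cong: "(\<And>l. l < n \<Longrightarrow> f l = g l) \<Longrightarrow> arr_sum C X Y f n = arr_sum C X Y g n"
  by (induction n) auto

lemma cmp_arr_sum:
  assumes "X \<in> obj C" "g \<in> arr C" "src C g = Y" "\<And>l. l < n \<Longrightarrow> f l \<in> hom C X Y"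
  shows "g \<cdot> arr_sum C X Y f n = arr_sum C X (tgt C g) (\<lambda>l. g \<cdot> f l) n"
  using assms(4) by (induction n) (use assms(1-3) in auto)

lemma arr_sum_cmp:
  assumes "Y \<in> obj C" "g \<in> arr C" "tgt C g = X" "\<And>l. l < n \<Longrightarrow> f l \<in> hom C X Y"
  shows "arr_sum C X Y f n \<cdot> g = arr_sum C (src C g) Y (\<lambda>l. f l \<cdot> g) n"
  using assms(4) by (induction n) (use assms(1-3) in auto)

lemma arr_sum_delta:
  assumes "X \<in> obj C" "Y \<in> obj C" "a \<in> hom C X Y"
  shows "arr_sum C X Y (\<lambda>l. if l = j then a else zer C X Y) n = (if j < n then a else zer C X Y)"
  by (induction n) (use assms in \<open>auto simp: less_Suc_eq\<close>)

lemma add_swap: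
  assumes "a \<in> hom C X Y" "b \<in> hom C X Y" "c \<in> hom C X Y" "d \<in> hom C X Y"
  shows "(a \<oplus> b) \<oplus> (c \<oplus> d) = (a \<oplus> c) \<oplus> (b \<oplus> d)"
proof -
  have "(a \<oplus> b) \<oplus> (c \<oplus> d) = a \<oplus> ((b \<oplus> c) \<oplus> d)"
    using assms by (simp add: add_assoc[of _ X Y])
  also have "b \<oplus> c = c \<oplus> b" using assms by (intro add_commute)
  also have "a \<oplus> ((c \<oplus> b) \<oplus> d) = (a \<oplus> c) \<oplus> (b \<oplus> d)"
    using assms by (simp add: add_assoc[of _ X Y])
  finally show ?thesis .
qed

lemma arr_sum_add:
  assumes "X \<in> obj C" "Y \<in> obj C" "\<And>l. l < n \<Longrightarrow> f l \<in> hom C X Y" "\<And>l. l < n \<Longrightarrow> g l \<in> hom C X Y"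
  shows "arr_sum C X Y (\<lambda>l. f l \<oplus> g l) n = arr_sum C X Y f n \<oplus> arr_sum C X Y g n"
  using assms(3,4)
proof (induction n)
  case (Suc n)
  then have "arr_sum C X Y (\<lambda>l. f l \<oplus> g l) n = arr_sum C X Y f n \<oplus> arr_sum C X Y g n" by simp
  then show ?case
    using Suc.prems assms(1,2) by (simp, intro add_swap[of _ X Y]) auto
qed (use assms in auto)

lemma arr_sum_scl:
  assumes "X \<in> obj C" "Y \<in> obj C" "\<And>l. l < n \<Longrightarrow> f l \<in> hom C X Y"
  shows "arr_sum C X Y (\<lambda>l. scl C a (f l)) n = scl C a (arr_sum C X Y f n)"
  using assms(3)
proof (induction n)
  case (Suc n)
  then have "arr_sum C X Y (\<lambda>l. scl C a (f l)) n = scl C a (arr_sum C X Y f n)" by simp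
  then show ?case
    using Suc.prems assms(1,2) by (simp add: scl_add_right[of _ X Y])
qed (use assms in auto)

lemma scl_left_distrib: "f \<in> arr C \<Longrightarrow> scl C (a + b) f = scl C a f \<oplus> scl C b f"
  by (rule scl_add_left) auto

lemma direct_sumD:
  assumes "is_direct_sum C n F S i p"
  shows "S \<in> obj C" "j < n \<Longrightarrow> i j \<in> arr C" "j < n \<Longrightarrow> src C (i j) = F j" "j < n \<Longrightarrow> tgt C (i j) = S"
    "j < n \<Longrightarrow> p j \<in> arr C" "j < n \<Longrightarrow> src C (p j) = S" "j < n \<Longrightarrow> tgt C (p j) = F j"
    "j < n \<Longrightarrow> l < n \<Longrightarrow> p j \<cdot> i l = (if j = l then idm C (F j) else zer C (F l) (F j))"
    "arr_sum C S S (\<lambda>j. i j \<cdot> p j) n = idm C S" "j < n \<Longrightarrow> F j \<in> obj C"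
proof -
  show "j < n \<Longrightarrow> F j \<in> obj C"
    using assms unfolding is_direct_sum_def by (metis in_hom src_in_obj)
qed (use assms in \<open>auto simp: is_direct_sum_def\<close>)

lemma direct_sum_expand_right:
  assumes d: "is_direct_sum C n F S i p" and f: "f \<in> arr C" "src C f = S"
  shows "f = arr_sum C S (tgt C f) (\<lambda>j. f \<cdot> (i j \<cdot> p j)) n"
proof -
  note D = direct_sumD[OF d]
  have "f = f \<cdot> arr_sum C S S (\<lambda>j. i j \<cdot> p j) n" using D(1,9) f by simp
  also have "\<dots> = arr_sum C S (tgt C f) (\<lambda>j. f \<cdot> (i j \<cdot> p j)) n"
    using D f by (intro cmp_arr_sum) auto
  finally show ?thesis .
qed

lemma direct_sum_expand_left:
  assumes d: "is_direct_sum C n F S i p" and f: "f \<in> arr C" "tgt C f = S"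
  shows "f = arr_sum C (src C f) S (\<lambda>j. i j \<cdot> (p j \<cdot> f)) n"
proof -
  note D = direct_sumD[OF d]
  have "f = arr_sum C S S (\<lambda>j. i j \<cdot> p j) n \<cdot> f" using D(1,9) f by simp
  also have "\<dots> = arr_sum C (src C f) S (\<lambda>j. (i j \<cdot> p j) \<cdot> f) n"
    using D f by (intro arr_sum_cmp) auto
  also have "\<dots> = arr_sum C (src C f) S (\<lambda>j. i j \<cdot> (p j \<cdot> f)) n"
    using D f by (intro arr_sum_cong) auto
  finally show ?thesis .
qed

lemma direct_sum_eqI:
  assumes d: "is_direct_sum C n F S i p" and f: "f \<in> arr C" "src C f = S" "g \<in> arr C" "src C g = S"
    "tgt C f = tgt C g" and e: "\<And>j. j < n \<Longrightarrow> f \<cdot> i j = g \<cdot> i j"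
  shows "f = g"
proof -
  note D = direct_sumD[OF d]
  have "f \<cdot> (i j \<cdot> p j) = g \<cdot> (i j \<cdot> p j)" if "j < n" for j
    using D f e[OF that] that by (simp flip: assoc)
  then have "arr_sum C S (tgt C f) (\<lambda>j. f \<cdot> (i j \<cdot> p j)) n
      = arr_sum C S (tgt C g) (\<lambda>j. g \<cdot> (i j \<cdot> p j)) n"
    unfolding f(5) by (rule arr_sum_cong)
  then show ?thesis
    using direct_sum_expand_right[OF d f(1,2)] direct_sum_expand_right[OF d f(3,4)] by metis
qed

lemma direct_sum_map_out:
  assumes d: "is_direct_sum C n F S i p" and Y: "Y \<in> obj C" and g: "\<And>j. j < n \<Longrightarrow> g j \<in> hom C (F j) Y"
  obtains u where "u \<in> arr C" "src C u = S" "tgt C u = Y" "\<And>j. j < n \<Longrightarrow> u \<cdot> i j = g j"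
proof
  note D = direct_sumD[OF d]
  let ?u = "arr_sum C S Y (\<lambda>j. g j \<cdot> p j) n"
  have h: "g j \<cdot> p j \<in> hom C S Y" if "j < n" for j using g[OF that] D that by simp
  show "?u \<in> arr C" "src C ?u = S" "tgt C ?u = Y" using h D Y by auto
  fix l assume l: "l < n"
  have "?u \<cdot> i l = arr_sum C (F l) Y (\<lambda>j. (g j \<cdot> p j) \<cdot> i l) n"
    using D l Y h arr_sum_cmp[of Y "i l" S n "\<lambda>j. g j \<cdot> p j"] by simp
  also have "\<dots> = arr_sum C (F l) Y (\<lambda>j. if j = l then g l else zer C (F l) Y) n"
  proof (rule arr_sum_cong)
    fix j assume j: "j < n"
    show "(g j \<cdot> p j) \<cdot> i l = (if j = l then g l else zer C (F l) Y)"
      using D(1-8,10) g[OF j] j l by auto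
  qed
  also have "\<dots> = g l" using l D Y g by (subst arr_sum_delta) auto
  finally show "?u \<cdot> i l = g l" .
qed

lemma direct_sum_iso:
  assumes d: "is_direct_sum C n F S i p" and f: "is_iso C f" "src C f = S"
  shows "is_direct_sum C n F (tgt C f) (\<lambda>j. f \<cdot> i j) (\<lambda>j. p j \<cdot> inv_arr C f)"
proof -
  note D = direct_sumD[OF d]
  note fa = iso_arr[OF f(1)]
  have "arr_sum C (tgt C f) (tgt C f) (\<lambda>j. (f \<cdot> i j) \<cdot> (p j \<cdot> inv_arr C f)) n
      = arr_sum C (tgt C f) (tgt C f) (\<lambda>j. f \<cdot> ((i j \<cdot> p j) \<cdot> inv_arr C f)) n"
    using D f fa by (intro arr_sum_cong) simp
  also have "\<dots> = f \<cdot> arr_sum C (tgt C f) S (\<lambda>j. (i j \<cdot> p j) \<cdot> inv_arr C f) n"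
    using D f fa cmp_arr_sum[of "tgt C f" f S n "\<lambda>j. (i j \<cdot> p j) \<cdot> inv_arr C f"] by simp
  also have "arr_sum C (tgt C f) S (\<lambda>j. (i j \<cdot> p j) \<cdot> inv_arr C f) n
      = arr_sum C S S (\<lambda>j. i j \<cdot> p j) n \<cdot> inv_arr C f"
    using D f fa arr_sum_cmp[of S "inv_arr C f" S n "\<lambda>j. i j \<cdot> p j"] by simp
  finally have s: "arr_sum C (tgt C f) (tgt C f) (\<lambda>j. (f \<cdot> i j) \<cdot> (p j \<cdot> inv_arr C f)) n = idm C (tgt C f)"
    using D f fa by simp
  show ?thesis
    unfolding is_direct_sum_def using D(1-8,10) f fa s by auto
qed

end

section \<open>Abelian categories\<close>

context linear_abelian_category
begin

text \<open>The axiom provides some \<open>g\<close> with kernel \<open>f\<close>. It factors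
  through the cokernel \<open>p\<close>, so whatever \<open>p\<close> kills is killed by
  \<open>g\<close> and thus factors through \<open>f\<close>.\<close>

lemma mono_kernel_of_cokernel:
  assumes "is_mono C f" "is_cokernel C f p"
  shows "is_kernel C p f"
proof -
  obtain g where g: "is_kernel C g f" using mono_kernel[OF assms(1)] by blast
  note G = kernelD[OF g] and P = cokernelD[OF assms(2)]
  obtain u where u: "u \<in> arr C" "src C u = tgt C p" "tgt C u = tgt C g" "u \<cdot> p = g"
    using cokernel_factor[OF assms(2), of g] G by auto
  show ?thesis
  proof (rule kernelI[OF assms(1)])
    fix h assume h: "h \<in> arr C" "tgt C h = src C p" "p \<cdot> h = zer C (src C h) (tgt C p)"
    then have "g \<cdot> h = zer C (src C h) (tgt C g)"
      using u P h reassoc[OF u(4), of h] by simp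
    then obtain v where "v \<in> arr C" "src C v = src C h" "tgt C v = src C f" "f \<cdot> v = h"
      using kernel_factor[OF g, of h] h P G by auto
    then show "\<exists>v\<in>hom C (src C h) (src C f). f \<cdot> v = h" by auto
  qed (use P in auto)
qed

lemma epi_cokernel_of_kernel:
  assumes "is_epi C f" "is_kernel C f i"
  shows "is_cokernel C i f"
proof -
  obtain g where g: "is_cokernel C g f" using epi_cokernel[OF assms(1)] by blast
  note G = cokernelD[OF g] and P = kernelD[OF assms(2)]
  obtain u where u: "u \<in> arr C" "src C u = src C g" "tgt C u = src C i" "i \<cdot> u = g"
    using kernel_factor[OF assms(2), of g] G by auto
  show ?thesis
  proof (rule cokernelI[OF assms(1)])
    fix h assume h: "h \<in> arr C" "src C h = tgt C i" "h \<cdot> i = zer C (src C i) (tgt C h)"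
    then have "h \<cdot> g = zer C (src C g) (tgt C h)"
      using u P h G by (metis assoc zer_cmp tgt_in_obj)
    then obtain v where "v \<in> arr C" "src C v = tgt C f" "tgt C v = tgt C h" "v \<cdot> f = h"
      using cokernel_factor[OF g, of h] h P G by auto
    then show "\<exists>v\<in>hom C (tgt C f) (tgt C h). v \<cdot> f = h" by auto
  qed (use P in auto)
qed

text \<open>If \<open>f\<close> is the kernel of \<open>g\<close>, then \<open>g\<close> vanishes
  because \<open>f\<close> is epic; the identity then factors through the kernel and gives an
  inverse.\<close>

lemma mono_epi_iso:
  assumes "is_mono C f" "is_epi C f"
  shows "is_iso C f"
proof -
  obtain g where g: "is_kernel C g f" using mono_kernel[OF assms(1)] by blast
  note G = kernelD[OF g]
  have "g = zer C (tgt C f) (tgt C g)"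
    using epi_zero[OF assms(2), of g] G by simp
  then have "g \<cdot> idm C (tgt C f) = zer C (tgt C f) (tgt C g)" using G by simp
  then obtain s where s: "s \<in> arr C" "src C s = tgt C f" "tgt C s = src C f" "f \<cdot> s = idm C (tgt C f)"
    using kernel_factor[OF g, of "idm C (tgt C f)"] G by auto
  have "f \<cdot> (s \<cdot> f) = f \<cdot> idm C (src C f)"
    using s G reassoc[OF s(4), of f] by simp
  then have "s \<cdot> f = idm C (src C f)"
    using s G by (intro mono_cancel[OF assms(1), of "s \<cdot> f" "idm C (src C f)"]) auto
  then show ?thesis using s G by (intro isoI[of _ s]) auto
qed

text \<open>The image is the kernel of the cokernel. The point is that \<open>e\<close> is epic: if
  \<open>h\<close> kills \<open>e\<close>, then \<open>f\<close> already factors through the kernel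
  \<open>k\<close> of \<open>h\<close> inside \<open>m\<close>, and comparing the cokernels of
  \<open>f\<close> and of \<open>m \<cdot> k\<close> shows that this kernel is everything.\<close>

lemma image_factorization:
  assumes f: "f \<in> arr C"
  obtains m e where "is_mono C m" "is_epi C e" "src C e = src C f" "tgt C m = tgt C f"
    "src C m = tgt C e" "f = m \<cdot> e"
proof -
  obtain c where c: "is_cokernel C f c" using cokernels[OF f] by blast
  note cD = cokernelD[OF c]
  obtain m where m: "is_kernel C c m" using kernels[OF cD(2)] by blast
  note mD = kernelD[OF m]
  obtain e where e: "e \<in> arr C" "src C e = src C f" "tgt C e = src C m" "m \<cdot> e = f"
    using kernel_factor[OF m, of f] cD by auto
  have "is_epi C e"
  proof (rule epiI[OF e(1)])
    fix h assume h: "h \<in> arr C" "src C h = tgt C e" "h \<cdot> e = zer C (src C e) (tgt C h)"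
    obtain k where k: "is_kernel C h k" using kernels[OF h(1)] by blast
    note kD = kernelD[OF k]
    obtain e' where e': "e' \<in> arr C" "src C e' = src C e" "tgt C e' = src C k" "k \<cdot> e' = e"
      using kernel_factor[OF k, of e] e h by auto
    have mk: "is_mono C (m \<cdot> k)"
      using kernel_mono[OF m] kernel_mono[OF k] kD mD e h by (intro mono_cmp) auto
    then have mka: "m \<cdot> k \<in> arr C" by (simp add: is_mono_def)
    obtain q where q: "is_cokernel C (m \<cdot> k) q" using cokernels[OF mka] by blast
    note qD = cokernelD[OF q]
    have fe: "f = (m \<cdot> k) \<cdot> e'" using e e' h kD mD by simp
    have "q \<cdot> f = (q \<cdot> (m \<cdot> k)) \<cdot> e'"
      unfolding fe using qD(1-3) e'(1-3) kD(1-3) mD(1-3) h e(1-3) by simp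
    also have "\<dots> = zer C (src C f) (tgt C q)"
      unfolding qD(4) using qD(1-3) e' mD(1-3) kD(1-3) h e by simp
    finally have qf: "q \<cdot> f = zer C (src C f) (tgt C q)" .
    obtain q' where q': "q' \<in> arr C" "src C q' = tgt C c" "tgt C q' = tgt C q" "q' \<cdot> c = q"
      using cokernel_factor[OF c, of q] qf qD mka mD kD h e cD by auto
    \<comment> \<open>The arrow \<open>q\<close> kills \<open>f\<close> and so factors through its
      cokernel \<open>c\<close>, and \<open>c\<close> kills \<open>m\<close> by
      construction.\<close>
    have "q \<cdot> m = zer C (src C m) (tgt C q)"
      using reassoc[OF q'(4), of m] q' mD cD qD by (metis cmp_zer src_in_obj)
    then obtain t where t: "t \<in> arr C" "src C t = src C m" "tgt C t = src C (m \<cdot> k)" "(m \<cdot> k) \<cdot> t = m"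
      using kernel_factor[OF mono_kernel_of_cokernel[OF mk q], of m] qD mD kD h e by auto
    have "m \<cdot> (k \<cdot> t) = m \<cdot> idm C (src C m)" using t mD kD h e by simp
    then have kt: "k \<cdot> t = idm C (src C m)"
      using t mD kD h e by (intro mono_cancel[OF kernel_mono[OF m], of "k \<cdot> t" "idm C (src C m)"]) auto
    have "h = (h \<cdot> k) \<cdot> t" using kt h(1,2) kD(1-3) t(1-3) e(1-3) mD(1-3) by simp
    also have "\<dots> = zer C (tgt C e) (tgt C h)"
      unfolding kD(4) using kD(1-3) t(1-3) h(1,2) e(1-3) mD(1-3) by simp
    finally show "h = zer C (tgt C e) (tgt C h)" .
  qed
  then show thesis
    using that[OF kernel_mono[OF m] _ e(2) _ e(3)[symmetric] e(4)[symmetric]] mD cD by auto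
qed

text \<open>The image of an idempotent \<open>e\<close> is the kernel of
  \<open>1 - e\<close>.\<close>

lemma idempotent_split:
  assumes e: "e \<in> hom C X X" "e \<cdot> e = e"
  obtains m q where "m \<in> arr C" "q \<in> arr C" "tgt C m = X" "src C q = X" "tgt C q = src C m"
    "m \<cdot> q = e" "q \<cdot> m = idm C (src C m)"
proof -
  have X: "X \<in> obj C" using e by auto
  let ?d = "idm C X \<oplus> scl C (-1) e"
  obtain m where m: "is_kernel C ?d m" using kernels[of ?d] X e by auto
  note mD = kernelD[OF m]
  have m': "m \<in> arr C" "tgt C m = X" using mD X e by auto
  have "?d \<cdot> e = zer C X X" using X e add_neg[of e] by simp
  then obtain q where q: "q \<in> arr C" "src C q = X" "tgt C q = src C m" "m \<cdot> q = e"
    using kernel_factor[OF m, of e] e X by auto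
  have "m \<oplus> scl C (-1) (e \<cdot> m) = zer C (src C m) (tgt C m)"
    using mD(4) m' X e by simp
  then have "m = e \<cdot> m" using m' e by (intro eq_if_diff_zero[of m "e \<cdot> m"]) auto
  then have "m \<cdot> (q \<cdot> m) = m \<cdot> idm C (src C m)"
    using reassoc[OF q(4), of m] q m' by simp
  then have "q \<cdot> m = idm C (src C m)"
    using q m' by (intro mono_cancel[OF kernel_mono[OF m], of "q \<cdot> m" "idm C (src C m)"]) auto
  then show thesis using that q m' by blast
qed

lemma simple_mono:
  "is_simple C X \<Longrightarrow> is_mono C i \<Longrightarrow> tgt C i = X \<Longrightarrow> is_zero_object C (src C i) \<or> is_iso C i"
  by (simp add: is_simple_def)

text \<open>First half of Schur's lemma: the image of \<open>u\<close> is a nonzero subobject of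
  \<open>S\<close>, hence all of \<open>S\<close>.\<close>

lemma to_simple_epi:
  assumes S: "is_simple C S" and u: "u \<in> arr C" "tgt C u = S" "u \<noteq> zer C (src C u) S"
  shows "is_epi C u"
proof -
  obtain m e where me: "is_mono C m" "is_epi C e" "src C e = src C u" "tgt C m = tgt C u"
    "src C m = tgt C e" "u = m \<cdot> e" using image_factorization[OF u(1)] by blast
  have a: "m \<in> arr C" "e \<in> arr C" using me by (auto simp: is_mono_def is_epi_def)
  have "\<not> is_zero_object C (src C m)"
  proof
    assume "is_zero_object C (src C m)"
    then have "m = zer C (src C m) S" using zero_objectD(1)[OF _ a(1)] me u by metis
    then have "u = zer C (src C u) S" using me a u zer_cmp[of e S "src C m"]
      by (metis tgt_in_obj)
    then show False using u by simp
  qed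
  then have "is_iso C m" using simple_mono[OF S me(1)] me u by auto
  then show ?thesis using me a by (metis epi_cmp iso_epi)
qed

text \<open>Second half of Schur's lemma: the kernel of a nonzero \<open>u\<close> is not all of
  \<open>S\<close>, hence zero.\<close>

lemma from_simple_mono:
  assumes S: "is_simple C S" and u: "u \<in> arr C" "src C u = S" "u \<noteq> zer C S (tgt C u)"
  shows "is_mono C u"
proof (rule monoI[OF u(1)])
  fix g assume g: "g \<in> arr C" "tgt C g = src C u" "u \<cdot> g = zer C (src C g) (tgt C u)"
  obtain k where k: "is_kernel C u k" using kernels[OF u(1)] by blast
  note kD = kernelD[OF k]
  have "\<not> is_iso C k"
  proof
    assume i: "is_iso C k"
    have "u = (u \<cdot> k) \<cdot> inv_arr C k" using i kD(1-3) by simp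
    also have "\<dots> = zer C S (tgt C u)" unfolding kD(4) using i kD(1-3) u by simp
    finally show False using u by simp
  qed
  then have z: "is_zero_object C (src C k)"
    using simple_mono[OF S kernel_mono[OF k]] kD u by auto
  obtain v where v: "v \<in> arr C" "src C v = src C g" "tgt C v = src C k" "k \<cdot> v = g"
    using kernel_factor[OF k, of g] g by auto
  have "v = zer C (src C g) (src C k)" using zero_objectD(2)[OF z v(1,3)] v by simp
  then show "g = zer C (src C g) (src C u)" using v kD by (metis cmp_zer src_in_obj)
qed

lemma epi_short_exact: "is_epi C u \<Longrightarrow> is_kernel C u k \<Longrightarrow> short_exact C k u"
  by (simp add: short_exact_def epi_cokernel_of_kernel)

lemma mono_short_exact: "is_mono C f \<Longrightarrow> is_cokernel C f p \<Longrightarrow> short_exact C f p"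
  by (simp add: short_exact_def mono_kernel_of_cokernel)

text \<open>Composition series speak about objects up to equality (\<open>extend\<close> concludes
  for \<open>tgt C f\<close>), so lengths have to be transported along isomorphisms
  explicitly.\<close>

lemma short_exact_iso:
  assumes fg: "short_exact C f g" and h: "is_iso C h" "src C h = tgt C f"
  shows "short_exact C (h \<cdot> f) (g \<cdot> inv_arr C h)"
proof -
  have k: "is_kernel C g f" and c: "is_cokernel C f g" using fg by (auto simp: short_exact_def)
  note K = kernelD[OF k] and ha = iso_arr[OF h(1)]
  have m: "is_mono C (h \<cdot> f)"
    using kernel_mono[OF k] iso_mono[OF h(1)] h K by (intro mono_cmp) auto
  have e: "is_epi C (g \<cdot> inv_arr C h)"
    using cokernel_epi[OF c] iso_epi[OF iso_inv[OF h(1)]] h K by (intro epi_cmp) auto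
  have "is_kernel C (g \<cdot> inv_arr C h) (h \<cdot> f)"
  proof (rule kernelI[OF m])
    fix x assume x: "x \<in> arr C" "tgt C x = src C (g \<cdot> inv_arr C h)"
      "g \<cdot> inv_arr C h \<cdot> x = zer C (src C x) (tgt C (g \<cdot> inv_arr C h))"
    obtain v where v: "v \<in> arr C" "src C v = src C x" "tgt C v = src C f" "f \<cdot> v = inv_arr C h \<cdot> x"
      using kernel_factor[OF k, of "inv_arr C h \<cdot> x"] x h K ha by auto
    have "(h \<cdot> f) \<cdot> v = h \<cdot> (f \<cdot> v)" using v(1-3) h K ha by simp
    also have "\<dots> = x" unfolding v(4) using x h K ha by simp
    finally show "\<exists>u\<in>hom C (src C x) (src C (h \<cdot> f)). h \<cdot> f \<cdot> u = x"
      using v(1-3) h K ha by (intro bexI[of _ v]) auto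
  qed (use h K ha in auto)
  then show ?thesis using epi_short_exact[OF e] by simp
qed

end

section \<open>Composition series and the length of an object\<close>

inductive has_length :: "('o, 'm, 'k) tensor_cat \<Rightarrow> nat \<Rightarrow> 'o \<Rightarrow> bool" for C where
  zero: "is_zero_object C X \<Longrightarrow> has_length C 0 X"
| extend: "short_exact C f g \<Longrightarrow> has_length C n (src C f) \<Longrightarrow> is_simple C (tgt C g) \<Longrightarrow>
    has_length C (Suc n) (tgt C f)"

lemma finite_length_iff: "finite_length C X \<longleftrightarrow> (\<exists>n. has_length C n X)"
proof
  show "finite_length C X \<Longrightarrow> \<exists>n. has_length C n X"
    by (induction rule: finite_length.induct) (auto intro: has_length.intros)
  have "has_length C n X \<Longrightarrow> finite_length C X" for n
    by (induction rule: has_length.induct) (auto intro: finite_length.intros)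
  then show "\<exists>n. has_length C n X \<Longrightarrow> finite_length C X" by blast
qed

text \<open>The length of a shortest composition series. A proper subobject or quotient inherits a
  strictly shorter series, which makes this a measure for inductions and for extremal
  choices.\<close>

definition obj_length :: "('o, 'm, 'k) tensor_cat \<Rightarrow> 'o \<Rightarrow> nat" where
  "obj_length C X = (LEAST n. has_length C n X)"

context linear_abelian_category
begin

lemma has_length_iso:
  assumes "has_length C n X" "is_iso C h" "src C h = X"
  shows "has_length C n (tgt C h)"
  using assms(1)
proof cases
  case zero
  then show ?thesis
    using epi_from_zero(1)[OF iso_epi[OF assms(2)] assms(3)] by (auto intro: has_length.zero)
next
  case (extend f g m)
  have K: "is_kernel C g f" using extend by (simp add: short_exact_def)
  note K' = kernelD[OF K]
  have e: "short_exact C (h \<cdot> f) (g \<cdot> inv_arr C h)"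
    using extend assms by (intro short_exact_iso) auto
  have "has_length C (Suc m) (tgt C (h \<cdot> f))"
    using extend assms K' iso_arr[OF assms(2)] by (intro has_length.extend[OF e]) auto
  then show ?thesis using extend assms K' iso_arr[OF assms(2)] by simp
qed

text \<open>A composition series of \<open>X\<close> is intersected with the subobject; the length drops unless
  every intersection step is an isomorphism.\<close>

lemma subobject_length:
  "has_length C n X \<Longrightarrow> is_mono C i \<Longrightarrow> tgt C i = X \<Longrightarrow>
    \<exists>a\<le>n. has_length C a (src C i) \<and> (a = n \<longrightarrow> is_iso C i)"
proof (induction arbitrary: i rule: has_length.induct)
  case (zero X)
  then show ?case using mono_to_zero[of i X] by (auto intro: has_length.zero)
next
  case (extend f g n)
  have kf: "is_kernel C g f" and cf: "is_cokernel C f g"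
    using extend by (auto simp: short_exact_def)
  note F = kernelD[OF kf]
  have i: "i \<in> arr C" "tgt C i = tgt C f" using extend by (auto simp: is_mono_def)
  let ?u = "g \<cdot> i"
  have u: "?u \<in> arr C" "src C ?u = src C i" "tgt C ?u = tgt C g" using i F by auto
  obtain k where k: "is_kernel C ?u k" using kernels[OF u(1)] by blast
  note K = kernelD[OF k]
  have K': "k \<in> arr C" "tgt C k = src C i" "g \<cdot> (i \<cdot> k) = zer C (src C k) (tgt C g)"
    using K u i F by auto
  obtain v where v: "v \<in> arr C" "src C v = src C k" "tgt C v = src C f" "f \<cdot> v = i \<cdot> k"
    using kernel_factor[OF kf, of "i \<cdot> k"] K' i F by auto
  have ik: "is_mono C (i \<cdot> k)"
    using extend.prems kernel_mono[OF k] K' by (intro mono_cmp) auto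
  have mv: "is_mono C v"
  proof (rule monoI[OF v(1)])
    fix x assume x: "x \<in> arr C" "tgt C x = src C v" "v \<cdot> x = zer C (src C x) (tgt C v)"
    have "(i \<cdot> k) \<cdot> x = f \<cdot> (v \<cdot> x)" using v x F by (simp flip: v(4))
    also have "\<dots> = zer C (src C x) (tgt C (i \<cdot> k))"
      unfolding x(3) using v(1-3) x(1,2) F(1-3) i K' by simp
    finally show "x = zer C (src C x) (src C v)"
      using mono_zero[OF ik x(1)] x(2) v(2) i K' by simp
  qed
  obtain a where a: "a \<le> n" "has_length C a (src C k)" "a = n \<longrightarrow> is_iso C v"
    using extend.IH[OF mv v(3)] v(2) by auto
  \<comment> \<open>If the subobject maps to zero in the simple factor, then \<open>k\<close> is an
    isomorphism and the subobject has a series of length \<open>a\<close>. Otherwise it maps onto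
    the simple factor, and the series of the kernel is extended by one step.\<close>
  show ?case
  proof (cases "?u = zer C (src C i) (tgt C g)")
    case True
    have "?u \<cdot> idm C (src C i) = zer C (src C i) (tgt C g)"
      using F(1) i True by simp
    then obtain t where t: "t \<in> arr C" "src C t = src C i" "tgt C t = src C k" "k \<cdot> t = idm C (src C i)"
      using kernel_factor[OF k, of "idm C (src C i)"] i u by auto
    have "is_iso C k"
      using mono_epi_iso[OF kernel_mono[OF k] split_epi[OF K'(1) t(1)]] t K' by simp
    then have "has_length C a (src C i)" using has_length_iso[OF a(2)] K' by force
    then show ?thesis using a(1) by (intro exI[of _ a]) auto
  next
    case False
    have eu: "is_epi C ?u"
      using False u extend.hyps(3) by (intro to_simple_epi) auto
    have l: "has_length C (Suc a) (tgt C k)"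
      using a(2) u extend.hyps(3) by (intro has_length.extend[OF epi_short_exact[OF eu k]]) auto
    \<comment> \<open>Equality of lengths makes \<open>v\<close> an isomorphism. An arrow
      \<open>h\<close> killing \<open>i\<close> then kills \<open>f\<close>, factors through
      \<open>g\<close> as \<open>w \<cdot> g\<close>, and \<open>w\<close> vanishes because
      \<open>g \<cdot> i\<close> is epic.\<close>
    have "is_iso C i" if "Suc a = Suc n"
    proof (rule mono_epi_iso[OF extend.prems(1)], rule epiI[OF i(1)])
      fix h assume h: "h \<in> arr C" "src C h = tgt C i" "h \<cdot> i = zer C (src C i) (tgt C h)"
      have iv: "is_iso C v" using a(3) that by simp
      have "(h \<cdot> f) \<cdot> v = h \<cdot> (i \<cdot> k)" using h(1,2) F i v by simp
      also have "\<dots> = (h \<cdot> i) \<cdot> k" using h(1,2) i K' by simp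
      also have "\<dots> = zer C (src C v) (tgt C (h \<cdot> f))"
        unfolding h(3) using h(1,2) F(1-3) i v(2) K' by simp
      finally have "h \<cdot> f = zer C (tgt C v) (tgt C (h \<cdot> f))"
        using h(1,2) F i v by (intro epi_zero[OF iso_epi[OF iv]]) auto
      then have "h \<cdot> f = zer C (src C f) (tgt C h)" using h(1,2) F i v by simp
      then obtain w where w: "w \<in> arr C" "src C w = tgt C g" "tgt C w = tgt C h" "w \<cdot> g = h"
        using cokernel_factor[OF cf, of h] h i by auto
      have "w \<cdot> ?u = h \<cdot> i" using reassoc[OF w(4), of i] w(1-3) F i by simp
      then have "w \<cdot> ?u = zer C (src C ?u) (tgt C w)" using h w u by simp
      then have wz: "w = zer C (tgt C g) (tgt C h)" using epi_zero[OF eu w(1)] w u by simp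
      show "h = zer C (tgt C i) (tgt C h)"
        using w(4) F h(1) i unfolding wz by simp
    qed
    then show ?thesis using l a(1) K' by (intro exI[of _ "Suc a"]) auto
  qed
qed

text \<open>Dual to \<open>subobject_length\<close>: the series of \<open>src C f\<close> is
  replaced by one of its image \<open>m\<close> under \<open>p\<close>. The remaining quotient
  \<open>c\<close> of \<open>tgt C p\<close> is also a quotient of the simple factor through
  \<open>w\<close>, hence zero or isomorphic to it.\<close>

lemma quotient_length:
  "has_length C n X \<Longrightarrow> is_epi C p \<Longrightarrow> src C p = X \<Longrightarrow>
    \<exists>a\<le>n. has_length C a (tgt C p) \<and> (a = n \<longrightarrow> is_iso C p)"
proof (induction arbitrary: p rule: has_length.induct)
  case (zero X)
  then show ?case using epi_from_zero[of p X] by (auto intro: has_length.zero)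
next
  case (extend f g n)
  have kf: "is_kernel C g f" and cf: "is_cokernel C f g"
    using extend by (auto simp: short_exact_def)
  note F = kernelD[OF kf]
  have p: "p \<in> arr C" "src C p = tgt C f" using extend by (auto simp: is_epi_def)
  obtain m e where me: "is_mono C m" "is_epi C e" "src C e = src C (p \<cdot> f)" "tgt C m = tgt C (p \<cdot> f)"
    "src C m = tgt C e" "p \<cdot> f = m \<cdot> e"
    using image_factorization[of "p \<cdot> f"] p F by auto
  have a: "m \<in> arr C" "e \<in> arr C" using me by (auto simp: is_mono_def is_epi_def)
  have me': "src C e = src C f" "tgt C m = tgt C p" using me(3,4) p F by auto
  obtain a where a': "a \<le> n" "has_length C a (tgt C e)" "a = n \<longrightarrow> is_iso C e"
    using extend.IH[OF me(2) me'(1)] by auto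
  obtain c where c: "is_cokernel C m c" using cokernels[OF a(1)] by blast
  note cD = cokernelD[OF c]
  have "(c \<cdot> p) \<cdot> f = c \<cdot> (m \<cdot> e)" using cD p F me' a me(6) by simp
  also have "\<dots> = (c \<cdot> m) \<cdot> e" using cD(1-3) me' a me(5) by simp
  also have "\<dots> = zer C (src C f) (tgt C c)" unfolding cD(4) using cD(1-3) me' me(5) a by simp
  finally obtain w where w: "w \<in> arr C" "src C w = tgt C g" "tgt C w = tgt C c" "w \<cdot> g = c \<cdot> p"
    using cokernel_factor[OF cf, of "c \<cdot> p"] cD p F me' by auto
  show ?case
  proof (cases "w = zer C (tgt C g) (tgt C c)")
    case True
    have "c \<cdot> p = zer C (src C p) (tgt C c)"
      using w(4) F p cD me' unfolding True by simp
    then have "c = zer C (tgt C p) (tgt C c)"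
      using epi_zero[OF extend.prems(1), of c] cD me' by simp
    then have "c \<cdot> idm C (tgt C p) = zer C (tgt C p) (tgt C c)"
      using cD me' by simp
    then obtain t where t: "t \<in> arr C" "src C t = tgt C p" "tgt C t = src C m" "m \<cdot> t = idm C (tgt C p)"
      using kernel_factor[OF mono_kernel_of_cokernel[OF me(1) c], of "idm C (tgt C p)"] cD me' p by auto
    have "is_iso C m"
      using mono_epi_iso[OF me(1) split_epi[OF a(1) t(1)]] t me' by simp
    then have "has_length C a (tgt C p)" using has_length_iso[OF a'(2), of m] me me' by simp
    then show ?thesis using a'(1) by (intro exI[of _ a]) auto
  next
    case False
    have mw: "is_mono C w"
      using False w(1-3) extend.hyps(3) by (intro from_simple_mono) auto
    have cp: "is_epi C (c \<cdot> p)"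
      using extend.prems cokernel_epi[OF c] cD me' by (intro epi_cmp) auto
    have ew: "is_epi C w"
    proof (rule epiI[OF w(1)])
      fix x assume x: "x \<in> arr C" "src C x = tgt C w" "x \<cdot> w = zer C (src C w) (tgt C x)"
      have "x \<cdot> (c \<cdot> p) = (x \<cdot> w) \<cdot> g" using x(1,2) w F by simp
      also have "\<dots> = zer C (src C (c \<cdot> p)) (tgt C x)"
        unfolding x(3) using x(1,2) w(1-3) F(1-3) p cD me' by simp
      finally have "x = zer C (tgt C (c \<cdot> p)) (tgt C x)"
        using x w cD p me' by (intro epi_zero[OF cp]) auto
      then show "x = zer C (tgt C w) (tgt C x)" using w cD p me' by simp
    qed
    have iw: "is_iso C w" using mono_epi_iso[OF mw ew] .
    \<comment> \<open>Composing \<open>c\<close> with the inverse of \<open>w\<close> makes the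
      quotient object literally \<open>tgt C g\<close>, which is the object known to be
      simple.\<close>
    have sc: "short_exact C m (inv_arr C w \<cdot> c)"
    proof (rule mono_short_exact[OF me(1)], rule cokernelI)
      show "is_epi C (inv_arr C w \<cdot> c)"
        using cokernel_epi[OF c] iso_epi[OF iso_inv[OF iw]] w iw by (intro epi_cmp) auto
      show "(inv_arr C w \<cdot> c) \<cdot> m = zer C (src C m) (tgt C (inv_arr C w \<cdot> c))"
        using iw w cD by simp
      fix h assume h: "h \<in> arr C" "src C h = tgt C m" "h \<cdot> m = zer C (src C m) (tgt C h)"
      obtain y where y: "y \<in> arr C" "src C y = tgt C c" "tgt C y = tgt C h" "y \<cdot> c = h"
        using cokernel_factor[OF c, of h] h by auto
      then have "(y \<cdot> w) \<cdot> (inv_arr C w \<cdot> c) = h" using w iw cD by simp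
      then show "\<exists>u\<in>hom C (tgt C (inv_arr C w \<cdot> c)) (tgt C h). u \<cdot> (inv_arr C w \<cdot> c) = h"
        using y w iw cD by (intro bexI[of _ "y \<cdot> w"]) auto
    qed (use iw w cD in auto)
    have l: "has_length C (Suc a) (tgt C m)"
      using a'(2) me w iw cD extend.hyps(3) by (intro has_length.extend[OF sc]) auto
    \<comment> \<open>Now \<open>e\<close> is an isomorphism. An arrow killed by \<open>p\<close>
      dies in the simple factor because \<open>w\<close> is monic, so it factors through
      \<open>f\<close>, where \<open>p \<cdot> f = m \<cdot> e\<close> is monic.\<close>
    have "is_iso C p" if "Suc a = Suc n"
    proof (rule mono_epi_iso[OF _ extend.prems(1)], rule monoI[OF p(1)])
      fix x assume x: "x \<in> arr C" "tgt C x = src C p" "p \<cdot> x = zer C (src C x) (tgt C p)"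
      have ie: "is_iso C e" using a'(3) that by simp
      have "w \<cdot> (g \<cdot> x) = (w \<cdot> g) \<cdot> x" using w(1-3) F p x by simp
      also have "\<dots> = c \<cdot> (p \<cdot> x)" unfolding w(4) using x cD p me' by simp
      also have "\<dots> = zer C (src C x) (tgt C w)"
        unfolding x(3) using cD(1-3) x(1,2) p me' w(3) by simp
      finally have "g \<cdot> x = zer C (src C (g \<cdot> x)) (src C w)"
        using w F x p by (intro mono_zero[OF mw]) auto
      then obtain y where y: "y \<in> arr C" "src C y = src C x" "tgt C y = src C f" "f \<cdot> y = x"
        using kernel_factor[OF kf, of x] x p w F by auto
      have "m \<cdot> (e \<cdot> y) = (p \<cdot> f) \<cdot> y" using y(1-3) a me(5) me' by (simp add: me(6))
      also have "\<dots> = p \<cdot> x" using p F y by simp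
      also have "\<dots> = zer C (src C y) (tgt C m)" using x y me' by simp
      finally have "e \<cdot> y = zer C (src C (e \<cdot> y)) (src C m)"
        using a me(5) me' y by (intro mono_zero[OF me(1)]) auto
      then have "e \<cdot> y = zer C (src C y) (tgt C e)" using a me(5) me' y by simp
      then have yz: "y = zer C (src C x) (src C f)"
        using mono_zero[OF iso_mono[OF ie] y(1)] me' y by simp
      show "x = zer C (src C x) (src C p)"
        using y(4) F x(1) p unfolding yz by simp
    qed
    then show ?thesis using l a'(1) me' by (intro exI[of _ "Suc a"]) auto
  qed
qed

lemma obj_length_mono:
  assumes "is_mono C i" "finite_length C (tgt C i)"
  shows "obj_length C (src C i) \<le> obj_length C (tgt C i)"
    "\<not> is_iso C i \<Longrightarrow> obj_length C (src C i) < obj_length C (tgt C i)"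
proof -
  have L: "has_length C (obj_length C (tgt C i)) (tgt C i)"
    unfolding obj_length_def by (rule LeastI_ex) (use assms(2) in \<open>simp add: finite_length_iff\<close>)
  obtain a where a: "a \<le> obj_length C (tgt C i)" "has_length C a (src C i)"
    "a = obj_length C (tgt C i) \<longrightarrow> is_iso C i"
    using subobject_length[OF L assms(1) refl] by auto
  have "obj_length C (src C i) \<le> a" unfolding obj_length_def using a(2) by (rule Least_le)
  then show "obj_length C (src C i) \<le> obj_length C (tgt C i)"
    "\<not> is_iso C i \<Longrightarrow> obj_length C (src C i) < obj_length C (tgt C i)"
    using a by (force, cases "a = obj_length C (tgt C i)") auto
qed

lemma obj_length_epi:
  assumes "is_epi C p" "finite_length C (src C p)" "\<not> is_iso C p"
  shows "obj_length C (tgt C p) < obj_length C (src C p)"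
proof -
  have L: "has_length C (obj_length C (src C p)) (src C p)"
    unfolding obj_length_def by (rule LeastI_ex) (use assms(2) in \<open>simp add: finite_length_iff\<close>)
  obtain a where a: "a \<le> obj_length C (src C p)" "has_length C a (tgt C p)"
    "a = obj_length C (src C p) \<longrightarrow> is_iso C p"
    using quotient_length[OF L assms(1) refl] by auto
  have "obj_length C (tgt C p) \<le> a" unfolding obj_length_def using a(2) by (rule Least_le)
  then show ?thesis using a assms(3) by (cases "a = obj_length C (src C p)") auto
qed

end

section \<open>Tensor categories\<close>

context linear_tensor_category
begin

lemma tob_simp [simp]: "X \<in> obj C \<Longrightarrow> Y \<in> obj C \<Longrightarrow> X \<otimes> Y \<in> obj C"
  by (rule tob_obj)

lemma unt_simp [simp]: "unt C \<in> obj C"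
  by (rule unt_obj)

lemma tar_simps [simp]:
  assumes "f \<in> arr C" "g \<in> arr C"
  shows "f \<odot> g \<in> arr C" "src C (f \<odot> g) = src C f \<otimes> src C g" "tgt C (f \<odot> g) = tgt C f \<otimes> tgt C g"
  using tar_hom[of f "src C f" "tgt C f" g "src C g" "tgt C g"] assms by auto

lemma tar_idm [simp]: "X \<in> obj C \<Longrightarrow> Y \<in> obj C \<Longrightarrow> idm C X \<odot> idm C Y = idm C (X \<otimes> Y)"
  by (rule tar_id)

lemma interchange [simp]:
  assumes "f \<in> arr C" "f' \<in> arr C" "g \<in> arr C" "g' \<in> arr C" "src C f' = tgt C f" "src C g' = tgt C g"
  shows "(f' \<odot> g') \<cdot> (f \<odot> g) = (f' \<cdot> f) \<odot> (g' \<cdot> g)"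
  using tar_cmp[of f "src C f" "tgt C f" f' "tgt C f'" g "src C g" "tgt C g" g' "tgt C g'"] assms by simp

lemma interchange_assoc [simp]:
  assumes "f \<in> arr C" "f' \<in> arr C" "g \<in> arr C" "g' \<in> arr C" "src C f' = tgt C f" "src C g' = tgt C g"
    "x \<in> arr C" "tgt C x = src C f \<otimes> src C g"
  shows "(f' \<odot> g') \<cdot> ((f \<odot> g) \<cdot> x) = ((f' \<cdot> f) \<odot> (g' \<cdot> g)) \<cdot> x"
  using assms by (intro reassoc interchange) auto

lemma tar_add_l [simp]:
  "f \<in> arr C \<Longrightarrow> f' \<in> arr C \<Longrightarrow> g \<in> arr C \<Longrightarrow> src C f' = src C f \<Longrightarrow> tgt C f' = tgt C f \<Longrightarrow>
    (f \<oplus> f') \<odot> g = f \<odot> g \<oplus> f' \<odot> g"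
  by (rule tar_add_left) auto

lemma tar_add_r [simp]:
  "f \<in> arr C \<Longrightarrow> g \<in> arr C \<Longrightarrow> g' \<in> arr C \<Longrightarrow> src C g' = src C g \<Longrightarrow> tgt C g' = tgt C g \<Longrightarrow>
    f \<odot> (g \<oplus> g') = f \<odot> g \<oplus> f \<odot> g'"
  by (rule tar_add_right) auto

lemma tar_scl_l [simp]: "f \<in> arr C \<Longrightarrow> g \<in> arr C \<Longrightarrow> scl C a f \<odot> g = scl C a (f \<odot> g)"
  by (rule tar_scl_left) auto

lemma tar_scl_r [simp]: "f \<in> arr C \<Longrightarrow> g \<in> arr C \<Longrightarrow> f \<odot> scl C a g = scl C a (f \<odot> g)"
  by (rule tar_scl_right) auto

lemma tar_zer_r [simp]:
  assumes "f \<in> arr C" "X \<in> obj C" "Y \<in> obj C"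
  shows "f \<odot> zer C X Y = zer C (src C f \<otimes> X) (tgt C f \<otimes> Y)"
  using tar_scl_r[of f "zer C X Y" 0] assms by simp

lemma tar_zer_l [simp]:
  assumes "f \<in> arr C" "X \<in> obj C" "Y \<in> obj C"
  shows "zer C X Y \<odot> f = zer C (X \<otimes> src C f) (Y \<otimes> tgt C f)"
  using tar_scl_l[of "zer C X Y" f 0] assms by simp

lemma arr_sum_tar:
  assumes "X \<in> obj C" "Y \<in> obj C" "\<And>l. l < n \<Longrightarrow> f l \<in> hom C X Y" "g \<in> arr C"
  shows "arr_sum C X Y f n \<odot> g = arr_sum C (X \<otimes> src C g) (Y \<otimes> tgt C g) (\<lambda>l. f l \<odot> g) n"
  using assms(3) by (induction n) (use assms in auto)

lemma tar_arr_sum: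
  assumes "X \<in> obj C" "Y \<in> obj C" "\<And>l. l < n \<Longrightarrow> f l \<in> hom C X Y" "g \<in> arr C"
  shows "g \<odot> arr_sum C X Y f n = arr_sum C (src C g \<otimes> X) (tgt C g \<otimes> Y) (\<lambda>l. g \<odot> f l) n"
  using assms(3) by (induction n) (use assms in auto)

lemma iso_tar [simp]:
  assumes "is_iso C f" "is_iso C g"
  shows "is_iso C (f \<odot> g)" and inv_tar: "inv_arr C (f \<odot> g) = inv_arr C f \<odot> inv_arr C g"
  by (rule isoI[of _ "inv_arr C f \<odot> inv_arr C g"] inv_eqI; use assms in \<open>simp add: iso_arr\<close>)+

lemma asc_simps [simp]:
  assumes "X \<in> obj C" "Y \<in> obj C" "Z \<in> obj C"
  shows "asc C X Y Z \<in> arr C" "src C (asc C X Y Z) = (X \<otimes> Y) \<otimes> Z" "tgt C (asc C X Y Z) = X \<otimes> (Y \<otimes> Z)"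
    "is_iso C (asc C X Y Z)"
  using asc_hom[OF assms] asc_iso[OF assms] by auto

lemma lun_simps [simp]:
  assumes "X \<in> obj C"
  shows "lun C X \<in> arr C" "src C (lun C X) = unt C \<otimes> X" "tgt C (lun C X) = X" "is_iso C (lun C X)"
  using lun_hom[OF assms] lun_iso[OF assms] by auto

lemma run_simps [simp]:
  assumes "X \<in> obj C"
  shows "run C X \<in> arr C" "src C (run C X) = X \<otimes> unt C" "tgt C (run C X) = X" "is_iso C (run C X)"
  using run_hom[OF assms] run_iso[OF assms] by auto

lemma bra_simps [simp]:
  assumes "X \<in> obj C" "Y \<in> obj C"
  shows "bra C X Y \<in> arr C" "src C (bra C X Y) = X \<otimes> Y" "tgt C (bra C X Y) = Y \<otimes> X"
    "bra C Y X \<cdot> bra C X Y = idm C (X \<otimes> Y)"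
  using bra_hom[OF assms] symmetry[OF assms] by auto

lemma bra_iso [simp]:
  assumes "X \<in> obj C" "Y \<in> obj C"
  shows "is_iso C (bra C X Y)" "inv_arr C (bra C X Y) = bra C Y X"
  by (rule isoI[of _ "bra C Y X"] inv_eqI; use assms in simp)+

lemma bra_bra [simp]:
  assumes "X \<in> obj C" "Y \<in> obj C" "x \<in> arr C" "tgt C x = X \<otimes> Y"
  shows "bra C Y X \<cdot> (bra C X Y \<cdot> x) = x"
  using reassoc[OF bra_simps(4), of X Y x] assms by simp

lemma asc_nat:
  assumes "f \<in> arr C" "g \<in> arr C" "h \<in> arr C"
  shows "asc C (tgt C f) (tgt C g) (tgt C h) \<cdot> ((f \<odot> g) \<odot> h) =
    (f \<odot> (g \<odot> h)) \<cdot> asc C (src C f) (src C g) (src C h)"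
  using assms by (intro asc_natural) auto

lemma lun_nat: "f \<in> arr C \<Longrightarrow> lun C (tgt C f) \<cdot> (idm C (unt C) \<odot> f) = f \<cdot> lun C (src C f)"
  by (rule lun_natural) auto

lemma run_nat: "f \<in> arr C \<Longrightarrow> run C (tgt C f) \<cdot> (f \<odot> idm C (unt C)) = f \<cdot> run C (src C f)"
  by (rule run_natural) auto

lemma bra_nat: "f \<in> arr C \<Longrightarrow> g \<in> arr C \<Longrightarrow>
    bra C (tgt C f) (tgt C g) \<cdot> (f \<odot> g) = (g \<odot> f) \<cdot> bra C (src C f) (src C g)"
  by (rule bra_natural) auto

text \<open>Tensoring with the unit is naturally isomorphic to the identity functor, hence faithful.
  Kelly's arguments prove an identity tensored with \<open>unt C\<close> and then cancel this
  factor.\<close>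

lemma tensor_unit_faithful:
  assumes e: "f \<odot> idm C (unt C) = g \<odot> idm C (unt C)"
    and a: "f \<in> arr C" "g \<in> arr C" "src C g = src C f" "tgt C g = tgt C f"
  shows "f = g"
proof -
  have "f \<cdot> run C (src C f) = run C (tgt C f) \<cdot> (f \<odot> idm C (unt C))" using a by (simp add: run_nat)
  also have "\<dots> = g \<cdot> run C (src C f)" unfolding e using run_nat[OF a(2)] a by simp
  finally show ?thesis using a by (intro iso_cancel_right[of "run C (src C f)" f g]) auto
qed

lemma unit_tensor_faithful:
  assumes e: "idm C (unt C) \<odot> f = idm C (unt C) \<odot> g"
    and a: "f \<in> arr C" "g \<in> arr C" "src C g = src C f" "tgt C g = tgt C f"
  shows "f = g"
proof -
  have "f \<cdot> lun C (src C f) = lun C (tgt C f) \<cdot> (idm C (unt C) \<odot> f)" using a by (simp add: lun_nat)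
  also have "\<dots> = g \<cdot> lun C (src C f)" unfolding e using lun_nat[OF a(2)] a by simp
  finally show ?thesis using a by (intro iso_cancel_right[of "lun C (src C f)" f g]) auto
qed

text \<open>Kelly's consequences of the pentagon and the triangle.\<close>

lemma run_tensor:
  assumes [simp]: "X \<in> obj C" "Y \<in> obj C"
  shows "(idm C X \<odot> run C Y) \<cdot> asc C X Y (unt C) = run C (X \<otimes> Y)"
proof -
  let ?I = "unt C" and ?a = "asc C X Y (unt C)"
  have N1: "?a \<cdot> (idm C (X \<otimes> Y) \<odot> lun C ?I) = (idm C X \<odot> (idm C Y \<odot> lun C ?I)) \<cdot> asc C X Y (?I \<otimes> ?I)"
    using asc_nat[of "idm C X" "idm C Y" "lun C ?I"] by simp
  have N2: "?a \<cdot> ((idm C X \<odot> run C Y) \<odot> idm C ?I) = (idm C X \<odot> (run C Y \<odot> idm C ?I)) \<cdot> asc C X (Y \<otimes> ?I) ?I"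
    using asc_nat[of "idm C X" "run C Y" "idm C ?I"] by simp
  have "?a \<cdot> (run C (X \<otimes> Y) \<odot> idm C ?I) = ?a \<cdot> ((idm C (X \<otimes> Y) \<odot> lun C ?I) \<cdot> asc C (X \<otimes> Y) ?I ?I)"
    by (simp add: triangle)
  also have "\<dots> = (idm C X \<odot> (idm C Y \<odot> lun C ?I)) \<cdot> (asc C X Y (?I \<otimes> ?I) \<cdot> asc C (X \<otimes> Y) ?I ?I)"
    by (simp add: reassoc[OF N1])
  also have "\<dots> = (idm C X \<odot> ((idm C Y \<odot> lun C ?I) \<cdot> asc C Y ?I ?I)) \<cdot> (asc C X (Y \<otimes> ?I) ?I \<cdot> (?a \<odot> idm C ?I))"
    by (simp add: pentagon)
  also have "\<dots> = (idm C X \<odot> (run C Y \<odot> idm C ?I)) \<cdot> (asc C X (Y \<otimes> ?I) ?I \<cdot> (?a \<odot> idm C ?I))"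
    by (simp add: triangle)
  also have "\<dots> = ?a \<cdot> (((idm C X \<odot> run C Y) \<cdot> ?a) \<odot> idm C ?I)"
    using reassoc[OF N2, of "?a \<odot> idm C ?I"] by simp
  finally have "run C (X \<otimes> Y) \<odot> idm C ?I = ((idm C X \<odot> run C Y) \<cdot> ?a) \<odot> idm C ?I"
    by (rule iso_cancel_left[rotated]) auto
  then show ?thesis
    by (intro tensor_unit_faithful[of "(idm C X \<odot> run C Y) \<cdot> ?a" "run C (X \<otimes> Y)"]) simp_all
qed

lemma lun_tensor:
  assumes [simp]: "X \<in> obj C" "Y \<in> obj C"
  shows "lun C (X \<otimes> Y) \<cdot> asc C (unt C) X Y = lun C X \<odot> idm C Y"
proof -
  let ?I = "unt C" and ?a = "asc C (unt C) X Y"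
  have N1: "?a \<cdot> ((run C ?I \<odot> idm C X) \<odot> idm C Y) = (run C ?I \<odot> idm C (X \<otimes> Y)) \<cdot> asc C (?I \<otimes> ?I) X Y"
    using asc_nat[of "run C ?I" "idm C X" "idm C Y"] by simp
  have N2: "?a \<cdot> ((idm C ?I \<odot> lun C X) \<odot> idm C Y) = (idm C ?I \<odot> (lun C X \<odot> idm C Y)) \<cdot> asc C ?I (?I \<otimes> X) Y"
    using asc_nat[of "idm C ?I" "lun C X" "idm C Y"] by simp
  let ?r = "asc C ?I (?I \<otimes> X) Y \<cdot> (asc C ?I ?I X \<odot> idm C Y)"
  have "(idm C ?I \<odot> (lun C (X \<otimes> Y) \<cdot> ?a)) \<cdot> ?r
      = (idm C ?I \<odot> lun C (X \<otimes> Y)) \<cdot> ((idm C ?I \<odot> ?a) \<cdot> ?r)"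
    by simp
  also have "(idm C ?I \<odot> ?a) \<cdot> ?r = asc C ?I ?I (X \<otimes> Y) \<cdot> asc C (?I \<otimes> ?I) X Y"
    using pentagon[of ?I ?I X Y] by simp
  also have "(idm C ?I \<odot> lun C (X \<otimes> Y)) \<cdot> (asc C ?I ?I (X \<otimes> Y) \<cdot> asc C (?I \<otimes> ?I) X Y)
      = (run C ?I \<odot> idm C (X \<otimes> Y)) \<cdot> asc C (?I \<otimes> ?I) X Y"
    by (simp add: reassoc[OF triangle])
  also have "\<dots> = ?a \<cdot> (((idm C ?I \<odot> lun C X) \<cdot> asc C ?I ?I X) \<odot> idm C Y)"
    using triangle[of ?I X] N1 by simp
  also have "\<dots> = (?a \<cdot> ((idm C ?I \<odot> lun C X) \<odot> idm C Y)) \<cdot> (asc C ?I ?I X \<odot> idm C Y)"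
    by simp
  also have "\<dots> = (idm C ?I \<odot> (lun C X \<odot> idm C Y)) \<cdot> ?r"
    unfolding N2 by simp
  finally have "idm C ?I \<odot> (lun C (X \<otimes> Y) \<cdot> ?a) = idm C ?I \<odot> (lun C X \<odot> idm C Y)"
    by (rule iso_cancel_right[rotated]) (auto intro!: iso_cmp)
  then show ?thesis
    by (rule unit_tensor_faithful) simp_all
qed

text \<open>Naturality of \<open>lun\<close> at \<open>lun C (unt C)\<close> identifies
  \<open>lun\<close> of \<open>I \<otimes> I\<close> with \<open>I\<close> tensored with
  \<open>lun\<close>; after that \<open>lun_tensor\<close> and the triangle compute the same arrow
  in two ways.\<close>

lemma lun_unt: "lun C (unt C) = run C (unt C)"
proof -
  let ?I = "unt C"
  have "lun C ?I \<cdot> lun C (?I \<otimes> ?I) = lun C ?I \<cdot> (idm C ?I \<odot> lun C ?I)"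
    using lun_nat[of "lun C ?I"] by simp
  then have "lun C (?I \<otimes> ?I) = idm C ?I \<odot> lun C ?I"
    by (rule iso_cancel_left[rotated]) simp_all
  then have "lun C ?I \<odot> idm C ?I = run C ?I \<odot> idm C ?I"
    using lun_tensor[of ?I ?I] triangle[of ?I ?I] by simp
  then show ?thesis by (rule tensor_unit_faithful) simp_all
qed

text \<open>The hexagon for \<open>X, I, I\<close> contains this identity tensored with
  \<open>I\<close>, preceded by an invertible braiding that can be cancelled.\<close>

lemma lun_bra:
  assumes [simp]: "X \<in> obj C"
  shows "lun C X \<cdot> bra C X (unt C) = run C X"
proof -
  let ?I = "unt C" and ?b = "bra C X (unt C)"
  have h: "asc C ?I ?I X \<cdot> (bra C X (?I \<otimes> ?I) \<cdot> asc C X ?I ?I)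
      = (idm C ?I \<odot> ?b) \<cdot> (asc C ?I X ?I \<cdot> (?b \<odot> idm C ?I))"
    using hexagon[of X ?I ?I] by simp
  have "?b \<cdot> (run C X \<odot> idm C ?I) = ?b \<cdot> ((idm C X \<odot> lun C ?I) \<cdot> asc C X ?I ?I)"
    by (simp add: triangle)
  also have "\<dots> = (lun C ?I \<odot> idm C X) \<cdot> (bra C X (?I \<otimes> ?I) \<cdot> asc C X ?I ?I)"
    using reassoc[OF bra_nat[of "idm C X" "lun C ?I"], of "asc C X ?I ?I"] by simp
  also have "\<dots> = lun C (?I \<otimes> X) \<cdot> (asc C ?I ?I X \<cdot> (bra C X (?I \<otimes> ?I) \<cdot> asc C X ?I ?I))"
    using reassoc[OF lun_tensor[of ?I X], of "bra C X (?I \<otimes> ?I) \<cdot> asc C X ?I ?I"] by simp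
  also have "\<dots> = (lun C (?I \<otimes> X) \<cdot> (idm C ?I \<odot> ?b)) \<cdot> (asc C ?I X ?I \<cdot> (?b \<odot> idm C ?I))"
    unfolding h by simp
  also have "\<dots> = ?b \<cdot> ((lun C (X \<otimes> ?I) \<cdot> asc C ?I X ?I) \<cdot> (?b \<odot> idm C ?I))"
    using lun_nat[of ?b] by simp
  also have "\<dots> = ?b \<cdot> ((lun C X \<cdot> ?b) \<odot> idm C ?I)"
    unfolding lun_tensor[OF assms unt_simp] by simp
  finally have "run C X \<odot> idm C ?I = (lun C X \<cdot> ?b) \<odot> idm C ?I"
    by (rule iso_cancel_left[rotated]) simp_all
  then show ?thesis
    by (intro tensor_unit_faithful[of "lun C X \<cdot> ?b" "run C X"]) simp_all
qed

lemma run_bra: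
  assumes [simp]: "X \<in> obj C"
  shows "run C X \<cdot> bra C (unt C) X = lun C X"
proof -
  have "run C X \<cdot> bra C (unt C) X = (lun C X \<cdot> bra C X (unt C)) \<cdot> bra C (unt C) X"
    by (simp only: lun_bra[OF assms])
  then show ?thesis by simp
qed

text \<open>Braiding does not change \<open>lun C (unt C)\<close>, since it exchanges
  \<open>lun\<close> and \<open>run\<close> and these agree on the unit. This later forces the
  symmetry on \<open>U \<otimes> U\<close> to be trivial for a subobject \<open>U\<close> of the
  unit.\<close>

lemma bra_unt: "bra C (unt C) (unt C) = idm C (unt C \<otimes> unt C)"
  by (rule iso_cancel_left[of "lun C (unt C)"]) (simp_all add: lun_bra, simp add: lun_unt)

lemma inv_run_nat:
  assumes [simp]: "f \<in> arr C"
  shows "inv_arr C (run C (tgt C f)) \<cdot> f = (f \<odot> idm C (unt C)) \<cdot> inv_arr C (run C (src C f))"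
proof (rule iso_cancel_left[of "run C (tgt C f)"])
  show "run C (tgt C f) \<cdot> (inv_arr C (run C (tgt C f)) \<cdot> f) =
      run C (tgt C f) \<cdot> ((f \<odot> idm C (unt C)) \<cdot> inv_arr C (run C (src C f)))"
    using reassoc[OF run_nat[of f], of "inv_arr C (run C (src C f))"] by simp
qed simp_all

lemma inv_lun_nat:
  assumes [simp]: "f \<in> arr C"
  shows "inv_arr C (lun C (tgt C f)) \<cdot> f = (idm C (unt C) \<odot> f) \<cdot> inv_arr C (lun C (src C f))"
proof (rule iso_cancel_left[of "lun C (tgt C f)"])
  show "lun C (tgt C f) \<cdot> (inv_arr C (lun C (tgt C f)) \<cdot> f) =
      lun C (tgt C f) \<cdot> ((idm C (unt C) \<odot> f) \<cdot> inv_arr C (lun C (src C f)))"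
    using reassoc[OF lun_nat[of f], of "inv_arr C (lun C (src C f))"] by simp
qed simp_all

lemma inv_asc_nat:
  assumes [simp]: "f \<in> arr C" "g \<in> arr C" "h \<in> arr C"
  shows "inv_arr C (asc C (tgt C f) (tgt C g) (tgt C h)) \<cdot> (f \<odot> (g \<odot> h)) =
    ((f \<odot> g) \<odot> h) \<cdot> inv_arr C (asc C (src C f) (src C g) (src C h))"
proof (rule iso_cancel_left[of "asc C (tgt C f) (tgt C g) (tgt C h)"])
  show "asc C (tgt C f) (tgt C g) (tgt C h) \<cdot>
        (inv_arr C (asc C (tgt C f) (tgt C g) (tgt C h)) \<cdot> (f \<odot> (g \<odot> h))) =
      asc C (tgt C f) (tgt C g) (tgt C h) \<cdot>
        (((f \<odot> g) \<odot> h) \<cdot> inv_arr C (asc C (src C f) (src C g) (src C h)))"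
    using reassoc[OF asc_nat[of f g h], of "inv_arr C (asc C (src C f) (src C g) (src C h))"] by simp
qed simp_all

subsection \<open>Duals\<close>

text \<open>Only the first triangle identity of a duality is kept; the failure of the second one is
  measured by \<open>dual_idem\<close>.\<close>

definition half_dual :: "'a \<Rightarrow> 'a \<Rightarrow> 'b \<Rightarrow> 'b \<Rightarrow> bool" where
  "half_dual X Y ev co \<longleftrightarrow> Y \<in> obj C \<and> ev \<in> hom C (Y \<otimes> X) (unt C) \<and> co \<in> hom C (unt C) (X \<otimes> Y) \<and>
     run C X \<cdot> ((idm C X \<odot> ev) \<cdot> (asc C X Y X \<cdot> (co \<odot> idm C X))) = lun C X"

text \<open>A pairing \<open>k : Z \<otimes> X \<rightarrow> I\<close> becomes an arrow
  \<open>Z \<rightarrow> Y\<close>: a pair \<open>X, Y\<close> is created to the right of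
  \<open>Z\<close> by \<open>co\<close>, and then \<open>Z\<close> is paired with
  \<open>X\<close>.\<close>

definition transpose :: "'a \<Rightarrow> 'a \<Rightarrow> 'a \<Rightarrow> 'b \<Rightarrow> 'b \<Rightarrow> 'b" where
  "transpose Z X Y k co =
     lun C Y \<cdot> ((k \<odot> idm C Y) \<cdot> (inv_arr C (asc C Z X Y) \<cdot> ((idm C Z \<odot> co) \<cdot> inv_arr C (run C Z))))"

text \<open>The left side of the second triangle identity, made an endomorphism of \<open>Y\<close>
  by inverting \<open>run C Y\<close>. For a half dual it is idempotent, and it is the identity
  exactly for a dual.\<close>

definition dual_idem :: "'a \<Rightarrow> 'a \<Rightarrow> 'b \<Rightarrow> 'b \<Rightarrow> 'b" where
  "dual_idem X Y ev co = transpose Y X Y ev co"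

lemma half_dualD:
  assumes "half_dual X Y ev co"
  shows "Y \<in> obj C" "ev \<in> arr C" "src C ev = Y \<otimes> X" "tgt C ev = unt C"
    "co \<in> arr C" "src C co = unt C" "tgt C co = X \<otimes> Y"
    "run C X \<cdot> ((idm C X \<odot> ev) \<cdot> (asc C X Y X \<cdot> (co \<odot> idm C X))) = lun C X"
  using assms by (auto simp: half_dual_def)

lemma dual_idem_simps [simp]:
  assumes "half_dual X Y ev co" "X \<in> obj C"
  shows "dual_idem X Y ev co \<in> arr C" "src C (dual_idem X Y ev co) = Y" "tgt C (dual_idem X Y ev co) = Y"
  using half_dualD(1-7)[OF assms(1)] assms(2) by (simp_all add: dual_idem_def transpose_def)

lemma is_dual_half:
  assumes X: "X \<in> obj C"
  shows "is_dual C X Y ev co \<longleftrightarrow> half_dual X Y ev co \<and> dual_idem X Y ev co = idm C Y"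
proof (cases "Y \<in> obj C \<and> ev \<in> hom C (Y \<otimes> X) (unt C) \<and> co \<in> hom C (unt C) (X \<otimes> Y)")
  case True
  then have t: "Y \<in> obj C" "ev \<in> arr C" "src C ev = Y \<otimes> X" "tgt C ev = unt C"
    "co \<in> arr C" "src C co = unt C" "tgt C co = X \<otimes> Y" by auto
  let ?l = "lun C Y \<cdot> ((ev \<odot> idm C Y) \<cdot> (inv_arr C (asc C Y X Y) \<cdot> (idm C Y \<odot> co)))"
  have e: "dual_idem X Y ev co = ?l \<cdot> inv_arr C (run C Y)"
    unfolding dual_idem_def transpose_def using t X by simp
  have l: "?l \<in> arr C" "src C ?l = Y \<otimes> unt C" "tgt C ?l = Y" using t X by simp_all
  have "?l = run C Y \<longleftrightarrow> ?l \<cdot> inv_arr C (run C Y) = idm C Y"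
  proof
    assume a: "?l \<cdot> inv_arr C (run C Y) = idm C Y"
    have "?l = (?l \<cdot> inv_arr C (run C Y)) \<cdot> run C Y" using l t X by simp
    also have "\<dots> = run C Y" unfolding a using t by simp
    finally show "?l = run C Y" .
  next
    assume a: "?l = run C Y"
    show "?l \<cdot> inv_arr C (run C Y) = idm C Y" unfolding a using t by simp
  qed
  then show ?thesis
    unfolding is_dual_def half_dual_def e using t X by simp
next
  case False
  then show ?thesis unfolding is_dual_def half_dual_def by blast
qed

text \<open>This is the first triangle identity tensored on the left with \<open>Z\<close>. Pentagon
  and naturality rebracket it into the composite that arises when a pair \<open>X, Y\<close> is
  created between \<open>Z\<close> and \<open>X\<close>.\<close>

lemma zigzag_left:
  assumes d: "half_dual X Y ev co" and X [simp]: "X \<in> obj C" and Z [simp]: "Z \<in> obj C"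
  shows "run C (Z \<otimes> X) \<cdot> ((idm C (Z \<otimes> X) \<odot> ev) \<cdot> (asc C (Z \<otimes> X) Y X \<cdot> ((inv_arr C (asc C Z X Y) \<odot> idm C X) \<cdot>
    (((idm C Z \<odot> co) \<odot> idm C X) \<cdot> (inv_arr C (run C Z) \<odot> idm C X))))) = idm C (Z \<otimes> X)"
proof -
  let ?I = "unt C"
  note D [simp] = half_dualD(1-7)[OF d] and T = half_dualD(8)[OF d]
  let ?x = "(inv_arr C (asc C Z X Y) \<odot> idm C X) \<cdot>
    (((idm C Z \<odot> co) \<odot> idm C X) \<cdot> (inv_arr C (run C Z) \<odot> idm C X))"
  have P: "asc C Z X (Y \<otimes> X) \<cdot> asc C (Z \<otimes> X) Y X
      = (idm C Z \<odot> asc C X Y X) \<cdot> (asc C Z (X \<otimes> Y) X \<cdot> (asc C Z X Y \<odot> idm C X))"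
    using pentagon[of Z X Y X] by simp
  have M: "asc C Z X ?I \<cdot> (idm C (Z \<otimes> X) \<odot> ev) = (idm C Z \<odot> (idm C X \<odot> ev)) \<cdot> asc C Z X (Y \<otimes> X)"
    using asc_nat[of "idm C Z" "idm C X" ev] by simp
  have Q: "asc C Z (X \<otimes> Y) X \<cdot> ((idm C Z \<odot> co) \<odot> idm C X) = (idm C Z \<odot> (co \<odot> idm C X)) \<cdot> asc C Z ?I X"
    using asc_nat[of "idm C Z" co "idm C X"] by simp
  have x: "?x \<in> arr C" "src C ?x = Z \<otimes> X" "tgt C ?x = ((Z \<otimes> X) \<otimes> Y) \<otimes> X" by simp_all
  have "run C (Z \<otimes> X) \<cdot> ((idm C (Z \<otimes> X) \<odot> ev) \<cdot> (asc C (Z \<otimes> X) Y X \<cdot> ?x))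
      = (idm C Z \<odot> run C X) \<cdot> ((asc C Z X ?I \<cdot> (idm C (Z \<otimes> X) \<odot> ev)) \<cdot> (asc C (Z \<otimes> X) Y X \<cdot> ?x))"
    using x by (simp del: interchange interchange_assoc flip: run_tensor)
  also have "\<dots> = (idm C Z \<odot> (run C X \<cdot> (idm C X \<odot> ev))) \<cdot> ((asc C Z X (Y \<otimes> X) \<cdot> asc C (Z \<otimes> X) Y X) \<cdot> ?x)"
    unfolding M using x by (simp del: interchange)
  also have "(asc C Z X (Y \<otimes> X) \<cdot> asc C (Z \<otimes> X) Y X) \<cdot> ?x
      = (idm C Z \<odot> asc C X Y X) \<cdot> ((asc C Z (X \<otimes> Y) X \<cdot> ((idm C Z \<odot> co) \<odot> idm C X))
          \<cdot> (inv_arr C (run C Z) \<odot> idm C X))"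
    unfolding P by simp
  also have "\<dots> = (idm C Z \<odot> (asc C X Y X \<cdot> (co \<odot> idm C X))) \<cdot> (asc C Z ?I X \<cdot> (inv_arr C (run C Z) \<odot> idm C X))"
    unfolding Q by simp
  also have "(idm C Z \<odot> (run C X \<cdot> (idm C X \<odot> ev))) \<cdot> \<dots>
      = (idm C Z \<odot> (run C X \<cdot> ((idm C X \<odot> ev) \<cdot> (asc C X Y X \<cdot> (co \<odot> idm C X)))))
          \<cdot> (asc C Z ?I X \<cdot> (inv_arr C (run C Z) \<odot> idm C X))"
    by simp
  also have "\<dots> = ((idm C Z \<odot> lun C X) \<cdot> asc C Z ?I X) \<cdot> (inv_arr C (run C Z) \<odot> idm C X)"
    unfolding T by simp
  also have "\<dots> = idm C (Z \<otimes> X)"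
    unfolding triangle[OF Z X] by simp
  finally show ?thesis .
qed

text \<open>The counterpart of \<open>zigzag_left\<close>: the first triangle identity tensored on
  the right with \<open>S\<close>, with the pair \<open>X, Y\<close> created to the left of
  \<open>X \<otimes> S\<close>.\<close>

lemma zigzag_right:
  assumes d: "half_dual X Y ev co" and X [simp]: "X \<in> obj C" and S [simp]: "S \<in> obj C"
  shows "(idm C X \<odot> lun C S) \<cdot> ((idm C X \<odot> (ev \<odot> idm C S)) \<cdot> ((idm C X \<odot> inv_arr C (asc C Y X S)) \<cdot>
    (asc C X Y (X \<otimes> S) \<cdot> ((co \<odot> idm C (X \<otimes> S)) \<cdot> inv_arr C (lun C (X \<otimes> S)))))) = idm C (X \<otimes> S)"
proof -
  let ?I = "unt C"
  note D [simp] = half_dualD(1-7)[OF d] and T = half_dualD(8)[OF d]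
  have P: "asc C X Y (X \<otimes> S) \<cdot> asc C (X \<otimes> Y) X S
      = (idm C X \<odot> asc C Y X S) \<cdot> (asc C X (Y \<otimes> X) S \<cdot> (asc C X Y X \<odot> idm C S))"
    using pentagon[of X Y X S] by simp
  have M: "(idm C X \<odot> (ev \<odot> idm C S)) \<cdot> asc C X (Y \<otimes> X) S = asc C X ?I S \<cdot> ((idm C X \<odot> ev) \<odot> idm C S)"
    using asc_nat[of "idm C X" ev "idm C S"] by simp
  have Q: "(co \<odot> idm C (X \<otimes> S)) \<cdot> asc C ?I X S = asc C (X \<otimes> Y) X S \<cdot> ((co \<odot> idm C X) \<odot> idm C S)"
    using asc_nat[of co "idm C X" "idm C S"] by simp
  have L: "inv_arr C (lun C (X \<otimes> S)) = asc C ?I X S \<cdot> (inv_arr C (lun C X) \<odot> idm C S)"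
  proof (rule iso_cancel_left[of "lun C (X \<otimes> S)"])
    show "lun C (X \<otimes> S) \<cdot> inv_arr C (lun C (X \<otimes> S))
        = lun C (X \<otimes> S) \<cdot> (asc C ?I X S \<cdot> (inv_arr C (lun C X) \<odot> idm C S))"
      using reassoc[OF lun_tensor[of X S], of "inv_arr C (lun C X) \<odot> idm C S"] by simp
  qed simp_all
  let ?l = "inv_arr C (lun C X) \<odot> idm C S"
  have "asc C X Y (X \<otimes> S) \<cdot> ((co \<odot> idm C (X \<otimes> S)) \<cdot> inv_arr C (lun C (X \<otimes> S)))
      = asc C X Y (X \<otimes> S) \<cdot> (((co \<odot> idm C (X \<otimes> S)) \<cdot> asc C ?I X S) \<cdot> ?l)"
    unfolding L by simp
  also have "\<dots> = (asc C X Y (X \<otimes> S) \<cdot> asc C (X \<otimes> Y) X S) \<cdot> (((co \<odot> idm C X) \<odot> idm C S) \<cdot> ?l)"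
    unfolding Q by simp
  also have "\<dots> = (idm C X \<odot> asc C Y X S) \<cdot> (asc C X (Y \<otimes> X) S \<cdot>
      ((asc C X Y X \<odot> idm C S) \<cdot> (((co \<odot> idm C X) \<odot> idm C S) \<cdot> ?l)))"
    unfolding P by simp
  finally have e: "(idm C X \<odot> inv_arr C (asc C Y X S)) \<cdot>
      (asc C X Y (X \<otimes> S) \<cdot> ((co \<odot> idm C (X \<otimes> S)) \<cdot> inv_arr C (lun C (X \<otimes> S))))
      = asc C X (Y \<otimes> X) S \<cdot> ((asc C X Y X \<odot> idm C S) \<cdot> (((co \<odot> idm C X) \<odot> idm C S) \<cdot> ?l))"
    by simp
  have "(idm C X \<odot> lun C S) \<cdot> ((idm C X \<odot> (ev \<odot> idm C S)) \<cdot> (asc C X (Y \<otimes> X) S \<cdot>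
      ((asc C X Y X \<odot> idm C S) \<cdot> (((co \<odot> idm C X) \<odot> idm C S) \<cdot> ?l))))
    = (idm C X \<odot> lun C S) \<cdot> (((idm C X \<odot> (ev \<odot> idm C S)) \<cdot> asc C X (Y \<otimes> X) S) \<cdot>
      ((asc C X Y X \<odot> idm C S) \<cdot> (((co \<odot> idm C X) \<odot> idm C S) \<cdot> ?l)))"
    by simp
  also have "\<dots> = ((idm C X \<odot> lun C S) \<cdot> asc C X ?I S) \<cdot> (((idm C X \<odot> ev) \<odot> idm C S) \<cdot>
      ((asc C X Y X \<odot> idm C S) \<cdot> (((co \<odot> idm C X) \<odot> idm C S) \<cdot> ?l)))"
    unfolding M by simp
  also have "\<dots> = ((run C X \<cdot> ((idm C X \<odot> ev) \<cdot> (asc C X Y X \<cdot> (co \<odot> idm C X)))) \<odot> idm C S) \<cdot> ?l"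
    unfolding triangle[OF X S] by simp
  also have "\<dots> = idm C (X \<otimes> S)" unfolding T by simp
  finally show ?thesis unfolding e .
qed

text \<open>The left side contains two evaluations. By interchange the other one can be carried out
  first; what precedes the remaining \<open>ev\<close> is then a zigzag of \<open>X\<close> next to
  \<open>Z = Y\<close>, which is the identity. This makes \<open>dual_idem\<close>
  idempotent.\<close>

lemma half_dual_ev:
  assumes d: "half_dual X Y ev co" and X [simp]: "X \<in> obj C"
  shows "ev \<cdot> (dual_idem X Y ev co \<odot> idm C X) = ev"
proof -
  let ?I = "unt C"
  note D [simp] = half_dualD(1-7)[OF d]
  let ?x = "(inv_arr C (asc C Y X Y) \<odot> idm C X) \<cdot>
    (((idm C Y \<odot> co) \<odot> idm C X) \<cdot> (inv_arr C (run C Y) \<odot> idm C X))"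
  have L: "ev \<cdot> (lun C Y \<odot> idm C X) = lun C ?I \<cdot> ((idm C ?I \<odot> ev) \<cdot> asc C ?I Y X)"
    using lun_nat[of ev] reassoc[OF lun_nat[of ev], of "asc C ?I Y X"] lun_tensor[of Y X] by simp
  have N: "asc C ?I Y X \<cdot> ((ev \<odot> idm C Y) \<odot> idm C X) = (ev \<odot> idm C (Y \<otimes> X)) \<cdot> asc C (Y \<otimes> X) Y X"
    using asc_nat[of ev "idm C Y" "idm C X"] by simp
  have R: "run C ?I \<cdot> (ev \<odot> idm C ?I) = ev \<cdot> run C (Y \<otimes> X)"
    using run_nat[of ev] by simp
  have x: "?x \<in> arr C" "src C ?x = Y \<otimes> X" "tgt C ?x = ((Y \<otimes> X) \<otimes> Y) \<otimes> X" by simp_all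
  have "ev \<cdot> (dual_idem X Y ev co \<odot> idm C X)
      = (ev \<cdot> (lun C Y \<odot> idm C X)) \<cdot> (((ev \<odot> idm C Y) \<odot> idm C X) \<cdot> ?x)"
    by (simp add: dual_idem_def transpose_def)
  also have "\<dots> = lun C ?I \<cdot> ((idm C ?I \<odot> ev) \<cdot> ((asc C ?I Y X \<cdot> ((ev \<odot> idm C Y) \<odot> idm C X)) \<cdot> ?x))"
    unfolding L using x by (simp del: interchange interchange_assoc)
  also have "\<dots> = (lun C ?I \<cdot> (ev \<odot> ev)) \<cdot> (asc C (Y \<otimes> X) Y X \<cdot> ?x)"
    unfolding N using x by (simp del: interchange)
  also have "lun C ?I \<cdot> (ev \<odot> ev) = (run C ?I \<cdot> (ev \<odot> idm C ?I)) \<cdot> (idm C (Y \<otimes> X) \<odot> ev)"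
    by (simp add: lun_unt)
  also have "\<dots> \<cdot> (asc C (Y \<otimes> X) Y X \<cdot> ?x)
      = ev \<cdot> (run C (Y \<otimes> X) \<cdot> ((idm C (Y \<otimes> X) \<odot> ev) \<cdot> (asc C (Y \<otimes> X) Y X \<cdot> ?x)))"
    unfolding R using x by (simp del: interchange interchange_assoc)
  also have "\<dots> = ev"
    unfolding zigzag_left[OF d X D(1)] by simp
  finally show ?thesis .
qed

lemma transpose_cmp:
  assumes [simp]: "X \<in> obj C" "Y \<in> obj C" "co \<in> arr C" "src C co = unt C" "tgt C co = X \<otimes> Y"
    "f \<in> arr C" "k \<in> arr C" "src C k = tgt C f \<otimes> X" "tgt C k = unt C"
  shows "transpose (tgt C f) X Y k co \<cdot> f = transpose (src C f) X Y (k \<cdot> (f \<odot> idm C X)) co"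
proof -
  have A: "inv_arr C (asc C (tgt C f) X Y) \<cdot> (f \<odot> idm C (X \<otimes> Y))
      = ((f \<odot> idm C X) \<odot> idm C Y) \<cdot> inv_arr C (asc C (src C f) X Y)"
    using inv_asc_nat[of f "idm C X" "idm C Y"] by simp
  have "transpose (tgt C f) X Y k co \<cdot> f
      = lun C Y \<cdot> ((k \<odot> idm C Y) \<cdot> (inv_arr C (asc C (tgt C f) X Y) \<cdot> ((f \<odot> co) \<cdot> inv_arr C (run C (src C f)))))"
    by (simp add: transpose_def inv_run_nat)
  also have "f \<odot> co = (f \<odot> idm C (X \<otimes> Y)) \<cdot> (idm C (src C f) \<odot> co)" by simp
  also have "inv_arr C (asc C (tgt C f) X Y) \<cdot> (\<dots> \<cdot> inv_arr C (run C (src C f)))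
      = (inv_arr C (asc C (tgt C f) X Y) \<cdot> (f \<odot> idm C (X \<otimes> Y))) \<cdot>
          ((idm C (src C f) \<odot> co) \<cdot> inv_arr C (run C (src C f)))"
    by (simp del: interchange)
  also have "\<dots> = ((f \<odot> idm C X) \<odot> idm C Y) \<cdot> (inv_arr C (asc C (src C f) X Y) \<cdot>
          ((idm C (src C f) \<odot> co) \<cdot> inv_arr C (run C (src C f))))"
    unfolding A by simp
  finally show ?thesis by (simp add: transpose_def)
qed

lemma cmp_transpose:
  assumes [simp]: "X \<in> obj C" "Z \<in> obj C" "co \<in> arr C" "src C co = unt C" "g \<in> arr C"
    "tgt C co = X \<otimes> src C g" "k \<in> arr C" "src C k = Z \<otimes> X" "tgt C k = unt C"
  shows "g \<cdot> transpose Z X (src C g) k co = transpose Z X (tgt C g) k ((idm C X \<odot> g) \<cdot> co)"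
proof -
  have A: "inv_arr C (asc C Z X (tgt C g)) \<cdot> (idm C Z \<odot> (idm C X \<odot> g))
      = (idm C (Z \<otimes> X) \<odot> g) \<cdot> inv_arr C (asc C Z X (src C g))"
    using inv_asc_nat[of "idm C Z" "idm C X" g] by simp
  have "transpose Z X (tgt C g) k ((idm C X \<odot> g) \<cdot> co)
      = lun C (tgt C g) \<cdot> ((k \<odot> idm C (tgt C g)) \<cdot> ((inv_arr C (asc C Z X (tgt C g)) \<cdot> (idm C Z \<odot> (idm C X \<odot> g)))
          \<cdot> ((idm C Z \<odot> co) \<cdot> inv_arr C (run C Z))))"
    by (simp add: transpose_def)
  also have "\<dots> = (lun C (tgt C g) \<cdot> (idm C (unt C) \<odot> g)) \<cdot> ((k \<odot> idm C (src C g)) \<cdot>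
      (inv_arr C (asc C Z X (src C g)) \<cdot> ((idm C Z \<odot> co) \<cdot> inv_arr C (run C Z))))"
    unfolding A by simp
  also have "\<dots> = g \<cdot> transpose Z X (src C g) k co"
    unfolding lun_nat[OF \<open>g \<in> arr C\<close>] by (simp add: transpose_def)
  finally show ?thesis by simp
qed

text \<open>A half dual gives a map from \<open>Hom (X \<otimes> Z, W)\<close> to
  \<open>Hom (X, W \<otimes> Y)\<close>, natural in \<open>X\<close>, and the first triangle
  identity makes it injective. Under it, precomposition with \<open>p \<odot> idm C Z\<close>
  becomes precomposition with \<open>p\<close>, which can be cancelled.\<close>

lemma tensor_right_epi:
  assumes p: "is_epi C p" and d: "half_dual Z Y ev co" and Z [simp]: "Z \<in> obj C"
  shows "is_epi C (p \<odot> idm C Z)"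
proof -
  note D [simp] = half_dualD(1-7)[OF d]
  have pa [simp]: "p \<in> arr C" using p by (simp add: is_epi_def)
  let ?X = "tgt C p"
  let ?c = "\<lambda>X. inv_arr C (asc C X Z Y) \<cdot> ((idm C X \<odot> co) \<cdot> inv_arr C (run C X))"
  have c: "?c ?X \<cdot> p = ((p \<odot> idm C Z) \<odot> idm C Y) \<cdot> ?c (src C p)"
  proof -
    have "?c ?X \<cdot> p = inv_arr C (asc C ?X Z Y) \<cdot> ((p \<odot> idm C (Z \<otimes> Y)) \<cdot> ((idm C (src C p) \<odot> co) \<cdot> inv_arr C (run C (src C p))))"
      by (simp add: inv_run_nat)
    then show ?thesis
      using reassoc[OF inv_asc_nat[of p "idm C Z" "idm C Y"],
          of "(idm C (src C p) \<odot> co) \<cdot> inv_arr C (run C (src C p))"] by simp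
  qed
  \<comment> \<open>Injectivity of the adjunction map: evaluating the adjunct of \<open>g\<close>
    returns \<open>g\<close> by \<open>zigzag_left\<close>.\<close>
  have recover: "run C (tgt C g) \<cdot> ((idm C (tgt C g) \<odot> ev) \<cdot> (asc C (tgt C g) Y Z \<cdot>
      (((g \<odot> idm C Y) \<cdot> ?c ?X) \<odot> idm C Z))) = g" if g [simp]: "g \<in> arr C" "src C g = ?X \<otimes> Z" for g
  proof -
    let ?x = "(inv_arr C (asc C ?X Z Y) \<odot> idm C Z) \<cdot>
      (((idm C ?X \<odot> co) \<odot> idm C Z) \<cdot> (inv_arr C (run C ?X) \<odot> idm C Z))"
    have x: "?x \<in> arr C" "src C ?x = ?X \<otimes> Z" "tgt C ?x = ((?X \<otimes> Z) \<otimes> Y) \<otimes> Z" by simp_all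
    have N: "asc C (tgt C g) Y Z \<cdot> ((g \<odot> idm C Y) \<odot> idm C Z) = (g \<odot> idm C (Y \<otimes> Z)) \<cdot> asc C (?X \<otimes> Z) Y Z"
      using asc_nat[of g "idm C Y" "idm C Z"] by simp
    have R: "run C (tgt C g) \<cdot> (g \<odot> idm C (unt C)) = g \<cdot> run C (?X \<otimes> Z)"
      using run_nat[of g] by simp
    have "asc C (tgt C g) Y Z \<cdot> (((g \<odot> idm C Y) \<cdot> ?c ?X) \<odot> idm C Z)
        = (asc C (tgt C g) Y Z \<cdot> ((g \<odot> idm C Y) \<odot> idm C Z)) \<cdot> ?x" by simp
    also have "\<dots> = (g \<odot> idm C (Y \<otimes> Z)) \<cdot> (asc C (?X \<otimes> Z) Y Z \<cdot> ?x)"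
      unfolding N using x by (simp del: interchange interchange_assoc)
    finally have M: "asc C (tgt C g) Y Z \<cdot> (((g \<odot> idm C Y) \<cdot> ?c ?X) \<odot> idm C Z)
      = (g \<odot> idm C (Y \<otimes> Z)) \<cdot> (asc C (?X \<otimes> Z) Y Z \<cdot> ?x)" .
    have "run C (tgt C g) \<cdot> ((idm C (tgt C g) \<odot> ev) \<cdot> ((g \<odot> idm C (Y \<otimes> Z)) \<cdot> (asc C (?X \<otimes> Z) Y Z \<cdot> ?x)))
        = (run C (tgt C g) \<cdot> (g \<odot> idm C (unt C))) \<cdot> ((idm C (?X \<otimes> Z) \<odot> ev) \<cdot> (asc C (?X \<otimes> Z) Y Z \<cdot> ?x))"
      using x by simp
    also have "\<dots> = g \<cdot> (run C (?X \<otimes> Z) \<cdot> ((idm C (?X \<otimes> Z) \<odot> ev) \<cdot> (asc C (?X \<otimes> Z) Y Z \<cdot> ?x)))"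
      unfolding R using x by (simp del: interchange interchange_assoc)
    also have "\<dots> = g"
      unfolding zigzag_left[OF d Z tgt_in_obj[OF pa]] by simp
    finally show ?thesis unfolding M .
  qed
  show ?thesis
    unfolding is_epi_def
  proof (intro conjI allI ballI impI)
    fix W g h
    assume "g \<in> hom C (tgt C (p \<odot> idm C Z)) W" "h \<in> hom C (tgt C (p \<odot> idm C Z)) W"
      and e: "g \<cdot> (p \<odot> idm C Z) = h \<cdot> (p \<odot> idm C Z)"
    then have gh [simp]: "g \<in> arr C" "src C g = ?X \<otimes> Z" "h \<in> arr C" "src C h = ?X \<otimes> Z" "tgt C h = tgt C g"
      by auto
    have "((k \<odot> idm C Y) \<cdot> ?c ?X) \<cdot> p = ((k \<cdot> (p \<odot> idm C Z)) \<odot> idm C Y) \<cdot> ?c (src C p)"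
      if "k \<in> arr C" "src C k = ?X \<otimes> Z" for k
      using that c by simp
    then have "((g \<odot> idm C Y) \<cdot> ?c ?X) \<cdot> p = ((h \<odot> idm C Y) \<cdot> ?c ?X) \<cdot> p"
      using e by (metis gh(1-4))
    then have "(g \<odot> idm C Y) \<cdot> ?c ?X = (h \<odot> idm C Y) \<cdot> ?c ?X"
      by (rule epi_cancel[OF p]) simp_all
    then show "g = h" using recover[of g] recover[of h] by (metis gh)
  qed simp
qed

text \<open>An arrow \<open>k : W \<rightarrow> Z \<otimes> S\<close> is determined by its adjunct
  \<open>Y \<otimes> W \<rightarrow> S\<close>, from which \<open>zigzag_right\<close> recovers it.
  If \<open>k\<close> is killed by \<open>idm C Z \<odot> f\<close>, then its adjunct is killed by
  \<open>f\<close>.\<close>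

lemma tensor_left_mono:
  assumes f: "is_mono C f" and d: "half_dual Z Y ev co" and Z [simp]: "Z \<in> obj C"
  shows "is_mono C (idm C Z \<odot> f)"
proof (rule monoI)
  note D [simp] = half_dualD(1-7)[OF d]
  have fa [simp]: "f \<in> arr C" using f by (simp add: is_mono_def)
  show "idm C Z \<odot> f \<in> arr C" by simp
  let ?S = "src C f"
  fix k assume "k \<in> arr C" "tgt C k = src C (idm C Z \<odot> f)"
    and kz: "(idm C Z \<odot> f) \<cdot> k = zer C (src C k) (tgt C (idm C Z \<odot> f))"
  then have k [simp]: "k \<in> arr C" "tgt C k = Z \<otimes> ?S" by auto
  let ?W = "src C k"
  \<comment> \<open>The natural arrow \<open>Y \<otimes> (Z \<otimes> S) \<rightarrow> S\<close>,
    the counit of the adjunction.\<close>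
  let ?b = "\<lambda>S. lun C S \<cdot> ((ev \<odot> idm C S) \<cdot> inv_arr C (asc C Y Z S))"
  have b: "f \<cdot> ?b ?S = ?b (tgt C f) \<cdot> (idm C Y \<odot> (idm C Z \<odot> f))"
  proof -
    have "?b (tgt C f) \<cdot> (idm C Y \<odot> (idm C Z \<odot> f))
        = lun C (tgt C f) \<cdot> ((idm C (unt C) \<odot> f) \<cdot> ((ev \<odot> idm C ?S) \<cdot> inv_arr C (asc C Y Z ?S)))"
      using inv_asc_nat[of "idm C Y" "idm C Z" f] by simp
    then show ?thesis
      using reassoc[OF lun_nat[of f], of "(ev \<odot> idm C ?S) \<cdot> inv_arr C (asc C Y Z ?S)"] by simp
  qed
  let ?k = "?b ?S \<cdot> (idm C Y \<odot> k)"
  have "f \<cdot> ?k = (f \<cdot> ?b ?S) \<cdot> (idm C Y \<odot> k)" by simp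
  also have "\<dots> = ?b (tgt C f) \<cdot> (idm C Y \<odot> ((idm C Z \<odot> f) \<cdot> k))" unfolding b by simp
  also have "\<dots> = zer C (Y \<otimes> ?W) (tgt C f)" unfolding kz by simp
  finally have kz': "?k = zer C (Y \<otimes> ?W) ?S"
    using mono_zero[OF f, of ?k] by simp
  have A: "asc C Z Y (Z \<otimes> ?S) \<cdot> (idm C (Z \<otimes> Y) \<odot> k) = (idm C Z \<odot> (idm C Y \<odot> k)) \<cdot> asc C Z Y ?W"
    using asc_nat[of "idm C Z" "idm C Y" k] by simp
  have "k = ((idm C Z \<odot> lun C ?S) \<cdot> ((idm C Z \<odot> (ev \<odot> idm C ?S)) \<cdot> ((idm C Z \<odot> inv_arr C (asc C Y Z ?S)) \<cdot>
    (asc C Z Y (Z \<otimes> ?S) \<cdot> ((co \<odot> idm C (Z \<otimes> ?S)) \<cdot> inv_arr C (lun C (Z \<otimes> ?S))))))) \<cdot> k"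
    unfolding zigzag_right[OF d Z src_in_obj[OF fa]] by simp
  also have "\<dots> = (idm C Z \<odot> lun C ?S) \<cdot> ((idm C Z \<odot> (ev \<odot> idm C ?S)) \<cdot> ((idm C Z \<odot> inv_arr C (asc C Y Z ?S)) \<cdot>
    (asc C Z Y (Z \<otimes> ?S) \<cdot> ((co \<odot> idm C (Z \<otimes> ?S)) \<cdot> (inv_arr C (lun C (Z \<otimes> ?S)) \<cdot> k)))))"
    by simp
  also have "inv_arr C (lun C (Z \<otimes> ?S)) \<cdot> k = (idm C (unt C) \<odot> k) \<cdot> inv_arr C (lun C ?W)"
    using inv_lun_nat[of k] by simp
  also have "asc C Z Y (Z \<otimes> ?S) \<cdot> ((co \<odot> idm C (Z \<otimes> ?S)) \<cdot> \<dots>)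
      = (asc C Z Y (Z \<otimes> ?S) \<cdot> (idm C (Z \<otimes> Y) \<odot> k)) \<cdot> ((co \<odot> idm C ?W) \<cdot> inv_arr C (lun C ?W))" by simp
  also have "\<dots> = (idm C Z \<odot> (idm C Y \<odot> k)) \<cdot> (asc C Z Y ?W \<cdot> ((co \<odot> idm C ?W) \<cdot> inv_arr C (lun C ?W)))"
    unfolding A by simp
  also have "(idm C Z \<odot> lun C ?S) \<cdot> ((idm C Z \<odot> (ev \<odot> idm C ?S)) \<cdot> ((idm C Z \<odot> inv_arr C (asc C Y Z ?S)) \<cdot> \<dots>))
      = (idm C Z \<odot> ?k) \<cdot> (asc C Z Y ?W \<cdot> ((co \<odot> idm C ?W) \<cdot> inv_arr C (lun C ?W)))" by simp
  also have "\<dots> = zer C ?W (Z \<otimes> ?S)" unfolding kz' by simp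
  finally show "k = zer C (src C k) (src C (idm C Z \<odot> f))" by simp
qed

end

text \<open>Abelian and tensor structure only: the construction of duals below has to be available
  for the category of modules before that category is known to be rigid.\<close>

locale abelian_tensor_category = linear_abelian_category + linear_tensor_category
begin

text \<open>Splitting the idempotent of the second triangle turns a half dual into a dual.\<close>

lemma half_dual_imp_dual:
  assumes d: "half_dual X Y ev co" and X [simp]: "X \<in> obj C"
  shows "\<exists>Y' ev' co'. is_dual C X Y' ev' co'"
proof -
  note D [simp] = half_dualD(1-7)[OF d] and T = half_dualD(8)[OF d]
  let ?e = "dual_idem X Y ev co"
  note e [simp] = dual_idem_simps[OF d X]
  have "?e \<cdot> ?e = transpose Y X Y (ev \<cdot> (?e \<odot> idm C X)) co"
    using transpose_cmp[of X Y co ?e ev] by (simp add: dual_idem_def[of X Y ev co, symmetric])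
  also have "\<dots> = ?e" unfolding half_dual_ev[OF d X] by (simp add: dual_idem_def)
  finally obtain m q where mq: "m \<in> arr C" "q \<in> arr C" "tgt C m = Y" "src C q = Y"
    "tgt C q = src C m" "m \<cdot> q = ?e" "q \<cdot> m = idm C (src C m)"
    using idempotent_split[of ?e Y] by auto
  note [simp] = mq(1-5)
  \<comment> \<open>The dual object is the image of \<open>dual_idem\<close>; evaluation is
    restricted to it and coevaluation projected to it.\<close>
  let ?Y = "src C m" and ?ev = "ev \<cdot> (m \<odot> idm C X)" and ?co = "(idm C X \<odot> q) \<cdot> co"
  have N: "asc C X ?Y X \<cdot> ((idm C X \<odot> q) \<odot> idm C X) = (idm C X \<odot> (q \<odot> idm C X)) \<cdot> asc C X Y X"
    using asc_nat[of "idm C X" q "idm C X"] by simp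
  have "run C X \<cdot> ((idm C X \<odot> ?ev) \<cdot> (asc C X ?Y X \<cdot> (?co \<odot> idm C X)))
      = run C X \<cdot> ((idm C X \<odot> ?ev) \<cdot> ((asc C X ?Y X \<cdot> ((idm C X \<odot> q) \<odot> idm C X)) \<cdot> (co \<odot> idm C X)))"
    by simp
  also have "\<dots> = run C X \<cdot> ((idm C X \<odot> (ev \<cdot> ((m \<cdot> q) \<odot> idm C X))) \<cdot> (asc C X Y X \<cdot> (co \<odot> idm C X)))"
    unfolding N by simp
  also have "\<dots> = lun C X" unfolding mq(6) half_dual_ev[OF d X] T ..
  finally have h: "half_dual X ?Y ?ev ?co" by (simp add: half_dual_def)
  \<comment> \<open>By naturality of \<open>transpose\<close> on both sides the new endomorphism is
    \<open>q \<cdot> (m \<cdot> q) \<cdot> m\<close>, which is the identity because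
    \<open>q \<cdot> m\<close> is.\<close>
  have "dual_idem X ?Y ?ev ?co = q \<cdot> transpose ?Y X Y ?ev co"
    using cmp_transpose[of X ?Y co q ?ev] by (simp add: dual_idem_def)
  also have "transpose ?Y X Y ?ev co = ?e \<cdot> m"
    using transpose_cmp[of X Y co m ev] by (simp add: dual_idem_def)
  also have "q \<cdot> (?e \<cdot> m) = (q \<cdot> m) \<cdot> (q \<cdot> m)" unfolding mq(6)[symmetric] by simp
  also have "\<dots> = idm C ?Y" unfolding mq(7) by simp
  finally show ?thesis using is_dual_half[OF X] h by blast
qed

end

text \<open>The unit object is simple (Deligne--Milne). If \<open>U\<close> is a subobject of the unit with quotient
  \<open>V\<close>, then \<open>V \<otimes> U = 0\<close> and the symmetry of \<open>U \<otimes> U\<close> is trivial, so that the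
  rank of \<open>U\<close> acts on \<open>U\<close> as the identity. Hence the rank is 1 unless \<open>U = 0\<close>, and then
  \<open>V\<close> is a retract of \<open>V \<otimes> (U \<otimes> U\<^sup>*) = 0\<close>.\<close>

context rigid_tensor_abelian_category
begin

sublocale abelian_tensor_category ..

lemma scl_eq_self:
  assumes "scl C a f = f" "f \<in> arr C" "a \<noteq> 1"
  shows "f = zer C (src C f) (tgt C f)"
proof -
  have "scl C (a + - 1) f = f \<oplus> scl C (- 1) f"
    using assms by (subst scl_left_distrib) simp_all
  also have "\<dots> = zer C (src C f) (tgt C f)" using add_neg assms by simp
  finally have "scl C (a - 1) f = zer C (src C f) (tgt C f)" by simp
  then have "scl C (inverse (a - 1)) (scl C (a - 1) f) = zer C (src C f) (tgt C f)"
    using assms by simp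
  then show ?thesis using assms by (simp add: scl_scl)
qed

lemma exists_half_dual: "X \<in> obj C \<Longrightarrow> \<exists>Y ev co. half_dual X Y ev co"
  using duals is_dual_half by blast

lemma tensor_epi: "is_epi C p \<Longrightarrow> Z \<in> obj C \<Longrightarrow> is_epi C (p \<odot> idm C Z)"
  using exists_half_dual tensor_right_epi by blast

lemma tensor_mono: "is_mono C f \<Longrightarrow> Z \<in> obj C \<Longrightarrow> is_mono C (idm C Z \<odot> f)"
  using exists_half_dual tensor_left_mono by blast

lemma tensor_mono_left:
  assumes "is_mono C f" and Z [simp]: "Z \<in> obj C"
  shows "is_mono C (f \<odot> idm C Z)"
proof -
  have [simp]: "f \<in> arr C" using assms by (simp add: is_mono_def)
  have "f \<odot> idm C Z = bra C Z (tgt C f) \<cdot> ((idm C Z \<odot> f) \<cdot> bra C (src C f) Z)"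
    using reassoc[OF bra_nat[of "idm C Z" f], of "bra C (src C f) Z"] by simp
  moreover have "is_mono C ((idm C Z \<odot> f) \<cdot> bra C (src C f) Z)"
    by (rule mono_cmp[OF iso_mono tensor_mono[OF assms]]) simp_all
  then have "is_mono C (bra C Z (tgt C f) \<cdot> ((idm C Z \<odot> f) \<cdot> bra C (src C f) Z))"
    by (rule mono_cmp[OF _ iso_mono]) simp_all
  ultimately show ?thesis by simp
qed

lemma unit_simple: "is_simple C (unt C)"
  unfolding is_simple_def
proof (intro conjI allI impI)
  let ?I = "unt C"
  show "\<not> is_zero_object C ?I"
  proof
    assume "is_zero_object C ?I"
    then have "idm C ?I = zer C ?I ?I" by (simp add: is_zero_object_def)
    then have "scl C 1 (idm C ?I) = scl C 0 (idm C ?I)" by simp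
    then show False using End_unt by (metis (mono_tags, lifting) bij_betw_def injD zero_neq_one)
  qed
  fix i assume a: "is_mono C i \<and> tgt C i = ?I"
  then have i [simp]: "i \<in> arr C" "tgt C i = ?I" and im: "is_mono C i" by (auto simp: is_mono_def)
  let ?U = "src C i"
  obtain p where p: "is_cokernel C i p" using cokernels i by blast
  note P = cokernelD[OF p]
  have [simp]: "p \<in> arr C" "src C p = ?I" using P by auto
  let ?V = "tgt C p"
  \<comment> \<open>Up to unit constraints \<open>p \<odot> i\<close> is the composite
    \<open>p \<cdot> i\<close>, which vanishes.\<close>
  have "run C ?V \<cdot> (p \<odot> i) = (run C ?V \<cdot> (p \<odot> idm C ?I)) \<cdot> (idm C ?I \<odot> i)" by simp
  also have "\<dots> = p \<cdot> (lun C ?I \<cdot> (idm C ?I \<odot> i))"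
    using run_nat[of p] by (simp add: lun_unt)
  also have "\<dots> = (p \<cdot> i) \<cdot> lun C ?U" using lun_nat[of i] by simp
  also have "\<dots> = run C ?V \<cdot> zer C (?I \<otimes> ?U) (?V \<otimes> ?I)" unfolding P(4) by simp
  finally have "p \<odot> i = zer C (?I \<otimes> ?U) (?V \<otimes> ?I)" by (rule iso_cancel_left[rotated]) simp_all
  \<comment> \<open>The vanishing arrow is written as a monomorphism after an epimorphism through
    \<open>V \<otimes> U\<close>; both can be cancelled, so this object is zero.\<close>
  then have "(idm C ?V \<odot> i) \<cdot> (p \<odot> idm C ?U) = zer C (src C (p \<odot> idm C ?U)) (tgt C (idm C ?V \<odot> i))"
    by simp
  then have "p \<odot> idm C ?U = zer C (?I \<otimes> ?U) (?V \<otimes> ?U)"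
    using mono_zero[OF tensor_mono[OF im], of ?V "p \<odot> idm C ?U"] by simp
  then have "idm C (?V \<otimes> ?U) \<cdot> (p \<odot> idm C ?U) = zer C (src C (p \<odot> idm C ?U)) (tgt C (idm C (?V \<otimes> ?U)))"
    by simp
  then have VU: "idm C (?V \<otimes> ?U) = zer C (?V \<otimes> ?U) (?V \<otimes> ?U)"
    using epi_zero[OF tensor_epi[OF cokernel_epi[OF p]], of ?U "idm C (?V \<otimes> ?U)"] by simp
  have ii: "is_mono C (i \<odot> i)"
    using mono_cmp[OF tensor_mono_left[OF im, of ?U] tensor_mono[OF im, of ?I]] by simp
  \<comment> \<open>The symmetry of \<open>I \<otimes> I\<close> is the identity, and naturality
    with respect to the monomorphism \<open>i \<odot> i\<close> passes this on to
    \<open>U \<otimes> U\<close>.\<close>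
  have "(i \<odot> i) \<cdot> bra C ?U ?U = bra C ?I ?I \<cdot> (i \<odot> i)" using bra_nat[of i i] by simp
  also have "\<dots> = (i \<odot> i) \<cdot> idm C (?U \<otimes> ?U)" unfolding bra_unt by simp
  finally have bUU: "bra C ?U ?U = idm C (?U \<otimes> ?U)" by (rule mono_cancel[OF ii]) simp_all
  obtain Y ev co where d: "half_dual ?U Y ev co" using exists_half_dual src_in_obj[OF i(1)] by blast
  note D [simp] = half_dualD(1-7)[OF d] and T = half_dualD(8)[OF d]
  \<comment> \<open>With a trivial symmetry on \<open>U \<otimes> U\<close>, the hexagon lets
    \<open>U\<close> pass \<open>U \<otimes> Y\<close> by crossing \<open>Y\<close> alone.\<close>
  have B: "asc C ?U Y ?U \<cdot> bra C ?U (?U \<otimes> Y) = idm C ?U \<odot> bra C ?U Y"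
    by (rule iso_cancel_right[of "asc C ?U ?U Y"]) (use hexagon[of ?U ?U Y] in \<open>simp_all add: bUU\<close>)
  \<comment> \<open>The rank of \<open>U\<close>, an endomorphism of the unit and hence a
    scalar.\<close>
  let ?d = "ev \<cdot> (bra C ?U Y \<cdot> co)"
  have "run C ?U \<cdot> (idm C ?U \<odot> ?d) = run C ?U \<cdot> ((idm C ?U \<odot> ev) \<cdot> ((idm C ?U \<odot> bra C ?U Y) \<cdot> (idm C ?U \<odot> co)))"
    by simp
  also have "\<dots> = run C ?U \<cdot> ((idm C ?U \<odot> ev) \<cdot> (asc C ?U Y ?U \<cdot> (bra C ?U (?U \<otimes> Y) \<cdot> (idm C ?U \<odot> co))))"
    unfolding B[symmetric] by simp
  also have "bra C ?U (?U \<otimes> Y) \<cdot> (idm C ?U \<odot> co) = (co \<odot> idm C ?U) \<cdot> bra C ?U ?I"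
    using bra_nat[of "idm C ?U" co] by simp
  also have "run C ?U \<cdot> ((idm C ?U \<odot> ev) \<cdot> (asc C ?U Y ?U \<cdot> \<dots>))
      = (run C ?U \<cdot> ((idm C ?U \<odot> ev) \<cdot> (asc C ?U Y ?U \<cdot> (co \<odot> idm C ?U)))) \<cdot> bra C ?U ?I" by simp
  also have "\<dots> = run C ?U" unfolding T by (simp add: lun_bra)
  finally have dU: "run C ?U \<cdot> (idm C ?U \<odot> ?d) = run C ?U" .
  have "?d \<in> hom C ?I ?I" by simp
  then have "?d \<in> range (\<lambda>a. scl C a (idm C ?I))" using End_unt unfolding bij_betw_def by blast
  then obtain a where da: "?d = scl C a (idm C ?I)" by blast
  then have sr: "scl C a (run C ?U) = run C ?U" using dU by simp
  show "is_zero_object C ?U \<or> is_iso C i"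
  proof (cases "a = 1")
    case False
    have "scl C a (run C ?U) \<cdot> inv_arr C (run C ?U) = run C ?U \<cdot> inv_arr C (run C ?U)"
      by (simp only: sr)
    then have "scl C a (idm C ?U) = idm C ?U" by simp
    then show ?thesis using scl_eq_self[OF _ _ False, of "idm C ?U"] by (simp add: is_zero_object_def)
  next
    case True
    \<comment> \<open>Rank \<open>1\<close> makes \<open>I\<close> a retract of
      \<open>U \<otimes> Y\<close>. Tensored with \<open>V\<close>, it makes \<open>V\<close> a
      retract of an object that contains the factor \<open>V \<otimes> U = 0\<close>.\<close>
    then have "idm C (?V \<otimes> ?I) = (idm C ?V \<odot> (ev \<cdot> bra C ?U Y)) \<cdot> (idm C ?V \<odot> co)"
      using da by simp
    also have "\<dots> = (idm C ?V \<odot> (ev \<cdot> bra C ?U Y)) \<cdot> (asc C ?V ?U Y \<cdot>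
        ((idm C (?V \<otimes> ?U) \<odot> idm C Y) \<cdot> (inv_arr C (asc C ?V ?U Y) \<cdot> (idm C ?V \<odot> co))))" by simp
    also have "\<dots> = zer C (?V \<otimes> ?I) (?V \<otimes> ?I)" unfolding VU by simp
    finally have "run C ?V \<cdot> (idm C (?V \<otimes> ?I) \<cdot> inv_arr C (run C ?V)) = zer C ?V ?V" by simp
    then have V: "is_zero_object C ?V" by (simp add: is_zero_object_def)
    have "is_epi C i"
    proof (rule epiI[OF i(1)])
      fix h assume h: "h \<in> arr C" "src C h = tgt C i" "h \<cdot> i = zer C (src C i) (tgt C h)"
      obtain w where w: "w \<in> arr C" "src C w = ?V" "tgt C w = tgt C h" "w \<cdot> p = h"
        using cokernel_factor[OF p, of h] h by auto
      have wz: "w = zer C ?V (tgt C h)" using zero_objectD(1)[OF V w(1,2)] w(3) by simp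
      show "h = zer C (tgt C i) (tgt C h)" using w(4) h(1) unfolding wz by simp
    qed
    then show ?thesis using mono_epi_iso[OF im] by simp
  qed
qed simp

end

section \<open>Finite separable extensions\<close>

locale field_extension =
  fixes \<iota> :: "'k::field \<Rightarrow> 'l::field"
  assumes embedding: "field_embedding \<iota>"
begin

lemma emb_1 [simp]: "\<iota> 1 = 1" and emb_add [simp]: "\<iota> (a + b) = \<iota> a + \<iota> b"
  and emb_mult [simp]: "\<iota> (a * b) = \<iota> a * \<iota> b"
  using embedding by (auto simp: field_embedding_def)

lemma emb_0 [simp]: "\<iota> 0 = 0"
  by (metis add.right_neutral add_left_imp_eq emb_add)

definition ev :: "'k poly \<Rightarrow> 'l \<Rightarrow> 'l" where
  "ev p x = poly (map_poly \<iota> p) x"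

lemma ev_0 [simp]: "ev 0 x = 0" and ev_pCons [simp]: "ev (pCons a p) x = \<iota> a + x * ev p x"
  by (simp_all add: ev_def map_poly_pCons)

lemma ev_add [simp]: "ev (p + q) x = ev p x + ev q x"
  by (induction p q rule: poly_induct2) (simp_all add: algebra_simps)

lemma ev_smult [simp]: "ev (smult a p) x = \<iota> a * ev p x"
  by (induction p) (simp_all add: algebra_simps)

lemma ev_mult [simp]: "ev (p * q) x = ev p x * ev q x"
  by (induction p) (simp_all add: algebra_simps)

text \<open>If \<open>p\<close> and its derivative both vanished at \<open>x\<close>, the polynomial
  \<open>g\<close> of least degree vanishing at \<open>x\<close> would divide both. Coprimality
  would make \<open>g\<close> a unit, and a unit has no root.\<close>

lemma separable_simple_root:
  assumes "separable_element \<iota> x"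
  obtains p where "ev p x = 0" "ev (pderiv p) x \<noteq> 0"
proof -
  obtain p where p: "irreducible p" "ev p x = 0" "coprime p (pderiv p)"
    using assms by (auto simp: separable_element_def ev_def)
  have "ev (pderiv p) x \<noteq> 0"
  proof
    assume d: "ev (pderiv p) x = 0"
    define g where "g = arg_min degree (\<lambda>g. g \<noteq> 0 \<and> ev g x = 0)"
    have "p \<noteq> 0" using p(1) by (simp add: irreducible_def)
    then have g: "g \<noteq> 0" "ev g x = 0" and m: "\<And>f. f \<noteq> 0 \<Longrightarrow> ev f x = 0 \<Longrightarrow> degree g \<le> degree f"
      using arg_min_nat_lemma[of "\<lambda>g. g \<noteq> 0 \<and> ev g x = 0" p degree] p(2) unfolding g_def by auto
    have dv: "g dvd f" if "ev f x = 0" for f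
    proof -
      have "ev (f div g * g + f mod g) x = 0" using that by (simp only: div_mult_mod_eq)
      then have "ev (f mod g) x = 0" unfolding ev_add ev_mult g(2) by simp
      then have "f mod g = 0" using m[of "f mod g"] degree_mod_less[OF g(1), of f] by force
      then show ?thesis by (simp add: mod_eq_0_iff_dvd)
    qed
    have "is_unit g" using p(3) dv[OF p(2)] dv[OF d] by (rule coprime_common_divisor)
    then obtain h where "1 = g * h" by (auto simp: dvd_def)
    then have "ev 1 x = ev g x * ev h x" by (metis ev_mult)
    then show False using g(2) by (simp add: one_pCons)
  qed
  then show thesis using that p(2) by blast
qed

text \<open>The basis is enumerated by \<open>nat\<close> and comes with coordinate functionals,
  because \<open>arr_sum\<close> and \<open>is_direct_sum\<close> take families indexed in this
  way.\<close>

lemma finite_extension_basis: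
  assumes "finite_extension \<iota>"
  obtains n :: nat and b :: "nat \<Rightarrow> 'l" and co :: "nat \<Rightarrow> 'l \<Rightarrow> 'k" where
    "\<And>i x y. co i (x + y) = co i x + co i y" "\<And>i a x. co i (\<iota> a * x) = a * co i x"
    "\<And>i l. i < n \<Longrightarrow> l < n \<Longrightarrow> co i (b l) = (if i = l then 1 else 0)"
    "\<And>x. x = (\<Sum>i<n. \<iota> (co i x) * b i)"
proof -
  obtain B where "finite_dimensional_vector_space (\<lambda>a x. \<iota> a * x) B"
    using assms by (auto simp: finite_extension_def)
  then interpret V: finite_dimensional_vector_space "\<lambda>a x. \<iota> a * x" B .
  obtain h where h: "bij_betw h {..<card B} B"
    using ex_bij_betw_nat_finite[OF V.finite_Basis] by (auto simp: atLeast0LessThan)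
  have sp: "v \<in> V.span B" for v using V.span_Basis by simp
  show thesis
  proof (rule that[of "\<lambda>i x. V.representation B x (h i)" "card B" h])
    show "V.representation B (x + y) (h i) = V.representation B x (h i) + V.representation B y (h i)" for i x y
      using V.representation_add[OF V.independent_Basis sp sp] by simp
    show "V.representation B (\<iota> a * x) (h i) = a * V.representation B x (h i)" for i a x
      using V.representation_scale[OF V.independent_Basis sp] by simp
    fix i l assume il: "i < card B" "l < card B"
    then have "h l \<in> B" using h by (auto simp: bij_betw_def)
    moreover have "h i = h l \<longleftrightarrow> i = l" using h il by (auto simp: bij_betw_def inj_on_def)
    ultimately show "V.representation B (h l) (h i) = (if i = l then 1 else 0)"
      by (simp add: V.representation_basis[OF V.independent_Basis])
  next
    fix x
    have "x = (\<Sum>v\<in>B. \<iota> (V.representation B x v) * v)"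
      using V.sum_representation_eq[OF V.independent_Basis sp V.finite_Basis order_refl] by simp
    also have "\<dots> = (\<Sum>i<card B. \<iota> (V.representation B x (h i)) * h i)"
      using sum.reindex_bij_betw[OF h, of "\<lambda>v. \<iota> (V.representation B x v) * v"] by simp
    finally show "x = (\<Sum>i<card B. \<iota> (V.representation B x (h i)) * h i)" .
  qed
qed

end

section \<open>Actions of \<open>K\<close> on an object and the separability idempotent\<close>

definition field_action ::
  "('k::field \<Rightarrow> 'l::field) \<Rightarrow> ('o, 'm, 'k) tensor_cat \<Rightarrow> 'o \<Rightarrow> ('l \<Rightarrow> 'm) \<Rightarrow> bool" where
  "field_action \<iota> C Z \<rho> \<longleftrightarrow> Z \<in> obj C \<and> (\<forall>c. \<rho> c \<in> hom C Z Z) \<and> (\<forall>c d. \<rho> (c + d) = \<rho> c \<oplus>\<^bsub>C\<^esub> \<rho> d) \<and>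
     (\<forall>c d. \<rho> (c * d) = \<rho> c \<cdot>\<^bsub>C\<^esub> \<rho> d) \<and> \<rho> 1 = idm C Z \<and> (\<forall>a. \<rho> (\<iota> a) = scl C a (idm C Z))"

locale extension_category = field_extension \<iota> + linear_category C
  for \<iota> :: "'k::field \<Rightarrow> 'l::field" and C :: "('o, 'm, 'k) tensor_cat" (structure)
begin

lemma actionD:
  assumes "field_action \<iota> C Z \<rho>"
  shows "Z \<in> obj C" "\<rho> c \<in> arr C" "src C (\<rho> c) = Z" "tgt C (\<rho> c) = Z" "\<rho> (c + d) = \<rho> c \<oplus> \<rho> d"
    "\<rho> c \<cdot> \<rho> d = \<rho> (c * d)" "\<rho> 1 = idm C Z" "\<rho> (\<iota> a) = scl C a (idm C Z)" "\<rho> 0 = zer C Z Z"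
    "\<rho> (\<iota> a * c) = scl C a (\<rho> c)"
proof -
  show *: "Z \<in> obj C" "\<rho> c \<in> arr C" "src C (\<rho> c) = Z" "tgt C (\<rho> c) = Z" "\<rho> (c + d) = \<rho> c \<oplus> \<rho> d"
    "\<rho> c \<cdot> \<rho> d = \<rho> (c * d)" "\<rho> 1 = idm C Z" "\<rho> (\<iota> a) = scl C a (idm C Z)"
    using assms by (auto simp: field_action_def)
  have "\<rho> (\<iota> 0) = scl C 0 (idm C Z)" using assms unfolding field_action_def by blast
  then show "\<rho> 0 = zer C Z Z" using * by simp
  have "\<rho> (\<iota> a * c) = \<rho> (\<iota> a) \<cdot> \<rho> c" using assms unfolding field_action_def by blast
  then show "\<rho> (\<iota> a * c) = scl C a (\<rho> c)" using * by simp
qed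

text \<open>The endomorphisms \<open>\<Sum>\<^sub>i \<rho> (u\<^sub>i) \<cdot> \<sigma> (v\<^sub>i)\<close>, recorded together with
  \<open>\<Sum>\<^sub>i u\<^sub>i v\<^sub>i\<close>: the images of elements of \<open>K \<otimes> K\<close> and of their product in \<open>K\<close>.\<close>

inductive tensor_op :: "'o \<Rightarrow> ('l \<Rightarrow> 'm) \<Rightarrow> ('l \<Rightarrow> 'm) \<Rightarrow> 'l \<Rightarrow> 'm \<Rightarrow> bool" for Z \<rho> \<sigma> where
  zero: "tensor_op Z \<rho> \<sigma> 0 (zer C Z Z)"
| gen: "tensor_op Z \<rho> \<sigma> (u * v) (\<rho> u \<cdot> \<sigma> v)"
| add: "tensor_op Z \<rho> \<sigma> s E \<Longrightarrow> tensor_op Z \<rho> \<sigma> t F \<Longrightarrow> tensor_op Z \<rho> \<sigma> (s + t) (E \<oplus> F)"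

end

text \<open>Two commuting actions turn \<open>Z\<close> into a module over
  \<open>K \<otimes> K\<close>. The case in view is \<open>M \<otimes> N\<close> with the actions on
  its two factors.\<close>

locale commuting_actions = extension_category +
  fixes Z \<rho> \<sigma>
  assumes r: "field_action \<iota> C Z \<rho>" and s: "field_action \<iota> C Z \<sigma>"
    and commute: "\<sigma> d \<cdot> \<rho> c = \<rho> c \<cdot> \<sigma> d"
begin

lemma action_simps [simp]:
  "Z \<in> obj C" "\<rho> c \<in> arr C" "src C (\<rho> c) = Z" "tgt C (\<rho> c) = Z"
  "\<sigma> c \<in> arr C" "src C (\<sigma> c) = Z" "tgt C (\<sigma> c) = Z"
  using actionD[OF r] actionD[OF s] by auto

abbreviation top where "top \<equiv> tensor_op Z \<rho> \<sigma>"

lemma top_hom [simp]: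
  assumes "top a E"
  shows "E \<in> arr C" "src C E = Z" "tgt C E = Z"
proof -
  have "E \<in> hom C Z Z" using assms by induction simp_all
  then show "E \<in> arr C" "src C E = Z" "tgt C E = Z" by auto
qed

text \<open>An arrow that does not distinguish the two actions sees an element of
  \<open>K \<otimes> K\<close> only through its product in \<open>K\<close>. For an operator over
  the element \<open>1\<close> this says that \<open>h\<close> absorbs it.\<close>

lemma top_balanced:
  assumes "top a E" and h: "h \<in> arr C" "src C h = Z" "\<And>c. h \<cdot> \<rho> c = h \<cdot> \<sigma> c"
  shows "h \<cdot> E = h \<cdot> \<sigma> a"
  using assms(1)
proof induction
  case zero
  show ?case using h by (simp add: actionD(9)[OF s])
next
  case (gen u v)
  have "h \<cdot> (\<rho> u \<cdot> \<sigma> v) = (h \<cdot> \<rho> u) \<cdot> \<sigma> v" using h(1,2) by simp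
  also have "\<dots> = h \<cdot> (\<sigma> u \<cdot> \<sigma> v)" unfolding h(3) using h(1,2) by simp
  finally show ?case by (simp add: actionD(6)[OF s])
next
  case (add a E b F)
  then show ?case using h(1,2) by (simp add: actionD(5)[OF s])
qed

lemma top_commute:
  assumes "top a E" and t: "t \<in> arr C" "src C t = Z" "tgt C t = Z"
    "\<And>c. t \<cdot> \<rho> c = \<rho> c \<cdot> t" "\<And>c. t \<cdot> \<sigma> c = \<sigma> c \<cdot> t"
  shows "t \<cdot> E = E \<cdot> t"
  using assms(1)
proof induction
  case (gen u v)
  then show ?case using t(1-3) by (simp add: t(5) reassoc[OF t(4)])
next
  case (add a E b F)
  then show ?case using t(1-3) by simp
qed (use t in simp)

lemma \<rho>_commute: "\<rho> c \<cdot> \<rho> d = \<rho> d \<cdot> \<rho> c" and \<sigma>_commute: "\<sigma> c \<cdot> \<sigma> d = \<sigma> d \<cdot> \<sigma> c"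
  by (simp_all add: actionD(6)[OF r] actionD(6)[OF s] mult.commute)

lemma top_\<rho>: "top a E \<Longrightarrow> \<rho> c \<cdot> E = E \<cdot> \<rho> c"
  by (rule top_commute) (simp_all add: \<rho>_commute commute)

lemma top_\<sigma>: "top a E \<Longrightarrow> \<sigma> c \<cdot> E = E \<cdot> \<sigma> c"
  by (rule top_commute) (simp_all add: \<sigma>_commute commute)

text \<open>The operators multiply like elements of \<open>K \<otimes> K\<close>, and the
  multiplication map to \<open>K\<close> is a ring homomorphism because \<open>K\<close> is
  commutative.\<close>

lemma top_cmp:
  assumes E: "top a E" and F: "top b F"
  shows "top (a * b) (E \<cdot> F)"
  using E
proof induction
  case zero
  then show ?case using F by (simp add: tensor_op.zero)
next
  case (gen u v)
  show ?case
    using F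
  proof induction
    case zero
    then show ?case by (simp add: tensor_op.zero)
  next
    case (gen u' v')
    have e1: "\<rho> u \<cdot> (\<sigma> v \<cdot> (\<rho> u' \<cdot> \<sigma> v')) = \<rho> (u * u') \<cdot> \<sigma> (v * v')"
      unfolding actionD(6)[OF r, symmetric] actionD(6)[OF s, symmetric]
      by (simp add: reassoc[OF commute])
    have e2: "u * v * (u' * v') = (u * u') * (v * v')" by (simp add: mult_ac)
    have "top (u * v * (u' * v')) (\<rho> u \<cdot> (\<sigma> v \<cdot> (\<rho> u' \<cdot> \<sigma> v')))"
      unfolding e1 e2 by (rule tensor_op.gen)
    then show ?case by simp
  next
    case (add b F c G)
    then show ?case by (simp add: distrib_left tensor_op.add)
  qed
next
  case (add a E c G)
  then show ?case using F by (simp add: distrib_right tensor_op.add)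
qed

text \<open>The operator \<open>D\<close> is \<open>(p(s) - p(t)) / (s - t)\<close> at \<open>s = \<rho> x\<close>,
  \<open>t = \<sigma> x\<close>; multiplying it out gives \<open>p'(x)\<close>.\<close>

lemma difference_quotient:
  "\<exists>D. top (ev (pderiv p) x) D \<and> \<rho> x \<cdot> D \<oplus> \<sigma> (ev p x) = \<sigma> x \<cdot> D \<oplus> \<rho> (ev p x)"
proof (induction p)
  case 0
  show ?case
    by (intro exI[of _ "zer C Z Z"]) (simp add: tensor_op.zero actionD(9)[OF r] actionD(9)[OF s])
next
  case (pCons a p)
  note [simp] = actionD(5,6,8)[OF r] actionD(5,6,8)[OF s]
  obtain D where D: "top (ev (pderiv p) x) D" and e: "\<rho> x \<cdot> D \<oplus> \<sigma> (ev p x) = \<sigma> x \<cdot> D \<oplus> \<rho> (ev p x)"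
    using pCons.IH by blast
  note [simp] = top_hom[OF D]
  \<comment> \<open>For \<open>a + X p\<close> the quotient is \<open>s D + p(t)\<close>, since
    \<open>s p(s) - t p(t) = s (p(s) - p(t)) + (s - t) p(t)\<close>. Setting
    \<open>s = t = x\<close> gives the product rule \<open>x p'(x) + p(x)\<close> for the
    derivative.\<close>
  let ?D = "\<rho> x \<cdot> D \<oplus> \<sigma> (ev p x)"
  have "top (x * 1 * ev (pderiv p) x + 1 * ev p x) ((\<rho> x \<cdot> \<sigma> 1) \<cdot> D \<oplus> \<rho> 1 \<cdot> \<sigma> (ev p x))"
    by (intro tensor_op.add top_cmp tensor_op.gen D)
  then have 1: "top (ev (pderiv (pCons a p)) x) ?D"
    by (simp add: actionD(7)[OF r] actionD(7)[OF s] pderiv_pCons add.commute)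
  have "\<rho> x \<cdot> ?D \<oplus> \<sigma> (ev (pCons a p) x)
      = (\<rho> x \<cdot> (\<sigma> x \<cdot> D) \<oplus> \<rho> (x * ev p x)) \<oplus> (scl C a (idm C Z) \<oplus> \<sigma> (x * ev p x))"
    unfolding e by simp
  also have "\<dots> = (\<rho> x \<cdot> (\<sigma> x \<cdot> D) \<oplus> \<rho> (x * ev p x)) \<oplus> (\<sigma> (x * ev p x) \<oplus> scl C a (idm C Z))"
    by (subst add_commute[of "scl C a (idm C Z)" Z Z]) auto
  also have "\<dots> = (\<rho> x \<cdot> (\<sigma> x \<cdot> D) \<oplus> \<sigma> (x * ev p x)) \<oplus> (\<rho> (x * ev p x) \<oplus> scl C a (idm C Z))"
    by (rule add_swap[of _ Z Z]) auto
  also have "\<dots> = (\<rho> x \<cdot> (\<sigma> x \<cdot> D) \<oplus> \<sigma> (x * ev p x)) \<oplus> (scl C a (idm C Z) \<oplus> \<rho> (x * ev p x))"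
    by (subst add_commute[of "scl C a (idm C Z)" Z Z]) auto
  also have "\<dots> = \<sigma> x \<cdot> ?D \<oplus> \<rho> (ev (pCons a p) x)"
    by (simp add: reassoc[OF commute])
  finally show ?case using 1 by blast
qed

text \<open>Since \<open>p\<close> vanishes at \<open>x\<close>, the difference quotient no longer
  distinguishes the two actions of \<open>x\<close>; since \<open>p'(x)\<close> is nonzero, it can
  be normalized to lie over \<open>1\<close>.\<close>

lemma separable_equalizer:
  assumes x: "separable_element \<iota> x"
  shows "\<exists>E. top 1 E \<and> \<rho> x \<cdot> E = \<sigma> x \<cdot> E"
proof -
  obtain p where p: "ev p x = 0" "ev (pderiv p) x \<noteq> 0" using separable_simple_root[OF x] .
  obtain D where D: "top (ev (pderiv p) x) D" and e: "\<rho> x \<cdot> D \<oplus> \<sigma> (ev p x) = \<sigma> x \<cdot> D \<oplus> \<rho> (ev p x)"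
    using difference_quotient by blast
  note [simp] = top_hom[OF D]
  have e': "\<rho> x \<cdot> D = \<sigma> x \<cdot> D" using e p(1) actionD(9)[OF r] actionD(9)[OF s] by simp
  let ?i = "inverse (ev (pderiv p) x)"
  have "top (1 * ?i * ev (pderiv p) x) ((\<rho> 1 \<cdot> \<sigma> ?i) \<cdot> D)"
    by (intro top_cmp tensor_op.gen D)
  then have 1: "top 1 (\<sigma> ?i \<cdot> D)" using p(2) by (simp add: actionD(7)[OF r])
  have "\<rho> x \<cdot> (\<sigma> ?i \<cdot> D) = \<sigma> ?i \<cdot> (\<rho> x \<cdot> D)"
    using reassoc[OF commute, of ?i x D] by simp
  also have "\<dots> = \<sigma> x \<cdot> (\<sigma> ?i \<cdot> D)" unfolding e' by (simp add: reassoc[OF \<sigma>_commute[of ?i x]])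
  finally show ?thesis using 1 by blast
qed

text \<open>Operators equalizing the actions of single elements are multiplied. They commute with
  both actions, so the product equalizes the actions of all these elements; for a basis,
  \<open>k\<close>-linearity extends this to \<open>K\<close>.\<close>

lemma separability_idempotent:
  assumes K: "finite_separable_extension \<iota>"
  obtains E where "top 1 E" "\<And>c. \<rho> c \<cdot> E = \<sigma> c \<cdot> E"
proof -
  have sep: "separable_element \<iota> x" for x using K by (simp add: finite_separable_extension_def)
  have fe: "finite_extension \<iota>" using K by (simp add: finite_separable_extension_def)
  obtain n :: nat and b :: "nat \<Rightarrow> 'b" and co :: "nat \<Rightarrow> 'b \<Rightarrow> 'a"
    where "\<And>i x y. co i (x + y) = co i x + co i y" "\<And>i a x. co i (\<iota> a * x) = a * co i x"
      "\<And>i l. i < n \<Longrightarrow> l < n \<Longrightarrow> co i (b l) = (if i = l then 1 else 0)"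
      and b: "\<And>x. x = (\<Sum>i<n. \<iota> (co i x) * b i)"
    by (rule finite_extension_basis[OF fe]) (rule that)
  have "\<exists>E. top 1 E \<and> (\<forall>x\<in>A. \<rho> x \<cdot> E = \<sigma> x \<cdot> E)" if "finite A" for A
    using that
  proof (induction A rule: finite_induct)
    case empty
    have "top (1 * 1) (\<rho> 1 \<cdot> \<sigma> 1)" by (rule tensor_op.gen)
    then show ?case by auto
  next
    case (insert x A)
    obtain E where E: "top 1 E" and Ee: "\<And>y. y \<in> A \<Longrightarrow> \<rho> y \<cdot> E = \<sigma> y \<cdot> E"
      using insert.IH by blast
    obtain F where F: "top 1 F" and Fe: "\<rho> x \<cdot> F = \<sigma> x \<cdot> F"
      using separable_equalizer[OF sep[of x]] by blast
    note [simp] = top_hom[OF E] top_hom[OF F]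
    have "\<rho> y \<cdot> (F \<cdot> E) = \<sigma> y \<cdot> (F \<cdot> E)" if "y \<in> insert x A" for y
    proof (cases "y = x")
      case True
      then show ?thesis using reassoc[OF Fe, of E] by simp
    next
      case False
      then have "F \<cdot> (\<rho> y \<cdot> E) = F \<cdot> (\<sigma> y \<cdot> E)" using that Ee by simp
      then show ?thesis by (simp add: reassoc[OF top_\<rho>[OF F]] reassoc[OF top_\<sigma>[OF F]])
    qed
    moreover have "top 1 (F \<cdot> E)" using top_cmp[OF F E] by simp
    ultimately show ?case by blast
  qed
  from this[of "b ` {..<n}"] obtain E where E: "top 1 E"
    and Ee: "\<And>i. i < n \<Longrightarrow> \<rho> (b i) \<cdot> E = \<sigma> (b i) \<cdot> E"
    by auto
  note [simp] = top_hom[OF E]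
  have "\<rho> (\<Sum>i<m. \<iota> (co i x) * b i) \<cdot> E = \<sigma> (\<Sum>i<m. \<iota> (co i x) * b i) \<cdot> E" if "m \<le> n" for m x
    using that
    by (induction m) (simp_all add: actionD(5,9,10)[OF r] actionD(5,9,10)[OF s] Ee)
  then have "\<rho> x \<cdot> E = \<sigma> x \<cdot> E" for x using b[of x] by (metis order_refl)
  then show thesis using that E by blast
qed

end

section \<open>The algebra \<open>K \<otimes> I\<close> and its modules\<close>

locale base_extension = extension_category \<iota> T + rigid_tensor_abelian_category T
  for \<iota> :: "'k::field \<Rightarrow> 'l::field" and T :: "('o, 'm, 'k) tensor_cat" (structure) +
  assumes separable: "finite_separable_extension \<iota>"
begin

text \<open>This extends \<open>scalar_linear\<close> from the source \<open>unt T\<close> to an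
  arbitrary source \<open>X\<close>, as required for arrows out of
  \<open>X \<otimes> A\<close>.\<close>

definition k_linear :: "'o \<Rightarrow> 'o \<Rightarrow> ('l \<Rightarrow> 'm) \<Rightarrow> bool" where
  "k_linear X Y h \<longleftrightarrow> (\<forall>c. h c \<in> hom T X Y) \<and> (\<forall>c d. h (c + d) = h c \<oplus> h d) \<and>
     (\<forall>a c. h (\<iota> a * c) = scl T a (h c))"

lemma scalar_linear_iff: "scalar_linear \<iota> T Y h \<longleftrightarrow> k_linear (unt T) Y h"
  by (simp add: scalar_linear_def k_linear_def)

lemma k_linearD:
  assumes "k_linear X Y h"
  shows "h c \<in> arr T" "src T (h c) = X" "tgt T (h c) = Y" "h (c + d) = h c \<oplus> h d"
    "h (\<iota> a * c) = scl T a (h c)" "h 0 = zer T X Y" "X \<in> obj T" "Y \<in> obj T"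
proof -
  show *: "h c \<in> arr T" "src T (h c) = X" "tgt T (h c) = Y" "h (c + d) = h c \<oplus> h d"
    "h (\<iota> a * c) = scl T a (h c)" for a c d
    using assms by (auto simp: k_linear_def)
  show "X \<in> obj T" using src_in_obj[OF *(1)] *(2) by simp
  show "Y \<in> obj T" using tgt_in_obj[OF *(1)] *(3) by simp
  show "h 0 = zer T X Y" using *(5)[of 0 0] *(1-3)[of 0] by simp
qed

lemma k_linear_sum:
  assumes h: "k_linear X Y h"
  shows "h (\<Sum>l<n. \<iota> (a l) * b l) = arr_sum T X Y (\<lambda>l. scl T (a l) (h (b l))) n"
  by (induction n) (simp_all add: k_linearD[OF h])

lemma k_linear_cmp:
  assumes h: "k_linear X Y h" and f: "f \<in> arr T" "src T f = Y"
  shows "k_linear X (tgt T f) (\<lambda>c. f \<cdot> h c)"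
  using f by (simp add: k_linear_def k_linearD[OF h])

definition basis :: "nat \<Rightarrow> (nat \<Rightarrow> 'l) \<Rightarrow> (nat \<Rightarrow> 'l \<Rightarrow> 'k) \<Rightarrow> bool" where
  "basis n b co \<longleftrightarrow> (\<forall>i x y. co i (x + y) = co i x + co i y) \<and> (\<forall>i a x. co i (\<iota> a * x) = a * co i x) \<and>
     (\<forall>i<n. \<forall>l<n. co i (b l) = (if i = l then 1 else 0)) \<and> (\<forall>x. x = (\<Sum>i<n. \<iota> (co i x) * b i))"

lemma basis_exists: "\<exists>n b co. basis n b co"
proof -
  have fe: "finite_extension \<iota>" using separable by (simp add: finite_separable_extension_def)
  obtain n :: nat and b :: "nat \<Rightarrow> 'l" and co :: "nat \<Rightarrow> 'l \<Rightarrow> 'k"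
    where "\<And>i x y. co i (x + y) = co i x + co i y" "\<And>i a x. co i (\<iota> a * x) = a * co i x"
      "\<And>i l. i < n \<Longrightarrow> l < n \<Longrightarrow> co i (b l) = (if i = l then 1 else 0)"
      "\<And>x. x = (\<Sum>i<n. \<iota> (co i x) * b i)"
    by (rule finite_extension_basis[OF fe]) (rule that)
  then show ?thesis unfolding basis_def by blast
qed

lemma basisD:
  assumes "basis n b co"
  shows "co i (x + y) = co i x + co i y" "co i (\<iota> a * x) = a * co i x"
    "i < n \<Longrightarrow> l < n \<Longrightarrow> co i (b l) = (if i = l then 1 else 0)" "x = (\<Sum>i<n. \<iota> (co i x) * b i)"
  using assms unfolding basis_def by blast+

lemma k_linear_basis:
  assumes "basis n b co" "k_linear X Y h"
  shows "h c = arr_sum T X Y (\<lambda>l. scl T (co l c) (h (b l))) n"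
  using k_linear_sum[OF assms(2), of "\<lambda>l. co l c" b n] basisD(4)[OF assms(1), of c] by simp

text \<open>A direct sum of copies of the unit indexed by a basis of \<open>K\<close> serves as
  \<open>K \<otimes> I\<close>, and \<open>j c\<close> is the column of coordinates of
  \<open>c\<close>.\<close>

lemma scalar_object_exists: "\<exists>P. is_scalar_object \<iota> T P"
proof -
  obtain n b co where bas: "basis n b co" using basis_exists by blast
  note B = basisD[OF bas]
  let ?I = "unt T"
  obtain S i p where d: "is_direct_sum T n (\<lambda>_. ?I) S i p"
    using direct_sums[of n "\<lambda>_. ?I"] by auto
  note D = direct_sumD[OF d]
  define j where "j c = arr_sum T ?I S (\<lambda>l. scl T (co l c) (i l)) n" for c
  have S [simp]: "S \<in> obj T" using D by simp
  have ji: "j (b l) = i l" if "l < n" for l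
  proof -
    have "j (b l) = arr_sum T ?I S (\<lambda>m. if m = l then i l else zer T ?I S) n"
      unfolding j_def using B(3) D that by (intro arr_sum_cong) auto
    then show ?thesis using D that by (simp add: arr_sum_delta)
  qed
  have jl: "k_linear ?I S j"
    unfolding k_linear_def
  proof (intro conjI allI)
    fix c d a
    show "j c \<in> hom T ?I S" unfolding j_def using D by simp
    have "j (c + d) = arr_sum T ?I S (\<lambda>l. scl T (co l c) (i l) \<oplus> scl T (co l d) (i l)) n"
      unfolding j_def using D by (intro arr_sum_cong) (simp add: B(1) scl_left_distrib)
    also have "\<dots> = j c \<oplus> j d" unfolding j_def using D by (intro arr_sum_add) auto
    finally show "j (c + d) = j c \<oplus> j d" .
    have "j (\<iota> a * c) = arr_sum T ?I S (\<lambda>l. scl T a (scl T (co l c) (i l))) n"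
      unfolding j_def using D by (intro arr_sum_cong) (simp add: B(2) scl_scl)
    also have "\<dots> = scl T a (j c)" unfolding j_def using D by (intro arr_sum_scl) auto
    finally show "j (\<iota> a * c) = scl T a (j c)" .
  qed
  have "is_scalar_object \<iota> T (S, j)"
    unfolding is_scalar_object_def
  proof (clarify, intro conjI ballI allI impI)
    show "scalar_linear \<iota> T S j" using jl by (simp add: scalar_linear_iff)
    fix Y h assume Y [simp]: "Y \<in> obj T" and "scalar_linear \<iota> T Y h"
    then have h: "k_linear ?I Y h" by (simp add: scalar_linear_iff)
    obtain u where u: "u \<in> arr T" "src T u = S" "tgt T u = Y" "\<And>l. l < n \<Longrightarrow> u \<cdot> i l = h (b l)"
      using direct_sum_map_out[OF d Y, of "\<lambda>l. h (b l)"] k_linearD[OF h] by auto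
    have uj: "u \<cdot> j c = h c" for c
    proof -
      have "u \<cdot> j c = arr_sum T ?I Y (\<lambda>l. u \<cdot> scl T (co l c) (i l)) n"
        unfolding j_def using u D cmp_arr_sum[of ?I u S n "\<lambda>l. scl T (co l c) (i l)"] by simp
      also have "\<dots> = arr_sum T ?I Y (\<lambda>l. scl T (co l c) (h (b l))) n"
        using u D by (intro arr_sum_cong) simp
      finally show ?thesis using k_linear_basis[OF bas h, of c] by simp
    qed
    show "\<exists>!u. u \<in> hom T S Y \<and> (\<forall>c. u \<cdot> j c = h c)"
    proof (rule ex1I[of _ u])
      show "u \<in> hom T S Y \<and> (\<forall>c. u \<cdot> j c = h c)" using u(1-3) uj by simp
      fix v assume v: "v \<in> hom T S Y \<and> (\<forall>c. v \<cdot> j c = h c)"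
      have vu: "v \<cdot> i l = u \<cdot> i l" if "l < n" for l
      proof -
        have "v \<cdot> j (b l) = u \<cdot> j (b l)" using v uj by simp
        then show ?thesis using ji[OF that] by simp
      qed
      have v': "v \<in> arr T" "src T v = S" "tgt T v = tgt T u" using v u(3) by simp_all
      show "v = u" by (rule direct_sum_eqI[OF d v'(1,2) u(1,2) v'(3) vu])
    qed
  qed simp
  then show ?thesis by blast
qed

abbreviation A where "A \<equiv> sc_obj \<iota> T"
abbreviation j where "j \<equiv> sc_elt \<iota> T"
abbreviation m where "m \<equiv> sc_mult \<iota> T"

text \<open>\<open>sc_obj\<close> and \<open>sc_elt\<close> come from an unspecified choice, so from
  here on everything about \<open>A\<close> is deduced from its universal property.\<close>

lemma scalar_object: "is_scalar_object \<iota> T (A, j)"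
proof -
  have "is_scalar_object \<iota> T (sc_pair \<iota> T)"
    unfolding sc_pair_def using scalar_object_exists by (rule someI_ex)
  then show ?thesis by (simp add: sc_obj_def sc_elt_def)
qed

lemma A_obj [simp]: "A \<in> obj T"
  using scalar_object by (simp add: is_scalar_object_def)

lemma j_linear: "k_linear (unt T) A j"
  using scalar_object by (simp add: is_scalar_object_def scalar_linear_iff)

lemma j_simps [simp]: "j c \<in> arr T" "src T (j c) = unt T" "tgt T (j c) = A"
  by (rule k_linearD[OF j_linear])+

lemma A_universal:
  assumes h: "k_linear (unt T) Y h"
  shows "\<exists>!u. u \<in> hom T A Y \<and> (\<forall>c. u \<cdot> j c = h c)"
proof -
  have "\<forall>Y\<in>obj T. \<forall>h. scalar_linear \<iota> T Y h \<longrightarrow> (\<exists>!u. u \<in> hom T A Y \<and> (\<forall>c. u \<cdot> j c = h c))"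
    using scalar_object unfolding is_scalar_object_def by blast
  then show ?thesis using h k_linearD(8)[OF h] scalar_linear_iff by blast
qed

lemma A_ext:
  assumes f: "f \<in> arr T" "src T f = A" and g: "g \<in> arr T" "src T g = A" "tgt T g = tgt T f"
    and e: "\<And>c. f \<cdot> j c = g \<cdot> j c"
  shows "f = g"
proof (rule ex1_eq[OF A_universal[OF k_linear_cmp[OF j_linear f]]])
  show "f \<in> hom T A (tgt T f) \<and> (\<forall>c. f \<cdot> j c = f \<cdot> j c)" using f by simp
  show "g \<in> hom T A (tgt T f) \<and> (\<forall>c. g \<cdot> j c = f \<cdot> j c)" using g e by simp
qed

lemma A_out:
  assumes h: "k_linear (unt T) Y h"
  obtains u where "u \<in> arr T" "src T u = A" "tgt T u = Y" "\<And>c. u \<cdot> j c = h c"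
proof -
  obtain u where "u \<in> hom T A Y \<and> (\<forall>c. u \<cdot> j c = h c)" using A_universal[OF h] by blast
  then show thesis by (intro that[of u]) auto
qed

text \<open>For the chosen object \<open>A\<close> the projections arise from the universal
  property, applied to the coordinate functionals of the basis.\<close>

lemma A_direct_sum:
  assumes bas: "basis n b co"
  obtains p where "is_direct_sum T n (\<lambda>_. unt T) A (\<lambda>l. j (b l)) p"
    "\<And>l c. p l \<cdot> j c = scl T (co l c) (idm T (unt T))" "\<And>l. p l \<in> hom T A (unt T)"
proof -
  note B = basisD[OF bas]
  let ?I = "unt T"
  have "\<exists>u. u \<in> hom T A ?I \<and> (\<forall>c. u \<cdot> j c = scl T (co l c) (idm T ?I))" for l
  proof -
    have "k_linear ?I ?I (\<lambda>c. scl T (co l c) (idm T ?I))"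
      by (simp add: k_linear_def B(1,2) scl_left_distrib scl_scl)
    then show ?thesis using A_universal by blast
  qed
  then obtain p where p: "\<And>l. p l \<in> hom T A ?I \<and> (\<forall>c. p l \<cdot> j c = scl T (co l c) (idm T ?I))"
    by metis
  then have p' [simp]: "p l \<in> arr T" "src T (p l) = A" "tgt T (p l) = ?I"
    and pj: "p l \<cdot> j c = scl T (co l c) (idm T ?I)" for l c by auto
  have "arr_sum T A A (\<lambda>l. j (b l) \<cdot> p l) n = idm T A"
  proof (rule A_ext)
    fix c
    have "arr_sum T A A (\<lambda>l. j (b l) \<cdot> p l) n \<cdot> j c = arr_sum T ?I A (\<lambda>l. (j (b l) \<cdot> p l) \<cdot> j c) n"
      using arr_sum_cmp[of A "j c" A n "\<lambda>l. j (b l) \<cdot> p l"] by simp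
    also have "\<dots> = arr_sum T ?I A (\<lambda>l. scl T (co l c) (j (b l))) n"
      by (intro arr_sum_cong) (simp add: pj)
    also have "\<dots> = j c" using k_linear_basis[OF bas j_linear, of c] by simp
    finally show "arr_sum T A A (\<lambda>l. j (b l) \<cdot> p l) n \<cdot> j c = idm T A \<cdot> j c" by simp
  qed simp_all
  then have "is_direct_sum T n (\<lambda>_. ?I) A (\<lambda>l. j (b l)) p"
    unfolding is_direct_sum_def by (simp add: pj B(3))
  then show thesis using that pj p by blast
qed

text \<open>\<open>ins X c\<close> is the arrow \<open>x \<mapsto> x \<otimes> c\<close>; these arrows are jointly epic, so that equations
  between arrows out of \<open>X \<otimes> A\<close> can be tested on elements of \<open>K\<close>.\<close>

definition ins :: "'o \<Rightarrow> 'l \<Rightarrow> 'm" where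
  "ins X c = (idm T X \<odot> j c) \<cdot> inv_arr T (run T X)"

lemma ins_simps [simp]:
  assumes "X \<in> obj T"
  shows "ins X c \<in> arr T" "src T (ins X c) = X" "tgt T (ins X c) = X \<otimes> A"
  using assms by (simp_all add: ins_def)

lemma ins_linear:
  assumes [simp]: "X \<in> obj T"
  shows "k_linear X (X \<otimes> A) (ins X)"
  unfolding k_linear_def by (simp, simp add: ins_def k_linearD(4,5)[OF j_linear])

lemma ins_nat: "f \<in> arr T \<Longrightarrow> (f \<odot> idm T A) \<cdot> ins (src T f) c = ins (tgt T f) c \<cdot> f"
  by (simp add: ins_def inv_run_nat)

lemma asc_ins:
  assumes [simp]: "X \<in> obj T" "Y \<in> obj T"
  shows "asc T X Y A \<cdot> ins (X \<otimes> Y) c = idm T X \<odot> ins Y c"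
proof -
  have r: "asc T X Y (unt T) \<cdot> inv_arr T (run T (X \<otimes> Y)) = idm T X \<odot> inv_arr T (run T Y)"
  proof (rule iso_cancel_left[of "idm T X \<odot> run T Y"])
    show "(idm T X \<odot> run T Y) \<cdot> (asc T X Y (unt T) \<cdot> inv_arr T (run T (X \<otimes> Y)))
        = (idm T X \<odot> run T Y) \<cdot> (idm T X \<odot> inv_arr T (run T Y))"
      using reassoc[OF run_tensor[of X Y], of "inv_arr T (run T (X \<otimes> Y))"] by simp
  qed simp_all
  have "asc T X Y A \<cdot> (idm T (X \<otimes> Y) \<odot> j c) = (idm T X \<odot> (idm T Y \<odot> j c)) \<cdot> asc T X Y (unt T)"
    using asc_nat[of "idm T X" "idm T Y" "j c"] by simp
  from reassoc[OF this, of "inv_arr T (run T (X \<otimes> Y))"] show ?thesis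
    by (simp add: ins_def r)
qed

lemma lun_ins: "lun T A \<cdot> ins (unt T) c = j c"
  using reassoc[OF lun_nat[of "j c"], of "inv_arr T (run T (unt T))"]
    inv_simps(5)[of "run T (unt T)"] by (simp add: ins_def lun_unt)

lemma bra_j: "X \<in> obj T \<Longrightarrow> bra T A X \<cdot> (j c \<odot> idm T X) = ins X c \<cdot> lun T X"
  using bra_nat[of "j c" "idm T X"] by (simp add: ins_def flip: run_bra)

text \<open>Additivity of the tensor product carries the decomposition of \<open>A\<close> over to
  \<open>X \<otimes> A\<close>. Both \<open>ins_ext\<close> and \<open>ins_out\<close> rest on
  it.\<close>

lemma tensor_A_direct_sum:
  assumes bas: "basis n b co" and X [simp]: "X \<in> obj T"
  obtains p where "is_direct_sum T n (\<lambda>_. X) (X \<otimes> A) (\<lambda>l. ins X (b l)) p"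
    "\<And>l c. p l \<cdot> ins X c = scl T (co l c) (idm T X)"
    "\<And>l. p l \<in> hom T (X \<otimes> A) X"
proof -
  let ?I = "unt T"
  note B = basisD[OF bas]
  obtain q where q: "is_direct_sum T n (\<lambda>_. ?I) A (\<lambda>l. j (b l)) q"
    "\<And>l c. q l \<cdot> j c = scl T (co l c) (idm T ?I)" "\<And>l. q l \<in> hom T A ?I"
    using A_direct_sum[OF bas] by blast
  then have [simp]: "q l \<in> arr T" "src T (q l) = A" "tgt T (q l) = ?I" for l by auto
  define p where "p l = run T X \<cdot> (idm T X \<odot> q l)" for l
  have [simp]: "p l \<in> arr T" "src T (p l) = X \<otimes> A" "tgt T (p l) = X" for l
    by (auto simp: p_def)
  have pi: "p l \<cdot> ins X c = scl T (co l c) (idm T X)" for l c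
    by (simp add: p_def ins_def q(2))
  have "arr_sum T (X \<otimes> A) (X \<otimes> A) (\<lambda>l. ins X (b l) \<cdot> p l) n
      = arr_sum T (X \<otimes> A) (X \<otimes> A) (\<lambda>l. idm T X \<odot> (j (b l) \<cdot> q l)) n"
    by (intro arr_sum_cong) (simp add: p_def ins_def)
  also have "\<dots> = idm T X \<odot> arr_sum T A A (\<lambda>l. j (b l) \<cdot> q l) n"
    using tar_arr_sum[of A A n "\<lambda>l. j (b l) \<cdot> q l" "idm T X"] by simp
  also have "\<dots> = idm T (X \<otimes> A)" unfolding direct_sumD(9)[OF q(1)] by simp
  finally have "is_direct_sum T n (\<lambda>_. X) (X \<otimes> A) (\<lambda>l. ins X (b l)) p"
    unfolding is_direct_sum_def by (simp add: pi B(3))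
  then show thesis by (rule that) (simp_all add: pi)
qed

lemma ins_ext:
  assumes "f \<in> arr T" "src T f = X \<otimes> A" "g \<in> arr T" "src T g = X \<otimes> A" "tgt T f = tgt T g"
    and X: "X \<in> obj T" and e: "\<And>c. f \<cdot> ins X c = g \<cdot> ins X c"
  shows "f = g"
proof -
  obtain n b co where bas: "basis n b co" using basis_exists by blast
  obtain p where d: "is_direct_sum T n (\<lambda>_. X) (X \<otimes> A) (\<lambda>l. ins X (b l)) p"
    by (rule tensor_A_direct_sum[OF bas X]) (rule that)
  show ?thesis by (rule direct_sum_eqI[OF d]) (use assms in auto)
qed

text \<open>Together with \<open>ins_ext\<close> this identifies
  \<open>Hom (X \<otimes> A, Y)\<close> with the \<open>k\<close>-linear maps from \<open>K\<close>
  to \<open>Hom (X, Y)\<close>: the universal property of \<open>A\<close>, relative to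
  \<open>X\<close>.\<close>

lemma ins_out:
  assumes h: "k_linear X Y h"
  obtains u where "u \<in> arr T" "src T u = X \<otimes> A" "tgt T u = Y" "\<And>c. u \<cdot> ins X c = h c"
proof -
  note H = k_linearD[OF h]
  obtain n b co where bas: "basis n b co" using basis_exists by blast
  obtain p where d: "is_direct_sum T n (\<lambda>_. X) (X \<otimes> A) (\<lambda>l. ins X (b l)) p"
    by (rule tensor_A_direct_sum[OF bas H(7)]) (rule that)
  obtain u where u: "u \<in> arr T" "src T u = X \<otimes> A" "tgt T u = Y" "\<And>l. l < n \<Longrightarrow> u \<cdot> ins X (b l) = h (b l)"
    using direct_sum_map_out[OF d H(8), of "\<lambda>l. h (b l)"] H by auto
  have "u \<cdot> ins X c = h c" for c
  proof -
    have "u \<cdot> ins X c = arr_sum T X (tgt T u) (\<lambda>l. scl T (co l c) (u \<cdot> ins X (b l))) n"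
      using k_linear_basis[OF bas k_linear_cmp[OF ins_linear[OF H(7)] u(1,2)], of c] .
    also have "\<dots> = arr_sum T X Y (\<lambda>l. scl T (co l c) (h (b l))) n"
      unfolding u(3) using u(4) by (intro arr_sum_cong) simp
    also have "\<dots> = h c" using k_linear_basis[OF bas h, of c] by simp
    finally show ?thesis .
  qed
  then show thesis using that u by blast
qed

text \<open>The symmetry exchanges \<open>j c \<odot> idm T X\<close> and \<open>ins X c\<close> up
  to unit constraints, so the test on \<open>X \<otimes> A\<close> carries over to
  \<open>A \<otimes> X\<close>.\<close>

lemma j_ext:
  assumes f: "f \<in> arr T" "src T f = A \<otimes> X" "g \<in> arr T" "src T g = A \<otimes> X" "tgt T f = tgt T g"
    and X [simp]: "X \<in> obj T" and e: "\<And>c. f \<cdot> (j c \<odot> idm T X) = g \<cdot> (j c \<odot> idm T X)"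
  shows "f = g"
proof -
  have b: "h \<cdot> bra T X A \<cdot> ins X c = h \<cdot> (j c \<odot> idm T X) \<cdot> inv_arr T (lun T X)"
    if "h \<in> arr T" "src T h = A \<otimes> X" for h c
  proof -
    have "ins X c = bra T A X \<cdot> ((j c \<odot> idm T X) \<cdot> inv_arr T (lun T X))"
      using reassoc[OF bra_j[OF X], of c "inv_arr T (lun T X)"] inv_simps(5)[of "lun T X"] by simp
    then show ?thesis using that by simp
  qed
  have "f \<cdot> bra T X A = g \<cdot> bra T X A"
  proof (rule ins_ext[OF _ _ _ _ _ X])
    fix c show "f \<cdot> bra T X A \<cdot> ins X c = g \<cdot> bra T X A \<cdot> ins X c"
      unfolding b[OF f(1,2)] b[OF f(3,4)] e ..
  qed (use f in auto)
  then show ?thesis using f by (intro iso_cancel_right[of "bra T X A" f g]) auto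
qed

text \<open>Justifies the description in \<open>sc_mult\<close>. Existence uses the universal
  property twice: for fixed \<open>d\<close>, multiplication by \<open>d\<close> is an endomorphism
  \<open>r d\<close> of \<open>A\<close>, and \<open>d \<mapsto> r d\<close> is again
  \<open>k\<close>-linear, so it defines an arrow out of \<open>A \<otimes> A\<close>. Uniqueness is
  the test on elements in both factors.\<close>

lemma m_properties:
  "m \<in> hom T (A \<otimes> A) A \<and> (\<forall>c d. m \<cdot> (j c \<odot> j d) = j (c * d) \<cdot> lun T (unt T))"
proof -
  let ?I = "unt T"
  let ?P = "\<lambda>u. u \<in> hom T (A \<otimes> A) A \<and> (\<forall>c d. u \<cdot> (j c \<odot> j d) = j (c * d) \<cdot> lun T ?I)"
  have "\<exists>u. u \<in> hom T A A \<and> (\<forall>c. u \<cdot> j c = j (c * d))" for d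
  proof -
    have "k_linear ?I A (\<lambda>c. j (c * d))"
      by (simp add: k_linear_def k_linearD(4,5)[OF j_linear] distrib_right mult.assoc)
    then show ?thesis using A_universal by blast
  qed
  then obtain r where r: "\<And>d. r d \<in> hom T A A \<and> (\<forall>c. r d \<cdot> j c = j (c * d))" by metis
  then have [simp]: "r d \<in> arr T" "src T (r d) = A" "tgt T (r d) = A" "r d \<cdot> j c = j (c * d)" for c d
    by auto
  have "k_linear A A r"
    unfolding k_linear_def
  proof (intro conjI allI)
    fix c d a
    show "r c \<in> hom T A A" by simp
    show "r (c + d) = r c \<oplus> r d"
      by (rule A_ext) (simp_all add: k_linearD(4)[OF j_linear] distrib_left)
    have "j (x * (\<iota> a * c)) = scl T a (j (x * c))" for x
      using k_linearD(5)[OF j_linear, of a "x * c"] by (simp add: mult.left_commute)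
    then show "r (\<iota> a * c) = scl T a (r c)"
      by (intro A_ext[of "r (\<iota> a * c)" "scl T a (r c)"]) simp_all
  qed
  then obtain u where u [simp]: "u \<in> arr T" "src T u = A \<otimes> A" "tgt T u = A" and ur: "\<And>c. u \<cdot> ins A c = r c"
    using ins_out by blast
  have *: "v \<cdot> (j c \<odot> j d) = (v \<cdot> ins A d) \<cdot> (j c \<cdot> run T ?I)"
    if "v \<in> arr T" "src T v = A \<otimes> A" for v c d
  proof -
    have n: "j c \<cdot> run T ?I = run T A \<cdot> (j c \<odot> idm T ?I)" using run_nat[of "j c"] by simp
    show ?thesis unfolding n using that by (simp add: ins_def)
  qed
  have "?P u" by (simp add: * ur lun_unt reassoc[of "r _"])
  moreover have "v = u" if v: "?P v" for v
  proof (rule ins_ext[OF _ _ _ _ _ A_obj])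
    fix d
    show "v \<cdot> ins A d = u \<cdot> ins A d"
    proof (rule A_ext)
      fix c
      have "(v \<cdot> ins A d) \<cdot> (j c \<cdot> run T ?I) = (u \<cdot> ins A d) \<cdot> (j c \<cdot> run T ?I)"
        using v \<open>?P u\<close> *[of v c d] *[of u c d] by simp
      then have "((v \<cdot> ins A d) \<cdot> j c) \<cdot> run T ?I = ((u \<cdot> ins A d) \<cdot> j c) \<cdot> run T ?I"
        using v by simp
      then show "v \<cdot> ins A d \<cdot> j c = u \<cdot> ins A d \<cdot> j c"
        by (rule iso_cancel_right[rotated]) (use v in simp_all)
    qed (use v in auto)
  qed (use v in auto)
  ultimately have "\<exists>!v. ?P v" by blast
  then show ?thesis unfolding sc_mult_def by (rule theI')
qed

lemma m_simps [simp]: "m \<in> arr T" "src T m = A \<otimes> A" "tgt T m = A"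
  using m_properties by auto

lemma m_ins: "m \<cdot> (ins A d \<cdot> j c) = j (c * d)"
proof -
  have "m \<cdot> (ins A d \<cdot> j c) = (m \<cdot> (j c \<odot> j d)) \<cdot> inv_arr T (run T (unt T))"
    using inv_run_nat[of "j c"] by (simp add: ins_def)
  also have "\<dots> = j (c * d)"
    using m_properties inv_simps(5)[of "run T (unt T)"] by (simp add: lun_unt)
  finally show ?thesis .
qed

section \<open>Modules as objects with an action of the field \<open>K\<close>\<close>

abbreviation act :: "'l \<Rightarrow> ('o, 'm) md \<Rightarrow> 'm" where "act \<equiv> homothety \<iota> T"
abbreviation mods where "mods \<equiv> modules \<iota> T"

lemma act_eq: "X \<in> obj T \<Longrightarrow> r \<in> hom T (X \<otimes> A) X \<Longrightarrow> act c (X, r) = r \<cdot> ins X c"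
  by (simp add: homothety_def ins_def)

text \<open>An equation of arrows out of \<open>(X \<otimes> A) \<otimes> A\<close> may be tested
  after inserting an element into each factor \<open>A\<close>. The action is a right action, and
  commutativity of \<open>K\<close> absorbs the resulting change of order.\<close>

lemma modules_iff:
  "(X, r) \<in> mods \<longleftrightarrow> X \<in> obj T \<and> r \<in> hom T (X \<otimes> A) X \<and>
    (\<forall>c d. (r \<cdot> ins X c) \<cdot> (r \<cdot> ins X d) = r \<cdot> ins X (c * d)) \<and> r \<cdot> ins X 1 = idm T X"
proof (cases "X \<in> obj T \<and> r \<in> hom T (X \<otimes> A) X")
  case True
  then have [simp]: "X \<in> obj T" "r \<in> arr T" "src T r = X \<otimes> A" "tgt T r = X" by auto
  have l: "(r \<cdot> (r \<odot> idm T A)) \<cdot> ins (X \<otimes> A) d \<cdot> ins X c = (r \<cdot> ins X d) \<cdot> (r \<cdot> ins X c)" for c d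
    using reassoc[OF ins_nat[of r d], of "ins X c"] by simp
  have r: "(r \<cdot> (idm T X \<odot> m) \<cdot> asc T X A A) \<cdot> ins (X \<otimes> A) d \<cdot> ins X c = r \<cdot> ins X (c * d)" for c d
    using reassoc[OF asc_ins[of X A d], of "ins X c"] by (simp add: ins_def[of X] m_ins)
  have "r \<cdot> (r \<odot> idm T A) = r \<cdot> (idm T X \<odot> m) \<cdot> asc T X A A \<longleftrightarrow>
    (\<forall>c d. (r \<cdot> ins X c) \<cdot> (r \<cdot> ins X d) = r \<cdot> ins X (c * d))" (is "?L = ?R \<longleftrightarrow> ?Q")
  proof
    assume e: "?L = ?R"
    show ?Q
    proof (intro allI)
      fix c d
      show "(r \<cdot> ins X c) \<cdot> (r \<cdot> ins X d) = r \<cdot> ins X (c * d)"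
        unfolding l[where c = d and d = c, symmetric] by (simp only: e r mult.commute[of d c])
    qed
  next
    assume q: ?Q
    show "?L = ?R"
    proof (rule ins_ext[of _ "X \<otimes> A"])
      fix d
      show "?L \<cdot> ins (X \<otimes> A) d = ?R \<cdot> ins (X \<otimes> A) d"
      proof (rule ins_ext[of _ X])
        fix c
        show "?L \<cdot> ins (X \<otimes> A) d \<cdot> ins X c = ?R \<cdot> ins (X \<otimes> A) d \<cdot> ins X c"
          unfolding l r q[rule_format] by (simp only: mult.commute)
      qed simp_all
    qed simp_all
  qed
  moreover have "r \<cdot> (idm T X \<odot> sc_unit \<iota> T) = run T X \<longleftrightarrow> r \<cdot> ins X 1 = idm T X"
  proof
    assume "r \<cdot> (idm T X \<odot> sc_unit \<iota> T) = run T X"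
    then have "(r \<cdot> (idm T X \<odot> j 1)) \<cdot> inv_arr T (run T X) = run T X \<cdot> inv_arr T (run T X)"
      by (simp only: sc_unit_def)
    then show "r \<cdot> ins X 1 = idm T X" by (simp add: ins_def)
  next
    assume e: "r \<cdot> ins X 1 = idm T X"
    have "r \<cdot> (idm T X \<odot> sc_unit \<iota> T) = (r \<cdot> ins X 1) \<cdot> run T X"
      by (simp add: ins_def sc_unit_def)
    then show "r \<cdot> (idm T X \<odot> sc_unit \<iota> T) = run T X" unfolding e by simp
  qed
  ultimately show ?thesis by (simp add: modules_def Let_def)
next
  case False
  then show ?thesis by (auto simp: modules_def Let_def)
qed

lemma module_simps [simp]:
  assumes "M \<in> mods"
  shows "fst M \<in> obj T" "snd M \<in> arr T" "src T (snd M) = fst M \<otimes> A" "tgt T (snd M) = fst M"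
  using assms by (cases M, auto simp: modules_iff)+

lemma act_module: "M \<in> mods \<Longrightarrow> act c M = snd M \<cdot> ins (fst M) c"
  by (cases M) (simp add: modules_iff act_eq)

lemma act_simps [simp]:
  assumes "M \<in> mods"
  shows "act c M \<in> arr T" "src T (act c M) = fst M" "tgt T (act c M) = fst M"
  using assms by (simp_all add: act_module)

lemma act_field_action: "M \<in> mods \<Longrightarrow> field_action \<iota> T (fst M) (\<lambda>c. act c M)"
proof -
  assume M: "M \<in> mods"
  note I = k_linearD[OF ins_linear[OF module_simps(1)[OF M]]]
  obtain X r where Mx: "M = (X, r)" by (cases M)
  have "act (\<iota> a * 1) M = scl T a (act 1 M)" for a
    unfolding act_module[OF M] I(5) using M by simp
  then show ?thesis
    using M modules_iff[of X r] I(4) by (simp add: field_action_def act_module Mx)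
qed

lemma act_mult: "M \<in> mods \<Longrightarrow> act c M \<cdot> act d M = act (c * d) M"
  and act_one: "M \<in> mods \<Longrightarrow> act 1 M = idm T (fst M)"
  and act_add: "M \<in> mods \<Longrightarrow> act (c + d) M = act c M \<oplus> act d M"
  and act_emb: "M \<in> mods \<Longrightarrow> act (\<iota> a) M = scl T a (idm T (fst M))"
  using actionD[OF act_field_action] by auto

lemma act_commute: "M \<in> mods \<Longrightarrow> act c M \<cdot> act d M = act d M \<cdot> act c M"
  by (simp add: act_mult mult.commute)

text \<open>Converse to \<open>act_field_action\<close>: a module structure on \<open>X\<close> is
  the same as an action of the field, so that submodules, quotients and sums are obtained by
  specifying \<open>\<rho>\<close> alone.\<close>

lemma field_action_module:
  assumes a: "field_action \<iota> T X \<rho>"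
  obtains M where "M \<in> mods" "fst M = X" "\<And>c. act c M = \<rho> c"
proof -
  note R = actionD[OF a]
  have "k_linear X X \<rho>" unfolding k_linear_def using R by simp
  then obtain r where r: "r \<in> arr T" "src T r = X \<otimes> A" "tgt T r = X" "\<And>c. r \<cdot> ins X c = \<rho> c"
    using ins_out by blast
  have m: "(X, r) \<in> mods" using r R by (simp add: modules_iff)
  show thesis using that[OF m] r R by (simp add: act_eq)
qed

lemma module_hom_iff:
  assumes M: "M \<in> mods" and N: "N \<in> mods"
  shows "f \<in> module_hom \<iota> T M N \<longleftrightarrow> f \<in> hom T (fst M) (fst N) \<and> (\<forall>c. f \<cdot> act c M = act c N \<cdot> f)"
proof (cases "f \<in> hom T (fst M) (fst N)")
  case True
  then have f [simp]: "f \<in> arr T" "src T f = fst M" "tgt T f = fst N" by auto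
  note [simp] = module_simps[OF M] module_simps[OF N]
  have l: "(f \<cdot> snd M) \<cdot> ins (fst M) c = f \<cdot> act c M" for c by (simp add: act_module M)
  have r: "(snd N \<cdot> (f \<odot> idm T A)) \<cdot> ins (fst M) c = act c N \<cdot> f" for c
    using ins_nat[of f c] by (simp add: act_module N)
  have "f \<cdot> snd M = snd N \<cdot> (f \<odot> idm T A) \<longleftrightarrow> (\<forall>c. f \<cdot> act c M = act c N \<cdot> f)"
  proof
    assume e: "f \<cdot> snd M = snd N \<cdot> (f \<odot> idm T A)"
    show "\<forall>c. f \<cdot> act c M = act c N \<cdot> f" unfolding l[symmetric] r[symmetric] e by simp
  next
    assume "\<forall>c. f \<cdot> act c M = act c N \<cdot> f"
    then show "f \<cdot> snd M = snd N \<cdot> (f \<odot> idm T A)"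
      by (intro ins_ext[of "f \<cdot> snd M" "fst M"]) (simp_all only: l r, simp_all)
  qed
  then show ?thesis by (simp add: module_hom_def)
next
  case False
  then show ?thesis by (auto simp: module_hom_def)
qed

abbreviation U where "U \<equiv> unit_module \<iota> T"
abbreviation Fr where "Fr \<equiv> free_module \<iota> T"

lemma U_module [simp]: "U \<in> mods" and fst_U [simp]: "fst U = A"
  and act_U: "act c U \<cdot> j d = j (d * c)"
proof -
  have "(A, m) \<in> mods"
    unfolding modules_iff
  proof (intro conjI allI)
    show "m \<cdot> ins A c \<cdot> (m \<cdot> ins A d) = m \<cdot> ins A (c * d)" for c d
      by (rule A_ext) (simp_all add: m_ins mult_ac)
    show "m \<cdot> ins A 1 = idm T A"
      by (rule A_ext) (simp_all add: m_ins)
  qed simp_all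
  then show "U \<in> mods" "fst U = A" "act c U \<cdot> j d = j (d * c)"
    by (simp_all add: unit_module_def act_eq m_ins)
qed

lemma act_free: "X \<in> obj T \<Longrightarrow> act c (Fr X) = idm T X \<odot> act c U"
  by (simp add: free_module_def unit_module_def act_eq asc_ins)

lemma act_free_ins:
  assumes [simp]: "X \<in> obj T"
  shows "act c (Fr X) \<cdot> ins X d = ins X (d * c)"
  by (simp add: act_free act_U ins_def)

lemma fst_Fr [simp]: "fst (Fr X) = X \<otimes> A"
  by (simp add: free_module_def)

lemma Fr_module [simp]:
  assumes [simp]: "X \<in> obj T"
  shows "Fr X \<in> mods"
proof -
  let ?r = "(idm T X \<odot> m) \<cdot> asc T X A A"
  have a: "?r \<cdot> ins (X \<otimes> A) c = idm T X \<odot> act c U" for c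
    by (simp add: asc_ins unit_module_def act_eq)
  have "(X \<otimes> A, ?r) \<in> mods"
    unfolding modules_iff a by (simp add: act_mult act_one)
  then show ?thesis by (simp add: free_module_def)
qed

end

section \<open>The abelian category of modules\<close>

context base_extension
begin

abbreviation Q where "Q \<equiv> module_category \<iota> T"

text \<open>Arrows of \<open>Q\<close> are triples. This predicate concerns the underlying arrow in
  \<open>T\<close>, where the computations take place.\<close>

definition mhom :: "('o, 'm) md \<Rightarrow> ('o, 'm) md \<Rightarrow> 'm \<Rightarrow> bool" where
  "mhom M N f \<longleftrightarrow> M \<in> mods \<and> N \<in> mods \<and> f \<in> hom T (fst M) (fst N) \<and> (\<forall>c. f \<cdot> act c M = act c N \<cdot> f)"

lemma mhomD:
  assumes "mhom M N f"
  shows "M \<in> mods" "N \<in> mods" "f \<in> arr T" "src T f = fst M" "tgt T f = fst N"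
    "f \<cdot> act c M = act c N \<cdot> f"
  using assms by (auto simp: mhom_def)

lemma obj_Q [simp]: "obj Q = mods"
  by (simp add: module_category_def)

lemma arr_Q [simp]: "(M, N, f) \<in> arr Q \<longleftrightarrow> mhom M N f"
  using module_hom_iff[of M N f] by (auto simp: module_category_def mhom_def)

lemma src_Q [simp]: "src Q (M, N, f) = M" and tgt_Q [simp]: "tgt Q (M, N, f) = N"
  and idm_Q [simp]: "idm Q M = (M, M, idm T (fst M))"
  and cmp_Q [simp]: "(M', N', g) \<cdot>\<^bsub>Q\<^esub> (M, N, f) = (M, N', g \<cdot> f)"
  and zer_Q [simp]: "zer Q M N = (M, N, zer T (fst M) (fst N))"
  and add_Q [simp]: "(M, N, f) \<oplus>\<^bsub>Q\<^esub> (M', N', g) = (M, N, f \<oplus> g)"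
  and scl_Q [simp]: "scl Q c (M, N, f) = (M, N, f \<cdot> act c M)"
  by (simp_all add: module_category_def)

lemma hom_QE:
  assumes "x \<in> hom Q M N"
  obtains f where "x = (M, N, f)" "mhom M N f"
  using assms by (cases x) auto

lemma arr_QE:
  assumes "x \<in> arr Q"
  obtains M N f where "x = (M, N, f)" "mhom M N f"
  using assms by (cases x) auto

lemma mhom_id [simp]: "M \<in> mods \<Longrightarrow> mhom M M (idm T (fst M))"
  by (simp add: mhom_def)

lemma mhom_cmp: "mhom M N f \<Longrightarrow> mhom N P g \<Longrightarrow> mhom M P (g \<cdot> f)"
  unfolding mhom_def by (auto, metis act_simps assoc)

lemma mhom_zer [simp]: "M \<in> mods \<Longrightarrow> N \<in> mods \<Longrightarrow> mhom M N (zer T (fst M) (fst N))"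
  by (simp add: mhom_def)

lemma mhom_add: "mhom M N f \<Longrightarrow> mhom M N g \<Longrightarrow> mhom M N (f \<oplus> g)"
  by (simp add: mhom_def)

lemma mhom_scl: "mhom M N f \<Longrightarrow> mhom M N (scl T a f)"
  by (simp add: mhom_def)

lemma mhom_act: "M \<in> mods \<Longrightarrow> mhom M M (act c M)"
  by (simp add: mhom_def act_commute)

lemma mhom_cmp_act: "mhom M N f \<Longrightarrow> mhom M N (f \<cdot> act c M)"
  by (rule mhom_cmp[OF mhom_act]) (rule mhomD(1))

lemma mhom_eq_add:
  assumes "mhom M N f"
  shows "f \<cdot> act (a + b) M = f \<cdot> act a M \<oplus> f \<cdot> act b M" "f \<cdot> act (a * b) M = f \<cdot> (act b M \<cdot> act a M)"
    "f \<cdot> act 1 M = f"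
  using mhomD[OF assms] by (simp_all add: act_add act_mult act_one mult.commute)

lemma category_Q: "category Q"
proof
  show "src Q x \<in> obj Q" if "x \<in> arr Q" for x using that by (cases x) (auto dest: mhomD)
  show "tgt Q x \<in> obj Q" if "x \<in> arr Q" for x using that by (cases x) (auto dest: mhomD)
  show "idm Q M \<in> hom Q M M" if "M \<in> obj Q" for M using that by simp
  show "y \<cdot>\<^bsub>Q\<^esub> x \<in> hom Q M P" if "x \<in> hom Q M N" "y \<in> hom Q N P" for x y M N P
    using that by (auto elim!: hom_QE intro: mhom_cmp simp del: in_hom) (auto intro: mhom_cmp)
  show "x \<cdot>\<^bsub>Q\<^esub> idm Q M = x" if "x \<in> hom Q M N" for x M N
    using that by (auto elim!: hom_QE simp: mhomD(3-5) simp del: in_hom)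
  show "idm Q N \<cdot>\<^bsub>Q\<^esub> x = x" if "x \<in> hom Q M N" for x M N
    using that by (auto elim!: hom_QE simp: mhomD(3-5) simp del: in_hom)
  show "z \<cdot>\<^bsub>Q\<^esub> (y \<cdot>\<^bsub>Q\<^esub> x) = z \<cdot>\<^bsub>Q\<^esub> y \<cdot>\<^bsub>Q\<^esub> x" if "x \<in> hom Q M N" "y \<in> hom Q N P" "z \<in> hom Q P R" for x y z M N P R
    using that by (auto elim!: hom_QE simp: mhomD simp del: in_hom)
qed

lemma linear_category_Q: "linear_category Q"
proof (intro linear_category.intro category_Q linear_category_axioms.intro)
  note [elim!] = hom_QE and [simp del] = in_hom
  fix M N P :: "('o, 'm) md" and x y z and a b :: 'l
  have h: "(M, N, f) \<in> hom Q M' N' \<longleftrightarrow> M = M' \<and> N = N' \<and> mhom M N f" for M N M' N' f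
    unfolding in_hom by auto
  note [simp] = h
  show "zer Q M N \<in> hom Q M N" if "M \<in> obj Q" "N \<in> obj Q" using that by simp
  show "x \<oplus>\<^bsub>Q\<^esub> y \<in> hom Q M N" if "x \<in> hom Q M N" "y \<in> hom Q M N" using that by (auto intro: mhom_add)
  show "scl Q a x \<in> hom Q M N" if "x \<in> hom Q M N"
    using that by (auto intro: mhom_cmp_act)
  show "x \<oplus>\<^bsub>Q\<^esub> y \<oplus>\<^bsub>Q\<^esub> z = x \<oplus>\<^bsub>Q\<^esub> (y \<oplus>\<^bsub>Q\<^esub> z)" if "x \<in> hom Q M N" "y \<in> hom Q M N" "z \<in> hom Q M N"
    using that by (auto simp: mhom_def add_assoc)
  show "x \<oplus>\<^bsub>Q\<^esub> y = y \<oplus>\<^bsub>Q\<^esub> x" if "x \<in> hom Q M N" "y \<in> hom Q M N"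
    using that by (auto simp: mhom_def add_commute)
  show "x \<oplus>\<^bsub>Q\<^esub> zer Q M N = x" if "x \<in> hom Q M N" using that by (auto simp: mhomD)
  show "\<exists>y\<in>hom Q M N. x \<oplus>\<^bsub>Q\<^esub> y = zer Q M N" if x: "x \<in> hom Q M N"
  proof -
    obtain f where f: "x = (M, N, f)" "mhom M N f" using x by blast
    show ?thesis
      using f mhomD[OF f(2)] add_neg[of f] mhom_scl[OF f(2)]
      by (intro bexI[of _ "(M, N, scl T (-1) f)"]) simp_all
  qed
  show "scl Q (a + b) x = scl Q a x \<oplus>\<^bsub>Q\<^esub> scl Q b x" if "x \<in> hom Q M N"
    using that by (auto simp: mhom_eq_add)
  show "scl Q a (x \<oplus>\<^bsub>Q\<^esub> y) = scl Q a x \<oplus>\<^bsub>Q\<^esub> scl Q a y" if "x \<in> hom Q M N" "y \<in> hom Q M N"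
    using that by (auto simp: mhomD(1-5))
  show "scl Q (a * b) x = scl Q a (scl Q b x)" if "x \<in> hom Q M N"
    using that by (auto simp: mhom_eq_add mhomD(1-5))
  show "scl Q 1 x = x" if "x \<in> hom Q M N"
    using that by (auto simp: mhom_eq_add)
  show "(y \<oplus>\<^bsub>Q\<^esub> z) \<cdot>\<^bsub>Q\<^esub> x = y \<cdot>\<^bsub>Q\<^esub> x \<oplus>\<^bsub>Q\<^esub> z \<cdot>\<^bsub>Q\<^esub> x" if "x \<in> hom Q M N" "y \<in> hom Q N P" "z \<in> hom Q N P"
    using that by (auto simp: mhomD(1-5))
  show "z \<cdot>\<^bsub>Q\<^esub> (x \<oplus>\<^bsub>Q\<^esub> y) = z \<cdot>\<^bsub>Q\<^esub> x \<oplus>\<^bsub>Q\<^esub> z \<cdot>\<^bsub>Q\<^esub> y" if "x \<in> hom Q M N" "y \<in> hom Q M N" "z \<in> hom Q N P"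
    using that by (auto simp: mhomD(1-5))
  show "scl Q a y \<cdot>\<^bsub>Q\<^esub> x = scl Q a (y \<cdot>\<^bsub>Q\<^esub> x)" if "x \<in> hom Q M N" "y \<in> hom Q N P"
    using that by (auto simp: mhomD(1-5)) (metis mhomD assoc act_simps)
  show "y \<cdot>\<^bsub>Q\<^esub> scl Q a x = scl Q a (y \<cdot>\<^bsub>Q\<^esub> x)" if "x \<in> hom Q M N" "y \<in> hom Q N P"
    using that by (auto simp: mhomD(1-5))
qed

sublocale Q: linear_category Q
  by (rule linear_category_Q)

text \<open>Along a monomorphism each homothety has at most one lift, so the lifts satisfy the
  identities of an action because the homotheties of \<open>M\<close> do.\<close>

lemma submodule:
  assumes M: "M \<in> mods" and i: "is_mono T i" "tgt T i = fst M"
    and r: "\<And>c. \<exists>u \<in> hom T (src T i) (src T i). i \<cdot> u = act c M \<cdot> i"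
  obtains W where "mhom W M i"
proof -
  have ia [simp]: "i \<in> arr T" "tgt T i = fst M" using i by (auto simp: is_mono_def)
  note [simp] = M
  obtain \<rho> where "\<And>c. \<rho> c \<in> hom T (src T i) (src T i) \<and> i \<cdot> \<rho> c = act c M \<cdot> i"
    using r by metis
  then have [simp]: "\<rho> c \<in> arr T" "src T (\<rho> c) = src T i" "tgt T (\<rho> c) = src T i"
    and ir: "i \<cdot> \<rho> c = act c M \<cdot> i" for c by auto
  note c = mono_cancel[OF i(1)]
  have "field_action \<iota> T (src T i) \<rho>"
    unfolding field_action_def
  proof (intro conjI allI)
    show "\<rho> (c + d) = \<rho> c \<oplus> \<rho> d" for c d
      by (rule c) (simp_all add: ir act_add)
    show "\<rho> (c * d) = \<rho> c \<cdot> \<rho> d" for c d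
    proof (rule c)
      have "i \<cdot> (\<rho> c \<cdot> \<rho> d) = act c M \<cdot> (act d M \<cdot> i)"
        using reassoc[OF ir, of c "\<rho> d"] by (simp add: ir)
      then show "i \<cdot> \<rho> (c * d) = i \<cdot> (\<rho> c \<cdot> \<rho> d)"
        using reassoc[OF act_mult[OF M], of c d i] by (simp add: ir)
    qed simp_all
    show "\<rho> 1 = idm T (src T i)" by (rule c) (simp_all add: ir act_one)
    show "\<rho> (\<iota> a) = scl T a (idm T (src T i))" for a
      by (rule c) (simp_all add: ir act_emb)
  qed simp_all
  then obtain W where W: "W \<in> mods" "fst W = src T i" "\<And>c. act c W = \<rho> c"
    by (rule field_action_module) (rule that)
  then have "mhom W M i" by (simp add: mhom_def ir)
  then show thesis by (rule that)
qed

lemma quotient_module: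
  assumes M: "M \<in> mods" and p: "is_epi T p" "src T p = fst M"
    and r: "\<And>c. \<exists>u \<in> hom T (tgt T p) (tgt T p). u \<cdot> p = p \<cdot> act c M"
  obtains W where "mhom M W p"
proof -
  have pa [simp]: "p \<in> arr T" "src T p = fst M" using p by (auto simp: is_epi_def)
  note [simp] = M
  obtain \<rho> where "\<And>c. \<rho> c \<in> hom T (tgt T p) (tgt T p) \<and> \<rho> c \<cdot> p = p \<cdot> act c M"
    using r by metis
  then have [simp]: "\<rho> c \<in> arr T" "src T (\<rho> c) = tgt T p" "tgt T (\<rho> c) = tgt T p"
    and rp: "\<rho> c \<cdot> p = p \<cdot> act c M" for c by auto
  note c = epi_cancel[OF p(1)]
  have "field_action \<iota> T (tgt T p) \<rho>"
    unfolding field_action_def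
  proof (intro conjI allI)
    show "\<rho> (c + d) = \<rho> c \<oplus> \<rho> d" for c d
      by (rule c) (simp_all add: rp act_add)
    show "\<rho> (c * d) = \<rho> c \<cdot> \<rho> d" for c d
      by (rule c) (simp_all add: rp reassoc[OF rp] act_mult)
    show "\<rho> 1 = idm T (tgt T p)" by (rule c) (simp_all add: rp act_one)
    show "\<rho> (\<iota> a) = scl T a (idm T (tgt T p))" for a
      by (rule c) (simp_all add: rp act_emb)
  qed simp_all
  then obtain W where W: "W \<in> mods" "fst W = tgt T p" "\<And>c. act c W = \<rho> c"
    by (rule field_action_module) (rule that)
  then have "mhom M W p" by (simp add: mhom_def rp)
  then show thesis by (rule that)
qed

lemma kernel_submodule:
  assumes f: "mhom M N f" and k: "is_kernel T f i"
  obtains W where "mhom W M i"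
proof (rule submodule[OF mhomD(1)[OF f] kernel_mono[OF k]])
  note F = mhomD[OF f] and K = kernelD[OF k]
  show "tgt T i = fst M" using K F by simp
  fix c
  have "f \<cdot> (act c M \<cdot> i) = act c N \<cdot> (f \<cdot> i)"
    using reassoc[OF F(6)[of c], of i] F(1-5) K(1-3) by simp
  also have "\<dots> = zer T (src T (act c M \<cdot> i)) (tgt T f)"
    unfolding K(4) using F K by simp
  finally have z: "f \<cdot> (act c M \<cdot> i) = zer T (src T (act c M \<cdot> i)) (tgt T f)" .
  obtain u where "u \<in> arr T" "src T u = src T i" "tgt T u = src T i" "i \<cdot> u = act c M \<cdot> i"
    using kernel_factor[OF k _ _ z] F(1-5) K(1-3) by auto
  then show "\<exists>u\<in>hom T (src T i) (src T i). i \<cdot> u = act c M \<cdot> i" by auto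
qed (rule that)

lemma cokernel_quotient_module:
  assumes f: "mhom M N f" and k: "is_cokernel T f p"
  obtains W where "mhom N W p"
proof (rule quotient_module[OF mhomD(2)[OF f] cokernel_epi[OF k]])
  note F = mhomD[OF f] and K = cokernelD[OF k]
  show "src T p = fst N" using K F by simp
  fix c
  have "(p \<cdot> act c N) \<cdot> f = (p \<cdot> f) \<cdot> act c M"
    using F K(1-3) by simp
  also have "\<dots> = zer T (src T f) (tgt T (p \<cdot> act c N))"
    unfolding K(4) using F K by simp
  finally have z: "p \<cdot> act c N \<cdot> f = zer T (src T f) (tgt T (p \<cdot> act c N))" .
  obtain u where "u \<in> arr T" "src T u = tgt T p" "tgt T u = tgt T p" "u \<cdot> p = p \<cdot> act c N"
    using cokernel_factor[OF k _ _ z] F(1-5) K(1-3) by auto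
  then show "\<exists>u\<in>hom T (tgt T p) (tgt T p). u \<cdot> p = p \<cdot> act c N" by auto
qed (rule that)

text \<open>The factorization exists in \<open>T\<close>, and it is linear because the linear
  monomorphism \<open>i\<close> can be cancelled. Thus kernels of modules are computed in
  \<open>T\<close>.\<close>

lemma kernel_Q:
  assumes f: "mhom M N f" and i: "mhom W M i" and k: "is_kernel T f i"
  shows "is_kernel Q (M, N, f) (W, M, i)"
  unfolding is_kernel_def
proof (intro conjI allI ballI impI)
  note F = mhomD[OF f] and I = mhomD[OF i] and K = kernelD[OF k]
  show "(M, N, f) \<in> arr Q" "(W, M, i) \<in> arr Q" "tgt Q (W, M, i) = src Q (M, N, f)"
    "(M, N, f) \<cdot>\<^bsub>Q\<^esub> (W, M, i) = zer Q (src Q (W, M, i)) (tgt Q (M, N, f))"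
    using f i K F I by simp_all
  fix V x assume x: "x \<in> hom Q V (src Q (M, N, f))" "(M, N, f) \<cdot>\<^bsub>Q\<^esub> x = zer Q V (tgt Q (M, N, f))"
  then obtain h where h: "x = (V, M, h)" "mhom V M h" by (auto elim: hom_QE simp del: in_hom)
  note H = mhomD[OF h(2)]
  obtain u where u: "u \<in> arr T" "src T u = fst V" "tgt T u = src T i" "i \<cdot> u = h"
    using kernel_factor[OF k, of h] x h F K H by auto
  have "u \<cdot> act c V = act c W \<cdot> u" for c
  proof (rule mono_cancel[OF kernel_mono[OF k]])
    have "i \<cdot> (act c W \<cdot> u) = act c M \<cdot> h"
      using reassoc[OF I(6)[of c], of u] I(1-5) u by simp
    then show "i \<cdot> (u \<cdot> act c V) = i \<cdot> (act c W \<cdot> u)"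
      using reassoc[OF u(4), of "act c V"] H I u(1-3) by simp
  qed (use u I H in simp_all)
  then have m: "mhom V W u" using u I H by (simp add: mhom_def)
  show "\<exists>!v. v \<in> hom Q V (src Q (W, M, i)) \<and> (W, M, i) \<cdot>\<^bsub>Q\<^esub> v = x"
  proof (rule ex1I[of _ "(V, W, u)"])
    show "(V, W, u) \<in> hom Q V (src Q (W, M, i)) \<and> (W, M, i) \<cdot>\<^bsub>Q\<^esub> (V, W, u) = x"
      using m u h by simp
    fix v assume "v \<in> hom Q V (src Q (W, M, i)) \<and> (W, M, i) \<cdot>\<^bsub>Q\<^esub> v = x"
    then obtain w where w: "v = (V, W, w)" "mhom V W w" "i \<cdot> w = h"
      using h by (auto elim!: hom_QE simp del: in_hom)
    have "w = u" by (rule mono_cancel[OF kernel_mono[OF k]]) (use w(3) mhomD[OF w(2)] u I in auto)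
    then show "v = (V, W, u)" using w by simp
  qed
qed

lemma cokernel_Q:
  assumes f: "mhom M N f" and p: "mhom N W p" and k: "is_cokernel T f p"
  shows "is_cokernel Q (M, N, f) (N, W, p)"
  unfolding is_cokernel_def
proof (intro conjI allI ballI impI)
  note F = mhomD[OF f] and P = mhomD[OF p] and K = cokernelD[OF k]
  show "(M, N, f) \<in> arr Q" "(N, W, p) \<in> arr Q" "src Q (N, W, p) = tgt Q (M, N, f)"
    "(N, W, p) \<cdot>\<^bsub>Q\<^esub> (M, N, f) = zer Q (src Q (M, N, f)) (tgt Q (N, W, p))"
    using f p K F P by simp_all
  fix V x assume x: "x \<in> hom Q (tgt Q (M, N, f)) V" "x \<cdot>\<^bsub>Q\<^esub> (M, N, f) = zer Q (src Q (M, N, f)) V"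
  then obtain h where h: "x = (N, V, h)" "mhom N V h" by (auto elim: hom_QE simp del: in_hom)
  note H = mhomD[OF h(2)]
  obtain u where u: "u \<in> arr T" "src T u = tgt T p" "tgt T u = fst V" "u \<cdot> p = h"
    using cokernel_factor[OF k, of h] x h F K H by auto
  have "u \<cdot> act c W = act c V \<cdot> u" for c
  proof (rule epi_cancel[OF cokernel_epi[OF k]])
    have "u \<cdot> act c W \<cdot> p = (u \<cdot> p) \<cdot> act c N"
      using P u(1-3) by simp
    then show "u \<cdot> act c W \<cdot> p = act c V \<cdot> u \<cdot> p"
      unfolding u(4) H(6) using u P H(1-5) by simp
  qed (use u P H in simp_all)
  then have m: "mhom W V u" using u P H by (simp add: mhom_def)
  show "\<exists>!v. v \<in> hom Q (tgt Q (N, W, p)) V \<and> v \<cdot>\<^bsub>Q\<^esub> (N, W, p) = x"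
  proof (rule ex1I[of _ "(W, V, u)"])
    show "(W, V, u) \<in> hom Q (tgt Q (N, W, p)) V \<and> (W, V, u) \<cdot>\<^bsub>Q\<^esub> (N, W, p) = x"
      using m u h by simp
    fix v assume "v \<in> hom Q (tgt Q (N, W, p)) V \<and> v \<cdot>\<^bsub>Q\<^esub> (N, W, p) = x"
    then obtain w where w: "v = (W, V, w)" "mhom W V w" "w \<cdot> p = h"
      using h by (auto elim!: hom_QE simp del: in_hom)
    have "w = u" by (rule epi_cancel[OF cokernel_epi[OF k]]) (use w(3) mhomD[OF w(2)] u P in auto)
    then show "v = (W, V, u)" using w by simp
  qed
qed

text \<open>The kernel in \<open>T\<close> of a linear arrow is a submodule, so it is visible to a
  monomorphism of \<open>Q\<close> and has to vanish. The other direction holds because the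
  underlying arrow determines the arrow of modules.\<close>

lemma mono_Q:
  assumes f: "mhom M N f"
  shows "is_mono Q (M, N, f) \<longleftrightarrow> is_mono T f"
proof
  note F = mhomD[OF f]
  assume m: "is_mono Q (M, N, f)"
  show "is_mono T f"
  proof (rule monoI[OF F(3)])
    fix g assume g: "g \<in> arr T" "tgt T g = src T f" "f \<cdot> g = zer T (src T g) (tgt T f)"
    obtain i where k: "is_kernel T f i" using kernels[OF F(3)] by blast
    note K = kernelD[OF k]
    obtain W where i: "mhom W M i" using kernel_submodule[OF f k] .
    note I = mhomD[OF i]
    have "(W, M, i) = zer Q W M"
      using Q.mono_zero[OF m, of "(W, M, i)"] i K(4) F I by simp
    then have "i = zer T (src T i) (src T f)" using I F by simp
    then show "g = zer T (src T g) (src T f)"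
      using kernel_factor[OF k g] by (metis F(3) K(2) g(1) src_in_obj zer_cmp)
  qed
next
  note F = mhomD[OF f]
  assume m: "is_mono T f"
  show "is_mono Q (M, N, f)"
    unfolding is_mono_def
  proof (intro conjI allI ballI impI)
    fix W x y assume "x \<in> hom Q W (src Q (M, N, f))" "y \<in> hom Q W (src Q (M, N, f))"
      "(M, N, f) \<cdot>\<^bsub>Q\<^esub> x = (M, N, f) \<cdot>\<^bsub>Q\<^esub> y"
    then obtain g h where g: "x = (W, M, g)" "mhom W M g" "y = (W, M, h)" "mhom W M h" "f \<cdot> g = f \<cdot> h"
      by (auto elim!: hom_QE simp del: in_hom)
    have "g = h" by (rule mono_cancel[OF m g(5)]) (use mhomD[OF g(2)] mhomD[OF g(4)] F in simp_all)
    then show "x = y" using g by simp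
  qed (use f in simp)
qed

lemma epi_Q:
  assumes f: "mhom M N f"
  shows "is_epi Q (M, N, f) \<longleftrightarrow> is_epi T f"
proof
  note F = mhomD[OF f]
  assume m: "is_epi Q (M, N, f)"
  show "is_epi T f"
  proof (rule epiI[OF F(3)])
    fix g assume g: "g \<in> arr T" "src T g = tgt T f" "g \<cdot> f = zer T (src T f) (tgt T g)"
    obtain i where k: "is_cokernel T f i" using cokernels[OF F(3)] by blast
    note K = cokernelD[OF k]
    obtain W where i: "mhom N W i" using cokernel_quotient_module[OF f k] .
    note I = mhomD[OF i]
    have "(N, W, i) = zer Q N W"
      using Q.epi_zero[OF m, of "(N, W, i)"] i K(4) F I by simp
    then have "i = zer T (tgt T f) (tgt T i)" using I F by simp
    then show "g = zer T (tgt T f) (tgt T g)"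
      using cokernel_factor[OF k g] by (metis F(3) K(2) g(1) tgt_in_obj cmp_zer)
  qed
next
  note F = mhomD[OF f]
  assume m: "is_epi T f"
  show "is_epi Q (M, N, f)"
    unfolding is_epi_def
  proof (intro conjI allI ballI impI)
    fix W x y assume "x \<in> hom Q (tgt Q (M, N, f)) W" "y \<in> hom Q (tgt Q (M, N, f)) W"
      "x \<cdot>\<^bsub>Q\<^esub> (M, N, f) = y \<cdot>\<^bsub>Q\<^esub> (M, N, f)"
    then obtain g h where g: "x = (N, W, g)" "mhom N W g" "y = (N, W, h)" "mhom N W h" "g \<cdot> f = h \<cdot> f"
      by (auto elim!: hom_QE simp del: in_hom)
    have "g = h" by (rule epi_cancel[OF m g(5)]) (use mhomD[OF g(2)] mhomD[OF g(4)] F in simp_all)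
    then show "x = y" using g by simp
  qed (use f in simp)
qed

lemma iso_mhom:
  assumes f: "mhom M N f" and i: "is_iso T f"
  shows "mhom N M (inv_arr T f)" "is_iso Q (M, N, f)"
proof -
  note F = mhomD[OF f]
  have "inv_arr T f \<cdot> act c N = act c M \<cdot> inv_arr T f" for c
  proof (rule iso_cancel_right[OF i])
    have "inv_arr T f \<cdot> act c N \<cdot> f = inv_arr T f \<cdot> (f \<cdot> act c M)" using F i by simp
    then show "inv_arr T f \<cdot> act c N \<cdot> f = act c M \<cdot> inv_arr T f \<cdot> f" using F(1-5) i by simp
  qed (use F i in simp_all)
  then show m: "mhom N M (inv_arr T f)" using F i by (simp add: mhom_def)
  show "is_iso Q (M, N, f)"
    by (rule Q.isoI[of _ "(N, M, inv_arr T f)"]) (use f m F i in simp_all)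
qed

lemma kernels_Q: "x \<in> arr Q \<Longrightarrow> \<exists>y. is_kernel Q x y"
  by (elim arr_QE) (metis kernel_Q kernel_submodule kernels mhomD(3))

lemma cokernels_Q: "x \<in> arr Q \<Longrightarrow> \<exists>y. is_cokernel Q x y"
  by (elim arr_QE) (metis cokernel_Q cokernel_quotient_module cokernels mhomD(3))

lemma mono_kernel_Q:
  assumes "is_mono Q x"
  shows "\<exists>y. is_kernel Q y x"
proof -
  have "x \<in> arr Q" using assms by (simp add: is_mono_def)
  then obtain M N f where x: "x = (M, N, f)" "mhom M N f" by (rule arr_QE)
  have m: "is_mono T f" using assms mono_Q[OF x(2)] x(1) by simp
  obtain p where p: "is_cokernel T f p" using cokernels[OF mhomD(3)[OF x(2)]] by blast
  obtain W where W: "mhom N W p" using cokernel_quotient_module[OF x(2) p] .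
  show ?thesis using kernel_Q[OF W x(2) mono_kernel_of_cokernel[OF m p]] x(1) by blast
qed

lemma epi_cokernel_Q:
  assumes "is_epi Q x"
  shows "\<exists>y. is_cokernel Q y x"
proof -
  have "x \<in> arr Q" using assms by (simp add: is_epi_def)
  then obtain M N f where x: "x = (M, N, f)" "mhom M N f" by (rule arr_QE)
  have m: "is_epi T f" using assms epi_Q[OF x(2)] x(1) by simp
  obtain i where i: "is_kernel T f i" using kernels[OF mhomD(3)[OF x(2)]] by blast
  obtain W where W: "mhom W M i" using kernel_submodule[OF x(2) i] .
  show ?thesis using cokernel_Q[OF W x(2) epi_cokernel_of_kernel[OF m i]] x(1) by blast
qed

lemma arr_sum_Q: "arr_sum Q M N (\<lambda>l. (M, N, f l)) n = (M, N, arr_sum T (fst M) (fst N) f n)"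
  by (induction n) simp_all

lemma direct_sum_Q:
  assumes S: "S \<in> mods" and d: "is_direct_sum T n (\<lambda>l. fst (F l)) (fst S) i p"
    and i: "\<And>l. l < n \<Longrightarrow> mhom (F l) S (i l)" and p: "\<And>l. l < n \<Longrightarrow> mhom S (F l) (p l)"
  shows "is_direct_sum Q n F S (\<lambda>l. (F l, S, i l)) (\<lambda>l. (S, F l, p l))"
  unfolding is_direct_sum_def
proof (intro conjI allI impI)
  note D = direct_sumD[OF d]
  show "S \<in> obj Q" using S by simp
  fix l assume l: "l < n"
  show "(F l, S, i l) \<in> hom Q (F l) S" "(S, F l, p l) \<in> hom Q S (F l)" using i[OF l] p[OF l] by simp_all
  fix l' assume l': "l' < n"
  show "(S, F l, p l) \<cdot>\<^bsub>Q\<^esub> (F l', S, i l') = (if l = l' then idm Q (F l) else zer Q (F l') (F l))"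
    using D(8)[OF l l'] by simp
next
  show "arr_sum Q S S (\<lambda>l. (F l, S, i l) \<cdot>\<^bsub>Q\<^esub> (S, F l, p l)) n = idm Q S"
    using direct_sumD(9)[OF d] arr_sum_Q[of S S "\<lambda>l. i l \<cdot> p l" n] by simp
qed

lemma direct_sums_Q:
  assumes F: "\<And>l. l < n \<Longrightarrow> F l \<in> obj Q"
  shows "\<exists>S i p. is_direct_sum Q n F S i p"
proof -
  have Fm [simp]: "l < n \<Longrightarrow> F l \<in> mods" for l using F by simp
  obtain S i p where d: "is_direct_sum T n (\<lambda>l. fst (F l)) S i p"
    using direct_sums[of n "\<lambda>l. fst (F l)"] by auto
  note D = direct_sumD[OF d]
  note [simp] = D(1-7,10)
  \<comment> \<open>The diagonal action: each summand is acted on separately.\<close>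
  define \<rho> where "\<rho> c = arr_sum T S S (\<lambda>l. i l \<cdot> (act c (F l) \<cdot> p l)) n" for c
  have [simp]: "\<rho> c \<in> arr T" "src T (\<rho> c) = S" "tgt T (\<rho> c) = S" for c
    unfolding \<rho>_def by simp_all
  have ri: "\<rho> c \<cdot> i l = i l \<cdot> act c (F l)" if l: "l < n" for c l
  proof -
    have "\<rho> c \<cdot> i l = arr_sum T (fst (F l)) S (\<lambda>r. (i r \<cdot> (act c (F r) \<cdot> p r)) \<cdot> i l) n"
      unfolding \<rho>_def using l arr_sum_cmp[of S "i l" S n "\<lambda>l. i l \<cdot> (act c (F l) \<cdot> p l)"] by simp
    also have "\<dots> = arr_sum T (fst (F l)) S (\<lambda>r. if r = l then i l \<cdot> act c (F l) else zer T (fst (F l)) S) n"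
      using l D(8) by (intro arr_sum_cong) auto
    finally show ?thesis using l by (simp add: arr_sum_delta)
  qed
  have pr: "p l \<cdot> \<rho> c = act c (F l) \<cdot> p l" if l: "l < n" for c l
  proof (rule direct_sum_eqI[OF d])
    fix r assume r: "r < n"
    show "p l \<cdot> \<rho> c \<cdot> i r = act c (F l) \<cdot> p l \<cdot> i r"
      using l r D(8)[OF l r] reassoc[OF D(8)[OF l r], of "act c (F r)"]
      by (cases "l = r") (simp_all add: ri)
  qed (use l in simp_all)
  have "field_action \<iota> T S \<rho>"
    unfolding field_action_def
  proof (intro conjI allI)
    fix c d a
    show "\<rho> (c + d) = \<rho> c \<oplus> \<rho> d"
      by (rule direct_sum_eqI[OF \<open>is_direct_sum T n (\<lambda>l. fst (F l)) S i p\<close>])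
        (simp_all add: ri act_add)
    show "\<rho> (c * d) = \<rho> c \<cdot> \<rho> d"
      by (rule direct_sum_eqI[OF \<open>is_direct_sum T n (\<lambda>l. fst (F l)) S i p\<close>])
        (simp_all add: ri reassoc[OF ri] act_mult)
    show "\<rho> 1 = idm T S"
      by (rule direct_sum_eqI[OF \<open>is_direct_sum T n (\<lambda>l. fst (F l)) S i p\<close>])
        (simp_all add: ri act_one)
    show "\<rho> (\<iota> a) = scl T a (idm T S)"
      by (rule direct_sum_eqI[OF \<open>is_direct_sum T n (\<lambda>l. fst (F l)) S i p\<close>])
        (simp_all add: ri act_emb)
  qed simp_all
  then obtain M where M: "M \<in> mods" "fst M = S" "\<And>c. act c M = \<rho> c"
    by (rule field_action_module) (rule that)
  have "mhom (F l) M (i l)" "mhom M (F l) (p l)" if "l < n" for l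
    using that M by (simp_all add: mhom_def ri pr)
  then have "is_direct_sum Q n F M (\<lambda>l. (F l, M, i l)) (\<lambda>l. (M, F l, p l))"
    using M(1) d by (intro direct_sum_Q) (simp_all add: M(2))
  then show ?thesis by blast
qed

lemma abelian_Q: "linear_abelian_category Q"
  by (intro linear_abelian_category.intro linear_category_Q linear_abelian_category_axioms.intro)
    (use direct_sums_Q kernels_Q cokernels_Q mono_kernel_Q epi_cokernel_Q in blast)+

sublocale Q: linear_abelian_category Q
  by (rule abelian_Q)

lemma zero_Q: "M \<in> mods \<Longrightarrow> is_zero_object Q M \<longleftrightarrow> is_zero_object T (fst M)"
  by (simp add: is_zero_object_def)

text \<open>Induction on the length of the underlying object. Series grow by a simple factor on top,
  so a simple quotient is needed: among nonzero quotient modules one with shortest underlying object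
  is simple, and the kernel of the projection to it is shorter than \<open>M\<close>.\<close>

lemma finite_length_Q: "M \<in> mods \<Longrightarrow> finite_length Q M"
proof (induction "obj_length T (fst M)" arbitrary: M rule: less_induct)
  case less
  note M [simp] = less.prems
  show ?case
  proof (cases "is_zero_object T (fst M)")
    case True
    then show ?thesis by (intro finite_length.zero) (simp add: zero_Q)
  next
    case False
    let ?P = "\<lambda>(N, p). mhom M N p \<and> is_epi T p \<and> \<not> is_zero_object T (fst N)"
    have "?P (M, idm T (fst M))" using False M by (simp add: iso_epi)
    then obtain z where z: "?P z" "\<And>y. ?P y \<Longrightarrow> obj_length T (fst (fst z)) \<le> obj_length T (fst (fst y))"
      using ex_has_least_nat[of ?P "(M, idm T (fst M))" "\<lambda>z. obj_length T (fst (fst z))"] by blast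
    obtain N p where Np: "mhom M N p" "is_epi T p" "\<not> is_zero_object T (fst N)" and zN: "z = (N, p)"
      using z(1) by (cases z) auto
    have min: "obj_length T (fst N) \<le> obj_length T (fst N')"
      if "mhom M N' p'" "is_epi T p'" "\<not> is_zero_object T (fst N')" for N' p'
      using z(2)[of "(N', p')"] that zN by simp
    note P = mhomD[OF Np(1)]
    have simple: "is_simple Q N"
      unfolding is_simple_def
    proof (intro conjI allI impI)
      show "N \<in> obj Q" "\<not> is_zero_object Q N" using P Np(3) zero_Q by simp_all
      fix x assume x: "is_mono Q x \<and> tgt Q x = N"
      then have "x \<in> arr Q" by (simp add: is_mono_def)
      then obtain W i where i: "x = (W, N, i)" "mhom W N i" using x by (auto elim: arr_QE)
      note I = mhomD[OF i(2)]
      have im: "is_mono T i" using x i(1) mono_Q[OF i(2)] by simp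
      obtain c where c: "is_cokernel T i c" using cokernels[OF I(3)] by blast
      note C = cokernelD[OF c]
      obtain V where V: "mhom N V c" using cokernel_quotient_module[OF i(2) c] .
      note V' = mhomD[OF V]
      have cp: "mhom M V (c \<cdot> p)" "is_epi T (c \<cdot> p)"
        using mhom_cmp[OF Np(1) V] epi_cmp[OF Np(2) cokernel_epi[OF c]] P V' by simp_all
      have fl: "finite_length T (src T c)" using all_finite_length[OF src_in_obj[OF C(2)]] .
      \<comment> \<open>The cokernel of a submodule of \<open>N\<close> is again a quotient of
        \<open>M\<close>. If it is nonzero, minimality forbids it to be shorter than
        \<open>N\<close>, so \<open>c\<close> is an isomorphism.\<close>
      have "is_zero_object T (fst V) \<or> is_iso T c"
        using min[OF cp] obj_length_epi[OF cokernel_epi[OF c] fl] V' by fastforce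
      then show "is_zero_object Q (src Q x) \<or> is_iso Q x"
      proof
        assume z: "is_zero_object T (fst V)"
        have "is_epi T i"
        proof (rule epiI[OF I(3)])
          fix h assume h: "h \<in> arr T" "src T h = tgt T i" "h \<cdot> i = zer T (src T i) (tgt T h)"
          obtain w where w: "w \<in> arr T" "src T w = tgt T c" "tgt T w = tgt T h" "w \<cdot> c = h"
            using cokernel_factor[OF c, of h] h by auto
          have wz: "w = zer T (tgt T c) (tgt T h)" using zero_objectD(1)[OF z w(1)] w V' by simp
          show "h = zer T (tgt T i) (tgt T h)" using w(4) h(1) C unfolding wz by simp
        qed
        then have "is_iso T i" using im mono_epi_iso by blast
        then show ?thesis using iso_mhom(2)[OF i(2)] i(1) by simp
      next
        assume s: "is_iso T c"
        have "i = zer T (src T i) (src T c)"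
          using mono_zero[OF iso_mono[OF s] I(3)] C by simp
        then have "i \<cdot> idm T (src T i) = zer T (src T i) (tgt T i)" using I V' by simp
        then have "idm T (src T i) = zer T (src T i) (src T i)"
          using mono_zero[OF im, of "idm T (src T i)"] I(3) by simp
        then have "is_zero_object T (fst W)" using I by (simp add: is_zero_object_def)
        then show ?thesis using i I zero_Q by simp
      qed
    qed
    obtain k where k: "is_kernel T p k" using kernels[OF P(3)] by blast
    note K = kernelD[OF k]
    obtain W where W: "mhom W M k" using kernel_submodule[OF Np(1) k] .
    note W' = mhomD[OF W]
    have "\<not> is_iso T k"
    proof
      assume s: "is_iso T k"
      have "p = zer T (tgt T k) (tgt T p)"
        using epi_zero[OF iso_epi[OF s] P(3)] K by simp
      then have "idm T (tgt T p) \<cdot> p = zer T (src T p) (tgt T p)" using P K by simp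
      then have "idm T (tgt T p) = zer T (tgt T p) (tgt T p)"
        using epi_zero[OF Np(2), of "idm T (tgt T p)"] P by simp
      then show False using Np(3) P by (simp add: is_zero_object_def)
    qed
    then have "obj_length T (fst W) < obj_length T (fst M)"
      using obj_length_mono(2)[OF kernel_mono[OF k]] all_finite_length[OF tgt_in_obj[OF K(2)]] W' by simp
    then have fW: "finite_length Q W" using less.hyps W'(1) by blast
    have e: "short_exact Q (W, M, k) (M, N, p)"
      unfolding short_exact_def
      using kernel_Q[OF Np(1) W k] cokernel_Q[OF W Np(1) epi_cokernel_of_kernel[OF Np(2) k]] by simp
    then have "finite_length Q (tgt Q (W, M, k))"
      using fW simple by (intro finite_length.extend[OF e]) simp_all
    then show ?thesis by simp
  qed
qed

end

section \<open>The tensor product of modules\<close>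

context base_extension
begin

lemma action_tar:
  assumes a: "field_action \<iota> T Z \<rho>" and W [simp]: "W \<in> obj T"
  shows "field_action \<iota> T (Z \<otimes> W) (\<lambda>c. \<rho> c \<odot> idm T W)" "field_action \<iota> T (W \<otimes> Z) (\<lambda>c. idm T W \<odot> \<rho> c)"
proof -
  note [simp] = actionD(1-4)[OF a]
  show "field_action \<iota> T (Z \<otimes> W) (\<lambda>c. \<rho> c \<odot> idm T W)" "field_action \<iota> T (W \<otimes> Z) (\<lambda>c. idm T W \<odot> \<rho> c)"
    by (simp_all add: field_action_def actionD(5-8)[OF a])
qed

text \<open>The expression of an operator through the two actions persists after tensoring with
  \<open>W\<close>; triple products need the separability idempotent on two of three
  factors.\<close>

lemma tensor_op_tar:
  assumes "tensor_op Z \<rho> \<sigma> a E" and a: "commuting_actions \<iota> T Z \<rho> \<sigma>" and W [simp]: "W \<in> obj T"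
  shows "tensor_op (Z \<otimes> W) (\<lambda>c. \<rho> c \<odot> idm T W) (\<lambda>c. \<sigma> c \<odot> idm T W) a (E \<odot> idm T W)"
    "tensor_op (W \<otimes> Z) (\<lambda>c. idm T W \<odot> \<rho> c) (\<lambda>c. idm T W \<odot> \<sigma> c) a (idm T W \<odot> E)"
proof -
  interpret commuting_actions \<iota> T Z \<rho> \<sigma> by (rule a)
  show "tensor_op (Z \<otimes> W) (\<lambda>c. \<rho> c \<odot> idm T W) (\<lambda>c. \<sigma> c \<odot> idm T W) a (E \<odot> idm T W)"
    using assms(1)
  proof induction
    case zero
    show ?case using tensor_op.zero[of "Z \<otimes> W" "\<lambda>c. \<rho> c \<odot> idm T W" "\<lambda>c. \<sigma> c \<odot> idm T W"] by simp
  next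
    case (gen u v)
    show ?case using tensor_op.gen[of "Z \<otimes> W" "\<lambda>c. \<rho> c \<odot> idm T W" "\<lambda>c. \<sigma> c \<odot> idm T W" u v] by simp
  next
    case (add b E c F)
    then show ?case using tensor_op.add[OF add.IH] by simp
  qed
  show "tensor_op (W \<otimes> Z) (\<lambda>c. idm T W \<odot> \<rho> c) (\<lambda>c. idm T W \<odot> \<sigma> c) a (idm T W \<odot> E)"
    using assms(1)
  proof induction
    case zero
    show ?case using tensor_op.zero[of "W \<otimes> Z" "\<lambda>c. idm T W \<odot> \<rho> c" "\<lambda>c. idm T W \<odot> \<sigma> c"] by simp
  next
    case (gen u v)
    show ?case using tensor_op.gen[of "W \<otimes> Z" "\<lambda>c. idm T W \<odot> \<rho> c" "\<lambda>c. idm T W \<odot> \<sigma> c" u v] by simp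
  next
    case (add b E c F)
    then show ?case using tensor_op.add[OF add.IH] by simp
  qed
qed

lemma commuting_tar:
  assumes a: "commuting_actions \<iota> T Z \<rho> \<sigma>" and W [simp]: "W \<in> obj T"
  shows "commuting_actions \<iota> T (Z \<otimes> W) (\<lambda>c. \<rho> c \<odot> idm T W) (\<lambda>c. \<sigma> c \<odot> idm T W)"
    "commuting_actions \<iota> T (W \<otimes> Z) (\<lambda>c. idm T W \<odot> \<rho> c) (\<lambda>c. idm T W \<odot> \<sigma> c)"
proof -
  interpret c: commuting_actions \<iota> T Z \<rho> \<sigma> by (rule a)
  show "commuting_actions \<iota> T (Z \<otimes> W) (\<lambda>c. \<rho> c \<odot> idm T W) (\<lambda>c. \<sigma> c \<odot> idm T W)"
    "commuting_actions \<iota> T (W \<otimes> Z) (\<lambda>c. idm T W \<odot> \<rho> c) (\<lambda>c. idm T W \<odot> \<sigma> c)"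
    by (unfold_locales; (intro action_tar c.r c.s W)?; simp add: c.commute)+
qed

lemma commuting_modules:
  assumes "M \<in> mods" "N \<in> mods"
  shows "commuting_actions \<iota> T (fst M \<otimes> fst N)
    (\<lambda>c. act c M \<odot> idm T (fst N)) (\<lambda>c. idm T (fst M) \<odot> act c N)"
  by (unfold_locales; (intro action_tar act_field_action)?; simp add: assms)

lemma direct_sum_tar:
  assumes d: "is_direct_sum T n F S i p" and Y [simp]: "Y \<in> obj T"
  shows "is_direct_sum T n (\<lambda>l. F l \<otimes> Y) (S \<otimes> Y) (\<lambda>l. i l \<odot> idm T Y) (\<lambda>l. p l \<odot> idm T Y)"
proof -
  note D = direct_sumD[OF d]
  note [simp] = D(1-7,10)
  have "arr_sum T (S \<otimes> Y) (S \<otimes> Y) (\<lambda>l. (i l \<odot> idm T Y) \<cdot> (p l \<odot> idm T Y)) n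
      = arr_sum T (S \<otimes> Y) (S \<otimes> Y) (\<lambda>l. (i l \<cdot> p l) \<odot> idm T Y) n"
    by (intro arr_sum_cong) simp
  also have "\<dots> = arr_sum T S S (\<lambda>l. i l \<cdot> p l) n \<odot> idm T Y"
    using arr_sum_tar[of S S n "\<lambda>l. i l \<cdot> p l" "idm T Y"] by simp
  also have "\<dots> = idm T (S \<otimes> Y)" unfolding D(9) by simp
  finally show ?thesis using D(8) by (simp add: is_direct_sum_def)
qed

lemma ins_tensor_ext:
  assumes f: "f \<in> arr T" "src T f = (X \<otimes> A) \<otimes> Y" "g \<in> arr T" "src T g = (X \<otimes> A) \<otimes> Y" "tgt T f = tgt T g"
    and X: "X \<in> obj T" and Y: "Y \<in> obj T"
    and e: "\<And>c. f \<cdot> (ins X c \<odot> idm T Y) = g \<cdot> (ins X c \<odot> idm T Y)"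
  shows "f = g"
proof -
  obtain n b co where bas: "basis n b co" using basis_exists by blast
  obtain p where d: "is_direct_sum T n (\<lambda>_. X) (X \<otimes> A) (\<lambda>l. ins X (b l)) p"
    by (rule tensor_A_direct_sum[OF bas X]) (rule that)
  show ?thesis by (rule direct_sum_eqI[OF direct_sum_tar[OF d Y] f e])
qed

text \<open>The coequalizer condition for \<open>M \<otimes>\<^sub>K N\<close>, tested on the
  elements of the middle factor \<open>A\<close>; \<open>balanced_iff\<close> gives the
  equivalence.\<close>

definition balanced :: "('o, 'm) md \<Rightarrow> ('o, 'm) md \<Rightarrow> 'm \<Rightarrow> bool" where
  "balanced M N h \<longleftrightarrow> h \<in> arr T \<and> src T h = fst M \<otimes> fst N \<and>
     (\<forall>c. h \<cdot> (act c M \<odot> idm T (fst N)) = h \<cdot> (idm T (fst M) \<odot> act c N))"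

text \<open>Inserting \<open>c\<close> into the middle factor turns the second arrow of the
  coequalizer pair into the action of \<open>c\<close> on \<open>N\<close>; the triangle axiom
  removes the unit left over between the factors.\<close>

lemma middle_ins:
  assumes [simp]: "X \<in> obj T" and N [simp]: "N \<in> mods"
  shows "(idm T X \<odot> (snd N \<cdot> bra T A (fst N))) \<cdot> (asc T X A (fst N) \<cdot> (ins X c \<odot> idm T (fst N)))
    = idm T X \<odot> act c N"
proof -
  let ?Y = "fst N" and ?I = "unt T"
  have n: "asc T X A ?Y \<cdot> ((idm T X \<odot> j c) \<odot> idm T ?Y) = (idm T X \<odot> (j c \<odot> idm T ?Y)) \<cdot> asc T X ?I ?Y"
    using asc_nat[of "idm T X" "j c" "idm T ?Y"] by simp
  have b: "(snd N \<cdot> bra T A ?Y) \<cdot> (j c \<odot> idm T ?Y) = act c N \<cdot> lun T ?Y"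
    by (simp add: bra_j act_module)
  have "(idm T X \<odot> (snd N \<cdot> bra T A ?Y)) \<cdot> (asc T X A ?Y \<cdot> (ins X c \<odot> idm T ?Y))
      = (idm T X \<odot> (snd N \<cdot> bra T A ?Y)) \<cdot>
      ((asc T X A ?Y \<cdot> ((idm T X \<odot> j c) \<odot> idm T ?Y)) \<cdot> (inv_arr T (run T X) \<odot> idm T ?Y))"
    by (simp add: ins_def)
  also have "\<dots> = (idm T X \<odot> ((snd N \<cdot> bra T A ?Y) \<cdot> (j c \<odot> idm T ?Y))) \<cdot>
      (asc T X ?I ?Y \<cdot> (inv_arr T (run T X) \<odot> idm T ?Y))"
    unfolding n by simp
  also have "\<dots> = (idm T X \<odot> act c N) \<cdot> (((idm T X \<odot> lun T ?Y) \<cdot> asc T X ?I ?Y)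
      \<cdot> (inv_arr T (run T X) \<odot> idm T ?Y))"
    unfolding b by simp
  also have "\<dots> = idm T X \<odot> act c N"
    unfolding triangle[OF assms(1) module_simps(1)[OF N]] by simp
  finally show ?thesis .
qed

lemma balanced_iff:
  assumes M [simp]: "M \<in> mods" and N [simp]: "N \<in> mods"
    and h [simp]: "h \<in> arr T" "src T h = fst M \<otimes> fst N"
  shows "h \<cdot> (snd M \<odot> idm T (fst N)) =
      h \<cdot> ((idm T (fst M) \<odot> (snd N \<cdot> bra T A (fst N))) \<cdot> asc T (fst M) A (fst N)) \<longleftrightarrow> balanced M N h"
    (is "?L = ?R \<longleftrightarrow> _")
proof -
  let ?X = "fst M" and ?Y = "fst N"
  have l: "?L \<cdot> (ins ?X c \<odot> idm T ?Y) = h \<cdot> (act c M \<odot> idm T ?Y)" for c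
    by (simp add: act_module)
  have r: "?R \<cdot> (ins ?X c \<odot> idm T ?Y) = h \<cdot> (idm T ?X \<odot> act c N)" for c
    by (simp add: middle_ins)
  show ?thesis
  proof
    assume e: "?L = ?R"
    show "balanced M N h"
      unfolding balanced_def l[symmetric] r[symmetric] e by simp
  next
    assume b: "balanced M N h"
    show "?L = ?R"
    proof (rule ins_tensor_ext[of _ ?X ?Y])
      show "?L \<cdot> (ins ?X c \<odot> idm T ?Y) = ?R \<cdot> (ins ?X c \<odot> idm T ?Y)" for c
        unfolding l r using b by (simp add: balanced_def)
    qed simp_all
  qed
qed

abbreviation tp where "tp \<equiv> ten_proj \<iota> T"
abbreviation tm where "tm \<equiv> ten_module \<iota> T"

lemma fst_tm [simp]: "fst (tm M N) = tgt T (tp M N)"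
  by (simp add: ten_module_def ten_carrier_def)

text \<open>Separability makes the coequalizer defining \<open>M \<otimes>\<^sub>K N\<close> split, hence preserved by tensoring
  with any object.\<close>

lemma ten_proj_split:
  assumes M [simp]: "M \<in> mods" and N [simp]: "N \<in> mods"
  shows "balanced M N (tp M N)"
    "\<exists>s. s \<in> hom T (tgt T (tp M N)) (fst M \<otimes> fst N) \<and> tp M N \<cdot> s = idm T (tgt T (tp M N)) \<and>
      tensor_op (fst M \<otimes> fst N) (\<lambda>c. act c M \<odot> idm T (fst N)) (\<lambda>c. idm T (fst M) \<odot> act c N) 1 (s \<cdot> tp M N)"
proof -
  let ?X = "fst M" and ?Y = "fst N"
  let ?f = "snd M \<odot> idm T ?Y"
  let ?g = "(idm T ?X \<odot> (snd N \<cdot> bra T A ?Y)) \<cdot> asc T ?X A ?Y"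
  interpret c: commuting_actions \<iota> T "?X \<otimes> ?Y" "\<lambda>c. act c M \<odot> idm T ?Y" "\<lambda>c. idm T ?X \<odot> act c N"
    by (rule commuting_modules[OF M N])
  obtain E where E: "c.top 1 E" and Ee: "\<And>c. (act c M \<odot> idm T ?Y) \<cdot> E = (idm T ?X \<odot> act c N) \<cdot> E"
    by (rule c.separability_idempotent[OF separable]) (rule that)
  note [simp] = c.top_hom[OF E]
  \<comment> \<open>The operator \<open>E\<close> lies over \<open>1\<close> in \<open>K\<close>, so
    balanced arrows absorb it.\<close>
  have hE: "h \<cdot> E = h" if h: "balanced M N h" for h
  proof -
    have "h \<cdot> E = h \<cdot> (idm T ?X \<odot> act 1 N)"
      using h by (intro c.top_balanced[OF E]) (simp_all add: balanced_def)
    then show ?thesis using h by (simp add: act_one balanced_def)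
  qed
  have bE: "balanced M N E"
    unfolding balanced_def c.top_\<rho>[OF E, symmetric] c.top_\<sigma>[OF E, symmetric] Ee by simp
  \<comment> \<open>Idempotence is the absorption property applied to \<open>E\<close> itself, which
    is balanced because it equalizes the two actions and commutes with both.\<close>
  have "E \<cdot> E = E" by (rule hE[OF bE])
  then obtain s p where sp: "s \<in> arr T" "p \<in> arr T" "tgt T s = ?X \<otimes> ?Y" "src T p = ?X \<otimes> ?Y"
    "tgt T p = src T s" "s \<cdot> p = E" "p \<cdot> s = idm T (src T s)"
    using idempotent_split[of E "?X \<otimes> ?Y"] by auto
  note [simp] = sp(1-5)
  have pE: "p = p \<cdot> E" using reassoc[OF sp(7), of p] by (simp flip: sp(6))
  have bp: "balanced M N p"
    unfolding balanced_def
  proof (intro conjI allI)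
    fix c
    have "p \<cdot> (act c M \<odot> idm T ?Y) = (p \<cdot> E) \<cdot> (act c M \<odot> idm T ?Y)" using pE by simp
    also have "\<dots> = p \<cdot> (E \<cdot> (act c M \<odot> idm T ?Y))" by simp
    also have "\<dots> = p \<cdot> (E \<cdot> (idm T ?X \<odot> act c N))" using bE by (simp add: balanced_def)
    also have "\<dots> = (p \<cdot> E) \<cdot> (idm T ?X \<odot> act c N)" by simp
    also have "\<dots> = p \<cdot> (idm T ?X \<odot> act c N)" using pE by simp
    finally show "p \<cdot> (act c M \<odot> idm T ?Y) = p \<cdot> (idm T ?X \<odot> act c N)" .
  qed simp_all
  have "is_coequalizer T ?f ?g p"
    unfolding is_coequalizer_def
  proof (intro conjI allI ballI impI)
    show "p \<cdot> ?f = p \<cdot> ?g" using balanced_iff[of M N p] bp by simp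
    fix W h assume h: "h \<in> hom T (tgt T ?f) W" "h \<cdot> ?f = h \<cdot> ?g"
    then have "balanced M N h" using balanced_iff[of M N h] by simp
    then have hE: "h \<cdot> E = h" by (rule hE)
    show "\<exists>!u. u \<in> hom T (tgt T p) W \<and> u \<cdot> p = h"
    \<comment> \<open>A balanced \<open>h\<close> absorbs \<open>E = s \<cdot> p\<close>, so it
      factors through \<open>p\<close> by way of the section \<open>s\<close>.\<close>
    proof (rule ex1I[of _ "h \<cdot> s"])
      show "h \<cdot> s \<in> hom T (tgt T p) W \<and> h \<cdot> s \<cdot> p = h" using h(1) sp(6) hE by simp
      fix u assume u: "u \<in> hom T (tgt T p) W \<and> u \<cdot> p = h"
      then have "h \<cdot> s = u \<cdot> (p \<cdot> s)" by auto
      then show "u = h \<cdot> s" using u sp(7) by simp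
    qed
  qed simp_all
  then have co: "is_coequalizer T ?f ?g (tp M N)"
    unfolding ten_proj_def by (rule someI)
  then have t [simp]: "tp M N \<in> arr T" "src T (tp M N) = ?X \<otimes> ?Y" and te: "tp M N \<cdot> ?f = tp M N \<cdot> ?g"
    and tu: "\<And>W h. h \<in> hom T (?X \<otimes> ?Y) W \<Longrightarrow> h \<cdot> ?f = h \<cdot> ?g \<Longrightarrow> \<exists>!u. u \<in> hom T (tgt T (tp M N)) W \<and> u \<cdot> tp M N = h"
    unfolding is_coequalizer_def by simp_all
  show b: "balanced M N (tp M N)" using balanced_iff[of M N "tp M N"] te by simp
  \<comment> \<open>The coequalizer selected by \<open>ten_proj\<close> may differ from
    \<open>p\<close>. Since \<open>E\<close> is balanced, it factors through the selected one, and
    the factor is a section of it.\<close>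
  have "\<exists>!u. u \<in> hom T (tgt T (tp M N)) (?X \<otimes> ?Y) \<and> u \<cdot> tp M N = E"
    using tu[of E "?X \<otimes> ?Y"] balanced_iff[of M N E] bE by simp
  then obtain u where u: "u \<in> hom T (tgt T (tp M N)) (?X \<otimes> ?Y)" "u \<cdot> tp M N = E" by blast
  have *: "\<exists>!v. v \<in> hom T (tgt T (tp M N)) (tgt T (tp M N)) \<and> v \<cdot> tp M N = tp M N"
    using tu[of "tp M N" "tgt T (tp M N)"] te by simp
  have "tp M N \<cdot> u = idm T (tgt T (tp M N))"
    by (rule ex1_eq[OF *]) (use u hE[OF b] in simp_all)
  then show "\<exists>s. s \<in> hom T (tgt T (tp M N)) (fst M \<otimes> fst N) \<and> tp M N \<cdot> s = idm T (tgt T (tp M N)) \<and>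
      tensor_op (fst M \<otimes> fst N) (\<lambda>c. act c M \<odot> idm T (fst N)) (\<lambda>c. idm T (fst M) \<odot> act c N) 1 (s \<cdot> tp M N)"
    using u E by auto
qed

text \<open>A section of \<open>tp M N\<close> that remembers the separability idempotent: the
  \<open>tensor_op\<close> clause lets balanced arrows absorb \<open>sec M N \<cdot> tp M N\<close>,
  also after tensoring with another object.\<close>

definition sec :: "('o, 'm) md \<Rightarrow> ('o, 'm) md \<Rightarrow> 'm" where
  "sec M N = (SOME s. s \<in> hom T (tgt T (tp M N)) (fst M \<otimes> fst N) \<and> tp M N \<cdot> s = idm T (tgt T (tp M N)) \<and>
      tensor_op (fst M \<otimes> fst N) (\<lambda>c. act c M \<odot> idm T (fst N)) (\<lambda>c. idm T (fst M) \<odot> act c N) 1 (s \<cdot> tp M N))"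

lemma tp_simps [simp]:
  assumes M: "M \<in> mods" and N: "N \<in> mods"
  shows "tp M N \<in> arr T" "src T (tp M N) = fst M \<otimes> fst N"
  using ten_proj_split(1)[OF assms] by (simp_all add: balanced_def)

lemma tp_balanced:
  assumes M: "M \<in> mods" and N: "N \<in> mods"
  shows "tp M N \<cdot> (act c M \<odot> idm T (fst N)) = tp M N \<cdot> (idm T (fst M) \<odot> act c N)"
  using ten_proj_split(1)[OF assms] by (simp add: balanced_def)

lemma sec_simps [simp]:
  assumes M: "M \<in> mods" and N: "N \<in> mods"
  shows "sec M N \<in> arr T" "src T (sec M N) = tgt T (tp M N)" "tgt T (sec M N) = fst M \<otimes> fst N"
    "tp M N \<cdot> sec M N = idm T (tgt T (tp M N))"
    and sec_tensor_op: "tensor_op (fst M \<otimes> fst N) (\<lambda>c. act c M \<odot> idm T (fst N))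
      (\<lambda>c. idm T (fst M) \<odot> act c N) 1 (sec M N \<cdot> tp M N)"
  using someI_ex[OF ten_proj_split(2)[OF assms], folded sec_def] by simp_all

lemma tp_epi: "M \<in> mods \<Longrightarrow> N \<in> mods \<Longrightarrow> is_epi T (tp M N)"
  by (rule split_epi[of _ "sec M N"]) simp_all

text \<open>A section tensored with an identity is again a section, so the projections stay epic
  under tensoring.\<close>

lemma tp_tar_epi:
  assumes [simp]: "M \<in> mods" "N \<in> mods" "Z \<in> obj T"
  shows "is_epi T (tp M N \<odot> idm T Z)" "is_epi T (idm T Z \<odot> tp M N)"
  by (rule split_epi[of _ "sec M N \<odot> idm T Z"], simp_all)
    (rule split_epi[of _ "idm T Z \<odot> sec M N"], simp_all)

lemma balanced_sec:
  assumes M [simp]: "M \<in> mods" and N [simp]: "N \<in> mods" and h: "balanced M N h"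
  shows "h \<cdot> (sec M N \<cdot> tp M N) = h"
proof -
  interpret c: commuting_actions \<iota> T "fst M \<otimes> fst N" "\<lambda>c. act c M \<odot> idm T (fst N)" "\<lambda>c. idm T (fst M) \<odot> act c N"
    by (rule commuting_modules[OF M N])
  have "h \<cdot> (sec M N \<cdot> tp M N) = h \<cdot> (idm T (fst M) \<odot> act 1 N)"
    using h by (intro c.top_balanced[OF sec_tensor_op[OF M N]]) (simp_all add: balanced_def)
  then show ?thesis using h by (simp add: act_one balanced_def)
qed

lemma balanced_sec_right:
  assumes M [simp]: "M \<in> mods" and N [simp]: "N \<in> mods" and Z [simp]: "Z \<in> obj T"
    and h [simp]: "h \<in> arr T" "src T h = (fst M \<otimes> fst N) \<otimes> Z"
    and b: "\<And>c. h \<cdot> ((act c M \<odot> idm T (fst N)) \<odot> idm T Z) = h \<cdot> ((idm T (fst M) \<odot> act c N) \<odot> idm T Z)"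
  shows "h \<cdot> ((sec M N \<cdot> tp M N) \<odot> idm T Z) = h"
proof -
  note ca = commuting_modules[OF M N]
  interpret c: commuting_actions \<iota> T "(fst M \<otimes> fst N) \<otimes> Z" "\<lambda>c. (act c M \<odot> idm T (fst N)) \<odot> idm T Z"
    "\<lambda>c. (idm T (fst M) \<odot> act c N) \<odot> idm T Z"
    by (rule commuting_tar(1)[OF ca Z])
  have "h \<cdot> ((sec M N \<cdot> tp M N) \<odot> idm T Z) = h \<cdot> ((idm T (fst M) \<odot> act 1 N) \<odot> idm T Z)"
    by (rule c.top_balanced[OF tensor_op_tar(1)[OF sec_tensor_op[OF M N] ca Z] h b])
  then show ?thesis by (simp add: act_one)
qed

lemma balanced_sec_left:
  assumes M [simp]: "M \<in> mods" and N [simp]: "N \<in> mods" and Z [simp]: "Z \<in> obj T"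
    and h [simp]: "h \<in> arr T" "src T h = Z \<otimes> (fst M \<otimes> fst N)"
    and b: "\<And>c. h \<cdot> (idm T Z \<odot> (act c M \<odot> idm T (fst N))) = h \<cdot> (idm T Z \<odot> (idm T (fst M) \<odot> act c N))"
  shows "h \<cdot> (idm T Z \<odot> (sec M N \<cdot> tp M N)) = h"
proof -
  note ca = commuting_modules[OF M N]
  interpret c: commuting_actions \<iota> T "Z \<otimes> (fst M \<otimes> fst N)" "\<lambda>c. idm T Z \<odot> (act c M \<odot> idm T (fst N))"
    "\<lambda>c. idm T Z \<odot> (idm T (fst M) \<odot> act c N)"
    by (rule commuting_tar(2)[OF ca Z])
  have "h \<cdot> (idm T Z \<odot> (sec M N \<cdot> tp M N)) = h \<cdot> (idm T Z \<odot> (idm T (fst M) \<odot> act 1 N))"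
    by (rule c.top_balanced[OF tensor_op_tar(2)[OF sec_tensor_op[OF M N] ca Z] h b])
  then show ?thesis by (simp add: act_one)
qed

lemma factor_through_eq:
  assumes "is_epi T p" "u \<in> arr T" "src T u = tgt T p" "u \<cdot> p = h"
  shows "factor_through T p h = u"
proof -
  have [simp]: "p \<in> arr T" using assms(1) by (simp add: is_epi_def)
  have t: "tgt T h = tgt T u" using assms by auto
  show ?thesis
    unfolding factor_through_def
  proof (rule the_equality)
    show "u \<in> hom T (tgt T p) (tgt T h) \<and> u \<cdot> p = h" using assms t by simp
    fix v assume v: "v \<in> hom T (tgt T p) (tgt T h) \<and> v \<cdot> p = h"
    have "v \<cdot> p = u \<cdot> p" using v assms(4) by simp
    then show "v = u" by (rule epi_cancel[OF assms(1)]) (use v t assms(2,3) in simp_all)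
  qed
qed

text \<open>The action on the second factor commutes with the idempotent and therefore descends to
  its image; the axioms of an action follow by cancelling the epimorphism
  \<open>tp M N\<close>.\<close>

lemma tm_module:
  assumes M [simp]: "M \<in> mods" and N [simp]: "N \<in> mods"
  shows "tm M N \<in> mods" "act c (tm M N) \<cdot> tp M N = tp M N \<cdot> (idm T (fst M) \<odot> act c N)"
proof -
  let ?X = "fst M" and ?Y = "fst N" and ?t = "tp M N" and ?P = "tgt T (tp M N)"
  let ?E = "sec M N \<cdot> ?t"
  have P [simp]: "?P \<in> obj T" using tgt_in_obj[of ?t] by simp
  interpret c: commuting_actions \<iota> T "?X \<otimes> ?Y" "\<lambda>c. act c M \<odot> idm T ?Y" "\<lambda>c. idm T ?X \<odot> act c N"
    by (rule commuting_modules[OF M N])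
  have Ec: "(idm T ?X \<odot> act c N) \<cdot> ?E = ?E \<cdot> (idm T ?X \<odot> act c N)" for c
    by (rule c.top_\<sigma>[OF sec_tensor_op[OF M N]])
  let ?h = "(?t \<cdot> (idm T ?X \<odot> snd N)) \<cdot> asc T ?X ?Y A"
  \<comment> \<open>The explicit value of \<open>factor_through\<close>: precomposition with the
    tensored section.\<close>
  let ?r = "?h \<cdot> (sec M N \<odot> idm T A)"
  have hi: "?h \<cdot> ins (?X \<otimes> ?Y) c = ?t \<cdot> (idm T ?X \<odot> act c N)" for c
    by (simp add: asc_ins act_module)
  have rt: "?r \<cdot> (?t \<odot> idm T A) = ?h"
  proof (rule ins_ext[of _ "?X \<otimes> ?Y"])
    fix c
    have "?r \<cdot> (?t \<odot> idm T A) \<cdot> ins (?X \<otimes> ?Y) c = ?h \<cdot> ((?E \<odot> idm T A) \<cdot> ins (?X \<otimes> ?Y) c)"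
      by simp
    also have "(?E \<odot> idm T A) \<cdot> ins (?X \<otimes> ?Y) c = ins (?X \<otimes> ?Y) c \<cdot> ?E"
      using ins_nat[of ?E c] by simp
    also have "?h \<cdot> (ins (?X \<otimes> ?Y) c \<cdot> ?E) = (?h \<cdot> ins (?X \<otimes> ?Y) c) \<cdot> ?E" by simp
    also have "\<dots> = ?t \<cdot> ((idm T ?X \<odot> act c N) \<cdot> ?E)" unfolding hi by simp
    also have "\<dots> = (?t \<cdot> ?E) \<cdot> (idm T ?X \<odot> act c N)" unfolding Ec by simp
    also have "\<dots> = ?h \<cdot> ins (?X \<otimes> ?Y) c" unfolding hi using reassoc[OF sec_simps(4)[OF M N], of ?t] by simp
    finally show "?r \<cdot> (?t \<odot> idm T A) \<cdot> ins (?X \<otimes> ?Y) c = ?h \<cdot> ins (?X \<otimes> ?Y) c" .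
  qed simp_all
  have tm: "tm M N = (?P, ?r)"
    unfolding ten_module_def ten_carrier_def
    using factor_through_eq[OF tp_tar_epi(1)[OF M N A_obj], of ?r ?h] rt by simp
  have a: "?r \<cdot> ins ?P c \<cdot> ?t = ?t \<cdot> (idm T ?X \<odot> act c N)" for c
  proof -
    have "?r \<cdot> ins ?P c \<cdot> ?t = (?r \<cdot> (?t \<odot> idm T A)) \<cdot> ins (?X \<otimes> ?Y) c"
      using ins_nat[of ?t c, symmetric] by simp
    then show ?thesis unfolding rt hi .
  qed
  define w where "w c = ?r \<cdot> ins ?P c" for c
  have w [simp]: "w c \<in> arr T" "src T (w c) = ?P" "tgt T (w c) = ?P" for c by (simp_all add: w_def)
  have wt: "w c \<cdot> ?t = ?t \<cdot> (idm T ?X \<odot> act c N)" for c unfolding w_def by (rule a)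
  have "w c \<cdot> w d = w (c * d)" for c d
    by (rule epi_cancel[OF tp_epi[OF M N]]) (simp_all add: wt reassoc[OF wt] act_mult)
  moreover have "w 1 = idm T ?P"
    by (rule epi_cancel[OF tp_epi[OF M N]]) (simp_all add: wt act_one)
  moreover have "?r \<in> hom T (?P \<otimes> A) ?P" by simp
  ultimately show m: "tm M N \<in> mods"
    unfolding tm modules_iff w_def[symmetric] by simp
  have "act c (tm M N) = ?r \<cdot> ins ?P c" unfolding tm by (rule act_eq) simp_all
  then show "act c (tm M N) \<cdot> tp M N = tp M N \<cdot> (idm T (fst M) \<odot> act c N)"
    using a by simp
qed

lemma tm_in_mods [simp]: "M \<in> mods \<Longrightarrow> N \<in> mods \<Longrightarrow> tm M N \<in> mods"
  by (rule tm_module)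

lemma act_tm: "M \<in> mods \<Longrightarrow> N \<in> mods \<Longrightarrow> act c (tm M N) \<cdot> tp M N = tp M N \<cdot> (act c M \<odot> idm T (fst N))"
  by (simp add: tm_module(2) tp_balanced)

definition bilin :: "('o, 'm) md \<Rightarrow> ('o, 'm) md \<Rightarrow> ('o, 'm) md \<Rightarrow> 'm \<Rightarrow> bool" where
  "bilin M N P h \<longleftrightarrow> M \<in> mods \<and> N \<in> mods \<and> P \<in> mods \<and> h \<in> hom T (fst M \<otimes> fst N) (fst P) \<and>
    (\<forall>c. h \<cdot> (act c M \<odot> idm T (fst N)) = act c P \<cdot> h) \<and> (\<forall>c. h \<cdot> (idm T (fst M) \<odot> act c N) = act c P \<cdot> h)"

abbreviation fac :: "('o, 'm) md \<Rightarrow> ('o, 'm) md \<Rightarrow> 'm \<Rightarrow> 'm" where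
  "fac M N h \<equiv> factor_through T (tp M N) h"

text \<open>With the section at hand the factorization is \<open>h \<cdot> sec M N\<close>. It is
  linear because this may be checked after \<open>tp M N\<close>.\<close>

lemma fac_props:
  assumes h: "bilin M N P h"
  shows "mhom (tm M N) P (fac M N h)" "fac M N h \<cdot> tp M N = h"
proof -
  have MNP [simp]: "M \<in> mods" "N \<in> mods" "P \<in> mods" "h \<in> arr T" "src T h = fst M \<otimes> fst N" "tgt T h = fst P"
    and l: "\<And>c. h \<cdot> (act c M \<odot> idm T (fst N)) = act c P \<cdot> h"
    and r: "\<And>c. h \<cdot> (idm T (fst M) \<odot> act c N) = act c P \<cdot> h"
    using h by (auto simp: bilin_def)
  let ?u = "h \<cdot> sec M N"
  have b: "balanced M N h" by (simp add: balanced_def l r)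
  have ut: "?u \<cdot> tp M N = h" using balanced_sec[OF MNP(1,2) b] by simp
  have f: "fac M N h = ?u" by (rule factor_through_eq[OF tp_epi _ _ ut]) simp_all
  show "fac M N h \<cdot> tp M N = h" unfolding f by (rule ut)
  have "?u \<cdot> act c (tm M N) = act c P \<cdot> ?u" for c
  proof (rule epi_cancel[OF tp_epi[OF MNP(1,2)]])
    have "?u \<cdot> act c (tm M N) \<cdot> tp M N = (?u \<cdot> tp M N) \<cdot> (idm T (fst M) \<odot> act c N)"
      using tm_module(2)[OF MNP(1,2), of c] by simp
    also have "\<dots> = act c P \<cdot> (?u \<cdot> tp M N)" unfolding ut by (rule r)
    finally show "?u \<cdot> act c (tm M N) \<cdot> tp M N = act c P \<cdot> ?u \<cdot> tp M N" by simp
  qed simp_all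
  then show "mhom (tm M N) P (fac M N h)" unfolding f by (simp add: mhom_def)
qed

lemma mhom_tm_eqI:
  assumes "mhom (tm M N) P u" "mhom (tm M N) P v" "M \<in> mods" "N \<in> mods" "u \<cdot> tp M N = v \<cdot> tp M N"
  shows "u = v"
  using mhomD[OF assms(1)] mhomD[OF assms(2)] assms(3-5)
  by (intro epi_cancel[OF tp_epi[of M N], of u v]) simp_all

lemma bilin_tp: "M \<in> mods \<Longrightarrow> N \<in> mods \<Longrightarrow> bilin M N (tm M N) (tp M N)"
  by (simp add: bilin_def tm_module(2) tp_balanced)

lemma bilin_tar:
  assumes f: "mhom M M' f" and g: "mhom N N' g" and h: "bilin M' N' P h"
  shows "bilin M N P (h \<cdot> (f \<odot> g))"
proof -
  note [simp] = mhomD(1-5)[OF f] mhomD(1-5)[OF g]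
  have [simp]: "P \<in> mods" "h \<in> arr T" "src T h = fst M' \<otimes> fst N'" "tgt T h = fst P"
    and l: "\<And>c. h \<cdot> (act c M' \<odot> idm T (fst N')) = act c P \<cdot> h"
    and r: "\<And>c. h \<cdot> (idm T (fst M') \<odot> act c N') = act c P \<cdot> h"
    using h by (auto simp: bilin_def)
  have "(h \<cdot> (f \<odot> g)) \<cdot> (act c M \<odot> idm T (fst N)) = (h \<cdot> (act c M' \<odot> idm T (fst N'))) \<cdot> (f \<odot> g)" for c
    by (simp add: mhomD(6)[OF f])
  moreover have "(h \<cdot> (f \<odot> g)) \<cdot> (idm T (fst M) \<odot> act c N) = (h \<cdot> (idm T (fst M') \<odot> act c N')) \<cdot> (f \<odot> g)" for c
    by (simp add: mhomD(6)[OF g])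
  ultimately show ?thesis unfolding bilin_def l r by simp
qed

definition tarm where
  "tarm M M' f N N' g = fac M N (tp M' N' \<cdot> (f \<odot> g))"

lemma tarm:
  assumes f: "mhom M M' f" and g: "mhom N N' g"
  shows "mhom (tm M N) (tm M' N') (tarm M M' f N N' g)"
    "tarm M M' f N N' g \<cdot> tp M N = tp M' N' \<cdot> (f \<odot> g)"
  unfolding tarm_def
  using fac_props[OF bilin_tar[OF f g bilin_tp]] mhomD[OF f] mhomD[OF g] by simp_all

end

section \<open>The tensor category of modules\<close>

context base_extension
begin

text \<open>The associator of \<open>T\<close> is not an equality, so trilinearity has a version for
  each bracketing; \<open>trilin'_asc\<close> and \<open>trilin_inv_asc\<close> pass between
  them.\<close>

definition trilin where
  "trilin L M N P h \<longleftrightarrow> L \<in> mods \<and> M \<in> mods \<and> N \<in> mods \<and> P \<in> mods \<and>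
    h \<in> hom T ((fst L \<otimes> fst M) \<otimes> fst N) (fst P) \<and>
    (\<forall>c. h \<cdot> ((act c L \<odot> idm T (fst M)) \<odot> idm T (fst N)) = act c P \<cdot> h) \<and>
    (\<forall>c. h \<cdot> ((idm T (fst L) \<odot> act c M) \<odot> idm T (fst N)) = act c P \<cdot> h) \<and>
    (\<forall>c. h \<cdot> (idm T (fst L \<otimes> fst M) \<odot> act c N) = act c P \<cdot> h)"

definition trilin' where
  "trilin' L M N P h \<longleftrightarrow> L \<in> mods \<and> M \<in> mods \<and> N \<in> mods \<and> P \<in> mods \<and>
    h \<in> hom T (fst L \<otimes> (fst M \<otimes> fst N)) (fst P) \<and>
    (\<forall>c. h \<cdot> (act c L \<odot> idm T (fst M \<otimes> fst N)) = act c P \<cdot> h) \<and>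
    (\<forall>c. h \<cdot> (idm T (fst L) \<odot> (act c M \<odot> idm T (fst N))) = act c P \<cdot> h) \<and>
    (\<forall>c. h \<cdot> (idm T (fst L) \<odot> (idm T (fst M) \<odot> act c N)) = act c P \<cdot> h)"

lemma trilinD:
  assumes "trilin L M N P h"
  shows "L \<in> mods" "M \<in> mods" "N \<in> mods" "P \<in> mods"
    "h \<in> arr T" "src T h = (fst L \<otimes> fst M) \<otimes> fst N" "tgt T h = fst P"
    "h \<cdot> ((act c L \<odot> idm T (fst M)) \<odot> idm T (fst N)) = act c P \<cdot> h"
    "h \<cdot> ((idm T (fst L) \<odot> act c M) \<odot> idm T (fst N)) = act c P \<cdot> h"
    "h \<cdot> (idm T (fst L \<otimes> fst M) \<odot> act c N) = act c P \<cdot> h"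
  using assms by (auto simp: trilin_def)

lemma trilin'D:
  assumes "trilin' L M N P h"
  shows "L \<in> mods" "M \<in> mods" "N \<in> mods" "P \<in> mods"
    "h \<in> arr T" "src T h = fst L \<otimes> (fst M \<otimes> fst N)" "tgt T h = fst P"
    "h \<cdot> (act c L \<odot> idm T (fst M \<otimes> fst N)) = act c P \<cdot> h"
    "h \<cdot> (idm T (fst L) \<odot> (act c M \<odot> idm T (fst N))) = act c P \<cdot> h"
    "h \<cdot> (idm T (fst L) \<odot> (idm T (fst M) \<odot> act c N)) = act c P \<cdot> h"
  using assms by (auto simp: trilin'_def)

lemma trilin'_asc:
  assumes h: "trilin' L M N P h"
  shows "trilin L M N P (h \<cdot> asc T (fst L) (fst M) (fst N))"
proof -
  note [simp] = trilin'D(1-7)[OF h] and H = trilin'D(8-10)[OF h]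
  let ?a = "asc T (fst L) (fst M) (fst N)"
  have "?a \<cdot> ((act c L \<odot> idm T (fst M)) \<odot> idm T (fst N)) = (act c L \<odot> idm T (fst M \<otimes> fst N)) \<cdot> ?a"
    "?a \<cdot> ((idm T (fst L) \<odot> act c M) \<odot> idm T (fst N)) = (idm T (fst L) \<odot> (act c M \<odot> idm T (fst N))) \<cdot> ?a"
    "?a \<cdot> (idm T (fst L \<otimes> fst M) \<odot> act c N) = (idm T (fst L) \<odot> (idm T (fst M) \<odot> act c N)) \<cdot> ?a" for c
    using asc_nat[of "act c L" "idm T (fst M)" "idm T (fst N)"]
      asc_nat[of "idm T (fst L)" "act c M" "idm T (fst N)"]
      asc_nat[of "idm T (fst L)" "idm T (fst M)" "act c N"] by simp_all
  then show ?thesis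
    by (simp add: trilin_def reassoc[OF H(1)] reassoc[OF H(2)] reassoc[OF H(3)])
qed

lemma trilin_inv_asc:
  assumes h: "trilin L M N P h"
  shows "trilin' L M N P (h \<cdot> inv_arr T (asc T (fst L) (fst M) (fst N)))"
proof -
  note [simp] = trilinD(1-7)[OF h] and H = trilinD(8-10)[OF h]
  let ?a = "inv_arr T (asc T (fst L) (fst M) (fst N))"
  have "?a \<cdot> (act c L \<odot> idm T (fst M \<otimes> fst N)) = ((act c L \<odot> idm T (fst M)) \<odot> idm T (fst N)) \<cdot> ?a"
    "?a \<cdot> (idm T (fst L) \<odot> (act c M \<odot> idm T (fst N))) = ((idm T (fst L) \<odot> act c M) \<odot> idm T (fst N)) \<cdot> ?a"
    "?a \<cdot> (idm T (fst L) \<odot> (idm T (fst M) \<odot> act c N)) = (idm T (fst L \<otimes> fst M) \<odot> act c N) \<cdot> ?a" for c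
    using inv_asc_nat[of "act c L" "idm T (fst M)" "idm T (fst N)"]
      inv_asc_nat[of "idm T (fst L)" "act c M" "idm T (fst N)"]
      inv_asc_nat[of "idm T (fst L)" "idm T (fst M)" "act c N"] by simp_all
  then show ?thesis
    by (simp add: trilin'_def reassoc[OF H(1)] reassoc[OF H(2)] reassoc[OF H(3)])
qed

lemma bilinD:
  assumes "bilin M N P h"
  shows "M \<in> mods" "N \<in> mods" "P \<in> mods" "h \<in> arr T" "src T h = fst M \<otimes> fst N" "tgt T h = fst P"
    "h \<cdot> (act c M \<odot> idm T (fst N)) = act c P \<cdot> h" "h \<cdot> (idm T (fst M) \<odot> act c N) = act c P \<cdot> h"
  using assms by (auto simp: bilin_def)

lemma bilin_trilin:
  assumes LM [simp]: "L \<in> mods" "M \<in> mods" and g: "bilin (tm L M) N P g"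
  shows "trilin L M N P (g \<cdot> (tp L M \<odot> idm T (fst N)))"
proof -
  note [simp] = bilinD(2-6)[OF g] and G = bilinD(7,8)[OF g]
  let ?Z = "idm T (fst N)"
  have "g \<cdot> (tp L M \<odot> ?Z) \<cdot> (x \<odot> ?Z) = act c P \<cdot> (g \<cdot> (tp L M \<odot> ?Z))"
    if x: "tp L M \<cdot> x = act c (tm L M) \<cdot> tp L M" "x \<in> arr T" "src T x = fst L \<otimes> fst M" "tgt T x = fst L \<otimes> fst M" for x c
  proof -
    have "g \<cdot> (tp L M \<odot> ?Z) \<cdot> (x \<odot> ?Z) = g \<cdot> ((tp L M \<cdot> x) \<odot> ?Z)" using x(2-4) by simp
    also have "\<dots> = (g \<cdot> (act c (tm L M) \<odot> ?Z)) \<cdot> (tp L M \<odot> ?Z)" unfolding x(1) by simp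
    finally show ?thesis unfolding G by simp
  qed
  note * = this[OF act_tm[OF LM, symmetric]] this[OF tm_module(2)[OF LM, symmetric]]
  have "g \<cdot> (tp L M \<odot> ?Z) \<cdot> (idm T (fst L \<otimes> fst M) \<odot> act c N) = (g \<cdot> (idm T (fst (tm L M)) \<odot> act c N)) \<cdot> (tp L M \<odot> ?Z)" for c
    by simp
  then show ?thesis unfolding trilin_def G using * by simp
qed

lemma bilin_trilin':
  assumes MN [simp]: "M \<in> mods" "N \<in> mods" and g: "bilin L (tm M N) P g"
  shows "trilin' L M N P (g \<cdot> (idm T (fst L) \<odot> tp M N))"
proof -
  note [simp] = bilinD(1,3-6)[OF g] and G = bilinD(7,8)[OF g]
  let ?Z = "idm T (fst L)"
  have "g \<cdot> (?Z \<odot> tp M N) \<cdot> (?Z \<odot> x) = act c P \<cdot> (g \<cdot> (?Z \<odot> tp M N))"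
    if x: "tp M N \<cdot> x = act c (tm M N) \<cdot> tp M N" "x \<in> arr T" "src T x = fst M \<otimes> fst N" "tgt T x = fst M \<otimes> fst N" for x c
  proof -
    have "g \<cdot> (?Z \<odot> tp M N) \<cdot> (?Z \<odot> x) = g \<cdot> (?Z \<odot> (tp M N \<cdot> x))" using x(2-4) by simp
    also have "\<dots> = (g \<cdot> (?Z \<odot> act c (tm M N))) \<cdot> (?Z \<odot> tp M N)" unfolding x(1) by simp
    finally show ?thesis unfolding G by simp
  qed
  note * = this[OF act_tm[OF MN, symmetric]] this[OF tm_module(2)[OF MN, symmetric]]
  have "g \<cdot> (?Z \<odot> tp M N) \<cdot> (act c L \<odot> idm T (fst M \<otimes> fst N)) = (g \<cdot> (act c L \<odot> idm T (fst (tm M N)))) \<cdot> (?Z \<odot> tp M N)" for c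
    by simp
  then show ?thesis unfolding trilin'_def G using * by simp
qed

definition tp3 where "tp3 L M N = tp (tm L M) N \<cdot> (tp L M \<odot> idm T (fst N))"
definition tp3' where "tp3' L M N = tp L (tm M N) \<cdot> (idm T (fst L) \<odot> tp M N)"

lemma trilin_tp3: "L \<in> mods \<Longrightarrow> M \<in> mods \<Longrightarrow> N \<in> mods \<Longrightarrow> trilin L M N (tm (tm L M) N) (tp3 L M N)"
  unfolding tp3_def by (rule bilin_trilin) (simp_all add: bilin_tp)

lemma trilin_tp3': "L \<in> mods \<Longrightarrow> M \<in> mods \<Longrightarrow> N \<in> mods \<Longrightarrow> trilin' L M N (tm L (tm M N)) (tp3' L M N)"
  unfolding tp3'_def by (rule bilin_trilin') (simp_all add: bilin_tp)

lemma tp3_simps [simp]: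
  assumes [simp]: "L \<in> mods" "M \<in> mods" "N \<in> mods"
  shows "tp3 L M N \<in> arr T" "src T (tp3 L M N) = (fst L \<otimes> fst M) \<otimes> fst N"
    "tgt T (tp3 L M N) = tgt T (tp (tm L M) N)"
    "tp3' L M N \<in> arr T" "src T (tp3' L M N) = fst L \<otimes> (fst M \<otimes> fst N)"
    "tgt T (tp3' L M N) = tgt T (tp L (tm M N))"
  by (simp_all add: tp3_def tp3'_def)

text \<open>Composites of split epimorphisms, one of them tensored with an identity. Identities
  between arrows out of triple products of modules are checked against these.\<close>

lemma tp3_epi:
  assumes [simp]: "L \<in> mods" "M \<in> mods" "N \<in> mods"
  shows "is_epi T (tp3 L M N)" "is_epi T (tp3' L M N)"
  unfolding tp3_def tp3'_def by (rule epi_cmp; simp add: tp_tar_epi tp_epi)+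

text \<open>Two successive factorizations. Precomposition with the tensored \<open>sec L M\<close>
  gives an arrow out of \<open>(L \<otimes>\<^sub>K M) \<otimes> N\<close>; it is bilinear because
  the tensored \<open>tp L M\<close> is epic, and \<open>fac_props\<close> provides the second
  factorization.\<close>

lemma trilin_factor:
  assumes h: "trilin L M N P h"
  shows "\<exists>u. mhom (tm (tm L M) N) P u \<and> u \<cdot> tp3 L M N = h"
proof -
  note [simp] = trilinD(1-7)[OF h] and H = trilinD(8-10)[OF h]
  let ?Z = "idm T (fst N)" and ?h = "h \<cdot> (sec L M \<odot> idm T (fst N))"
  have ht: "?h \<cdot> (tp L M \<odot> ?Z) = h"
    using balanced_sec_right[of L M "fst N" h] H by simp
  have "bilin (tm L M) N P ?h"
    unfolding bilin_def
  proof (intro conjI allI)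
    fix c
    show "?h \<cdot> (act c (tm L M) \<odot> idm T (fst N)) = act c P \<cdot> ?h"
    proof (rule epi_cancel[OF tp_tar_epi(1)[of L M "fst N"]])
      have "?h \<cdot> (act c (tm L M) \<odot> ?Z) \<cdot> (tp L M \<odot> ?Z) = ?h \<cdot> ((act c (tm L M) \<cdot> tp L M) \<odot> ?Z)"
        by simp
      also have "\<dots> = (?h \<cdot> (tp L M \<odot> ?Z)) \<cdot> ((act c L \<odot> idm T (fst M)) \<odot> ?Z)"
        unfolding act_tm[OF trilinD(1,2)[OF h]] by simp
      also have "\<dots> = act c P \<cdot> (?h \<cdot> (tp L M \<odot> ?Z))" unfolding ht by (rule H)
      finally show "?h \<cdot> (act c (tm L M) \<odot> ?Z) \<cdot> (tp L M \<odot> ?Z) = act c P \<cdot> ?h \<cdot> (tp L M \<odot> ?Z)"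
        by simp
    qed simp_all
    show "?h \<cdot> (idm T (fst (tm L M)) \<odot> act c N) = act c P \<cdot> ?h"
    proof (rule epi_cancel[OF tp_tar_epi(1)[of L M "fst N"]])
      have "?h \<cdot> (idm T (fst (tm L M)) \<odot> act c N) \<cdot> (tp L M \<odot> ?Z)
          = (?h \<cdot> (tp L M \<odot> ?Z)) \<cdot> (idm T (fst L \<otimes> fst M) \<odot> act c N)"
        by simp
      also have "\<dots> = act c P \<cdot> (?h \<cdot> (tp L M \<odot> ?Z))" unfolding ht by (rule H)
      finally show "?h \<cdot> (idm T (fst (tm L M)) \<odot> act c N) \<cdot> (tp L M \<odot> ?Z) = act c P \<cdot> ?h \<cdot> (tp L M \<odot> ?Z)"
        by simp
    qed simp_all
  qed simp_all
  from fac_props[OF this] have f: "mhom (tm (tm L M) N) P (fac (tm L M) N ?h)"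
    "fac (tm L M) N ?h \<cdot> tp (tm L M) N = ?h" .
  note [simp] = mhomD(3-5)[OF f(1)]
  have "fac (tm L M) N ?h \<cdot> tp3 L M N = (fac (tm L M) N ?h \<cdot> tp (tm L M) N) \<cdot> (tp L M \<odot> ?Z)"
    unfolding tp3_def by simp
  then have "fac (tm L M) N ?h \<cdot> tp3 L M N = ?h \<cdot> (tp L M \<odot> ?Z)" by (simp only: f(2))
  then show ?thesis using f(1) ht by auto
qed

lemma trilin'_factor:
  assumes h: "trilin' L M N P h"
  shows "\<exists>u. mhom (tm L (tm M N)) P u \<and> u \<cdot> tp3' L M N = h"
proof -
  note [simp] = trilin'D(1-7)[OF h] and H = trilin'D(8-10)[OF h]
  let ?Z = "idm T (fst L)" and ?h = "h \<cdot> (idm T (fst L) \<odot> sec M N)"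
  have ht: "?h \<cdot> (?Z \<odot> tp M N) = h"
    using balanced_sec_left[of M N "fst L" h] H by simp
  have "bilin L (tm M N) P ?h"
    unfolding bilin_def
  proof (intro conjI allI)
    fix c
    show "?h \<cdot> (idm T (fst L) \<odot> act c (tm M N)) = act c P \<cdot> ?h"
    proof (rule epi_cancel[OF tp_tar_epi(2)[of M N "fst L"]])
      have "?h \<cdot> (?Z \<odot> act c (tm M N)) \<cdot> (?Z \<odot> tp M N) = ?h \<cdot> (?Z \<odot> (act c (tm M N) \<cdot> tp M N))"
        by simp
      also have "\<dots> = (?h \<cdot> (?Z \<odot> tp M N)) \<cdot> (?Z \<odot> (act c M \<odot> idm T (fst N)))"
        unfolding act_tm[OF trilin'D(2,3)[OF h]] by simp
      also have "\<dots> = act c P \<cdot> (?h \<cdot> (?Z \<odot> tp M N))" unfolding ht by (rule H)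
      finally show "?h \<cdot> (?Z \<odot> act c (tm M N)) \<cdot> (?Z \<odot> tp M N) = act c P \<cdot> ?h \<cdot> (?Z \<odot> tp M N)"
        by simp
    qed simp_all
    show "?h \<cdot> (act c L \<odot> idm T (fst (tm M N))) = act c P \<cdot> ?h"
    proof (rule epi_cancel[OF tp_tar_epi(2)[of M N "fst L"]])
      have "?h \<cdot> (act c L \<odot> idm T (fst (tm M N))) \<cdot> (?Z \<odot> tp M N)
          = (?h \<cdot> (?Z \<odot> tp M N)) \<cdot> (act c L \<odot> idm T (fst M \<otimes> fst N))"
        by simp
      also have "\<dots> = act c P \<cdot> (?h \<cdot> (?Z \<odot> tp M N))" unfolding ht by (rule H)
      finally show "?h \<cdot> (act c L \<odot> idm T (fst (tm M N))) \<cdot> (?Z \<odot> tp M N) = act c P \<cdot> ?h \<cdot> (?Z \<odot> tp M N)"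
        by simp
    qed simp_all
  qed simp_all
  from fac_props[OF this] have f: "mhom (tm L (tm M N)) P (fac L (tm M N) ?h)"
    "fac L (tm M N) ?h \<cdot> tp L (tm M N) = ?h" .
  note [simp] = mhomD(3-5)[OF f(1)]
  have "fac L (tm M N) ?h \<cdot> tp3' L M N = (fac L (tm M N) ?h \<cdot> tp L (tm M N)) \<cdot> (?Z \<odot> tp M N)"
    unfolding tp3'_def by simp
  then have "fac L (tm M N) ?h \<cdot> tp3' L M N = ?h \<cdot> (?Z \<odot> tp M N)" by (simp only: f(2))
  then show ?thesis using f(1) ht by auto
qed

definition ascm where
  "ascm L M N = factor_through T (tp (tm L M) N \<cdot> (tp L M \<odot> idm T (fst N)))
     (tp L (tm M N) \<cdot> (idm T (fst L) \<odot> tp M N) \<cdot> asc T (fst L) (fst M) (fst N))"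

text \<open>Both bracketings represent trilinear arrows. The inverse is obtained by factoring
  through the inverse associator of \<open>T\<close>, and the two composites are identified by
  cancelling \<open>tp3\<close> and \<open>tp3'\<close>.\<close>

lemma ascm:
  assumes [simp]: "L \<in> mods" "M \<in> mods" "N \<in> mods"
  shows "mhom (tm (tm L M) N) (tm L (tm M N)) (ascm L M N)"
    "ascm L M N \<cdot> tp3 L M N = tp3' L M N \<cdot> asc T (fst L) (fst M) (fst N)"
    "is_iso T (ascm L M N)"
proof -
  let ?a = "asc T (fst L) (fst M) (fst N)"
  obtain u where u: "mhom (tm (tm L M) N) (tm L (tm M N)) u" "u \<cdot> tp3 L M N = tp3' L M N \<cdot> ?a"
    using trilin_factor[OF trilin'_asc[OF trilin_tp3'[of L M N]]] by auto
  note U [simp] = mhomD(3-5)[OF u(1)]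
  have au: "ascm L M N = u"
    unfolding ascm_def tp3_def[symmetric] tp3'_def[symmetric]
    by (rule factor_through_eq[OF tp3_epi(1) _ _ u(2)]) simp_all
  then show "mhom (tm (tm L M) N) (tm L (tm M N)) (ascm L M N)"
    "ascm L M N \<cdot> tp3 L M N = tp3' L M N \<cdot> ?a" using u by simp_all
  obtain v where v: "mhom (tm L (tm M N)) (tm (tm L M) N) v" "v \<cdot> tp3' L M N = tp3 L M N \<cdot> inv_arr T ?a"
    using trilin'_factor[OF trilin_inv_asc[OF trilin_tp3[of L M N]]] by auto
  note V [simp] = mhomD(3-5)[OF v(1)]
  have "v \<cdot> u = idm T (fst (tm (tm L M) N))"
    by (rule epi_cancel[OF tp3_epi(1)[of L M N]]) (simp_all add: u(2) reassoc[OF v(2)])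
  moreover have "u \<cdot> v = idm T (fst (tm L (tm M N)))"
    by (rule epi_cancel[OF tp3_epi(2)[of L M N]]) (simp_all add: v(2) reassoc[OF u(2)])
  ultimately show "is_iso T (ascm L M N)"
    unfolding au by (intro isoI[of u v]) simp_all
qed

definition lunm where "lunm M = fac U M (snd M \<cdot> bra T A (fst M))"
definition runm where "runm M = fac M U (snd M)"
definition bram where "bram M N = fac M N (tp N M \<cdot> bra T (fst M) (fst N))"

lemma snd_ins: "M \<in> mods \<Longrightarrow> snd M \<cdot> ins (fst M) c = act c M"
  by (simp add: act_module)

lemma act_linear_ins:
  assumes [simp]: "M \<in> mods"
  shows "(snd M \<cdot> bra T A (fst M)) \<cdot> (j c \<odot> idm T (fst M)) = act c M \<cdot> lun T (fst M)"
  by (simp add: bra_j reassoc[OF snd_ins])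

text \<open>The inverse is \<open>x \<mapsto> 1 \<otimes> x\<close>: balancing turns
  \<open>c \<otimes> x\<close> into \<open>1 \<otimes> c x\<close>. The formula for the inverse
  reduces later identities to the element \<open>1\<close>.\<close>

lemma lunm:
  assumes M [simp]: "M \<in> mods"
  shows "mhom (tm U M) M (lunm M)" "lunm M \<cdot> tp U M = snd M \<cdot> bra T A (fst M)" "is_iso T (lunm M)"
    "inv_arr T (lunm M) = tp U M \<cdot> ((j 1 \<odot> idm T (fst M)) \<cdot> inv_arr T (lun T (fst M)))"
proof -
  let ?h = "snd M \<cdot> bra T A (fst M)" and ?X = "fst M"
  note hj = act_linear_ins[OF M]
  have b: "bilin U M M ?h"
    unfolding bilin_def
  proof (intro conjI allI)
    fix c
    show "?h \<cdot> (act c U \<odot> idm T (fst M)) = act c M \<cdot> ?h"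
    proof (rule j_ext[of _ ?X])
      fix d
      have "?h \<cdot> (act c U \<odot> idm T ?X) \<cdot> (j d \<odot> idm T ?X) = ?h \<cdot> ((act c U \<cdot> j d) \<odot> idm T ?X)" by simp
      also have "\<dots> = act (d * c) M \<cdot> lun T ?X" unfolding act_U by (rule hj)
      also have "\<dots> = act c M \<cdot> (?h \<cdot> (j d \<odot> idm T ?X))"
        unfolding hj by (simp add: reassoc[OF act_mult] mult.commute)
      finally show "?h \<cdot> (act c U \<odot> idm T ?X) \<cdot> (j d \<odot> idm T ?X) = act c M \<cdot> ?h \<cdot> (j d \<odot> idm T ?X)"
        by simp
    qed simp_all
    show "?h \<cdot> (idm T (fst U) \<odot> act c M) = act c M \<cdot> ?h"
    proof (rule j_ext[of _ ?X])
      fix d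
      have "?h \<cdot> (idm T (fst U) \<odot> act c M) \<cdot> (j d \<odot> idm T ?X)
          = (?h \<cdot> (j d \<odot> idm T ?X)) \<cdot> (idm T (unt T) \<odot> act c M)" by simp
      also have "\<dots> = act d M \<cdot> (act c M \<cdot> lun T ?X)" unfolding hj using lun_nat[of "act c M"] by simp
      also have "\<dots> = act c M \<cdot> (?h \<cdot> (j d \<odot> idm T ?X))"
        unfolding hj by (simp add: reassoc[OF act_mult] mult.commute)
      finally show "?h \<cdot> (idm T (fst U) \<odot> act c M) \<cdot> (j d \<odot> idm T ?X) = act c M \<cdot> ?h \<cdot> (j d \<odot> idm T ?X)"
        by simp
    qed simp_all
  qed simp_all
  show m: "mhom (tm U M) M (lunm M)" and e: "lunm M \<cdot> tp U M = ?h"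
    unfolding lunm_def using fac_props[OF b] by simp_all
  note [simp] = mhomD(3-5)[OF m]
  let ?v = "tp U M \<cdot> ((j 1 \<odot> idm T ?X) \<cdot> inv_arr T (lun T ?X))"
  have "lunm M \<cdot> ?v = (lunm M \<cdot> tp U M) \<cdot> ((j 1 \<odot> idm T ?X) \<cdot> inv_arr T (lun T ?X))" by simp
  also have "\<dots> = (?h \<cdot> (j 1 \<odot> idm T ?X)) \<cdot> inv_arr T (lun T ?X)" unfolding e by simp
  also have "\<dots> = idm T ?X" unfolding hj by (simp add: act_one)
  finally have 1: "lunm M \<cdot> ?v = idm T ?X" .
  have "?v \<cdot> ?h = tp U M"
  proof (rule j_ext[of _ ?X])
    fix c
    have "?v \<cdot> ?h \<cdot> (j c \<odot> idm T ?X) = ?v \<cdot> (?h \<cdot> (j c \<odot> idm T ?X))" by simp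
    also have "\<dots> = tp U M \<cdot> ((j 1 \<odot> idm T ?X) \<cdot> ((inv_arr T (lun T ?X) \<cdot> act c M) \<cdot> lun T ?X))"
      unfolding hj by simp
    also have "inv_arr T (lun T ?X) \<cdot> act c M = (idm T (unt T) \<odot> act c M) \<cdot> inv_arr T (lun T ?X)"
      using inv_lun_nat[of "act c M"] by simp
    also have "tp U M \<cdot> ((j 1 \<odot> idm T ?X) \<cdot> (((idm T (unt T) \<odot> act c M) \<cdot> inv_arr T (lun T ?X)) \<cdot> lun T ?X))
        = (tp U M \<cdot> (idm T A \<odot> act c M)) \<cdot> (j 1 \<odot> idm T ?X)" by simp
    also have "\<dots> = (tp U M \<cdot> (act c U \<odot> idm T ?X)) \<cdot> (j 1 \<odot> idm T ?X)"
      using tp_balanced[of U M c] by simp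
    also have "\<dots> = tp U M \<cdot> (j c \<odot> idm T ?X)" by (simp add: act_U)
    finally show "?v \<cdot> ?h \<cdot> (j c \<odot> idm T ?X) = tp U M \<cdot> (j c \<odot> idm T ?X)" .
  qed simp_all
  then have "?v \<cdot> lunm M = idm T (fst (tm U M))"
    by (intro epi_cancel[OF tp_epi[of U M], of "?v \<cdot> lunm M" "idm T (fst (tm U M))"]) (simp_all add: e)
  then show "is_iso T (lunm M)" "inv_arr T (lunm M) = ?v"
    using 1 by (intro isoI[of "lunm M" ?v] inv_eqI[of "lunm M" ?v]; simp)+
qed

text \<open>As for \<open>lunm\<close>, with inverse \<open>x \<mapsto> x \<otimes> 1\<close>. The
  last conclusion makes the action map linear from the free module on \<open>fst M\<close> to
  \<open>M\<close>.\<close>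

lemma runm:
  assumes M [simp]: "M \<in> mods"
  shows "mhom (tm M U) M (runm M)" "runm M \<cdot> tp M U = snd M" "is_iso T (runm M)"
    "inv_arr T (runm M) = tp M U \<cdot> ins (fst M) 1"
    "snd M \<cdot> (idm T (fst M) \<odot> act c U) = act c M \<cdot> snd M"
proof -
  let ?X = "fst M"
  have b: "bilin M U M (snd M)"
    unfolding bilin_def
  proof (intro conjI allI)
    fix c
    show "snd M \<cdot> (act c M \<odot> idm T (fst U)) = act c M \<cdot> snd M"
    proof (rule ins_ext[of _ ?X])
      fix d
      show "snd M \<cdot> (act c M \<odot> idm T (fst U)) \<cdot> ins ?X d = act c M \<cdot> snd M \<cdot> ins ?X d"
        using ins_nat[of "act c M" d] by (simp add: snd_ins reassoc[OF snd_ins] act_mult mult.commute)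
    qed simp_all
    show "snd M \<cdot> (idm T (fst M) \<odot> act c U) = act c M \<cdot> snd M"
    proof (rule ins_ext[of _ ?X])
      fix d
      have "(idm T ?X \<odot> act c U) \<cdot> ins ?X d = ins ?X (d * c)"
        using act_free_ins[of ?X c d] by (simp add: act_free)
      then show "snd M \<cdot> (idm T (fst M) \<odot> act c U) \<cdot> ins ?X d = act c M \<cdot> snd M \<cdot> ins ?X d"
        by (simp add: snd_ins act_mult mult.commute)
    qed simp_all
  qed simp_all
  show m: "mhom (tm M U) M (runm M)" and e: "runm M \<cdot> tp M U = snd M"
    unfolding runm_def using fac_props[OF b] by simp_all
  note [simp] = mhomD(3-5)[OF m]
  let ?v = "tp M U \<cdot> ins ?X 1"
  have 1: "runm M \<cdot> ?v = idm T ?X"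
    using reassoc[OF e, of "ins ?X 1"] by (simp add: snd_ins act_one)
  have "?v \<cdot> snd M = tp M U"
  proof (rule ins_ext[of _ ?X])
    fix c
    have i: "(idm T ?X \<odot> act c U) \<cdot> ins ?X 1 = ins ?X c"
      using act_free_ins[of ?X c 1] by (simp add: act_free)
    have "?v \<cdot> snd M \<cdot> ins ?X c = tp M U \<cdot> (ins ?X 1 \<cdot> act c M)" by (simp add: snd_ins)
    also have "\<dots> = (tp M U \<cdot> (act c M \<odot> idm T A)) \<cdot> ins ?X 1"
      using ins_nat[of "act c M" 1] by simp
    also have "\<dots> = tp M U \<cdot> ((idm T ?X \<odot> act c U) \<cdot> ins ?X 1)"
      using tp_balanced[of M U c] by simp
    finally show "?v \<cdot> snd M \<cdot> ins ?X c = tp M U \<cdot> ins ?X c" unfolding i .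
  qed simp_all
  then have "?v \<cdot> runm M = idm T (fst (tm M U))"
    by (intro epi_cancel[OF tp_epi[of M U], of "?v \<cdot> runm M" "idm T (fst (tm M U))"]) (simp_all add: e)
  then show "is_iso T (runm M)" "inv_arr T (runm M) = ?v"
    using 1 by (intro isoI[of "runm M" ?v] inv_eqI[of "runm M" ?v]; simp)+
  show "snd M \<cdot> (idm T (fst M) \<odot> act c U) = act c M \<cdot> snd M"
    using b by (simp add: bilin_def)
qed

lemma bram:
  assumes [simp]: "M \<in> mods" "N \<in> mods"
  shows "mhom (tm M N) (tm N M) (bram M N)" "bram M N \<cdot> tp M N = tp N M \<cdot> bra T (fst M) (fst N)"
proof -
  let ?b = "bra T (fst M) (fst N)"
  have 1: "tp N M \<cdot> ?b \<cdot> (act c M \<odot> idm T (fst N)) = act c (tm N M) \<cdot> (tp N M \<cdot> ?b)" for c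
  proof -
    have "tp N M \<cdot> ?b \<cdot> (act c M \<odot> idm T (fst N)) = (tp N M \<cdot> (idm T (fst N) \<odot> act c M)) \<cdot> ?b"
      using bra_nat[of "act c M" "idm T (fst N)"] by simp
    then show ?thesis by (simp flip: tm_module(2))
  qed
  have 2: "tp N M \<cdot> ?b \<cdot> (idm T (fst M) \<odot> act c N) = act c (tm N M) \<cdot> (tp N M \<cdot> ?b)" for c
  proof -
    have "tp N M \<cdot> ?b \<cdot> (idm T (fst M) \<odot> act c N) = (tp N M \<cdot> (act c N \<odot> idm T (fst M))) \<cdot> ?b"
      using bra_nat[of "idm T (fst M)" "act c N"] by simp
    then show ?thesis by (simp flip: act_tm)
  qed
  have "bilin M N (tm N M) (tp N M \<cdot> ?b)"
    unfolding bilin_def 1 2 by simp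
  from fac_props[OF this] show "mhom (tm M N) (tm N M) (bram M N)"
    "bram M N \<cdot> tp M N = tp N M \<cdot> bra T (fst M) (fst N)"
    unfolding bram_def by simp_all
qed

lemma tob_Q [simp]: "M \<otimes>\<^bsub>Q\<^esub> N = tm M N" and unt_Q [simp]: "unt Q = U"
  and tar_Q [simp]: "(M, M', f) \<odot>\<^bsub>Q\<^esub> (N, N', g) = (tm M N, tm M' N', tarm M M' f N N' g)"
  and asc_Q [simp]: "asc Q L M N = (tm (tm L M) N, tm L (tm M N), ascm L M N)"
  and lun_Q [simp]: "lun Q M = (tm U M, M, lunm M)"
  and run_Q [simp]: "run Q M = (tm M U, M, runm M)"
  and bra_Q [simp]: "bra Q M N = (tm M N, tm N M, bram M N)"
  by (simp_all add: module_category_def tarm_def ascm_def lunm_def runm_def bram_def)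

end

section \<open>Naturality and coherence of the constraints for modules\<close>

context base_extension
begin

lemma tarm_tp_assoc:
  assumes f: "mhom M M' f" and g: "mhom N N' g" and x: "x \<in> arr T" "tgt T x = fst M \<otimes> fst N"
  shows "tarm M M' f N N' g \<cdot> (tp M N \<cdot> x) = tp M' N' \<cdot> ((f \<odot> g) \<cdot> x)"
proof -
  note [simp] = mhomD(1-5)[OF f] mhomD(1-5)[OF g] mhomD(3-5)[OF tarm(1)[OF f g]]
  show ?thesis using reassoc[OF tarm(2)[OF f g], of x] x by simp
qed

lemma tarm_simps:
  assumes f: "mhom M M' f" and g: "mhom N N' g"
  shows "tarm M M' f N N' g \<in> arr T" "src T (tarm M M' f N N' g) = tgt T (tp M N)"
    "tgt T (tarm M M' f N N' g) = tgt T (tp M' N')"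
  using mhomD(3-5)[OF tarm(1)[OF f g]] by simp_all

lemma tarm_eqI:
  assumes f: "mhom M M' f" and g: "mhom N N' g" and u: "mhom (tm M N) (tm M' N') u"
    and e: "u \<cdot> tp M N = tp M' N' \<cdot> (f \<odot> g)"
  shows "tarm M M' f N N' g = u"
  using mhomD(1)[OF f] mhomD(1)[OF g] e tarm(2)[OF f g]
  by (intro mhom_tm_eqI[OF tarm(1)[OF f g] u]) simp_all

lemma tp3_nat:
  assumes f: "mhom L L' f" and g: "mhom M M' g" and h: "mhom N N' h"
  shows "tarm (tm L M) (tm L' M') (tarm L L' f M M' g) N N' h \<cdot> tp3 L M N = tp3 L' M' N' \<cdot> ((f \<odot> g) \<odot> h)"
    "tarm L L' f (tm M N) (tm M' N') (tarm M M' g N N' h) \<cdot> tp3' L M N = tp3' L' M' N' \<cdot> (f \<odot> (g \<odot> h))"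
proof -
  note [simp] = mhomD(1-5)[OF f] mhomD(1-5)[OF g] mhomD(1-5)[OF h]
    tarm_simps[OF f g] tarm_simps[OF g h]
  note fg = tarm(2)[OF f g] tarm(2)[OF g h]
  show "tarm (tm L M) (tm L' M') (tarm L L' f M M' g) N N' h \<cdot> tp3 L M N = tp3 L' M' N' \<cdot> ((f \<odot> g) \<odot> h)"
    by (simp add: tp3_def tarm_tp_assoc[OF tarm(1)[OF f g] h] fg)
  show "tarm L L' f (tm M N) (tm M' N') (tarm M M' g N N' h) \<cdot> tp3' L M N = tp3' L' M' N' \<cdot> (f \<odot> (g \<odot> h))"
    by (simp add: tp3'_def tarm_tp_assoc[OF f tarm(1)[OF g h]] fg)
qed

lemma ascm_nat:
  assumes f: "mhom L L' f" and g: "mhom M M' g" and h: "mhom N N' h"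
  shows "ascm L' M' N' \<cdot> tarm (tm L M) (tm L' M') (tarm L L' f M M' g) N N' h
    = tarm L L' f (tm M N) (tm M' N') (tarm M M' g N N' h) \<cdot> ascm L M N"
proof -
  note [simp] = mhomD(1-5)[OF f] mhomD(1-5)[OF g] mhomD(1-5)[OF h]
  note 1 = tarm(1)[OF tarm(1)[OF f g] h] and 2 = tarm(1)[OF f tarm(1)[OF g h]]
  note [simp] = mhomD(3-5)[OF 1] mhomD(3-5)[OF 2]
    mhomD(3-5)[OF ascm(1)[of L M N]] mhomD(3-5)[OF ascm(1)[of L' M' N']]
  let ?a = "asc T (fst L) (fst M) (fst N)" and ?a' = "asc T (fst L') (fst M') (fst N')"
  note n = tp3_nat[OF f g h]
  show ?thesis
  proof (rule epi_cancel[OF tp3_epi(1)[of L M N]])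
    have "ascm L' M' N' \<cdot> tarm (tm L M) (tm L' M') (tarm L L' f M M' g) N N' h \<cdot> tp3 L M N
        = (ascm L' M' N' \<cdot> tp3 L' M' N') \<cdot> ((f \<odot> g) \<odot> h)"
      by (simp add: n)
    also have "\<dots> = tp3' L' M' N' \<cdot> (?a' \<cdot> ((f \<odot> g) \<odot> h))"
      by (simp add: ascm(2))
    also have "?a' \<cdot> ((f \<odot> g) \<odot> h) = (f \<odot> (g \<odot> h)) \<cdot> ?a" using asc_nat[of f g h] by simp
    also have "tp3' L' M' N' \<cdot> ((f \<odot> (g \<odot> h)) \<cdot> ?a) = (tp3' L' M' N' \<cdot> (f \<odot> (g \<odot> h))) \<cdot> ?a" by simp
    also have "\<dots> = tarm L L' f (tm M N) (tm M' N') (tarm M M' g N N' h) \<cdot> (tp3' L M N \<cdot> ?a)"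
      unfolding n(2)[symmetric] by simp
    also have "\<dots> = tarm L L' f (tm M N) (tm M' N') (tarm M M' g N N' h) \<cdot> ascm L M N \<cdot> tp3 L M N"
      by (simp add: ascm(2))
    finally show "ascm L' M' N' \<cdot> tarm (tm L M) (tm L' M') (tarm L L' f M M' g) N N' h \<cdot> tp3 L M N
      = tarm L L' f (tm M N) (tm M' N') (tarm M M' g N N' h) \<cdot> ascm L M N \<cdot> tp3 L M N" .
  qed simp_all
qed

lemma lunm_nat:
  assumes f: "mhom M N f"
  shows "lunm N \<cdot> tarm U U (idm T A) M N f = f \<cdot> lunm M"
proof -
  note F = mhomD[OF f]
  note [simp] = F(1-5) mhomD(3-5)[OF lunm(1)[of M]] mhomD(3-5)[OF lunm(1)[of N]]
  have i: "mhom U U (idm T A)" using mhom_id[of U] by simp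
  note [simp] = tarm_simps[OF i f]
  have fs: "f \<cdot> snd M = snd N \<cdot> (f \<odot> idm T A)"
    using module_hom_iff[OF F(1,2), of f] F by (simp add: module_hom_def)
  show ?thesis
  proof (rule epi_cancel[OF tp_epi[of U M]])
    have "lunm N \<cdot> tarm U U (idm T A) M N f \<cdot> tp U M = (lunm N \<cdot> tp U N) \<cdot> (idm T A \<odot> f)"
      by (simp add: tarm(2)[OF i f])
    also have "\<dots> = snd N \<cdot> (bra T A (fst N) \<cdot> (idm T A \<odot> f))" by (simp add: lunm(2))
    also have "bra T A (fst N) \<cdot> (idm T A \<odot> f) = (f \<odot> idm T A) \<cdot> bra T A (fst M)"
      using bra_nat[of "idm T A" f] by simp
    also have "snd N \<cdot> ((f \<odot> idm T A) \<cdot> bra T A (fst M)) = (f \<cdot> snd M) \<cdot> bra T A (fst M)"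
      unfolding fs by simp
    also have "\<dots> = f \<cdot> lunm M \<cdot> tp U M" by (simp add: lunm(2))
    finally show "lunm N \<cdot> tarm U U (idm T A) M N f \<cdot> tp U M = f \<cdot> lunm M \<cdot> tp U M" .
  qed simp_all
qed

lemma runm_nat:
  assumes f: "mhom M N f"
  shows "runm N \<cdot> tarm M N f U U (idm T A) = f \<cdot> runm M"
proof -
  note F = mhomD[OF f]
  note [simp] = F(1-5) mhomD(3-5)[OF runm(1)[of M]] mhomD(3-5)[OF runm(1)[of N]]
  have i: "mhom U U (idm T A)" using mhom_id[of U] by simp
  note [simp] = tarm_simps[OF f i]
  have fs: "snd N \<cdot> (f \<odot> idm T A) = f \<cdot> snd M"
    using module_hom_iff[OF F(1,2), of f] F by (simp add: module_hom_def)
  show ?thesis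
    by (rule epi_cancel[OF tp_epi[of M U]])
      (simp_all add: tarm(2)[OF f i] runm(2) reassoc[OF runm(2)] fs)
qed

lemma bram_nat:
  assumes f: "mhom M M' f" and g: "mhom N N' g"
  shows "bram M' N' \<cdot> tarm M M' f N N' g = tarm N N' g M M' f \<cdot> bram M N"
proof -
  note [simp] = mhomD(1-5)[OF f] mhomD(1-5)[OF g] tarm_simps[OF f g] tarm_simps[OF g f]
    mhomD(3-5)[OF bram(1)[of M N]] mhomD(3-5)[OF bram(1)[of M' N']]
  show ?thesis
    using bra_nat[of f g]
    by (intro epi_cancel[OF tp_epi[of M N], of "bram M' N' \<cdot> tarm M M' f N N' g" "tarm N N' g M M' f \<cdot> bram M N"])
      (simp_all add: tarm(2)[OF f g] bram(2) reassoc[OF bram(2)] tarm_tp_assoc[OF g f])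
qed

lemma ascm_tp3:
  assumes [simp]: "L \<in> mods" "M \<in> mods" "N \<in> mods"
  shows "ascm L M N \<cdot> (tp (tm L M) N \<cdot> (tp L M \<odot> idm T (fst N)))
    = tp L (tm M N) \<cdot> ((idm T (fst L) \<odot> tp M N) \<cdot> asc T (fst L) (fst M) (fst N))"
  using ascm(2)[of L M N] by (simp add: tp3_def tp3'_def)

text \<open>Both sides are precomposed with the projection from the fourfold product in
  \<open>T\<close>, which is epic. Moving each constraint past the projections replaces it by the
  constraint of \<open>T\<close>, and what remains is the pentagon of \<open>T\<close>.\<close>

lemma pentagon_Q:
  assumes [simp]: "K \<in> mods" "L \<in> mods" "M \<in> mods" "N \<in> mods"
  shows "ascm K L (tm M N) \<cdot> ascm (tm K L) M N
    = tarm K K (idm T (fst K)) (tm (tm L M) N) (tm L (tm M N)) (ascm L M N) \<cdot>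
      ascm K (tm L M) N \<cdot> tarm (tm (tm K L) M) (tm K (tm L M)) (ascm K L M) N N (idm T (fst N))"
proof -
  have iK: "mhom K K (idm T (fst K))" and iN: "mhom N N (idm T (fst N))" by simp_all
  note aL = ascm(1)[of L M N] and aK = ascm(1)[of K L M]
  note [simp] = mhomD(3-5)[OF ascm(1)[of K L "tm M N"]] mhomD(3-5)[OF ascm(1)[of "tm K L" M N]]
    mhomD(3-5)[OF ascm(1)[of K "tm L M" N]] mhomD(3-5)[OF aL] mhomD(3-5)[OF aK]
    tarm_simps[OF iK aL] tarm_simps[OF aK iN]
  let ?W = "fst K" and ?X = "fst L" and ?Y = "fst M" and ?Z = "fst N"
  let ?t = "(tp K L \<odot> idm T ?Y) \<odot> idm T ?Z"
  let ?top = "tp3 (tm K L) M N \<cdot> ?t"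
  let ?aK = "asc T ?W ?X ?Y" and ?aL = "asc T ?X ?Y ?Z"
  let ?R = "tarm K K (idm T ?W) (tm (tm L M) N) (tm L (tm M N)) (ascm L M N)"
  let ?S = "tarm (tm (tm K L) M) (tm K (tm L M)) (ascm K L M) N N (idm T ?Z)"
  have ep: "is_epi T ?top"
    by (rule epi_cmp[OF _ tp3_epi(1)], rule split_epi[of _ "(sec K L \<odot> idm T ?Y) \<odot> idm T ?Z"]) simp_all
  have 1: "asc T (fst (tm K L)) ?Y ?Z \<cdot> ?t = (tp K L \<odot> idm T (?Y \<otimes> ?Z)) \<cdot> asc T (?W \<otimes> ?X) ?Y ?Z"
    using asc_nat[of "tp K L" "idm T ?Y" "idm T ?Z"] by simp
  have 2: "asc T ?W ?X (fst (tm M N)) \<cdot> (idm T (?W \<otimes> ?X) \<odot> tp M N)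
      = (idm T ?W \<odot> (idm T ?X \<odot> tp M N)) \<cdot> asc T ?W ?X (?Y \<otimes> ?Z)"
    using asc_nat[of "idm T ?W" "idm T ?X" "tp M N"] by simp
  have 3: "asc T ?W (fst (tm L M)) ?Z \<cdot> ((idm T ?W \<odot> tp L M) \<odot> idm T ?Z)
      = (idm T ?W \<odot> (tp L M \<odot> idm T ?Z)) \<cdot> asc T ?W (?X \<otimes> ?Y) ?Z"
    using asc_nat[of "idm T ?W" "tp L M" "idm T ?Z"] by simp
  have "ascm K L (tm M N) \<cdot> ascm (tm K L) M N \<cdot> ?top
      = ascm K L (tm M N) \<cdot> ((ascm (tm K L) M N \<cdot> tp3 (tm K L) M N) \<cdot> ?t)" by simp
  also have "\<dots> = ascm K L (tm M N) \<cdot> (tp3' (tm K L) M N \<cdot> (asc T (fst (tm K L)) ?Y ?Z \<cdot> ?t))"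
    by (simp add: ascm(2))
  also have "\<dots> = (ascm K L (tm M N) \<cdot> tp3 K L (tm M N)) \<cdot> ((idm T (?W \<otimes> ?X) \<odot> tp M N) \<cdot> asc T (?W \<otimes> ?X) ?Y ?Z)"
    unfolding 1 by (simp add: tp3_def tp3'_def)
  also have "\<dots> = tp3' K L (tm M N) \<cdot> ((asc T ?W ?X (fst (tm M N)) \<cdot> (idm T (?W \<otimes> ?X) \<odot> tp M N)) \<cdot> asc T (?W \<otimes> ?X) ?Y ?Z)"
    by (simp add: ascm(2))
  also have "\<dots> = tp K (tm L (tm M N)) \<cdot> ((idm T ?W \<odot> tp3' L M N) \<cdot> (asc T ?W ?X (?Y \<otimes> ?Z) \<cdot> asc T (?W \<otimes> ?X) ?Y ?Z))"
    unfolding 2 by (simp add: tp3'_def)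
  finally have l: "ascm K L (tm M N) \<cdot> ascm (tm K L) M N \<cdot> ?top
    = tp K (tm L (tm M N)) \<cdot> ((idm T ?W \<odot> tp3' L M N) \<cdot> (asc T ?W ?X (?Y \<otimes> ?Z) \<cdot> asc T (?W \<otimes> ?X) ?Y ?Z))" .
  have "?R \<cdot> (ascm K (tm L M) N \<cdot> ?S) \<cdot> ?top
      = ?R \<cdot> (ascm K (tm L M) N \<cdot> (?S \<cdot> (tp (tm (tm K L) M) N \<cdot> (tp3 K L M \<odot> idm T ?Z))))"
    by (simp add: tp3_def)
  also have "?S \<cdot> (tp (tm (tm K L) M) N \<cdot> (tp3 K L M \<odot> idm T ?Z))
      = tp (tm K (tm L M)) N \<cdot> ((ascm K L M \<cdot> tp3 K L M) \<odot> idm T ?Z)"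
    by (simp add: tarm_tp_assoc[OF aK iN])
  also have "\<dots> = tp3 K (tm L M) N \<cdot> (((idm T ?W \<odot> tp L M) \<odot> idm T ?Z) \<cdot> (?aK \<odot> idm T ?Z))"
    by (simp add: ascm_tp3 tp3_def tp3'_def)
  also have "ascm K (tm L M) N \<cdot> (tp3 K (tm L M) N \<cdot> (((idm T ?W \<odot> tp L M) \<odot> idm T ?Z) \<cdot> (?aK \<odot> idm T ?Z)))
      = (ascm K (tm L M) N \<cdot> tp3 K (tm L M) N) \<cdot> (((idm T ?W \<odot> tp L M) \<odot> idm T ?Z) \<cdot> (?aK \<odot> idm T ?Z))"
    by simp
  also have "\<dots> = tp3' K (tm L M) N \<cdot> ((asc T ?W (fst (tm L M)) ?Z \<cdot> ((idm T ?W \<odot> tp L M) \<odot> idm T ?Z)) \<cdot> (?aK \<odot> idm T ?Z))"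
    unfolding ascm(2)[OF assms(1) tm_in_mods[OF assms(2,3)] assms(4)] by simp
  also have "\<dots> = tp K (tm (tm L M) N) \<cdot> ((idm T ?W \<odot> tp3 L M N) \<cdot> (asc T ?W (?X \<otimes> ?Y) ?Z \<cdot> (?aK \<odot> idm T ?Z)))"
    unfolding 3 by (simp add: tp3_def tp3'_def)
  also have "?R \<cdot> (tp K (tm (tm L M) N) \<cdot> ((idm T ?W \<odot> tp3 L M N) \<cdot> (asc T ?W (?X \<otimes> ?Y) ?Z \<cdot> (?aK \<odot> idm T ?Z))))
      = tp K (tm L (tm M N)) \<cdot> ((idm T ?W \<odot> (ascm L M N \<cdot> tp3 L M N)) \<cdot> (asc T ?W (?X \<otimes> ?Y) ?Z \<cdot> (?aK \<odot> idm T ?Z)))"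
    by (simp add: tarm_tp_assoc[OF iK aL])
  also have "\<dots> = tp K (tm L (tm M N)) \<cdot> ((idm T ?W \<odot> tp3' L M N) \<cdot>
      ((idm T ?W \<odot> ?aL) \<cdot> (asc T ?W (?X \<otimes> ?Y) ?Z \<cdot> (?aK \<odot> idm T ?Z))))"
    by (simp add: ascm(2))
  also have "(idm T ?W \<odot> ?aL) \<cdot> (asc T ?W (?X \<otimes> ?Y) ?Z \<cdot> (?aK \<odot> idm T ?Z))
      = asc T ?W ?X (?Y \<otimes> ?Z) \<cdot> asc T (?W \<otimes> ?X) ?Y ?Z"
    using pentagon[of ?W ?X ?Y ?Z] by simp
  finally have r: "?R \<cdot> (ascm K (tm L M) N \<cdot> ?S) \<cdot> ?top
    = tp K (tm L (tm M N)) \<cdot> ((idm T ?W \<odot> tp3' L M N) \<cdot> (asc T ?W ?X (?Y \<otimes> ?Z) \<cdot> asc T (?W \<otimes> ?X) ?Y ?Z))" .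
  have "ascm K L (tm M N) \<cdot> ascm (tm K L) M N = ?R \<cdot> (ascm K (tm L M) N \<cdot> ?S)"
    by (rule epi_cancel[OF ep], unfold l r) simp_all
  then show ?thesis by simp
qed

text \<open>After precomposition with \<open>tp3 M U N\<close> the identity becomes the statement
  that \<open>tp M N\<close> coequalizes the two actions, in the arrow form given by
  \<open>balanced_iff\<close>.\<close>

lemma triangle_Q:
  assumes [simp]: "M \<in> mods" "N \<in> mods"
  shows "tarm M M (idm T (fst M)) (tm U N) N (lunm N) \<cdot> ascm M U N
    = tarm (tm M U) M (runm M) N N (idm T (fst N))"
proof -
  have iM: "mhom M M (idm T (fst M))" and iN: "mhom N N (idm T (fst N))" by simp_all
  note l = lunm(1)[of N] and r = runm(1)[of M]
  note [simp] = mhomD(3-5)[OF l] mhomD(3-5)[OF r] mhomD(3-5)[OF ascm(1)[of M U N]]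
    tarm_simps[OF iM l] tarm_simps[OF r iN]
  have b: "tp M N \<cdot> (snd M \<odot> idm T (fst N)) =
      tp M N \<cdot> ((idm T (fst M) \<odot> (snd N \<cdot> bra T A (fst N))) \<cdot> asc T (fst M) A (fst N))"
    using balanced_iff[of M N "tp M N"] ten_proj_split(1)[of M N] by simp
  show ?thesis
  proof (rule epi_cancel[OF tp3_epi(1)[of M U N]])
    have "tarm M M (idm T (fst M)) (tm U N) N (lunm N) \<cdot> ascm M U N \<cdot> tp3 M U N
        = tarm M M (idm T (fst M)) (tm U N) N (lunm N) \<cdot> (tp M (tm U N) \<cdot>
            ((idm T (fst M) \<odot> tp U N) \<cdot> asc T (fst M) A (fst N)))"
      by (simp add: ascm(2) tp3'_def)
    also have "\<dots> = tp M N \<cdot> ((idm T (fst M) \<odot> (lunm N \<cdot> tp U N)) \<cdot> asc T (fst M) A (fst N))"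
      by (simp add: tarm_tp_assoc[OF iM l])
    also have "\<dots> = tp M N \<cdot> (snd M \<odot> idm T (fst N))"
      unfolding b lunm(2)[OF assms(2)] ..
    also have "\<dots> = tarm (tm M U) M (runm M) N N (idm T (fst N)) \<cdot> tp3 M U N"
      by (simp add: tp3_def tarm_tp_assoc[OF r iN] runm(2))
    finally show "tarm M M (idm T (fst M)) (tm U N) N (lunm N) \<cdot> ascm M U N \<cdot> tp3 M U N
      = tarm (tm M U) M (runm M) N N (idm T (fst N)) \<cdot> tp3 M U N" .
  qed simp_all
qed

lemma hexagon_Q:
  assumes [simp]: "L \<in> mods" "M \<in> mods" "N \<in> mods"
  shows "ascm M N L \<cdot> bram L (tm M N) \<cdot> ascm L M N
    = tarm M M (idm T (fst M)) (tm L N) (tm N L) (bram L N) \<cdot>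
      ascm M L N \<cdot> tarm (tm L M) (tm M L) (bram L M) N N (idm T (fst N))"
proof -
  have iM: "mhom M M (idm T (fst M))" and iN: "mhom N N (idm T (fst N))" by simp_all
  note bLN = bram(1)[of L N] and bLM = bram(1)[of L M]
  note [simp] = mhomD(3-5)[OF bLN] mhomD(3-5)[OF bLM] mhomD(3-5)[OF bram(1)[of L "tm M N"]]
    mhomD(3-5)[OF ascm(1)[of L M N]] mhomD(3-5)[OF ascm(1)[of M N L]] mhomD(3-5)[OF ascm(1)[of M L N]]
    tarm_simps[OF iM bLN] tarm_simps[OF bLM iN]
  let ?X = "fst L" and ?Y = "fst M" and ?Z = "fst N"
  let ?R = "tarm M M (idm T ?Y) (tm L N) (tm N L) (bram L N)"
  let ?S = "tarm (tm L M) (tm M L) (bram L M) N N (idm T ?Z)"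
  have 1: "bra T ?X (fst (tm M N)) \<cdot> (idm T ?X \<odot> tp M N) = (tp M N \<odot> idm T ?X) \<cdot> bra T ?X (?Y \<otimes> ?Z)"
    using bra_nat[of "idm T ?X" "tp M N"] by simp
  have "ascm M N L \<cdot> (bram L (tm M N) \<cdot> ascm L M N) \<cdot> tp3 L M N
      = ascm M N L \<cdot> ((bram L (tm M N) \<cdot> tp L (tm M N)) \<cdot> ((idm T ?X \<odot> tp M N) \<cdot> asc T ?X ?Y ?Z))"
    by (simp add: ascm(2) tp3'_def)
  also have "\<dots> = ascm M N L \<cdot> (tp (tm M N) L \<cdot> ((bra T ?X (fst (tm M N)) \<cdot> (idm T ?X \<odot> tp M N)) \<cdot> asc T ?X ?Y ?Z))"
    by (simp add: bram(2))
  also have "\<dots> = (ascm M N L \<cdot> tp3 M N L) \<cdot> (bra T ?X (?Y \<otimes> ?Z) \<cdot> asc T ?X ?Y ?Z)"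
    unfolding 1 by (simp add: tp3_def)
  also have "\<dots> = tp3' M N L \<cdot> (asc T ?Y ?Z ?X \<cdot> (bra T ?X (?Y \<otimes> ?Z) \<cdot> asc T ?X ?Y ?Z))"
    by (simp add: ascm(2))
  also have "asc T ?Y ?Z ?X \<cdot> (bra T ?X (?Y \<otimes> ?Z) \<cdot> asc T ?X ?Y ?Z)
      = (idm T ?Y \<odot> bra T ?X ?Z) \<cdot> (asc T ?Y ?X ?Z \<cdot> (bra T ?X ?Y \<odot> idm T ?Z))"
    using hexagon[of ?X ?Y ?Z] by simp
  finally have l: "ascm M N L \<cdot> (bram L (tm M N) \<cdot> ascm L M N) \<cdot> tp3 L M N
    = tp3' M N L \<cdot> ((idm T ?Y \<odot> bra T ?X ?Z) \<cdot> (asc T ?Y ?X ?Z \<cdot> (bra T ?X ?Y \<odot> idm T ?Z)))" .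
  have "?R \<cdot> (ascm M L N \<cdot> ?S) \<cdot> tp3 L M N = ?R \<cdot> (ascm M L N \<cdot> (tp (tm M L) N \<cdot> ((bram L M \<cdot> tp L M) \<odot> idm T ?Z)))"
    by (simp add: tp3_def tarm_tp_assoc[OF bLM iN])
  also have "\<dots> = ?R \<cdot> ((ascm M L N \<cdot> tp3 M L N) \<cdot> (bra T ?X ?Y \<odot> idm T ?Z))"
    by (simp add: tp3_def bram(2))
  also have "\<dots> = ?R \<cdot> (tp M (tm L N) \<cdot> ((idm T ?Y \<odot> tp L N) \<cdot> (asc T ?Y ?X ?Z \<cdot> (bra T ?X ?Y \<odot> idm T ?Z))))"
    by (simp add: ascm(2) tp3'_def)
  also have "\<dots> = tp M (tm N L) \<cdot> ((idm T ?Y \<odot> (bram L N \<cdot> tp L N)) \<cdot> (asc T ?Y ?X ?Z \<cdot> (bra T ?X ?Y \<odot> idm T ?Z)))"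
    by (simp add: tarm_tp_assoc[OF iM bLN])
  also have "\<dots> = tp3' M N L \<cdot> ((idm T ?Y \<odot> bra T ?X ?Z) \<cdot> (asc T ?Y ?X ?Z \<cdot> (bra T ?X ?Y \<odot> idm T ?Z)))"
    by (simp add: bram(2) tp3'_def)
  finally have r: "?R \<cdot> (ascm M L N \<cdot> ?S) \<cdot> tp3 L M N
    = tp3' M N L \<cdot> ((idm T ?Y \<odot> bra T ?X ?Z) \<cdot> (asc T ?Y ?X ?Z \<cdot> (bra T ?X ?Y \<odot> idm T ?Z)))" .
  have "ascm M N L \<cdot> (bram L (tm M N) \<cdot> ascm L M N) = ?R \<cdot> (ascm M L N \<cdot> ?S)"
    by (rule epi_cancel[OF tp3_epi(1)[of L M N]], unfold l r) simp_all
  then show ?thesis by simp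
qed

lemma symmetry_Q:
  assumes [simp]: "M \<in> mods" "N \<in> mods"
  shows "bram N M \<cdot> bram M N = idm T (fst (tm M N))"
proof -
  note [simp] = mhomD(3-5)[OF bram(1)[of M N]] mhomD(3-5)[OF bram(1)[of N M]]
  show ?thesis
    by (rule epi_cancel[OF tp_epi[of M N]]) (simp_all add: bram(2) reassoc[OF bram(2)])
qed

lemma tensor_category_Q: "linear_tensor_category Q"
proof (intro linear_tensor_category.intro linear_category_Q linear_tensor_category_axioms.intro)
  note [elim!] = hom_QE and [simp del] = in_hom
  have h: "(M, N, f) \<in> hom Q M' N' \<longleftrightarrow> M = M' \<and> N = N' \<and> mhom M N f" for M N M' N' f
    unfolding in_hom by auto
  note [simp] = h
  fix K L M N M' N' M'' N'' :: "('o, 'm) md" and x x' y y' and a :: 'l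
  show "M \<otimes>\<^bsub>Q\<^esub> N \<in> obj Q" if "M \<in> obj Q" "N \<in> obj Q" using that by simp
  show "x \<odot>\<^bsub>Q\<^esub> y \<in> hom Q (M \<otimes>\<^bsub>Q\<^esub> N) (M' \<otimes>\<^bsub>Q\<^esub> N')" if "x \<in> hom Q M M'" "y \<in> hom Q N N'"
    using that by (auto intro: tarm)
  show "idm Q M \<odot>\<^bsub>Q\<^esub> idm Q N = idm Q (M \<otimes>\<^bsub>Q\<^esub> N)" if "M \<in> obj Q" "N \<in> obj Q"
    using that by (auto intro!: tarm_eqI) (use mhom_id[of "tm M N"] in simp)
  show "(x' \<cdot>\<^bsub>Q\<^esub> x) \<odot>\<^bsub>Q\<^esub> (y' \<cdot>\<^bsub>Q\<^esub> y) = (x' \<odot>\<^bsub>Q\<^esub> y') \<cdot>\<^bsub>Q\<^esub> (x \<odot>\<^bsub>Q\<^esub> y)"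
    if "x \<in> hom Q M M'" "x' \<in> hom Q M' M''" "y \<in> hom Q N N'" "y' \<in> hom Q N' N''"
  proof -
    from that obtain f f' g g' where e: "x = (M, M', f)" "x' = (M', M'', f')" "y = (N, N', g)" "y' = (N', N'', g')"
      and f: "mhom M M' f" and f': "mhom M' M'' f'" and g: "mhom N N' g" and g': "mhom N' N'' g'" by blast
    note [simp] = mhomD(1-5)[OF f] mhomD(2-5)[OF f'] mhomD(1-5)[OF g] mhomD(2-5)[OF g']
      tarm_simps[OF f g] tarm_simps[OF f' g']
    have "tarm M M'' (f' \<cdot> f) N N'' (g' \<cdot> g) = tarm M' M'' f' N' N'' g' \<cdot> tarm M M' f N N' g"
      by (rule tarm_eqI[OF mhom_cmp[OF f f'] mhom_cmp[OF g g'] mhom_cmp[OF tarm(1)[OF f g] tarm(1)[OF f' g']]])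
        (simp add: tarm(2)[OF f g] tarm_tp_assoc[OF f' g'])
    then show ?thesis by (simp add: e)
  qed
  show "(x \<oplus>\<^bsub>Q\<^esub> x') \<odot>\<^bsub>Q\<^esub> y = x \<odot>\<^bsub>Q\<^esub> y \<oplus>\<^bsub>Q\<^esub> x' \<odot>\<^bsub>Q\<^esub> y"
    if "x \<in> hom Q M M'" "x' \<in> hom Q M M'" "y \<in> hom Q N N'"
  proof -
    from that obtain f f' g where e: "x = (M, M', f)" "x' = (M, M', f')" "y = (N, N', g)"
      and f: "mhom M M' f" and f': "mhom M M' f'" and g: "mhom N N' g" by blast
    note [simp] = mhomD(1-5)[OF f] mhomD(2-5)[OF f'] mhomD(1-5)[OF g] tarm_simps[OF f g] tarm_simps[OF f' g]
    have "tarm M M' (f \<oplus> f') N N' g = tarm M M' f N N' g \<oplus> tarm M M' f' N N' g"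
      by (rule tarm_eqI[OF mhom_add[OF f f'] g mhom_add[OF tarm(1)[OF f g] tarm(1)[OF f' g]]])
        (simp add: tarm(2)[OF f g] tarm(2)[OF f' g])
    then show ?thesis by (simp add: e)
  qed
  show "x \<odot>\<^bsub>Q\<^esub> (y \<oplus>\<^bsub>Q\<^esub> y') = x \<odot>\<^bsub>Q\<^esub> y \<oplus>\<^bsub>Q\<^esub> x \<odot>\<^bsub>Q\<^esub> y'"
    if "x \<in> hom Q M M'" "y \<in> hom Q N N'" "y' \<in> hom Q N N'"
  proof -
    from that obtain f g g' where e: "x = (M, M', f)" "y = (N, N', g)" "y' = (N, N', g')"
      and f: "mhom M M' f" and g: "mhom N N' g" and g': "mhom N N' g'" by blast
    note [simp] = mhomD(1-5)[OF f] mhomD(2-5)[OF g'] mhomD(1-5)[OF g] tarm_simps[OF f g] tarm_simps[OF f g']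
    have "tarm M M' f N N' (g \<oplus> g') = tarm M M' f N N' g \<oplus> tarm M M' f N N' g'"
      by (rule tarm_eqI[OF f mhom_add[OF g g'] mhom_add[OF tarm(1)[OF f g] tarm(1)[OF f g']]])
        (simp add: tarm(2)[OF f g] tarm(2)[OF f g'])
    then show ?thesis by (simp add: e)
  qed
  show "scl Q a x \<odot>\<^bsub>Q\<^esub> y = scl Q a (x \<odot>\<^bsub>Q\<^esub> y)" if "x \<in> hom Q M M'" "y \<in> hom Q N N'"
  proof -
    from that obtain f g where e: "x = (M, M', f)" "y = (N, N', g)"
      and f: "mhom M M' f" and g: "mhom N N' g" by blast
    note [simp] = mhomD(1-5)[OF f] mhomD(1-5)[OF g] tarm_simps[OF f g]
    have "tarm M M' (f \<cdot> act a M) N N' g = tarm M M' f N N' g \<cdot> act a (tm M N)"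
      by (rule tarm_eqI[OF mhom_cmp_act[OF f] g mhom_cmp_act[OF tarm(1)[OF f g]]])
        (simp add: act_tm tarm_tp_assoc[OF f g])
    then show ?thesis by (simp add: e)
  qed
  show "x \<odot>\<^bsub>Q\<^esub> scl Q a y = scl Q a (x \<odot>\<^bsub>Q\<^esub> y)" if "x \<in> hom Q M M'" "y \<in> hom Q N N'"
  proof -
    from that obtain f g where e: "x = (M, M', f)" "y = (N, N', g)"
      and f: "mhom M M' f" and g: "mhom N N' g" by blast
    note [simp] = mhomD(1-5)[OF f] mhomD(1-5)[OF g] tarm_simps[OF f g]
    have "tarm M M' f N N' (g \<cdot> act a N) = tarm M M' f N N' g \<cdot> act a (tm M N)"
      by (rule tarm_eqI[OF f mhom_cmp_act[OF g] mhom_cmp_act[OF tarm(1)[OF f g]]])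
        (simp add: tm_module(2) tarm_tp_assoc[OF f g])
    then show ?thesis by (simp add: e)
  qed
  show "unt Q \<in> obj Q" by simp
  show "asc Q L M N \<in> hom Q (L \<otimes>\<^bsub>Q\<^esub> M \<otimes>\<^bsub>Q\<^esub> N) (L \<otimes>\<^bsub>Q\<^esub> (M \<otimes>\<^bsub>Q\<^esub> N))" "is_iso Q (asc Q L M N)"
    if "L \<in> obj Q" "M \<in> obj Q" "N \<in> obj Q"
    using that iso_mhom(2)[OF ascm(1,3)] by (simp_all add: ascm(1))
  show "asc Q M' N' N'' \<cdot>\<^bsub>Q\<^esub> (x \<odot>\<^bsub>Q\<^esub> y \<odot>\<^bsub>Q\<^esub> y') = (x \<odot>\<^bsub>Q\<^esub> (y \<odot>\<^bsub>Q\<^esub> y')) \<cdot>\<^bsub>Q\<^esub> asc Q M N M''"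
    if "x \<in> hom Q M M'" "y \<in> hom Q N N'" "y' \<in> hom Q M'' N''"
    using that by (auto simp: ascm_nat)
  show "lun Q M \<in> hom Q (unt Q \<otimes>\<^bsub>Q\<^esub> M) M" "is_iso Q (lun Q M)" if "M \<in> obj Q"
    using that iso_mhom(2)[OF lunm(1,3)] by (simp_all add: lunm(1))
  show "run Q M \<in> hom Q (M \<otimes>\<^bsub>Q\<^esub> unt Q) M" "is_iso Q (run Q M)" if "M \<in> obj Q"
    using that iso_mhom(2)[OF runm(1,3)] by (simp_all add: runm(1))
  show "lun Q N \<cdot>\<^bsub>Q\<^esub> (idm Q (unt Q) \<odot>\<^bsub>Q\<^esub> x) = x \<cdot>\<^bsub>Q\<^esub> lun Q M" if "x \<in> hom Q M N"
    using that by (auto simp: lunm_nat)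
  show "run Q N \<cdot>\<^bsub>Q\<^esub> (x \<odot>\<^bsub>Q\<^esub> idm Q (unt Q)) = x \<cdot>\<^bsub>Q\<^esub> run Q M" if "x \<in> hom Q M N"
    using that by (auto simp: runm_nat)
  show "bra Q M N \<in> hom Q (M \<otimes>\<^bsub>Q\<^esub> N) (N \<otimes>\<^bsub>Q\<^esub> M)" if "M \<in> obj Q" "N \<in> obj Q"
    using that by (simp add: bram(1))
  show "bra Q M' N' \<cdot>\<^bsub>Q\<^esub> (x \<odot>\<^bsub>Q\<^esub> y) = (y \<odot>\<^bsub>Q\<^esub> x) \<cdot>\<^bsub>Q\<^esub> bra Q M N" if "x \<in> hom Q M M'" "y \<in> hom Q N N'"
    using that by (auto simp: bram_nat)
  show "asc Q K L (M \<otimes>\<^bsub>Q\<^esub> N) \<cdot>\<^bsub>Q\<^esub> asc Q (K \<otimes>\<^bsub>Q\<^esub> L) M N =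
      (idm Q K \<odot>\<^bsub>Q\<^esub> asc Q L M N) \<cdot>\<^bsub>Q\<^esub> asc Q K (L \<otimes>\<^bsub>Q\<^esub> M) N \<cdot>\<^bsub>Q\<^esub> (asc Q K L M \<odot>\<^bsub>Q\<^esub> idm Q N)"
    if "K \<in> obj Q" "L \<in> obj Q" "M \<in> obj Q" "N \<in> obj Q"
    using that by (simp add: pentagon_Q)
  show "(idm Q M \<odot>\<^bsub>Q\<^esub> lun Q N) \<cdot>\<^bsub>Q\<^esub> asc Q M (unt Q) N = run Q M \<odot>\<^bsub>Q\<^esub> idm Q N"
    if "M \<in> obj Q" "N \<in> obj Q"
    using that by (simp add: triangle_Q)
  show "asc Q M N L \<cdot>\<^bsub>Q\<^esub> bra Q L (M \<otimes>\<^bsub>Q\<^esub> N) \<cdot>\<^bsub>Q\<^esub> asc Q L M N =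
      (idm Q M \<odot>\<^bsub>Q\<^esub> bra Q L N) \<cdot>\<^bsub>Q\<^esub> asc Q M L N \<cdot>\<^bsub>Q\<^esub> (bra Q L M \<odot>\<^bsub>Q\<^esub> idm Q N)"
    if "L \<in> obj Q" "M \<in> obj Q" "N \<in> obj Q"
    using that by (simp add: hexagon_Q)
  show "bra Q N M \<cdot>\<^bsub>Q\<^esub> bra Q M N = idm Q (M \<otimes>\<^bsub>Q\<^esub> N)" if "M \<in> obj Q" "N \<in> obj Q"
    using that by (simp add: symmetry_Q)
qed

end

section \<open>Rigidity of the category of modules\<close>

context base_extension
begin

sublocale Q: abelian_tensor_category Q
  by (intro abelian_tensor_category.intro abelian_Q tensor_category_Q)

text \<open>The projections of \<open>A\<close> turn \<open>j c\<close> into the coordinates of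
  \<open>c\<close>, and distinct scalars are distinct endomorphisms of the unit.\<close>

lemma j_inj: "j c = j d \<Longrightarrow> c = d"
proof -
  assume e: "j c = j d"
  obtain n b co where bas: "basis n b co" using basis_exists by blast
  obtain p where p: "\<And>l c. p l \<cdot> j c = scl T (co l c) (idm T (unt T))"
    by (rule A_direct_sum[OF bas]) (rule that)
  have "inj (\<lambda>a. scl T a (idm T (unt T)))" using End_unt by (simp add: bij_betw_def)
  moreover have "scl T (co l c) (idm T (unt T)) = scl T (co l d) (idm T (unt T))" for l
    using p[of l c] p[of l d] e by simp
  ultimately have "co l c = co l d" for l by (rule injD)
  then show "c = d" using basisD(4)[OF bas, of c] basisD(4)[OF bas, of d] by simp
qed

text \<open>\<open>End(I) = k\<close> makes the components of \<open>z\<close> scalars, and these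
  are the coordinates of the desired element of \<open>K\<close>.\<close>

lemma hom_unt_A:
  assumes z: "z \<in> hom T (unt T) A"
  obtains c where "z = j c"
proof -
  let ?I = "unt T"
  have z' [simp]: "z \<in> arr T" "src T z = ?I" "tgt T z = A" using z by auto
  obtain n b co where bas: "basis n b co" using basis_exists by blast
  obtain p where p: "is_direct_sum T n (\<lambda>_. ?I) A (\<lambda>l. j (b l)) p"
    "\<And>l. p l \<in> hom T A ?I" by (rule A_direct_sum[OF bas]) (rule that)
  have "\<exists>a. p l \<cdot> z = scl T a (idm T ?I)" for l
  proof -
    have "p l \<cdot> z \<in> hom T ?I ?I" using p(2)[of l] by simp
    then have "p l \<cdot> z \<in> range (\<lambda>a. scl T a (idm T ?I))" using End_unt unfolding bij_betw_def by blast
    then show ?thesis by blast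
  qed
  then obtain a where a: "\<And>l. p l \<cdot> z = scl T (a l) (idm T ?I)" by metis
  have "z = arr_sum T ?I A (\<lambda>l. j (b l) \<cdot> (p l \<cdot> z)) n"
    using direct_sum_expand_left[OF p(1) z'(1,3)] by simp
  also have "\<dots> = arr_sum T ?I A (\<lambda>l. scl T (a l) (j (b l))) n"
    by (intro arr_sum_cong) (simp add: a)
  also have "\<dots> = j (\<Sum>l<n. \<iota> (a l) * b l)" using k_linear_sum[OF j_linear, of a b n] by simp
  finally show thesis by (rule that)
qed

text \<open>The unit module is free on the unit object, with \<open>z\<close> as the image of the
  element \<open>1\<close>; \<open>U_ext\<close> is the corresponding uniqueness.\<close>

lemma from_U:
  assumes P [simp]: "P \<in> mods" and z: "z \<in> arr T" "src T z = unt T" "tgt T z = fst P"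
  obtains u where "mhom U P u" "\<And>c. u \<cdot> j c = act c P \<cdot> z"
proof -
  note [simp] = z
  have "k_linear (unt T) (fst P) (\<lambda>c. act c P \<cdot> z)"
    by (simp add: k_linear_def act_add act_mult[symmetric] act_emb)
  then obtain u where u: "u \<in> arr T" "src T u = A" "tgt T u = fst P" "\<And>c. u \<cdot> j c = act c P \<cdot> z"
    using A_out by blast
  have "u \<cdot> act c U = act c P \<cdot> u" for c
    by (rule A_ext) (use u in \<open>simp_all add: act_U reassoc[OF act_mult] mult.commute\<close>)
  then have "mhom U P u" using u by (simp add: mhom_def)
  then show thesis using u(4) by (rule that)
qed

lemma U_ext:
  assumes u: "mhom U P u" and v: "mhom U P v" and e: "u \<cdot> j 1 = v \<cdot> j 1"
  shows "u = v"
proof (rule A_ext)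
  note [simp] = mhomD(1-5)[OF u] mhomD(3-5)[OF v]
  have *: "w \<cdot> j c = act c P \<cdot> (w \<cdot> j 1)" if w: "mhom U P w" for w c
  proof -
    note [simp] = mhomD(3-5)[OF w]
    have "w \<cdot> j c = w \<cdot> (act c U \<cdot> j 1)" by (simp add: act_U)
    also have "\<dots> = (w \<cdot> act c U) \<cdot> j 1" by simp
    finally show ?thesis unfolding mhomD(6)[OF w] by simp
  qed
  show "u \<cdot> j c = v \<cdot> j c" for c
    unfolding *[OF u, of c] *[OF v, of c] e ..
qed (use mhomD[OF u] mhomD[OF v] in simp_all)

text \<open>A linear endomorphism of \<open>U\<close> is determined by its value at
  \<open>1\<close>, which is an arrow \<open>I \<rightarrow> A\<close> and so an element of
  \<open>K\<close>.\<close>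

lemma End_Q: "bij_betw (\<lambda>c. scl Q c (idm Q (unt Q))) UNIV (hom Q (unt Q) (unt Q))"
  unfolding bij_betw_def
proof
  have s: "scl Q c (idm Q (unt Q)) = (U, U, act c U)" for c by simp
  show "inj (\<lambda>c. scl Q c (idm Q (unt Q)))"
  proof (rule injI)
    fix c d assume "scl Q c (idm Q (unt Q)) = scl Q d (idm Q (unt Q))"
    then have "act c U \<cdot> j 1 = act d U \<cdot> j 1" unfolding s by simp
    then show "c = d" by (intro j_inj) (simp add: act_U)
  qed
  show "range (\<lambda>c. scl Q c (idm Q (unt Q))) = hom Q (unt Q) (unt Q)"
  proof
    show "range (\<lambda>c. scl Q c (idm Q (unt Q))) \<subseteq> hom Q (unt Q) (unt Q)"
      unfolding s using mhom_act[of U] by auto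
    show "hom Q (unt Q) (unt Q) \<subseteq> range (\<lambda>c. scl Q c (idm Q (unt Q)))"
    proof
      fix x assume "x \<in> hom Q (unt Q) (unt Q)"
      then obtain f where f: "x = (U, U, f)" "mhom U U f" by (auto elim: hom_QE simp del: in_hom)
      note [simp] = mhomD(3-5)[OF f(2)]
      obtain c where c: "f \<cdot> j 1 = j c" using hom_unt_A[of "f \<cdot> j 1"] by auto
      have "f = act c U"
        by (rule U_ext[OF f(2) mhom_act]) (simp_all add: c act_U)
      then show "x \<in> range (\<lambda>c. scl Q c (idm Q (unt Q)))" unfolding s f(1) by blast
    qed
  qed
qed

lemma sec_linear:
  assumes M [simp]: "M \<in> mods" and N [simp]: "N \<in> mods"
  shows "(idm T (fst M) \<odot> act c N) \<cdot> sec M N = sec M N \<cdot> act c (tm M N)"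
proof (rule epi_cancel[OF tp_epi[OF M N]])
  interpret c: commuting_actions \<iota> T "fst M \<otimes> fst N" "\<lambda>c. act c M \<odot> idm T (fst N)" "\<lambda>c. idm T (fst M) \<odot> act c N"
    by (rule commuting_modules[OF M N])
  show "(idm T (fst M) \<odot> act c N) \<cdot> sec M N \<cdot> tp M N = sec M N \<cdot> act c (tm M N) \<cdot> tp M N"
    using c.top_\<sigma>[OF sec_tensor_op[OF M N], of c] by (simp add: tm_module(2))
qed simp_all

lemma act_Fr: "X \<in> obj T \<Longrightarrow> act c (Fr X) = idm T X \<odot> act c U"
  by (rule act_free)

lemma snd_mhom: "M \<in> mods \<Longrightarrow> mhom (Fr (fst M)) M (snd M)"
  by (simp add: mhom_def act_Fr runm(5))

text \<open>The isomorphism of \<open>M \<otimes>\<^sub>K U\<close> with \<open>M\<close> turns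
  \<open>tp M U\<close> into the action map, so the linear section \<open>sec M U\<close> splits the
  action. Hence every module is a direct summand of a free one.\<close>

lemma free_section:
  assumes M [simp]: "M \<in> mods"
  obtains s where "mhom M (Fr (fst M)) s" "snd M \<cdot> s = idm T (fst M)"
proof -
  note I = iso_mhom(1)[OF runm(1)[OF M] runm(3)[OF M]]
  note [simp] = mhomD(3-5)[OF runm(1)[OF M]] runm(3)[OF M]
  define s where "s = sec M U \<cdot> inv_arr T (runm M)"
  have [simp]: "s \<in> arr T" "src T s = fst M" "tgt T s = fst M \<otimes> A" by (simp_all add: s_def)
  have "(idm T (fst M) \<odot> act c U) \<cdot> s = s \<cdot> act c M" for c
    using reassoc[OF sec_linear[OF M U_module, of c], of "inv_arr T (runm M)"] mhomD(6)[OF I, of c]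
    by (simp add: s_def)
  then have 1: "mhom M (Fr (fst M)) s" by (simp add: mhom_def act_Fr)
  have "snd M \<cdot> s = (runm M \<cdot> tp M U) \<cdot> s" by (simp only: runm(2)[OF M])
  also have "\<dots> = runm M \<cdot> ((tp M U \<cdot> sec M U) \<cdot> inv_arr T (runm M))"
    unfolding s_def by (simp del: sec_simps(4))
  also have "\<dots> = idm T (fst M)" by simp
  finally show thesis using that[OF 1] by simp
qed

text \<open>The inverse of \<open>lunm\<close> is \<open>x \<mapsto> 1 \<otimes> x\<close>, so
  equality on these elements already gives equality.\<close>

lemma tensor_U_ext:
  assumes u: "mhom (tm U M) P u" and v: "mhom (tm U M) P v" and M [simp]: "M \<in> mods"
    and e: "u \<cdot> tp U M \<cdot> (j 1 \<odot> idm T (fst M)) = v \<cdot> tp U M \<cdot> (j 1 \<odot> idm T (fst M))"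
  shows "u = v"
proof (rule iso_cancel_right[OF iso_inv[OF lunm(3)[OF M]]])
  note [simp] = mhomD(2-5)[OF u] mhomD(3-5)[OF v] mhomD(3-5)[OF lunm(1)[OF M]] lunm(3)[OF M]
  have "u \<cdot> inv_arr T (lunm M) = (u \<cdot> tp U M \<cdot> (j 1 \<odot> idm T (fst M))) \<cdot> inv_arr T (lun T (fst M))"
    unfolding lunm(4)[OF M] by simp
  also have "\<dots> = v \<cdot> inv_arr T (lunm M)" unfolding e lunm(4)[OF M] by simp
  finally show "u \<cdot> inv_arr T (lunm M) = v \<cdot> inv_arr T (lunm M)" .
  show "u \<in> arr T" "v \<in> arr T" "src T u = tgt T (inv_arr T (lunm M))" "src T v = tgt T (inv_arr T (lunm M))"
    by simp_all
qed

text \<open>The extension is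
  \<open>(y \<otimes> c) \<otimes> x \<mapsto> f (y \<otimes> c x)\<close>; linearity of
  \<open>f\<close> in the second variable makes it bilinear over \<open>K\<close>.\<close>

lemma ins_tensor_bilin:
  assumes Y [simp]: "Y \<in> obj T" and M [simp]: "M \<in> mods" and P [simp]: "P \<in> mods"
    and f [simp]: "f \<in> arr T" "src T f = Y \<otimes> fst M" "tgt T f = fst P"
    and l: "\<And>c. f \<cdot> (idm T Y \<odot> act c M) = act c P \<cdot> f"
  obtains h where "bilin (Fr Y) M P h" "\<And>c. h \<cdot> (ins Y c \<odot> idm T (fst M)) = act c P \<cdot> f"
proof -
  define h where "h = f \<cdot> ((idm T Y \<odot> (snd M \<cdot> bra T A (fst M))) \<cdot> asc T Y A (fst M))"
  have [simp]: "h \<in> arr T" "src T h = (Y \<otimes> A) \<otimes> fst M" "tgt T h = fst P" by (simp_all add: h_def)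
  have hi: "h \<cdot> (ins Y c \<odot> idm T (fst M)) = act c P \<cdot> f" for c
  proof -
    have "h \<cdot> (ins Y c \<odot> idm T (fst M)) = f \<cdot> ((idm T Y \<odot> (snd M \<cdot> bra T A (fst M))) \<cdot>
        (asc T Y A (fst M) \<cdot> (ins Y c \<odot> idm T (fst M))))" by (simp add: h_def)
    then show ?thesis unfolding middle_ins[OF Y M] l .
  qed
  have "bilin (Fr Y) M P h"
    unfolding bilin_def
  proof (intro conjI allI)
    fix c
    show "h \<cdot> (act c (Fr Y) \<odot> idm T (fst M)) = act c P \<cdot> h"
    proof (rule ins_tensor_ext[of _ Y "fst M"])
      fix d
      have "h \<cdot> (act c (Fr Y) \<odot> idm T (fst M)) \<cdot> (ins Y d \<odot> idm T (fst M))
          = h \<cdot> ((act c (Fr Y) \<cdot> ins Y d) \<odot> idm T (fst M))" by simp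
      also have "\<dots> = act (d * c) P \<cdot> f" unfolding act_free_ins[OF Y] by (rule hi)
      also have "\<dots> = act c P \<cdot> (h \<cdot> (ins Y d \<odot> idm T (fst M)))"
        unfolding hi by (simp add: reassoc[OF act_mult] mult.commute)
      finally show "h \<cdot> (act c (Fr Y) \<odot> idm T (fst M)) \<cdot> (ins Y d \<odot> idm T (fst M))
        = act c P \<cdot> h \<cdot> (ins Y d \<odot> idm T (fst M))" by simp
    qed simp_all
    show "h \<cdot> (idm T (fst (Fr Y)) \<odot> act c M) = act c P \<cdot> h"
    proof (rule ins_tensor_ext[of _ Y "fst M"])
      fix d
      have "h \<cdot> (idm T (fst (Fr Y)) \<odot> act c M) \<cdot> (ins Y d \<odot> idm T (fst M))
          = (h \<cdot> (ins Y d \<odot> idm T (fst M))) \<cdot> (idm T Y \<odot> act c M)" by simp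
      also have "\<dots> = act d P \<cdot> (act c P \<cdot> f)" unfolding hi using l by simp
      also have "\<dots> = act c P \<cdot> (h \<cdot> (ins Y d \<odot> idm T (fst M)))"
        unfolding hi by (simp add: reassoc[OF act_mult] mult.commute)
      finally show "h \<cdot> (idm T (fst (Fr Y)) \<odot> act c M) \<cdot> (ins Y d \<odot> idm T (fst M))
        = act c P \<cdot> h \<cdot> (ins Y d \<odot> idm T (fst M))" by simp
    qed simp_all
  qed simp_all
  then show thesis using hi by (rule that)
qed

text \<open>If \<open>Y\<close> is dual to the underlying object \<open>X\<close> of a module \<open>M\<close>, then \<open>Y \<otimes> A\<close> is half dual to
  \<open>M\<close>: the evaluation \<open>Y \<otimes> X \<rightarrow> A\<close> uses the section \<open>X \<rightarrow> X \<otimes> A\<close> of the action.\<close>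

lemma half_dual_Q:
  assumes M [simp]: "M \<in> mods"
  shows "\<exists>N ev co. Q.half_dual M N ev co"
proof -
  let ?X = "fst M"
  obtain Y e k where d: "half_dual ?X Y e k" using exists_half_dual module_simps(1)[OF M] by blast
  note D [simp] = half_dualD(1-7)[OF d]
  obtain s where s: "mhom M (Fr ?X) s" "snd M \<cdot> s = idm T ?X" by (rule free_section[OF M])
  note S [simp] = mhomD(3-5)[OF s(1), simplified] and sl = mhomD(6)[OF s(1), unfolded act_Fr[OF module_simps(1)[OF M]]]
  let ?N = "Fr Y"
  have N [simp]: "?N \<in> mods" by simp
  \<comment> \<open>A pairing with values in \<open>A\<close>: \<open>x\<close> is mapped by
    \<open>s\<close> into \<open>X \<otimes> A\<close>, and the component in \<open>X\<close> is
    paired with \<open>y\<close>. It inherits linearity in \<open>x\<close> from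
    \<open>s\<close>.\<close>
  define e' where "e' = lun T A \<cdot> ((e \<odot> idm T A) \<cdot> (inv_arr T (asc T Y ?X A) \<cdot> (idm T Y \<odot> s)))"
  have e' [simp]: "e' \<in> arr T" "src T e' = Y \<otimes> ?X" "tgt T e' = A" by (simp_all add: e'_def)
  have e'l: "e' \<cdot> (idm T Y \<odot> act c M) = act c U \<cdot> e'" for c
  proof -
    have 1: "inv_arr T (asc T Y ?X A) \<cdot> (idm T Y \<odot> (idm T ?X \<odot> act c U))
        = (idm T (Y \<otimes> ?X) \<odot> act c U) \<cdot> inv_arr T (asc T Y ?X A)"
      using inv_asc_nat[of "idm T Y" "idm T ?X" "act c U"] by simp
    have 2: "lun T A \<cdot> (idm T (unt T) \<odot> act c U) = act c U \<cdot> lun T A"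
      using lun_nat[of "act c U"] by simp
    have "e' \<cdot> (idm T Y \<odot> act c M) = lun T A \<cdot> ((e \<odot> idm T A) \<cdot>
        ((inv_arr T (asc T Y ?X A) \<cdot> (idm T Y \<odot> (idm T ?X \<odot> act c U))) \<cdot> (idm T Y \<odot> s)))"
      by (simp add: e'_def sl)
    also have "\<dots> = (lun T A \<cdot> (idm T (unt T) \<odot> act c U)) \<cdot>
        ((e \<odot> idm T A) \<cdot> (inv_arr T (asc T Y ?X A) \<cdot> (idm T Y \<odot> s)))"
      unfolding 1 by simp
    also have "\<dots> = act c U \<cdot> e'" unfolding 2 by (simp add: e'_def)
    finally show ?thesis .
  qed
  obtain h where h: "bilin ?N M U h" "\<And>c. h \<cdot> (ins Y c \<odot> idm T ?X) = act c U \<cdot> e'"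
    by (rule ins_tensor_bilin[of Y M U e']) (simp_all add: e'l)
  define ev where "ev = fac ?N M h"
  have ev: "mhom (tm ?N M) U ev" "ev \<cdot> tp ?N M = h"
    unfolding ev_def using fac_props[OF h(1)] by simp_all
  note [simp] = mhomD(3-5)[OF ev(1)] bilinD(4-6)[OF h(1)]
  \<comment> \<open>The value of the coevaluation at \<open>1\<close>: the pair created in
    \<open>T\<close>, with its second factor placed in the free module at the element
    \<open>1\<close>.\<close>
  define k' where "k' = tp M ?N \<cdot> ((idm T ?X \<odot> ins Y 1) \<cdot> k)"
  have [simp]: "k' \<in> arr T" "src T k' = unt T" "tgt T k' = tgt T (tp M ?N)" by (simp_all add: k'_def)
  obtain co where co: "mhom U (tm M ?N) co" "\<And>c. co \<cdot> j c = act c (tm M ?N) \<cdot> k'"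
    by (rule from_U[of "tm M ?N" k']) simp_all
  note [simp] = mhomD(3-5)[OF co(1)]
  have co1: "co \<cdot> j 1 = k'" using co(2)[of 1] by (simp add: act_one)
  have iM: "mhom M M (idm T ?X)" by simp
  note a = ascm(1)[OF M N M] and tc = tarm(1)[OF co(1) iM] and te = tarm(1)[OF iM ev(1)]
  note [simp] = mhomD(3-5)[OF a] mhomD(3-5)[OF tc] mhomD(3-5)[OF te]
    mhomD(3-5)[OF runm(1)[OF M]] mhomD(3-5)[OF lunm(1)[OF M]]
  let ?tc = "tarm U (tm M ?N) co M M (idm T ?X)" and ?te = "tarm M M (idm T ?X) (tm ?N M) U ev"
  \<comment> \<open>The first triangle identity for modules, tested on the elements
    \<open>1 \<otimes> x\<close>.\<close>
  have key: "runm M \<cdot> (?te \<cdot> (ascm M ?N M \<cdot> ?tc)) = lunm M"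
  proof (rule tensor_U_ext[OF _ lunm(1)[OF M] M])
    show "mhom (tm U M) M (runm M \<cdot> (?te \<cdot> (ascm M ?N M \<cdot> ?tc)))"
      by (rule mhom_cmp[OF mhom_cmp[OF mhom_cmp[OF tc a] te] runm(1)[OF M]])
    let ?k = "k \<odot> idm T ?X"
    have 1: "asc T ?X (Y \<otimes> A) ?X \<cdot> ((idm T ?X \<odot> ins Y 1) \<odot> idm T ?X) = (idm T ?X \<odot> (ins Y 1 \<odot> idm T ?X)) \<cdot> asc T ?X Y ?X"
      using asc_nat[of "idm T ?X" "ins Y 1" "idm T ?X"] by simp
    have 2: "asc T ?X Y (?X \<otimes> A) \<cdot> (idm T (?X \<otimes> Y) \<odot> s) = (idm T ?X \<odot> (idm T Y \<odot> s)) \<cdot> asc T ?X Y ?X"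
      using asc_nat[of "idm T ?X" "idm T Y" s] by simp
    have h1: "h \<cdot> (ins Y 1 \<odot> idm T ?X) = e'" using h(2)[of 1] by (simp add: act_one)
    have "?tc \<cdot> (tp U M \<cdot> (j 1 \<odot> idm T ?X)) = tp (tm M ?N) M \<cdot> ((co \<cdot> j 1) \<odot> idm T ?X)"
      by (simp add: tarm_tp_assoc[OF co(1) iM])
    also have "\<dots> = tp3 M ?N M \<cdot> (((idm T ?X \<odot> ins Y 1) \<odot> idm T ?X) \<cdot> ?k)"
      unfolding co1 by (simp add: k'_def tp3_def)
    finally have "ascm M ?N M \<cdot> (?tc \<cdot> (tp U M \<cdot> (j 1 \<odot> idm T ?X)))
        = (ascm M ?N M \<cdot> tp3 M ?N M) \<cdot> (((idm T ?X \<odot> ins Y 1) \<odot> idm T ?X) \<cdot> ?k)" by simp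
    also have "\<dots> = tp3' M ?N M \<cdot> ((asc T ?X (Y \<otimes> A) ?X \<cdot> ((idm T ?X \<odot> ins Y 1) \<odot> idm T ?X)) \<cdot> ?k)"
      by (simp add: ascm(2))
    also have "\<dots> = tp M (tm ?N M) \<cdot> ((idm T ?X \<odot> (tp ?N M \<cdot> (ins Y 1 \<odot> idm T ?X))) \<cdot> (asc T ?X Y ?X \<cdot> ?k))"
      unfolding 1 by (simp add: tp3'_def)
    finally have "?te \<cdot> (ascm M ?N M \<cdot> (?tc \<cdot> (tp U M \<cdot> (j 1 \<odot> idm T ?X))))
        = ?te \<cdot> (tp M (tm ?N M) \<cdot> ((idm T ?X \<odot> (tp ?N M \<cdot> (ins Y 1 \<odot> idm T ?X))) \<cdot> (asc T ?X Y ?X \<cdot> ?k)))"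
      by simp
    also have "\<dots> = tp M U \<cdot> ((idm T ?X \<odot> ((ev \<cdot> tp ?N M) \<cdot> (ins Y 1 \<odot> idm T ?X))) \<cdot> (asc T ?X Y ?X \<cdot> ?k))"
      by (simp add: tarm_tp_assoc[OF iM ev(1)])
    also have "\<dots> = tp M U \<cdot> ((idm T ?X \<odot> e') \<cdot> (asc T ?X Y ?X \<cdot> ?k))"
      unfolding ev(2) h1 ..
    finally have "runm M \<cdot> (?te \<cdot> (ascm M ?N M \<cdot> (?tc \<cdot> (tp U M \<cdot> (j 1 \<odot> idm T ?X)))))
        = (runm M \<cdot> tp M U) \<cdot> ((idm T ?X \<odot> e') \<cdot> (asc T ?X Y ?X \<cdot> ?k))" by simp
    also have "\<dots> = snd M \<cdot> ((idm T ?X \<odot> lun T A) \<cdot> ((idm T ?X \<odot> (e \<odot> idm T A)) \<cdot>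
        ((idm T ?X \<odot> inv_arr T (asc T Y ?X A)) \<cdot> (((idm T ?X \<odot> (idm T Y \<odot> s)) \<cdot> asc T ?X Y ?X) \<cdot> ?k))))"
      unfolding runm(2)[OF M] by (simp add: e'_def)
    \<comment> \<open>The section \<open>s\<close> is moved in front of the coevaluation. What
      follows it is a complete zigzag of \<open>T\<close> next to \<open>A\<close>, and once this is
      removed \<open>snd M \<cdot> s\<close> is the identity.\<close>
    also have "\<dots> = snd M \<cdot> (((idm T ?X \<odot> lun T A) \<cdot> ((idm T ?X \<odot> (e \<odot> idm T A)) \<cdot>
        ((idm T ?X \<odot> inv_arr T (asc T Y ?X A)) \<cdot> (asc T ?X Y (?X \<otimes> A) \<cdot>
        ((k \<odot> idm T (?X \<otimes> A)) \<cdot> inv_arr T (lun T (?X \<otimes> A))))))) \<cdot> (lun T (?X \<otimes> A) \<cdot> (idm T (unt T) \<odot> s)))"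
      unfolding 2[symmetric] by simp
    also have "\<dots> = (snd M \<cdot> s) \<cdot> lun T ?X"
      unfolding zigzag_right[OF d module_simps(1)[OF M] A_obj] using lun_nat[of s] by simp
    also have "\<dots> = lunm M \<cdot> tp U M \<cdot> (j 1 \<odot> idm T ?X)"
      unfolding s(2) lunm(2)[OF M] act_linear_ins[OF M] by (simp add: act_one)
    finally show "(runm M \<cdot> (?te \<cdot> (ascm M ?N M \<cdot> ?tc))) \<cdot> tp U M \<cdot> (j 1 \<odot> idm T ?X)
      = lunm M \<cdot> tp U M \<cdot> (j 1 \<odot> idm T ?X)" by simp
  qed
  have "Q.half_dual M ?N (tm ?N M, U, ev) (U, tm M ?N, co)"
    unfolding Q.half_dual_def using ev(1) co(1) by (simp add: key)
  then show ?thesis by blast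
qed

lemma rigid_Q: "rigid_tensor_abelian_category Q"
proof (intro rigid_tensor_abelian_category.intro abelian_Q tensor_category_Q rigid_tensor_abelian_category_axioms.intro)
  show "bij_betw (\<lambda>c. scl Q c (idm Q (unt Q))) UNIV (hom Q (unt Q) (unt Q))" by (rule End_Q)
  show "\<exists>N ev co. is_dual Q M N ev co" if "M \<in> obj Q" for M
  proof -
    have "M \<in> mods" using that by simp
    then obtain N ev co where "Q.half_dual M N ev co" using half_dual_Q by blast
    then show ?thesis using Q.half_dual_imp_dual that by blast
  qed
  show "finite_length Q M" if "M \<in> obj Q" for M using finite_length_Q that by simp
qed

end

section \<open>The extension functor\<close>

context base_extension
begin

lemma iso_Q_iso:
  assumes "is_iso Q (M, N, f)"
  shows "is_iso T f"
proof -
  have f: "mhom M N f" using Q.iso_arr[OF assms] by simp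
  have "inv_arr Q (M, N, f) \<in> hom Q N M" using Q.inv_simps(1-3)[OF assms] by simp
  then obtain g where g: "inv_arr Q (M, N, f) = (N, M, g)" "mhom N M g" by (rule hom_QE)
  have "g \<cdot> f = idm T (fst M)" "f \<cdot> g = idm T (fst N)"
    using Q.inv_simps(4,5)[OF assms] unfolding g by simp_all
  then show ?thesis using mhomD[OF f] mhomD[OF g(2)] by (intro isoI[of f g]) simp_all
qed

text \<open>The general rule for isomorphisms in a tensor category applies in \<open>Q\<close>, and
  \<open>iso_Q_iso\<close> returns to the underlying arrow.\<close>

lemma tarm_iso:
  assumes "mhom M M' f" "is_iso T f" "mhom N N' g" "is_iso T g"
  shows "is_iso T (tarm M M' f N N' g)"
proof -
  have "is_iso Q ((M, M', f) \<odot>\<^bsub>Q\<^esub> (N, N', g))"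
    using assms by (intro Q.iso_tar iso_mhom(2))
  then show ?thesis using iso_Q_iso by simp
qed

lemma free_mhom:
  assumes [simp]: "f \<in> arr T"
  shows "mhom (Fr (src T f)) (Fr (tgt T f)) (f \<odot> idm T A)"
  by (simp add: mhom_def act_Fr)

lemma free_ext:
  assumes X [simp]: "X \<in> obj T" and u: "mhom (Fr X) P u" and v: "mhom (Fr X) P v"
    and e: "u \<cdot> ins X 1 = v \<cdot> ins X 1"
  shows "u = v"
proof (rule ins_ext[OF _ _ _ _ _ X])
  note [simp] = mhomD(3-5)[OF u] mhomD(3-5)[OF v] mhomD(2)[OF u]
  have *: "w \<cdot> ins X c = act c P \<cdot> (w \<cdot> ins X 1)" if w: "mhom (Fr X) P w" for w c
  proof -
    note [simp] = mhomD(3-5)[OF w]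
    have "w \<cdot> ins X c = w \<cdot> (act c (Fr X) \<cdot> ins X 1)" by (simp add: act_free_ins)
    also have "\<dots> = (w \<cdot> act c (Fr X)) \<cdot> ins X 1" by simp
    finally show ?thesis unfolding mhomD(6)[OF w] by simp
  qed
  show "u \<cdot> ins X c = v \<cdot> ins X c" for c
    unfolding *[OF u, of c] *[OF v, of c] e ..
qed (use mhomD[OF u] mhomD[OF v] in simp_all)

text \<open>With \<open>free_ext\<close>, this is the adjunction between
  \<open>X \<mapsto> X \<otimes> A\<close> and the forgetful functor from modules.\<close>

lemma free_out:
  assumes P [simp]: "P \<in> mods" and X [simp]: "X \<in> obj T"
    and z [simp]: "z \<in> arr T" "src T z = X" "tgt T z = fst P"
  obtains u where "mhom (Fr X) P u" "\<And>c. u \<cdot> ins X c = act c P \<cdot> z"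
proof -
  have "k_linear X (fst P) (\<lambda>c. act c P \<cdot> z)"
    by (simp add: k_linear_def act_add act_mult[symmetric] act_emb)
  then obtain u where u: "u \<in> arr T" "src T u = X \<otimes> A" "tgt T u = fst P" "\<And>c. u \<cdot> ins X c = act c P \<cdot> z"
    using ins_out by blast
  have "u \<cdot> act c (Fr X) = act c P \<cdot> u" for c
    by (rule ins_ext[of _ X]) (use u in \<open>simp_all add: act_free_ins reassoc[OF act_mult] mult.commute\<close>)
  then have "mhom (Fr X) P u" using u by (simp add: mhom_def)
  then show thesis using u(4) by (rule that)
qed

lemma asc_inv_ins:
  assumes [simp]: "X \<in> obj T" "Y \<in> obj T"
  shows "inv_arr T (asc T X Y A) \<cdot> (idm T X \<odot> ins Y c) = ins (X \<otimes> Y) c"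
  unfolding asc_ins[OF assms, symmetric] by simp

text \<open>The second arrow of the coequalizer pair, for the free module on \<open>Y\<close>, is
  contained in \<open>free_mult\<close>, so \<open>middle_ins\<close> computes its values on
  elements.\<close>

lemma free_mult_ins:
  assumes [simp]: "X \<in> obj T" "Y \<in> obj T"
  shows "free_mult \<iota> T X Y \<in> arr T" "src T (free_mult \<iota> T X Y) = (X \<otimes> A) \<otimes> (Y \<otimes> A)"
    "tgt T (free_mult \<iota> T X Y) = (X \<otimes> Y) \<otimes> A"
    "free_mult \<iota> T X Y \<cdot> (ins X c \<odot> ins Y d) = ins (X \<otimes> Y) (d * c)"
proof -
  have f: "free_mult \<iota> T X Y = inv_arr T (asc T X Y A) \<cdot>
      ((idm T X \<odot> (snd (Fr Y) \<cdot> bra T A (fst (Fr Y)))) \<cdot> asc T X A (fst (Fr Y)))"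
    by (simp add: free_mult_def Let_def free_module_def)
  have [simp]: "snd (Fr Y) \<in> arr T" "src T (snd (Fr Y)) = (Y \<otimes> A) \<otimes> A" "tgt T (snd (Fr Y)) = Y \<otimes> A"
    using module_simps[OF Fr_module[OF assms(2)]] by simp_all
  show "free_mult \<iota> T X Y \<in> arr T" "src T (free_mult \<iota> T X Y) = (X \<otimes> A) \<otimes> (Y \<otimes> A)"
    "tgt T (free_mult \<iota> T X Y) = (X \<otimes> Y) \<otimes> A"
    unfolding f by simp_all
  have "free_mult \<iota> T X Y \<cdot> (ins X c \<odot> ins Y d) = inv_arr T (asc T X Y A) \<cdot>
      (((idm T X \<odot> (snd (Fr Y) \<cdot> bra T A (fst (Fr Y)))) \<cdot>
        (asc T X A (fst (Fr Y)) \<cdot> (ins X c \<odot> idm T (fst (Fr Y))))) \<cdot> (idm T X \<odot> ins Y d))"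
    unfolding f by simp
  also have "\<dots> = inv_arr T (asc T X Y A) \<cdot> (idm T X \<odot> (act c (Fr Y) \<cdot> ins Y d))"
    unfolding middle_ins[OF assms(1) Fr_module[OF assms(2)]] by simp
  also have "\<dots> = ins (X \<otimes> Y) (d * c)"
    unfolding act_free_ins[OF assms(2)] by (rule asc_inv_ins[OF assms])
  finally show "free_mult \<iota> T X Y \<cdot> (ins X c \<odot> ins Y d) = ins (X \<otimes> Y) (d * c)" .
qed

lemma ins2_ext:
  assumes [simp]: "X \<in> obj T" "Y \<in> obj T"
    and f [simp]: "f \<in> arr T" "src T f = (X \<otimes> A) \<otimes> (Y \<otimes> A)"
    and g [simp]: "g \<in> arr T" "src T g = (X \<otimes> A) \<otimes> (Y \<otimes> A)" "tgt T g = tgt T f"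
    and e: "\<And>c d. f \<cdot> (ins X c \<odot> ins Y d) = g \<cdot> (ins X c \<odot> ins Y d)"
  shows "f = g"
proof (rule ins_tensor_ext[of _ X "Y \<otimes> A"])
  fix c
  let ?i = "ins X c \<odot> idm T (Y \<otimes> A)"
  have "f \<cdot> ?i \<cdot> asc T X Y A = g \<cdot> ?i \<cdot> asc T X Y A"
  proof (rule ins_ext[of _ "X \<otimes> Y"])
    fix d
    show "f \<cdot> ?i \<cdot> asc T X Y A \<cdot> ins (X \<otimes> Y) d = g \<cdot> ?i \<cdot> asc T X Y A \<cdot> ins (X \<otimes> Y) d"
      using e[of c d] by (simp add: asc_ins)
  qed simp_all
  then show "f \<cdot> ?i = g \<cdot> ?i"
    by (rule iso_cancel_right[rotated]) simp_all
qed simp_all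

abbreviation fmulm where "fmulm X Y \<equiv> fac (Fr X) (Fr Y) (free_mult \<iota> T X Y)"

text \<open>The inverse is the linear extension of \<open>x \<otimes> y \<mapsto> (x \<otimes> 1)
  \<otimes> (y \<otimes> 1)\<close>. One composite is checked on generators of the free module, the
  other one after \<open>tp\<close>, where bilinearity supplies all elements \<open>c\<close> and
  \<open>d\<close>.\<close>

lemma fmulm:
  assumes [simp]: "X \<in> obj T" "Y \<in> obj T"
  shows "mhom (tm (Fr X) (Fr Y)) (Fr (X \<otimes> Y)) (fmulm X Y)"
    "fmulm X Y \<cdot> tp (Fr X) (Fr Y) = free_mult \<iota> T X Y" "is_iso T (fmulm X Y)"
    "inv_arr T (fmulm X Y) \<cdot> ins (X \<otimes> Y) 1 = tp (Fr X) (Fr Y) \<cdot> (ins X 1 \<odot> ins Y 1)"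
proof -
  note [simp] = free_mult_ins(1-3)[OF assms] and F = free_mult_ins(4)[OF assms]
  let ?f = "free_mult \<iota> T X Y" and ?t = "tp (Fr X) (Fr Y)"
  have b: "bilin (Fr X) (Fr Y) (Fr (X \<otimes> Y)) ?f"
    unfolding bilin_def
  proof (intro conjI allI)
    fix c
    show "?f \<cdot> (act c (Fr X) \<odot> idm T (fst (Fr Y))) = act c (Fr (X \<otimes> Y)) \<cdot> ?f"
      by (rule ins2_ext[of X Y]) (simp_all add: F act_free_ins mult_ac)
    show "?f \<cdot> (idm T (fst (Fr X)) \<odot> act c (Fr Y)) = act c (Fr (X \<otimes> Y)) \<cdot> ?f"
      by (rule ins2_ext[of X Y]) (simp_all add: F act_free_ins mult_ac)
  qed simp_all
  show m: "mhom (tm (Fr X) (Fr Y)) (Fr (X \<otimes> Y)) (fmulm X Y)"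
    and e: "fmulm X Y \<cdot> ?t = ?f" using fac_props[OF b] by simp_all
  note [simp] = mhomD(3-5)[OF m, simplified]
  let ?i = "ins X 1 \<odot> ins Y 1"
  obtain w where w: "mhom (Fr (X \<otimes> Y)) (tm (Fr X) (Fr Y)) w"
    "\<And>c. w \<cdot> ins (X \<otimes> Y) c = act c (tm (Fr X) (Fr Y)) \<cdot> (?t \<cdot> ?i)"
    by (rule free_out[of "tm (Fr X) (Fr Y)" "X \<otimes> Y" "?t \<cdot> ?i"]) simp_all
  note [simp] = mhomD(3-5)[OF w(1), simplified]
  have w1: "w \<cdot> ins (X \<otimes> Y) 1 = ?t \<cdot> ?i" using w(2)[of 1] by (simp add: act_one)
  have "fmulm X Y \<cdot> (w \<cdot> ins (X \<otimes> Y) 1) = (fmulm X Y \<cdot> ?t) \<cdot> ?i" unfolding w1 by simp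
  also have "\<dots> = ins (X \<otimes> Y) 1" unfolding e F by simp
  finally have fw: "fmulm X Y \<cdot> (w \<cdot> ins (X \<otimes> Y) 1) = ins (X \<otimes> Y) 1" .
  have "fmulm X Y \<cdot> w = idm T (fst (Fr (X \<otimes> Y)))"
    by (rule free_ext[OF tob_simp[OF assms] mhom_cmp[OF w(1) m] mhom_id]) (simp_all add: fw)
  moreover have "w \<cdot> ?f = ?t"
  proof (rule ins2_ext[of X Y])
    fix c d
    let ?a = "\<lambda>c. act c (tm (Fr X) (Fr Y))"
    have "?a d \<cdot> (?t \<cdot> ?i) = (?a d \<cdot> ?t) \<cdot> ?i" by simp
    then have 1: "?a d \<cdot> (?t \<cdot> ?i) = ?t \<cdot> (ins X 1 \<odot> ins Y d)"
      unfolding tm_module(2)[OF Fr_module[OF assms(1)] Fr_module[OF assms(2)]] by (simp add: act_free_ins)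
    have "?a c \<cdot> (?t \<cdot> (ins X 1 \<odot> ins Y d)) = (?a c \<cdot> ?t) \<cdot> (ins X 1 \<odot> ins Y d)" by simp
    then have 2: "?a c \<cdot> (?t \<cdot> (ins X 1 \<odot> ins Y d)) = ?t \<cdot> (ins X c \<odot> ins Y d)"
      unfolding act_tm[OF Fr_module[OF assms(1)] Fr_module[OF assms(2)]] by (simp add: act_free_ins)
    have "w \<cdot> ?f \<cdot> (ins X c \<odot> ins Y d) = ?a c \<cdot> (?a d \<cdot> (?t \<cdot> ?i))"
      by (simp add: F w(2) reassoc[OF act_mult] mult.commute)
    also have "\<dots> = ?t \<cdot> (ins X c \<odot> ins Y d)" unfolding 1 2 ..
    finally show "w \<cdot> ?f \<cdot> (ins X c \<odot> ins Y d) = ?t \<cdot> (ins X c \<odot> ins Y d)" .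
  qed simp_all
  then have "w \<cdot> fmulm X Y \<cdot> ?t = idm T (fst (tm (Fr X) (Fr Y))) \<cdot> ?t"
    by (simp add: e)
  then have "w \<cdot> fmulm X Y = idm T (fst (tm (Fr X) (Fr Y)))"
    by (rule epi_cancel[OF tp_epi, rotated 2]) simp_all
  ultimately have "is_iso T (fmulm X Y)" "inv_arr T (fmulm X Y) = w"
    by (simp_all add: isoI[of "fmulm X Y" w] inv_eqI[of "fmulm X Y" w])
  then show "is_iso T (fmulm X Y)" "inv_arr T (fmulm X Y) \<cdot> ins (X \<otimes> Y) 1 = ?t \<cdot> ?i"
    using w1 by simp_all
qed

lemma fmulm_tp:
  assumes [simp]: "X \<in> obj T" "Y \<in> obj T"
  shows "fmulm X Y \<cdot> (tp (Fr X) (Fr Y) \<cdot> (ins X 1 \<odot> ins Y 1)) = ins (X \<otimes> Y) 1"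
  using mhomD(3-5)[OF fmulm(1)[OF assms]] reassoc[OF fmulm(2)[OF assms], of "ins X 1 \<odot> ins Y 1"]
    free_mult_ins(4)[OF assms, of 1 1] by simp

text \<open>Through \<open>fmulm\<close> the product of two free modules is free on
  \<open>X \<otimes> Y\<close>, so a linear arrow out of it is determined by its values on
  \<open>(x \<otimes> 1) \<otimes> (y \<otimes> 1)\<close>. The axioms of the tensor functor are
  verified there.\<close>

lemma free2_ext:
  assumes X [simp]: "X \<in> obj T" "Y \<in> obj T"
    and u: "mhom (tm (Fr X) (Fr Y)) P u" and v: "mhom (tm (Fr X) (Fr Y)) P v"
    and e: "u \<cdot> (tp (Fr X) (Fr Y) \<cdot> (ins X 1 \<odot> ins Y 1)) = v \<cdot> (tp (Fr X) (Fr Y) \<cdot> (ins X 1 \<odot> ins Y 1))"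
  shows "u = v"
proof -
  let ?w = "inv_arr T (fmulm X Y)"
  note F = fmulm[OF X] and I = iso_mhom(1)[OF fmulm(1)[OF X] fmulm(3)[OF X]]
  note [simp] = mhomD(3-5)[OF u, simplified] mhomD(3-5)[OF v, simplified] mhomD(3-5)[OF I, simplified]
  have "u \<cdot> ?w = v \<cdot> ?w"
    by (rule free_ext[OF tob_simp[OF X] mhom_cmp[OF I u] mhom_cmp[OF I v]]) (simp add: F(4) e)
  then show ?thesis
    by (rule iso_cancel_right[OF iso_inv[OF F(3)]]) (use mhomD(3-5)[OF F(1)] F(3) in simp_all)
qed

text \<open>The inverse of \<open>fmulm\<close>, tensored with the identity of the third factor,
  reduces three free factors to the two factors treated in \<open>free2_ext\<close>.\<close>

lemma free3_ext:
  assumes X [simp]: "X \<in> obj T" "Y \<in> obj T" and Z [simp]: "Z \<in> obj T"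
    and u: "mhom (tm (tm (Fr X) (Fr Y)) (Fr Z)) P u" and v: "mhom (tm (tm (Fr X) (Fr Y)) (Fr Z)) P v"
    and e: "u \<cdot> (tp3 (Fr X) (Fr Y) (Fr Z) \<cdot> ((ins X 1 \<odot> ins Y 1) \<odot> ins Z 1)) =
      v \<cdot> (tp3 (Fr X) (Fr Y) (Fr Z) \<cdot> ((ins X 1 \<odot> ins Y 1) \<odot> ins Z 1))"
  shows "u = v"
proof -
  let ?w = "inv_arr T (fmulm X Y)"
  note F = fmulm[OF X] and I = iso_mhom(1)[OF fmulm(1)[OF X] fmulm(3)[OF X]]
  have iZ: "mhom (Fr Z) (Fr Z) (idm T (Z \<otimes> A))" using mhom_id[of "Fr Z"] by simp
  let ?t = "tarm (Fr (X \<otimes> Y)) (tm (Fr X) (Fr Y)) ?w (Fr Z) (Fr Z) (idm T (Z \<otimes> A))"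
  note t = tarm(1)[OF I iZ]
  note [simp] = mhomD(3-5)[OF u, simplified] mhomD(3-5)[OF v, simplified] mhomD(3-5)[OF I, simplified]
    mhomD(3-5)[OF t, simplified]
  have tt: "?t \<cdot> (tp (Fr (X \<otimes> Y)) (Fr Z) \<cdot> (ins (X \<otimes> Y) 1 \<odot> ins Z 1))
      = tp3 (Fr X) (Fr Y) (Fr Z) \<cdot> ((ins X 1 \<odot> ins Y 1) \<odot> ins Z 1)"
    by (simp add: tarm_tp_assoc[OF I iZ] F(4) tp3_def)
  have "u \<cdot> ?t = v \<cdot> ?t"
    by (rule free2_ext[OF tob_simp[OF X] Z mhom_cmp[OF t u] mhom_cmp[OF t v]]) (simp add: tt e)
  moreover have "is_iso T ?t"
    by (rule tarm_iso[OF I iso_inv[OF F(3)] iZ]) simp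
  ultimately show ?thesis
    by (intro iso_cancel_right[of ?t u v]) simp_all
qed

lemma fmulm_nat:
  assumes [simp]: "f \<in> arr T" "g \<in> arr T"
  shows "fmulm (tgt T f) (tgt T g) \<cdot> tarm (Fr (src T f)) (Fr (tgt T f)) (f \<odot> idm T A) (Fr (src T g)) (Fr (tgt T g)) (g \<odot> idm T A)
    = ((f \<odot> g) \<odot> idm T A) \<cdot> fmulm (src T f) (src T g)"
proof (rule free2_ext[of "src T f" "src T g"])
  note f = free_mhom[OF assms(1)] and g = free_mhom[OF assms(2)]
  let ?X = "src T f" and ?Y = "src T g" and ?X' = "tgt T f" and ?Y' = "tgt T g"
  note F = fmulm(1)[of ?X ?Y] and F' = fmulm(1)[of ?X' ?Y']
  note fg = free_mhom[of "f \<odot> g", simplified]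
  show "mhom (tm (Fr ?X) (Fr ?Y)) (Fr (?X' \<otimes> ?Y')) (fmulm ?X' ?Y' \<cdot>
      tarm (Fr ?X) (Fr ?X') (f \<odot> idm T A) (Fr ?Y) (Fr ?Y') (g \<odot> idm T A))"
    by (rule mhom_cmp[OF tarm(1)[OF f g] F']) simp_all
  show "mhom (tm (Fr ?X) (Fr ?Y)) (Fr (?X' \<otimes> ?Y')) (((f \<odot> g) \<odot> idm T A) \<cdot> fmulm ?X ?Y)"
    by (rule mhom_cmp[OF F fg]) simp_all
  note [simp] = mhomD(3-5)[OF F, simplified] mhomD(3-5)[OF F', simplified] tarm_simps[OF f g, simplified]
  have 1: "(f \<odot> idm T A) \<cdot> ins ?X 1 = ins ?X' 1 \<cdot> f" "(g \<odot> idm T A) \<cdot> ins ?Y 1 = ins ?Y' 1 \<cdot> g"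
    "((f \<odot> g) \<odot> idm T A) \<cdot> ins (?X \<otimes> ?Y) 1 = ins (?X' \<otimes> ?Y') 1 \<cdot> (f \<odot> g)"
    using ins_nat[of f 1] ins_nat[of g 1] ins_nat[of "f \<odot> g" 1] by simp_all
  have t: "tarm (Fr ?X) (Fr ?X') (f \<odot> idm T A) (Fr ?Y) (Fr ?Y') (g \<odot> idm T A) \<cdot>
      (tp (Fr ?X) (Fr ?Y) \<cdot> (ins ?X 1 \<odot> ins ?Y 1)) = (tp (Fr ?X') (Fr ?Y') \<cdot> (ins ?X' 1 \<odot> ins ?Y' 1)) \<cdot> (f \<odot> g)"
    by (simp add: tarm_tp_assoc[OF f g] 1)
  have "fmulm ?X' ?Y' \<cdot> tarm (Fr ?X) (Fr ?X') (f \<odot> idm T A) (Fr ?Y) (Fr ?Y') (g \<odot> idm T A) \<cdot>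
      (tp (Fr ?X) (Fr ?Y) \<cdot> (ins ?X 1 \<odot> ins ?Y 1))
    = fmulm ?X' ?Y' \<cdot> (tarm (Fr ?X) (Fr ?X') (f \<odot> idm T A) (Fr ?Y) (Fr ?Y') (g \<odot> idm T A) \<cdot>
      (tp (Fr ?X) (Fr ?Y) \<cdot> (ins ?X 1 \<odot> ins ?Y 1)))" by simp
  also have "\<dots> = (fmulm ?X' ?Y' \<cdot> (tp (Fr ?X') (Fr ?Y') \<cdot> (ins ?X' 1 \<odot> ins ?Y' 1))) \<cdot> (f \<odot> g)"
    unfolding t by simp
  also have "\<dots> = ((f \<odot> g) \<odot> idm T A) \<cdot> fmulm ?X ?Y \<cdot> (tp (Fr ?X) (Fr ?Y) \<cdot> (ins ?X 1 \<odot> ins ?Y 1))"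
    unfolding fmulm_tp[OF tgt_in_obj[OF assms(1)] tgt_in_obj[OF assms(2)]] by (simp add: fmulm_tp 1)
  finally show "fmulm ?X' ?Y' \<cdot> tarm (Fr ?X) (Fr ?X') (f \<odot> idm T A) (Fr ?Y) (Fr ?Y') (g \<odot> idm T A) \<cdot>
      (tp (Fr ?X) (Fr ?Y) \<cdot> (ins ?X 1 \<odot> ins ?Y 1))
    = ((f \<odot> g) \<odot> idm T A) \<cdot> fmulm ?X ?Y \<cdot> (tp (Fr ?X) (Fr ?Y) \<cdot> (ins ?X 1 \<odot> ins ?Y 1))" .
qed simp_all

lemma fmulm_asc:
  assumes X [simp]: "X \<in> obj T" and Y [simp]: "Y \<in> obj T" and Z [simp]: "Z \<in> obj T"
  shows "(asc T X Y Z \<odot> idm T A) \<cdot> (fmulm (X \<otimes> Y) Z \<cdot>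
      tarm (tm (Fr X) (Fr Y)) (Fr (X \<otimes> Y)) (fmulm X Y) (Fr Z) (Fr Z) (idm T (Z \<otimes> A)))
    = fmulm X (Y \<otimes> Z) \<cdot> (tarm (Fr X) (Fr X) (idm T (X \<otimes> A)) (tm (Fr Y) (Fr Z)) (Fr (Y \<otimes> Z)) (fmulm Y Z) \<cdot>
      ascm (Fr X) (Fr Y) (Fr Z))"
proof (rule free3_ext[OF X Y Z])
  have iX: "mhom (Fr X) (Fr X) (idm T (X \<otimes> A))" and iZ: "mhom (Fr Z) (Fr Z) (idm T (Z \<otimes> A))"
    using mhom_id[of "Fr X"] mhom_id[of "Fr Z"] by simp_all
  note FXY = fmulm(1)[OF X Y] and FYZ = fmulm(1)[OF Y Z]
    and FXY' = fmulm(1)[OF tob_simp[OF X Y] Z] and FYZ' = fmulm(1)[OF X tob_simp[OF Y Z]]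
  note a = free_mhom[of "asc T X Y Z", simplified] and aa = ascm(1)[of "Fr X" "Fr Y" "Fr Z"]
  note t1 = tarm(1)[OF FXY iZ] and t2 = tarm(1)[OF iX FYZ]
  let ?l = "(asc T X Y Z \<odot> idm T A) \<cdot> (fmulm (X \<otimes> Y) Z \<cdot>
      tarm (tm (Fr X) (Fr Y)) (Fr (X \<otimes> Y)) (fmulm X Y) (Fr Z) (Fr Z) (idm T (Z \<otimes> A)))"
  let ?t2 = "tarm (Fr X) (Fr X) (idm T (X \<otimes> A)) (tm (Fr Y) (Fr Z)) (Fr (Y \<otimes> Z)) (fmulm Y Z)"
  let ?r = "fmulm X (Y \<otimes> Z) \<cdot> (?t2 \<cdot> ascm (Fr X) (Fr Y) (Fr Z))"
  show "mhom (tm (tm (Fr X) (Fr Y)) (Fr Z)) (Fr (X \<otimes> (Y \<otimes> Z))) ?l"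
    by (rule mhom_cmp[OF mhom_cmp[OF t1 FXY'] a])
  show "mhom (tm (tm (Fr X) (Fr Y)) (Fr Z)) (Fr (X \<otimes> (Y \<otimes> Z))) ?r"
    by (rule mhom_cmp[OF mhom_cmp[OF aa t2] FYZ']) simp_all
  note [simp] = mhomD(3-5)[OF FXY, simplified] mhomD(3-5)[OF FYZ, simplified] mhomD(3-5)[OF FXY', simplified]
    mhomD(3-5)[OF FYZ', simplified] mhomD(3-5)[OF aa, simplified] mhomD(3-5)[OF t1, simplified] mhomD(3-5)[OF t2, simplified]
  let ?i = "(ins X 1 \<odot> ins Y 1) \<odot> ins Z 1" and ?i' = "ins X 1 \<odot> (ins Y 1 \<odot> ins Z 1)"
  have n: "asc T (X \<otimes> A) (Y \<otimes> A) (Z \<otimes> A) \<cdot> ?i = ?i' \<cdot> asc T X Y Z"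
    using asc_nat[of "ins X 1" "ins Y 1" "ins Z 1"] by simp
  have n': "(asc T X Y Z \<odot> idm T A) \<cdot> ins ((X \<otimes> Y) \<otimes> Z) 1 = ins (X \<otimes> (Y \<otimes> Z)) 1 \<cdot> asc T X Y Z"
    using ins_nat[of "asc T X Y Z" 1] by simp
  have "?l \<cdot> (tp3 (Fr X) (Fr Y) (Fr Z) \<cdot> ?i) = (asc T X Y Z \<odot> idm T A) \<cdot> (fmulm (X \<otimes> Y) Z \<cdot>
      (tp (Fr (X \<otimes> Y)) (Fr Z) \<cdot> ((fmulm X Y \<cdot> (tp (Fr X) (Fr Y) \<cdot> (ins X 1 \<odot> ins Y 1))) \<odot> ins Z 1)))"
    by (simp add: tp3_def tarm_tp_assoc[OF FXY iZ])
  also have "\<dots> = ins (X \<otimes> (Y \<otimes> Z)) 1 \<cdot> asc T X Y Z"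
    by (simp add: fmulm_tp n')
  finally have l: "?l \<cdot> (tp3 (Fr X) (Fr Y) (Fr Z) \<cdot> ?i) = ins (X \<otimes> (Y \<otimes> Z)) 1 \<cdot> asc T X Y Z" .
  have "?r \<cdot> (tp3 (Fr X) (Fr Y) (Fr Z) \<cdot> ?i)
      = fmulm X (Y \<otimes> Z) \<cdot> (?t2 \<cdot> ((ascm (Fr X) (Fr Y) (Fr Z) \<cdot> tp3 (Fr X) (Fr Y) (Fr Z)) \<cdot> ?i))"
    by simp
  also have "\<dots> = fmulm X (Y \<otimes> Z) \<cdot> (?t2 \<cdot> (tp3' (Fr X) (Fr Y) (Fr Z) \<cdot> (?i' \<cdot> asc T X Y Z)))"
    by (simp add: ascm(2) n)
  also have "\<dots> = fmulm X (Y \<otimes> Z) \<cdot> (tp (Fr X) (Fr (Y \<otimes> Z)) \<cdot>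
      ((ins X 1 \<odot> (fmulm Y Z \<cdot> (tp (Fr Y) (Fr Z) \<cdot> (ins Y 1 \<odot> ins Z 1)))) \<cdot> asc T X Y Z))"
    by (simp add: tp3'_def tarm_tp_assoc[OF iX FYZ])
  also have "\<dots> = (fmulm X (Y \<otimes> Z) \<cdot> (tp (Fr X) (Fr (Y \<otimes> Z)) \<cdot> (ins X 1 \<odot> ins (Y \<otimes> Z) 1))) \<cdot> asc T X Y Z"
    by (simp add: fmulm_tp[OF Y Z])
  also have "\<dots> = ins (X \<otimes> (Y \<otimes> Z)) 1 \<cdot> asc T X Y Z" unfolding fmulm_tp[OF X tob_simp[OF Y Z]] ..
  finally show "?l \<cdot> (tp3 (Fr X) (Fr Y) (Fr Z) \<cdot> ?i) = ?r \<cdot> (tp3 (Fr X) (Fr Y) (Fr Z) \<cdot> ?i)"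
    unfolding l ..
qed

lemma fmulm_bra:
  assumes X [simp]: "X \<in> obj T" and Y [simp]: "Y \<in> obj T"
  shows "(bra T X Y \<odot> idm T A) \<cdot> fmulm X Y = fmulm Y X \<cdot> bram (Fr X) (Fr Y)"
proof (rule free2_ext[OF X Y])
  note FXY = fmulm(1)[OF X Y] and FYX = fmulm(1)[OF Y X] and b = bram(1)[of "Fr X" "Fr Y"]
  note bb = free_mhom[of "bra T X Y", simplified]
  show "mhom (tm (Fr X) (Fr Y)) (Fr (Y \<otimes> X)) ((bra T X Y \<odot> idm T A) \<cdot> fmulm X Y)"
    by (rule mhom_cmp[OF FXY bb])
  show "mhom (tm (Fr X) (Fr Y)) (Fr (Y \<otimes> X)) (fmulm Y X \<cdot> bram (Fr X) (Fr Y))"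
    by (rule mhom_cmp[OF b FYX]) simp_all
  note [simp] = mhomD(3-5)[OF FXY, simplified] mhomD(3-5)[OF FYX, simplified] mhomD(3-5)[OF b, simplified]
  have n: "bra T (X \<otimes> A) (Y \<otimes> A) \<cdot> (ins X 1 \<odot> ins Y 1) = (ins Y 1 \<odot> ins X 1) \<cdot> bra T X Y"
    using bra_nat[of "ins X 1" "ins Y 1"] by simp
  have n': "(bra T X Y \<odot> idm T A) \<cdot> ins (X \<otimes> Y) 1 = ins (Y \<otimes> X) 1 \<cdot> bra T X Y"
    using ins_nat[of "bra T X Y" 1] by simp
  have "fmulm Y X \<cdot> bram (Fr X) (Fr Y) \<cdot> (tp (Fr X) (Fr Y) \<cdot> (ins X 1 \<odot> ins Y 1))
      = (fmulm Y X \<cdot> (tp (Fr Y) (Fr X) \<cdot> (ins Y 1 \<odot> ins X 1))) \<cdot> bra T X Y"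
    by (simp add: reassoc[OF bram(2)] n)
  then show "(bra T X Y \<odot> idm T A) \<cdot> fmulm X Y \<cdot> (tp (Fr X) (Fr Y) \<cdot> (ins X 1 \<odot> ins Y 1)) =
      fmulm Y X \<cdot> bram (Fr X) (Fr Y) \<cdot> (tp (Fr X) (Fr Y) \<cdot> (ins X 1 \<odot> ins Y 1))"
    by (simp add: fmulm_tp n')
qed

abbreviation fonem where "fonem \<equiv> inv_arr T (lun T A)"

lemma fonem_j: "fonem \<cdot> j c = ins (unt T) c"
  unfolding lun_ins[symmetric] by simp

lemma fonem: "mhom U (Fr (unt T)) fonem"
proof -
  have "fonem \<cdot> act c U = act c (Fr (unt T)) \<cdot> fonem" for c
    by (rule A_ext) (simp_all add: act_U fonem_j act_free_ins)
  then show ?thesis by (simp add: mhom_def)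
qed

text \<open>Precomposition with the inverse of \<open>lunm\<close> turns both sides into arrows out
  of a free module, which are compared on the generators \<open>x \<otimes> 1\<close>.\<close>

lemma fonem_lun:
  assumes X [simp]: "X \<in> obj T"
  shows "(lun T X \<odot> idm T A) \<cdot> (fmulm (unt T) X \<cdot> tarm U (Fr (unt T)) fonem (Fr X) (Fr X) (idm T (X \<otimes> A)))
    = lunm (Fr X)"
proof -
  have iX: "mhom (Fr X) (Fr X) (idm T (X \<otimes> A))" using mhom_id[of "Fr X"] by simp
  note F = fmulm(1)[OF unt_simp X] and t = tarm(1)[OF fonem iX] and l = lunm[of "Fr X"]
  note lm = l(1)[OF Fr_module[OF X]] and li = l(3)[OF Fr_module[OF X]]
  note I = iso_mhom(1)[OF lm li] and lx = free_mhom[of "lun T X", simplified]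
  let ?l = "(lun T X \<odot> idm T A) \<cdot> (fmulm (unt T) X \<cdot> tarm U (Fr (unt T)) fonem (Fr X) (Fr X) (idm T (X \<otimes> A)))"
  have m: "mhom (tm U (Fr X)) (Fr X) ?l"
    by (rule mhom_cmp[OF mhom_cmp[OF t F] lx])
  note [simp] = mhomD(3-5)[OF m, simplified] mhomD(3-5)[OF lm, simplified] mhomD(3-5)[OF I, simplified]
    mhomD(3-5)[OF F, simplified] mhomD(3-5)[OF t, simplified] li
  have "inv_arr T (lun T (X \<otimes> A)) \<cdot> ins X 1 = (idm T (unt T) \<odot> ins X 1) \<cdot> inv_arr T (lun T X)"
    using inv_lun_nat[of "ins X 1"] by simp
  then have i: "inv_arr T (lunm (Fr X)) \<cdot> ins X 1 = tp U (Fr X) \<cdot> ((j 1 \<odot> ins X 1) \<cdot> inv_arr T (lun T X))"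
    unfolding l(4)[OF Fr_module[OF X]] by simp
  have n: "(lun T X \<odot> idm T A) \<cdot> ins (unt T \<otimes> X) 1 = ins X 1 \<cdot> lun T X"
    using ins_nat[of "lun T X" 1] by simp
  have "?l \<cdot> inv_arr T (lunm (Fr X)) = lunm (Fr X) \<cdot> inv_arr T (lunm (Fr X))"
  proof (rule free_ext[OF X mhom_cmp[OF I m] mhom_cmp[OF I lm]])
    have "?l \<cdot> inv_arr T (lunm (Fr X)) \<cdot> ins X 1 = (lun T X \<odot> idm T A) \<cdot> ((fmulm (unt T) X \<cdot>
        (tp (Fr (unt T)) (Fr X) \<cdot> ((fonem \<cdot> j 1) \<odot> ins X 1))) \<cdot> inv_arr T (lun T X))"
      by (simp add: i tarm_tp_assoc[OF fonem iX])
    also have "\<dots> = ins X 1"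
      unfolding fonem_j fmulm_tp[OF unt_simp X] by (simp add: reassoc[OF n])
    finally show "?l \<cdot> inv_arr T (lunm (Fr X)) \<cdot> ins X 1 = lunm (Fr X) \<cdot> inv_arr T (lunm (Fr X)) \<cdot> ins X 1"
      by simp
  qed
  then show ?thesis by (rule iso_cancel_right[OF iso_inv[OF li]]) simp_all
qed

lemma fonem_run:
  assumes X [simp]: "X \<in> obj T"
  shows "(run T X \<odot> idm T A) \<cdot> (fmulm X (unt T) \<cdot> tarm (Fr X) (Fr X) (idm T (X \<otimes> A)) U (Fr (unt T)) fonem)
    = runm (Fr X)"
proof -
  have iX: "mhom (Fr X) (Fr X) (idm T (X \<otimes> A))" using mhom_id[of "Fr X"] by simp
  note F = fmulm(1)[OF X unt_simp] and t = tarm(1)[OF iX fonem] and l = runm[of "Fr X"]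
  note lm = l(1)[OF Fr_module[OF X]] and li = l(3)[OF Fr_module[OF X]]
  note I = iso_mhom(1)[OF lm li] and lx = free_mhom[of "run T X", simplified]
  let ?l = "(run T X \<odot> idm T A) \<cdot> (fmulm X (unt T) \<cdot> tarm (Fr X) (Fr X) (idm T (X \<otimes> A)) U (Fr (unt T)) fonem)"
  have m: "mhom (tm (Fr X) U) (Fr X) ?l"
    by (rule mhom_cmp[OF mhom_cmp[OF t F] lx])
  note [simp] = mhomD(3-5)[OF m, simplified] mhomD(3-5)[OF lm, simplified] mhomD(3-5)[OF I, simplified]
    mhomD(3-5)[OF F, simplified] mhomD(3-5)[OF t, simplified] li
  have "inv_arr T (run T (X \<otimes> A)) \<cdot> ins X 1 = (ins X 1 \<odot> idm T (unt T)) \<cdot> inv_arr T (run T X)"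
    using inv_run_nat[of "ins X 1"] by simp
  then have i: "inv_arr T (runm (Fr X)) \<cdot> ins X 1 = tp (Fr X) U \<cdot> ((ins X 1 \<odot> j 1) \<cdot> inv_arr T (run T X))"
    unfolding l(4)[OF Fr_module[OF X]] by (simp add: ins_def[of "X \<otimes> A"])
  have n: "(run T X \<odot> idm T A) \<cdot> ins (X \<otimes> unt T) 1 = ins X 1 \<cdot> run T X"
    using ins_nat[of "run T X" 1] by simp
  have "?l \<cdot> inv_arr T (runm (Fr X)) = runm (Fr X) \<cdot> inv_arr T (runm (Fr X))"
  proof (rule free_ext[OF X mhom_cmp[OF I m] mhom_cmp[OF I lm]])
    have "?l \<cdot> inv_arr T (runm (Fr X)) \<cdot> ins X 1 = (run T X \<odot> idm T A) \<cdot> ((fmulm X (unt T) \<cdot>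
        (tp (Fr X) (Fr (unt T)) \<cdot> (ins X 1 \<odot> (fonem \<cdot> j 1)))) \<cdot> inv_arr T (run T X))"
      by (simp add: i tarm_tp_assoc[OF iX fonem])
    also have "\<dots> = ins X 1"
      unfolding fonem_j fmulm_tp[OF X unt_simp] by (simp add: reassoc[OF n])
    finally show "?l \<cdot> inv_arr T (runm (Fr X)) \<cdot> ins X 1 = runm (Fr X) \<cdot> inv_arr T (runm (Fr X)) \<cdot> ins X 1"
      by simp
  qed
  then show ?thesis by (rule iso_cancel_right[OF iso_inv[OF li]]) simp_all
qed

text \<open>As \<open>A\<close> is a sum of copies of \<open>I\<close>, an arrow killed by
  \<open>g \<odot> idm T A\<close> has components killed by \<open>g\<close>; these factor through
  \<open>f\<close> one by one.\<close>

lemma free_kernel: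
  assumes k: "is_kernel T g f"
  shows "is_kernel T (g \<odot> idm T A) (f \<odot> idm T A)"
proof (rule kernelI[OF tensor_mono_left[OF kernel_mono[OF k] A_obj]])
  note K [simp] = kernelD(1-3)[OF k] and K4 = kernelD(4)[OF k]
  show "g \<odot> idm T A \<in> arr T" "tgt T (f \<odot> idm T A) = src T (g \<odot> idm T A)"
    "(g \<odot> idm T A) \<cdot> (f \<odot> idm T A) = zer T (src T (f \<odot> idm T A)) (tgt T (g \<odot> idm T A))"
    by (simp_all add: K4)
  let ?Y = "src T g" and ?X = "src T f" and ?Z = "tgt T g"
  fix h assume "h \<in> arr T" "tgt T h = src T (g \<odot> idm T A)"
    and h0: "(g \<odot> idm T A) \<cdot> h = zer T (src T h) (tgt T (g \<odot> idm T A))"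
  then have [simp]: "h \<in> arr T" "tgt T h = ?Y \<otimes> A" by simp_all
  obtain n b co where bas: "basis n b co" using basis_exists by blast
  obtain p where p: "is_direct_sum T n (\<lambda>_. ?Y) (?Y \<otimes> A) (\<lambda>l. ins ?Y (b l)) p"
    "\<And>l c. p l \<cdot> ins ?Y c = scl T (co l c) (idm T ?Y)" "\<And>l. p l \<in> hom T (?Y \<otimes> A) ?Y"
    by (rule tensor_A_direct_sum[OF bas, of ?Y]) (simp, rule that)
  obtain p' where p': "\<And>l c. p' l \<cdot> ins ?Z c = scl T (co l c) (idm T ?Z)" "\<And>l. p' l \<in> hom T (?Z \<otimes> A) ?Z"
    by (rule tensor_A_direct_sum[OF bas, of ?Z]) (simp, rule that)
  have [simp]: "p l \<in> arr T" "src T (p l) = ?Y \<otimes> A" "tgt T (p l) = ?Y"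
    "p' l \<in> arr T" "src T (p' l) = ?Z \<otimes> A" "tgt T (p' l) = ?Z" for l
    using p(3)[of l] p'(2)[of l] by auto
  have pg: "p' l \<cdot> (g \<odot> idm T A) = g \<cdot> p l" for l
  proof (rule ins_ext[of _ ?Y])
    fix c
    have "(g \<odot> idm T A) \<cdot> ins ?Y c = ins ?Z c \<cdot> g" using ins_nat[of g c] by simp
    then show "p' l \<cdot> (g \<odot> idm T A) \<cdot> ins ?Y c = g \<cdot> p l \<cdot> ins ?Y c"
      by (simp add: p(2) reassoc[OF p'(1)])
  qed simp_all
  have "\<exists>v. v \<in> hom T (src T h) ?X \<and> f \<cdot> v = p l \<cdot> h" for l
  proof -
    have "g \<cdot> (p l \<cdot> h) = p' l \<cdot> ((g \<odot> idm T A) \<cdot> h)" by (simp add: reassoc[OF pg])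
    also have "\<dots> = zer T (src T (p l \<cdot> h)) (tgt T g)" unfolding h0 by simp
    finally have z: "g \<cdot> (p l \<cdot> h) = zer T (src T (p l \<cdot> h)) (tgt T g)" .
    obtain v where "v \<in> arr T" "src T v = src T h" "tgt T v = ?X" "f \<cdot> v = p l \<cdot> h"
      using kernel_factor[OF k _ _ z] by auto
    then show ?thesis by auto
  qed
  then obtain v where v: "\<And>l. v l \<in> hom T (src T h) ?X \<and> f \<cdot> v l = p l \<cdot> h" by metis
  then have [simp]: "v l \<in> arr T" "src T (v l) = src T h" "tgt T (v l) = ?X" and fv: "f \<cdot> v l = p l \<cdot> h" for l
    by auto
  \<comment> \<open>The factored components, reassembled along the basis.\<close>
  let ?v = "arr_sum T (src T h) (?X \<otimes> A) (\<lambda>l. ins ?X (b l) \<cdot> v l) n"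
  have "(f \<odot> idm T A) \<cdot> ?v = arr_sum T (src T h) (?Y \<otimes> A) (\<lambda>l. (f \<odot> idm T A) \<cdot> (ins ?X (b l) \<cdot> v l)) n"
    using cmp_arr_sum[of "src T h" "f \<odot> idm T A" "?X \<otimes> A" n "\<lambda>l. ins ?X (b l) \<cdot> v l"] by simp
  also have "\<dots> = arr_sum T (src T h) (?Y \<otimes> A) (\<lambda>l. ins ?Y (b l) \<cdot> (p l \<cdot> h)) n"
  proof (rule arr_sum_cong)
    fix l
    show "(f \<odot> idm T A) \<cdot> (ins ?X (b l) \<cdot> v l) = ins ?Y (b l) \<cdot> (p l \<cdot> h)"
      using reassoc[OF ins_nat[of f "b l"], of "v l"] by (simp add: fv)
  qed
  also have "\<dots> = h" using direct_sum_expand_left[OF p(1), of h] by simp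
  finally show "\<exists>u\<in>hom T (src T h) (src T (f \<odot> idm T A)). (f \<odot> idm T A) \<cdot> u = h"
    by (intro bexI[of _ ?v]) simp_all
qed

abbreviation q where "q \<equiv> extension_functor \<iota> T"

lemma fob_q [simp]: "fob q X = Fr X"
  and far_q [simp]: "far q f = (Fr (src T f), Fr (tgt T f), f \<odot> idm T A)"
  and fmul_q [simp]: "fmul q X Y = (tm (Fr X) (Fr Y), Fr (X \<otimes> Y), fmulm X Y)"
  and fone_q [simp]: "fone q = (U, Fr (unt T), fonem)"
  by (simp_all add: extension_functor_def)

lemma short_exact_q:
  assumes e: "short_exact T f g"
  shows "short_exact Q (far q f) (far q g)"
proof -
  have k: "is_kernel T g f" and c: "is_cokernel T f g" using e by (auto simp: short_exact_def)
  note K [simp] = kernelD(1-3)[OF k]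
  note f = free_mhom[OF K(2)] and g = free_mhom[OF K(1)]
  have "is_cokernel T (f \<odot> idm T A) (g \<odot> idm T A)"
    by (rule epi_cokernel_of_kernel[OF tensor_epi[OF cokernel_epi[OF c] A_obj] free_kernel[OF k]])
  then show ?thesis
    using kernel_Q[of "Fr (src T g)" "Fr (tgt T g)" "g \<odot> idm T A" "Fr (src T f)" "f \<odot> idm T A"]
      cokernel_Q[of "Fr (src T f)" "Fr (src T g)" "f \<odot> idm T A" "Fr (tgt T g)" "g \<odot> idm T A"]
      free_kernel[OF k] f g by (simp add: short_exact_def)
qed

lemma exact_tensor_functor_q: "exact_tensor_functor \<iota> T Q q"
proof (intro exact_tensor_functor.intro linear_functor.intro exact_tensor_functor_axioms.intro)
  fix X Y Z X' Y' f g and a :: 'k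
  show "fob q X \<in> obj Q" if "X \<in> obj T" using that by simp
  show "far q f \<in> hom Q (fob q X) (fob q Y)" if "f \<in> hom T X Y"
    using that free_mhom[of f] by auto
  show "far q (idm T X) = idm Q (fob q X)" if "X \<in> obj T" using that by simp
  show "far q (g \<cdot> f) = far q g \<cdot>\<^bsub>Q\<^esub> far q f" if "f \<in> hom T X Y" "g \<in> hom T Y Z"
    using that by auto
  show "far q (f \<oplus> g) = far q f \<oplus>\<^bsub>Q\<^esub> far q g" if "f \<in> hom T X Y" "g \<in> hom T X Y"
    using that by auto
  show "far q (scl T a f) = scl Q (\<iota> a) (far q f)" if "f \<in> hom T X Y"
    using that by (auto simp: act_emb)
  show "short_exact Q (far q f) (far q g)" if "short_exact T f g" using that by (rule short_exact_q)
  show "fmul q X Y \<in> hom Q (fob q X \<otimes>\<^bsub>Q\<^esub> fob q Y) (fob q (X \<otimes> Y))" "is_iso Q (fmul q X Y)"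
    if "X \<in> obj T" "Y \<in> obj T"
    using that iso_mhom(2)[OF fmulm(1,3)] by (simp_all add: fmulm(1))
  show "fmul q X' Y' \<cdot>\<^bsub>Q\<^esub> (far q f \<odot>\<^bsub>Q\<^esub> far q g) = far q (f \<odot> g) \<cdot>\<^bsub>Q\<^esub> fmul q X Y"
    if "f \<in> hom T X X'" "g \<in> hom T Y Y'"
    using that fmulm_nat[of f g] by auto
  show "far q (asc T X Y Z) \<cdot>\<^bsub>Q\<^esub> fmul q (X \<otimes> Y) Z \<cdot>\<^bsub>Q\<^esub> (fmul q X Y \<odot>\<^bsub>Q\<^esub> idm Q (fob q Z)) =
      fmul q X (Y \<otimes> Z) \<cdot>\<^bsub>Q\<^esub> (idm Q (fob q X) \<odot>\<^bsub>Q\<^esub> fmul q Y Z) \<cdot>\<^bsub>Q\<^esub> asc Q (fob q X) (fob q Y) (fob q Z)"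
    if XYZ: "X \<in> obj T" "Y \<in> obj T" "Z \<in> obj T"
  proof -
    have iX: "mhom (Fr X) (Fr X) (idm T (X \<otimes> A))" and iZ: "mhom (Fr Z) (Fr Z) (idm T (Z \<otimes> A))"
      using mhom_id[of "Fr X"] mhom_id[of "Fr Z"] XYZ by simp_all
    note [simp] = XYZ mhomD(3-5)[OF fmulm(1)[of "X \<otimes> Y" Z]] mhomD(3-5)[OF fmulm(1)[of X "Y \<otimes> Z"]]
      mhomD(3-5)[OF tarm(1)[OF fmulm(1)[OF XYZ(1,2)] iZ]] mhomD(3-5)[OF tarm(1)[OF iX fmulm(1)[OF XYZ(2,3)]]]
      mhomD(3-5)[OF ascm(1)[of "Fr X" "Fr Y" "Fr Z"]]
    show ?thesis using fmulm_asc[OF XYZ] by simp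
  qed
  show "far q (bra T X Y) \<cdot>\<^bsub>Q\<^esub> fmul q X Y = fmul q Y X \<cdot>\<^bsub>Q\<^esub> bra Q (fob q X) (fob q Y)"
    if "X \<in> obj T" "Y \<in> obj T"
    using that by (simp add: fmulm_bra)
  show "fone q \<in> hom Q (unt Q) (fob q (unt T))" using fonem by simp
  show "is_iso Q (fone q)" using iso_mhom(2)[OF fonem iso_inv] by simp
  show "far q (lun T X) \<cdot>\<^bsub>Q\<^esub> fmul q (unt T) X \<cdot>\<^bsub>Q\<^esub> (fone q \<odot>\<^bsub>Q\<^esub> idm Q (fob q X)) = lun Q (fob q X)"
    if X [simp]: "X \<in> obj T"
  proof -
    have iX: "mhom (Fr X) (Fr X) (idm T (X \<otimes> A))" using mhom_id[of "Fr X"] by simp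
    note [simp] = mhomD(3-5)[OF fmulm(1)[OF unt_simp X]] mhomD(3-5)[OF tarm(1)[OF fonem iX]]
    show ?thesis using fonem_lun[OF X] by simp
  qed
  show "far q (run T X) \<cdot>\<^bsub>Q\<^esub> fmul q X (unt T) \<cdot>\<^bsub>Q\<^esub> (idm Q (fob q X) \<odot>\<^bsub>Q\<^esub> fone q) = run Q (fob q X)"
    if X [simp]: "X \<in> obj T"
  proof -
    have iX: "mhom (Fr X) (Fr X) (idm T (X \<otimes> A))" using mhom_id[of "Fr X"] by simp
    note [simp] = mhomD(3-5)[OF fmulm(1)[OF X unt_simp]] mhomD(3-5)[OF tarm(1)[OF iX fonem]]
    show ?thesis using fonem_run[OF X] by simp
  qed
qed

end

section \<open>Trivial subobjects\<close>

context rigid_tensor_abelian_category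
begin

lemma unit_nonzero: "idm C (unt C) \<noteq> zer C (unt C) (unt C)"
  using unit_simple by (simp add: is_simple_def is_zero_object_def)

lemma trivial_extend:
  assumes X: "is_trivial C X" and d: "is_direct_sum C (Suc (Suc 0)) (\<lambda>l. if l = 0 then X else unt C) B i p"
  shows "is_trivial C B"
proof -
  let ?I = "unt C"
  obtain n i' p' where e: "is_direct_sum C n (\<lambda>_. ?I) X i' p'" using X by (auto simp: is_trivial_def)
  note E = direct_sumD[OF e] and D = direct_sumD[OF d]
  let ?i = "i 0" and ?p = "p 0" and ?j = "i (Suc 0)" and ?r = "p (Suc 0)"
  have [simp]: "?i \<in> arr C" "src C ?i = X" "tgt C ?i = B" "?p \<in> arr C" "src C ?p = B" "tgt C ?p = X"
    "?j \<in> arr C" "src C ?j = ?I" "tgt C ?j = B" "?r \<in> arr C" "src C ?r = B" "tgt C ?r = ?I"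
    "?p \<cdot> ?i = idm C X" "?p \<cdot> ?j = zer C ?I X" "?r \<cdot> ?i = zer C X ?I" "?r \<cdot> ?j = idm C ?I"
    using D(2-7)[of 0] D(2-7)[of "Suc 0"] D(8)[of 0 0] D(8)[of 0 "Suc 0"] D(8)[of "Suc 0" 0] D(8)[of "Suc 0" "Suc 0"]
    by simp_all
  note [simp] = D(1) E(1-7)
  have id: "?i \<cdot> ?p \<oplus> ?j \<cdot> ?r = idm C B" using D(9) by simp
  \<comment> \<open>The added copy of the unit receives the index \<open>n\<close>, so the sum over
    \<open>Suc n\<close> terms splits off exactly the new summand.\<close>
  let ?i' = "\<lambda>l. if l < n then ?i \<cdot> i' l else ?j" and ?p' = "\<lambda>l. if l < n then p' l \<cdot> ?p else ?r"
  have "arr_sum C B B (\<lambda>l. ?i' l \<cdot> ?p' l) n = arr_sum C B B (\<lambda>l. ?i \<cdot> (i' l \<cdot> p' l \<cdot> ?p)) n"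
    by (intro arr_sum_cong) simp
  also have "\<dots> = ?i \<cdot> arr_sum C B X (\<lambda>l. i' l \<cdot> p' l \<cdot> ?p) n"
    using cmp_arr_sum[of B ?i X n "\<lambda>l. i' l \<cdot> p' l \<cdot> ?p"] by simp
  also have "arr_sum C B X (\<lambda>l. i' l \<cdot> p' l \<cdot> ?p) n = arr_sum C X X (\<lambda>l. i' l \<cdot> p' l) n \<cdot> ?p"
    using arr_sum_cmp[of X ?p X n "\<lambda>l. i' l \<cdot> p' l"] by simp
  also have "\<dots> = ?p" unfolding E(9) by simp
  finally have s: "arr_sum C B B (\<lambda>l. ?i' l \<cdot> ?p' l) (Suc n) = idm C B"
    using id by simp
  have z: "?p \<cdot> (?i \<cdot> x) = x" "?r \<cdot> (?i \<cdot> x) = zer C ?I ?I"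
    if "x \<in> arr C" "src C x = ?I" "tgt C x = X" for x
    using that reassoc[of ?p ?i "idm C X" x] reassoc[of ?r ?i "zer C X ?I" x] by simp_all
  have "is_direct_sum C (Suc n) (\<lambda>_. ?I) B ?i' ?p'"
    unfolding is_direct_sum_def using s E(8) by (simp add: z)
  then show ?thesis by (auto simp: is_trivial_def)
qed

text \<open>A trivial subobject of maximal length absorbs every arrow from the unit: otherwise the arrow
  could be added to it, because the unit is simple.\<close>

lemma maximal_trivial_subobject:
  assumes X [simp]: "X \<in> obj C"
  obtains t where "is_mono C t" "tgt C t = X" "is_trivial C (src C t)"
    "\<And>g. g \<in> hom C (unt C) X \<Longrightarrow> \<exists>u \<in> hom C (unt C) (src C t). t \<cdot> u = g"
proof -
  let ?I = "unt C"
  let ?P = "\<lambda>t. is_mono C t \<and> tgt C t = X \<and> is_trivial C (src C t)"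
  obtain S i p where S: "is_direct_sum C 0 (\<lambda>_. ?I) S i p" using direct_sums[of 0 "\<lambda>_. ?I"] by auto
  then have Sz: "is_zero_object C S" by (auto simp: is_direct_sum_def is_zero_object_def)
  then have [simp]: "S \<in> obj C" by (simp add: is_zero_object_def)
  have "is_mono C (zer C S X)"
    by (rule monoI) (use zero_objectD(2)[OF Sz] in simp_all)
  \<comment> \<open>The zero subobject, a sum of no copies of the unit, shows that trivial
    subobjects exist; their lengths are bounded by that of \<open>X\<close>.\<close>
  then have "?P (zer C S X)" using S by (auto simp: is_trivial_def)
  moreover have "\<forall>t. ?P t \<longrightarrow> obj_length C (src C t) < Suc (obj_length C X)"
    using obj_length_mono(1) all_finite_length[OF X] by (auto simp: less_Suc_eq_le)
  ultimately obtain t where t: "?P t"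
    and max: "\<And>t'. ?P t' \<Longrightarrow> obj_length C (src C t') \<le> obj_length C (src C t)"
    using ex_has_greatest_nat[of ?P "zer C S X" "\<lambda>t. obj_length C (src C t)"] by blast
  then have tm: "is_mono C t" and [simp]: "t \<in> arr C" "tgt C t = X" and tt: "is_trivial C (src C t)"
    by (auto simp: is_mono_def)
  have "\<exists>u \<in> hom C ?I (src C t). t \<cdot> u = g" if g: "g \<in> hom C ?I X" for g
  proof (rule ccontr)
    assume no: "\<not> (\<exists>u \<in> hom C ?I (src C t). t \<cdot> u = g)"
    have [simp]: "g \<in> arr C" "src C g = ?I" "tgt C g = X" using g by auto
    let ?F = "\<lambda>l :: nat. if l = 0 then src C t else ?I"
    have "\<exists>B i p. is_direct_sum C (Suc (Suc 0)) ?F B i p"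
      by (rule direct_sums) simp
    then obtain B i p where d: "is_direct_sum C (Suc (Suc 0)) ?F B i p"
      by blast
    note D = direct_sumD[OF d]
    let ?i = "i 0" and ?p = "p 0" and ?j = "i (Suc 0)" and ?r = "p (Suc 0)"
    have [simp]: "B \<in> obj C" "?i \<in> arr C" "src C ?i = src C t" "tgt C ?i = B" "?p \<in> arr C" "src C ?p = B"
      "tgt C ?p = src C t" "?j \<in> arr C" "src C ?j = ?I" "tgt C ?j = B" "?r \<in> arr C" "src C ?r = B" "tgt C ?r = ?I"
      "?p \<cdot> ?i = idm C (src C t)" "?r \<cdot> ?i = zer C (src C t) ?I" "?r \<cdot> ?j = idm C ?I"
      using D(1) D(2-7)[of 0] D(2-7)[of "Suc 0"] D(8)[of 0 0] D(8)[of "Suc 0" 0] D(8)[of "Suc 0" "Suc 0"]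
      by simp_all
    have id: "?i \<cdot> ?p \<oplus> ?j \<cdot> ?r = idm C B" using D(9) by simp
    \<comment> \<open>The arrow \<open>h\<close> is \<open>t\<close> on the old summand and
      \<open>g\<close> on the added copy of the unit; its kernel measures the overlap of the
      two.\<close>
    obtain h where h: "h \<in> arr C" "src C h = B" "tgt C h = X"
      "\<And>l. l < Suc (Suc 0) \<Longrightarrow> h \<cdot> i l = (if l = 0 then t else g)"
    proof (rule direct_sum_map_out[OF d X, of "\<lambda>l. if l = 0 then t else g"])
      show "(if l = 0 then t else g) \<in> hom C (if l = 0 then src C t else ?I) X" for l :: nat
        by simp
    qed (rule that)
    have [simp]: "h \<in> arr C" "src C h = B" "tgt C h = X" and hi: "h \<cdot> ?i = t" and hj: "h \<cdot> ?j = g"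
      using h(1-3) h(4)[of 0] h(4)[of "Suc 0"] by simp_all
    have split: "x = ?i \<cdot> (?p \<cdot> x) \<oplus> ?j \<cdot> (?r \<cdot> x)" if x: "x \<in> arr C" "tgt C x = B" for x
    proof -
      have "x = (?i \<cdot> ?p \<oplus> ?j \<cdot> ?r) \<cdot> x" unfolding id using x by simp
      then show ?thesis using x by simp
    qed
    have hx: "h \<cdot> x = t \<cdot> (?p \<cdot> x) \<oplus> g \<cdot> (?r \<cdot> x)" if x: "x \<in> arr C" "tgt C x = B" for x
    proof -
      have "h \<cdot> x = h \<cdot> (?i \<cdot> (?p \<cdot> x) \<oplus> ?j \<cdot> (?r \<cdot> x))" by (simp only: split[OF x, symmetric])
      then show ?thesis using x by (simp add: reassoc[OF hi] reassoc[OF hj])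
    qed
    obtain k where k: "is_kernel C h k" using kernels[of h] by auto
    note K = kernelD[OF k]
    have [simp]: "k \<in> arr C" "tgt C k = B" using K by simp_all
    have hk: "h \<cdot> k = zer C (src C k) X" using K by simp
    \<comment> \<open>Because \<open>t\<close> is monic, an element of the kernel is determined by
      its component in the unit. So the kernel is a subobject of a simple object.\<close>
    have um: "is_mono C (?r \<cdot> k)"
    proof (rule monoI)
      fix x assume x: "x \<in> arr C" "tgt C x = src C (?r \<cdot> k)" "?r \<cdot> k \<cdot> x = zer C (src C x) (tgt C (?r \<cdot> k))"
      then have [simp]: "tgt C x = src C k" and rk: "?r \<cdot> (k \<cdot> x) = zer C (src C x) ?I" by simp_all
      have "h \<cdot> (k \<cdot> x) = zer C (src C x) X" using reassoc[OF hk, of x] x(1) by simp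
      then have "t \<cdot> (?p \<cdot> (k \<cdot> x)) = zer C (src C x) X"
        using hx[of "k \<cdot> x"] x(1) rk by simp
      then have "?p \<cdot> (k \<cdot> x) = zer C (src C x) (src C t)"
        using mono_zero[OF tm, of "?p \<cdot> (k \<cdot> x)"] x(1) by simp
      then have "k \<cdot> x = zer C (src C x) B"
        using split[of "k \<cdot> x"] x(1) rk by simp
      then show "x = zer C (src C x) (src C (?r \<cdot> k))"
        using mono_zero[OF kernel_mono[OF k] x(1)] by simp
    qed simp
    have "is_zero_object C (src C (?r \<cdot> k)) \<or> is_iso C (?r \<cdot> k)"
      using simple_mono[OF unit_simple um] by simp
    then show False
    proof
      assume z: "is_zero_object C (src C (?r \<cdot> k))"
      have hm: "is_mono C h"
      proof (rule monoI)
        fix x assume x: "x \<in> arr C" "tgt C x = src C h" "h \<cdot> x = zer C (src C x) (tgt C h)"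
        obtain v where v: "v \<in> arr C" "src C v = src C x" "tgt C v = src C k" "k \<cdot> v = x"
          using kernel_factor[OF k x] by blast
        have "v = zer C (src C v) (src C k)"
          by (rule zero_objectD(2)[OF z, simplified]) (use v in simp_all)
        then have "k \<cdot> v = k \<cdot> zer C (src C x) (src C k)" using v(2) by metis
        then show "x = zer C (src C x) (src C h)" using v(4) x(1) by simp
      qed simp
      have "is_trivial C B" by (rule trivial_extend[OF tt d])
      then have le: "obj_length C B \<le> obj_length C (src C t)"
        using max[of h] hm by simp
      have im: "is_mono C ?i" by (rule split_mono[of ?p]) simp_all
      \<comment> \<open>With \<open>h\<close> monic, \<open>B\<close> is a trivial subobject; it is
        strictly longer than \<open>src C t\<close>, because the projection \<open>?r\<close> kills
        \<open>?i\<close> but not the added unit. This contradicts maximality.\<close>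
      have "\<not> is_iso C ?i"
      proof
        assume s: "is_iso C ?i"
        have "?r = zer C B ?I"
          using epi_zero[OF iso_epi[OF s], of ?r] by simp
        then have "?r \<cdot> ?j = zer C ?I ?I" by (metis zer_cmp \<open>?j \<in> arr C\<close> \<open>tgt C ?j = B\<close> \<open>src C ?j = ?I\<close> unt_simp)
        then show False using unit_nonzero by simp
      qed
      then show False
        using obj_length_mono(2)[OF im] all_finite_length[of B] le by simp
    next
      assume s: "is_iso C (?r \<cdot> k)"
      \<comment> \<open>If the kernel is a full copy of the unit, normalizing its second component
        to \<open>1\<close> gives the relation \<open>t \<cdot> (?p \<cdot> ?v) + g = 0\<close>,
        which exhibits \<open>g\<close> as factoring through \<open>t\<close>.\<close>
      let ?v = "k \<cdot> inv_arr C (?r \<cdot> k)"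
      have [simp]: "inv_arr C (?r \<cdot> k) \<in> arr C" "src C (inv_arr C (?r \<cdot> k)) = ?I" "tgt C (inv_arr C (?r \<cdot> k)) = src C k"
        using inv_simps(1-3)[OF s] by simp_all
      have rv: "?r \<cdot> ?v = idm C ?I" using inv_simps(5)[OF s] by simp
      have "h \<cdot> ?v = zer C ?I X" using reassoc[OF hk, of "inv_arr C (?r \<cdot> k)"] by simp
      then have "t \<cdot> (?p \<cdot> ?v) \<oplus> g = zer C ?I X" using hx[of ?v] rv by simp
      then have z: "g \<oplus> t \<cdot> (?p \<cdot> ?v) = zer C ?I X"
        using add_commute[of "t \<cdot> (?p \<cdot> ?v)" ?I X g] by simp
      have "g \<oplus> scl C (-1) (t \<cdot> scl C (-1) (?p \<cdot> ?v)) = zer C (src C g) (tgt C g)"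
        using z by (simp add: scl_scl)
      then have "g = t \<cdot> scl C (-1) (?p \<cdot> ?v)"
        by (rule eq_if_diff_zero) simp_all
      moreover have "scl C (-1) (?p \<cdot> ?v) \<in> hom C ?I (src C t)" by simp
      ultimately show False using no by metis
    qed
  qed
  then show thesis using that tm tt by simp
qed

end

section \<open>Trivial subobjects under extension of scalars and the quotient conditions\<close>

context base_extension
begin

lemma free_trivial:
  assumes "is_trivial T X"
  shows "is_trivial Q (Fr X)"
proof -
  let ?I = "unt T" and ?l = "lun T A" and ?f = "inv_arr T (lun T A)"
  obtain n i p where d: "is_direct_sum T n (\<lambda>_. ?I) X i p" using assms by (auto simp: is_trivial_def)
  note e = direct_sum_tar[OF d A_obj]
  note D [simp] = direct_sumD(1-7)[OF d] and E = direct_sumD[OF e]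
  have il: "mhom U (Fr X) ((i l \<odot> idm T A) \<cdot> ?f)" if "l < n" for l
    using mhom_cmp[OF fonem, of "Fr X" "i l \<odot> idm T A"] free_mhom[of "i l"] that by simp
  have pl: "mhom (Fr X) U (?l \<cdot> (p l \<odot> idm T A))" if "l < n" for l
    using mhom_cmp[OF _ iso_mhom(1)[OF fonem], of "Fr X" "p l \<odot> idm T A"] free_mhom[of "p l"] that
      inv_eqI[of ?f ?l] by (simp add: iso_inv)
  have "arr_sum T (X \<otimes> A) (X \<otimes> A) (\<lambda>l. ((i l \<odot> idm T A) \<cdot> ?f) \<cdot> (?l \<cdot> (p l \<odot> idm T A))) n
      = arr_sum T (X \<otimes> A) (X \<otimes> A) (\<lambda>l. (i l \<odot> idm T A) \<cdot> (p l \<odot> idm T A)) n"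
    by (intro arr_sum_cong) simp
  also have "\<dots> = idm T (X \<otimes> A)" by (rule E(9))
  finally have s: "arr_sum T (X \<otimes> A) (X \<otimes> A) (\<lambda>l. ((i l \<odot> idm T A) \<cdot> ?f) \<cdot> (?l \<cdot> (p l \<odot> idm T A))) n
      = idm T (X \<otimes> A)" .
  have "(?l \<cdot> (p l \<odot> idm T A)) \<cdot> ((i r \<odot> idm T A) \<cdot> ?f) = (if l = r then idm T A else zer T A A)"
    if "l < n" "r < n" for l r
    using that direct_sumD(8)[OF d that] by simp
  then have "is_direct_sum T n (\<lambda>_. A) (X \<otimes> A) (\<lambda>l. (i l \<odot> idm T A) \<cdot> ?f) (\<lambda>l. ?l \<cdot> (p l \<odot> idm T A))"
    unfolding is_direct_sum_def using s by simp
  then have "is_direct_sum Q n (\<lambda>_. U) (Fr X) (\<lambda>l. (U, Fr X, (i l \<odot> idm T A) \<cdot> ?f)) (\<lambda>l. (Fr X, U, ?l \<cdot> (p l \<odot> idm T A)))"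
    using il pl by (intro direct_sum_Q) simp_all
  then show ?thesis by (auto simp: is_trivial_def)
qed

text \<open>Some coordinate of \<open>1\<close> is nonzero, and the projection to it, rescaled, is a
  retraction. It follows that extension of scalars is faithful.\<close>

lemma ins_one_mono:
  assumes X [simp]: "X \<in> obj T"
  shows "is_mono T (ins X 1)"
proof -
  obtain n b co where bas: "basis n b co" using basis_exists by blast
  obtain p where p: "\<And>l c. p l \<cdot> ins X c = scl T (co l c) (idm T X)" "\<And>l. p l \<in> hom T (X \<otimes> A) X"
    by (rule tensor_A_direct_sum[OF bas X]) (rule that)
  have "\<exists>l. co l 1 \<noteq> 0"
  proof (rule ccontr)
    assume "\<not> (\<exists>l. co l 1 \<noteq> 0)"
    then have "(1 :: 'l) = (\<Sum>l<n. \<iota> 0 * b l)" using basisD(4)[OF bas, of 1] by simp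
    then show False by simp
  qed
  then obtain l where l: "co l 1 \<noteq> 0" by blast
  have [simp]: "p l \<in> arr T" "src T (p l) = X \<otimes> A" "tgt T (p l) = X" using p(2)[of l] by auto
  show ?thesis
    by (rule split_mono[of "scl T (inverse (co l 1)) (p l)"]) (simp_all add: p(1) scl_scl l)
qed

text \<open>Arrows \<open>K \<otimes> I \<rightarrow> X \<otimes> K\<close> have their components in \<open>Hom(I, X)\<close>, so the largest trivial
  subobject of \<open>X \<otimes> K\<close> is extended from that of \<open>X\<close>.\<close>

lemma unit_factor:
  assumes t: "is_mono T t" "tgt T t = X"
    and f: "\<And>g. g \<in> hom T (unt T) X \<Longrightarrow> \<exists>u \<in> hom T (unt T) (src T t). t \<cdot> u = g"
    and g: "mhom U (Fr X) g"
  shows "\<exists>u. mhom U (Fr (src T t)) u \<and> (t \<odot> idm T A) \<cdot> u = g"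
proof -
  let ?I = "unt T" and ?Y = "src T t"
  have ta [simp]: "t \<in> arr T" "tgt T t = X" using t by (auto simp: is_mono_def)
  have X [simp]: "X \<in> obj T" using tgt_in_obj[OF ta(1)] by simp
  note G [simp] = mhomD(3-5)[OF g, simplified]
  obtain n b co where bas: "basis n b co" using basis_exists by blast
  obtain p where p: "is_direct_sum T n (\<lambda>_. X) (X \<otimes> A) (\<lambda>l. ins X (b l)) p"
    "\<And>l. p l \<in> hom T (X \<otimes> A) X"
    by (rule tensor_A_direct_sum[OF bas X]) (rule that)
  have [simp]: "p l \<in> arr T" "src T (p l) = X \<otimes> A" "tgt T (p l) = X" for l using p(2)[of l] by auto
  let ?g = "g \<cdot> j 1"
  have "\<exists>y. y \<in> hom T ?I ?Y \<and> t \<cdot> y = p l \<cdot> ?g" for l using f[of "p l \<cdot> ?g"] by auto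
  then obtain y where "\<And>l. y l \<in> hom T ?I ?Y \<and> t \<cdot> y l = p l \<cdot> ?g" by metis
  then have [simp]: "y l \<in> arr T" "src T (y l) = ?I" "tgt T (y l) = ?Y" and ty: "t \<cdot> y l = p l \<cdot> ?g" for l
    by auto
  let ?z = "arr_sum T ?I (?Y \<otimes> A) (\<lambda>l. ins ?Y (b l) \<cdot> y l) n"
  have "(t \<odot> idm T A) \<cdot> ?z = arr_sum T ?I (X \<otimes> A) (\<lambda>l. (t \<odot> idm T A) \<cdot> (ins ?Y (b l) \<cdot> y l)) n"
    using cmp_arr_sum[of ?I "t \<odot> idm T A" "?Y \<otimes> A" n "\<lambda>l. ins ?Y (b l) \<cdot> y l"] by simp
  also have "\<dots> = arr_sum T ?I (X \<otimes> A) (\<lambda>l. ins X (b l) \<cdot> (p l \<cdot> ?g)) n"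
  proof (rule arr_sum_cong)
    fix l
    show "(t \<odot> idm T A) \<cdot> (ins ?Y (b l) \<cdot> y l) = ins X (b l) \<cdot> (p l \<cdot> ?g)"
      using reassoc[OF ins_nat[of t "b l"], of "y l"] by (simp add: ty)
  qed
  also have "\<dots> = ?g" using direct_sum_expand_left[OF p(1), of ?g] by simp
  finally have z: "(t \<odot> idm T A) \<cdot> ?z = ?g" .
  obtain u where u: "mhom U (Fr ?Y) u" "\<And>c. u \<cdot> j c = act c (Fr ?Y) \<cdot> ?z"
    by (rule from_U[of "Fr ?Y" ?z]) simp_all
  note [simp] = mhomD(3-5)[OF u(1), simplified]
  have u1: "u \<cdot> j 1 = ?z" using u(2)[of 1] by (simp add: act_one)
  have tA: "mhom (Fr ?Y) (Fr X) (t \<odot> idm T A)" using free_mhom[of t] by simp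
  have "(t \<odot> idm T A) \<cdot> u = g"
    by (rule U_ext[OF mhom_cmp[OF u(1) tA] g]) (simp add: u1 z)
  then show ?thesis using u(1) by blast
qed

text \<open>A trivial source is a sum of copies of \<open>U\<close>, so the factorization is made on
  each summand by \<open>unit_factor\<close> and then assembled.\<close>

lemma trivial_factor:
  assumes t: "is_mono T t" "tgt T t = X"
    and f: "\<And>g. g \<in> hom T (unt T) X \<Longrightarrow> \<exists>u \<in> hom T (unt T) (src T t). t \<cdot> u = g"
    and h: "h \<in> arr Q" "tgt Q h = Fr X" "is_trivial Q (src Q h)"
  shows "\<exists>u \<in> hom Q (src Q h) (Fr (src T t)). far q t \<cdot>\<^bsub>Q\<^esub> u = h"
proof -
  have ta [simp]: "t \<in> arr T" "tgt T t = X" using t by (auto simp: is_mono_def)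
  obtain n i p where "is_direct_sum Q n (\<lambda>_. unt Q) (src Q h) i p"
    using h(3) by (auto simp: is_trivial_def)
  then have d: "is_direct_sum Q n (\<lambda>_. U) (src Q h) i p" by simp
  note D = Q.direct_sumD[OF d]
  let ?t = "far q t"
  have tQ: "?t \<in> hom Q (Fr (src T t)) (Fr X)" using free_mhom[of t] by simp
  have "\<exists>v. l < n \<longrightarrow> v \<in> hom Q U (Fr (src T t)) \<and> ?t \<cdot>\<^bsub>Q\<^esub> v = h \<cdot>\<^bsub>Q\<^esub> i l" for l
  proof (cases "l < n")
    case True
    then have "h \<cdot>\<^bsub>Q\<^esub> i l \<in> hom Q U (Fr X)" using D(2-4) h by simp
    then obtain g where g: "h \<cdot>\<^bsub>Q\<^esub> i l = (U, Fr X, g)" "mhom U (Fr X) g" by (rule hom_QE)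
    obtain u where u: "mhom U (Fr (src T t)) u" "(t \<odot> idm T A) \<cdot> u = g"
      using unit_factor[OF t f g(2)] by blast
    show ?thesis using u g by (intro exI[of _ "(U, Fr (src T t), u)"]) simp
  qed simp
  then obtain v where v: "\<And>l. l < n \<Longrightarrow> v l \<in> hom Q U (Fr (src T t)) \<and> ?t \<cdot>\<^bsub>Q\<^esub> v l = h \<cdot>\<^bsub>Q\<^esub> i l" by metis
  have S: "Fr (src T t) \<in> obj Q" by simp
  have vh: "l < n \<Longrightarrow> v l \<in> hom Q U (Fr (src T t))" for l using v by blast
  obtain u where u: "u \<in> arr Q" "src Q u = src Q h" "tgt Q u = Fr (src T t)" "\<And>l. l < n \<Longrightarrow> u \<cdot>\<^bsub>Q\<^esub> i l = v l"
    by (rule Q.direct_sum_map_out[OF d S vh]) (assumption, rule that)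
  have tQ': "?t \<in> arr Q" "src Q ?t = Fr (src T t)" "tgt Q ?t = Fr X" using tQ unfolding in_hom by blast+
  have "?t \<cdot>\<^bsub>Q\<^esub> u = h"
  proof (rule Q.direct_sum_eqI[OF d])
    show "?t \<cdot>\<^bsub>Q\<^esub> u \<in> arr Q" "src Q (?t \<cdot>\<^bsub>Q\<^esub> u) = src Q h" "tgt Q (?t \<cdot>\<^bsub>Q\<^esub> u) = tgt Q h"
      using Q.cmp_simps[of u ?t] u tQ' h by simp_all
    show "h \<in> arr Q" "src Q h = src Q h" using h by simp_all
    fix l assume l: "l < n"
    have "(?t \<cdot>\<^bsub>Q\<^esub> u) \<cdot>\<^bsub>Q\<^esub> i l = ?t \<cdot>\<^bsub>Q\<^esub> (u \<cdot>\<^bsub>Q\<^esub> i l)"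
      using Q.assoc[of "i l" u ?t] D(2-4)[OF l] u tQ' by simp
    also have "\<dots> = h \<cdot>\<^bsub>Q\<^esub> i l" using u(4)[OF l] v[OF l] by simp
    finally show "(?t \<cdot>\<^bsub>Q\<^esub> u) \<cdot>\<^bsub>Q\<^esub> i l = h \<cdot>\<^bsub>Q\<^esub> i l" .
  qed
  then show ?thesis using u by auto
qed

lemma largest_trivial_q:
  assumes X [simp]: "X \<in> obj T"
  obtains t where "is_mono T t" "tgt T t = X" "is_trivial T (src T t)"
    "largest_trivial_subobject Q (Fr X) (far q t)"
proof -
  obtain t where t: "is_mono T t" "tgt T t = X" "is_trivial T (src T t)"
    and f: "\<And>g. g \<in> hom T (unt T) X \<Longrightarrow> \<exists>u \<in> hom T (unt T) (src T t). t \<cdot> u = g"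
    by (rule maximal_trivial_subobject[OF X]) (rule that)
  have ta [simp]: "t \<in> arr T" using t by (simp add: is_mono_def)
  have m: "is_mono Q (far q t)"
    using mono_Q[OF free_mhom[OF ta]] tensor_mono_left[OF t(1)] t(2) by simp
  have "largest_trivial_subobject Q (Fr X) (far q t)"
    unfolding largest_trivial_subobject_def
  proof (intro conjI allI impI)
    show "tgt Q (far q t) = Fr X" "is_trivial Q (src Q (far q t))"
      using t(2) free_trivial[OF t(3)] by simp_all
    fix h assume h: "is_mono Q h \<and> tgt Q h = Fr X \<and> is_trivial Q (src Q h)"
    then have "h \<in> arr Q" by (simp add: is_mono_def)
    then show "\<exists>u\<in>hom Q (src Q h) (src Q (far q t)). far q t \<cdot>\<^bsub>Q\<^esub> u = h"
      using trivial_factor[OF t(1,2) f, of h] h by simp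
  qed (rule m)
  then show thesis using that t by blast
qed

text \<open>If \<open>X \<otimes> A\<close> is trivial, its identity factors through the extension
  of the maximal trivial subobject \<open>t\<close>. This extension is then epic, hence so is
  \<open>t\<close> by faithfulness, and \<open>X\<close> is isomorphic to a trivial object.\<close>

lemma invariant_q: "invariant_objects T Q q = {X \<in> obj T. is_trivial T X}"
proof (intro equalityI subsetI)
  fix X assume "X \<in> {X \<in> obj T. is_trivial T X}"
  then show "X \<in> invariant_objects T Q q" by (simp add: invariant_objects_def free_trivial)
next
  fix X assume "X \<in> invariant_objects T Q q"
  then have X [simp]: "X \<in> obj T" and tr: "is_trivial Q (Fr X)" by (auto simp: invariant_objects_def)
  obtain t where t: "is_mono T t" "tgt T t = X" "is_trivial T (src T t)"
    and l: "largest_trivial_subobject Q (Fr X) (far q t)" by (rule largest_trivial_q[OF X])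
  have [simp]: "t \<in> arr T" "tgt T t = X" using t by (auto simp: is_mono_def)
  have m: "is_mono Q (idm Q (Fr X))" by (rule Q.iso_mono[OF Q.iso_idm]) simp
  have "\<exists>u\<in>hom Q (Fr X) (src Q (far q t)). far q t \<cdot>\<^bsub>Q\<^esub> u = idm Q (Fr X)"
    using l m tr unfolding largest_trivial_subobject_def by (metis Q.idm_simps(2,3) Fr_module X obj_Q)
  then obtain u where u: "mhom (Fr X) (Fr (src T t)) u" "(t \<odot> idm T A) \<cdot> u = idm T (X \<otimes> A)"
    by (auto elim!: hom_QE simp del: in_hom)
  note [simp] = mhomD(3-5)[OF u(1), simplified]
  have ep: "is_epi T (t \<odot> idm T A)" by (rule split_epi[of _ u]) (simp_all add: u(2))
  \<comment> \<open>If \<open>g\<close> kills \<open>t\<close>, then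
    \<open>g \<odot> idm T A\<close> vanishes, and naturality of
    \<open>x \<mapsto> x \<otimes> 1\<close>, a monomorphism, gives \<open>g = 0\<close>.\<close>
  have "is_epi T t"
  proof (rule epiI)
    fix g assume g: "g \<in> arr T" "src T g = tgt T t" "g \<cdot> t = zer T (src T t) (tgt T g)"
    have "(g \<odot> idm T A) \<cdot> (t \<odot> idm T A) = zer T (src T (t \<odot> idm T A)) (tgt T (g \<odot> idm T A))"
      using g by simp
    then have z: "g \<odot> idm T A = zer T (X \<otimes> A) (tgt T g \<otimes> A)"
      using epi_zero[OF ep, of "g \<odot> idm T A"] g(1,2) by simp
    have "ins (tgt T g) 1 \<cdot> g = (g \<odot> idm T A) \<cdot> ins X 1" using ins_nat[of g 1] g(1,2) by simp
    also have "\<dots> = zer T (src T g) (tgt T (ins (tgt T g) 1))" unfolding z using g(1,2) by simp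
    finally show "g = zer T (tgt T t) (tgt T g)"
      using mono_zero[OF ins_one_mono[OF tgt_in_obj[OF g(1)]] g(1)] g(1,2) by simp
  qed simp
  then have "is_iso T t" by (rule mono_epi_iso[OF t(1)])
  moreover obtain n i p where "is_direct_sum T n (\<lambda>_. unt T) (src T t) i p"
    using t(3) unfolding is_trivial_def by blast
  ultimately have "is_trivial T X"
    using direct_sum_iso[of n "\<lambda>_. unt T" "src T t" i p t] t(2) unfolding is_trivial_def by blast
  then show "X \<in> {X \<in> obj T. is_trivial T X}" by simp
qed

lemma K_quotient_q: "K_quotient \<iota> T Q q"
proof (intro K_quotient.intro exact_tensor_functor_q K_quotient_axioms.intro rigid_Q)
  fix X assume X: "X \<in> obj T"
  obtain t where t: "is_mono T t" "tgt T t = X" "largest_trivial_subobject Q (Fr X) (far q t)"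
    by (rule largest_trivial_q[OF X]) (rule that)
  have [simp]: "t \<in> arr T" using t by (simp add: is_mono_def)
  \<comment> \<open>The largest trivial subobject was found as the image of \<open>t\<close> itself,
    so the required isomorphism of subobjects is an identity.\<close>
  have "idm Q (Fr (src T t)) \<in> hom Q (src Q (far q t)) (fob q (src T t))"
    "is_iso Q (idm Q (Fr (src T t)))" "far q t \<cdot>\<^bsub>Q\<^esub> idm Q (Fr (src T t)) = far q t"
    using Q.iso_idm[of "Fr (src T t)"] mhom_id[of "Fr (src T t)"] by simp_all
  then show "\<exists>i t e. largest_trivial_subobject Q (fob q X) i \<and> is_mono T t \<and> tgt T t = X \<and>
      e \<in> hom Q (src Q i) (fob q (src T t)) \<and> is_iso Q e \<and> far q t \<cdot>\<^bsub>Q\<^esub> e = i"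
    using t unfolding fob_q by blast
next
  fix M assume "M \<in> obj Q"
  then have M: "M \<in> mods" by simp
  obtain s where s: "mhom M (Fr (fst M)) s" "snd M \<cdot> s = idm T (fst M)" by (rule free_section[OF M])
  note [simp] = M mhomD(3-5)[OF s(1), simplified]
  have "is_mono T s" by (rule split_mono[of "snd M"]) (simp_all add: s(2))
  then have "is_mono Q (M, Fr (fst M), s)" using mono_Q[OF s(1)] by simp
  then show "\<exists>X\<in>obj T. \<exists>i\<in>hom Q M (fob q X). is_mono Q i"
    using s(1) by (intro bexI[of _ "fst M"] bexI[of _ "(M, Fr (fst M), s)"]) simp_all
  have "is_epi T (snd M)" by (rule split_epi[of _ s]) (simp_all add: s(2))
  then have "is_epi Q (Fr (fst M), M, snd M)" using epi_Q[OF snd_mhom[OF M]] by simp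
  then show "\<exists>X\<in>obj T. \<exists>p\<in>hom Q (fob q X) M. is_epi Q p"
    using snd_mhom[OF M] by (intro bexI[of _ "fst M"] bexI[of _ "(Fr (fst M), M, snd M)"]) simp_all
qed

end

theorem theorem5p8:
  fixes T :: "('o, 'm, 'k::field) tensor_cat"
    and \<iota> :: "'k \<Rightarrow> 'l::field"
  assumes "rigid_tensor_abelian_category T"
    and "finite_separable_extension \<iota>"
  shows "is_base_change \<iota> T (module_category \<iota> T) (extension_functor \<iota> T)"
proof -
  interpret rigid_tensor_abelian_category T by (rule assms(1))
  interpret field_extension \<iota>
    by unfold_locales (use assms(2) in \<open>simp add: finite_separable_extension_def\<close>)
  interpret base_extension \<iota> T
    by unfold_locales (rule assms(2))
  show ?thesis
    unfolding is_base_change_def using K_quotient_q invariant_q by blast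
qed

end
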